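(* Let $d\ge 3$, $n\in\mathbb N$, $T>0$, and let the data $a_{\alpha\beta},\sigma_\alpha,s,V,\chi,\bar f^0_\alpha$ be as in the context. Let $\bar f=(\bar f_1,\dots,\bar f_n)$ be a solution of the limiting system (L) with $\bar f_\alpha\in L^\infty(0,T;L^1\cap L^\infty(\mathbb R^d))\cap L^2(0,T;H^1(\mathbb R^d))$ for $\alpha=1,\dots,n$, and for each $\varepsilon>0$ let $\tilde f_\varepsilon=(\tilde f_{1,\varepsilon},\dots,\tilde f_{n,\varepsilon})$ be the solution of the intermediate system (I), satisfying $$\max_{\alpha=1,\dots,n}\ \sup_{\varepsilon}\ \|\tilde f_{\alpha,\varepsilon}\|_{L^\infty(0,T;L^1\cap L^\infty(\mathbb R^d))\cap L^2(0,T;H^1(\mathbb R^d))}<C(T).$$ Then for any $\varepsilon>0$ and every $\alpha=1,\dots,n$, $$\sup_{t\in[0,T]}\Big(\|\tilde f_{\alpha,\varepsilon}-\bar f_\alpha\|_{L^2}^2+H(\tilde f_{\alpha,\varepsilon}|\bar f_\alpha)\Big)\le C\varepsilon^2,$$ where the constant $C$ does not depend on $\varepsilon$. In particular, for every $n$-tuple $\mathbf K=(K_1,\dots,K_n)$ of natural numbers, with $|\mathbf K|=\sum_\alpha K_\alpha$, $$\sup_{t\in[0,T]}\Big\|\prod_{\alpha=1}^n\tilde f_{\alpha,\varepsilon}^{\otimes K_\alpha}-\prod_{\alpha=1}^n\bar f_\alpha^{\otimes K_\alpha}\Big\|_{L^1(\mathbb R^{d|\mathbf K|})}\le C\varepsilon,$$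 where the constant $C$ depends on $|\mathbf K|$ (and not on $\varepsilon$).
   Context: Standing data. $d\ge3$; $n$ is the fixed number of species; $\alpha,\beta\in\{1,\dots,n\}$; $a_{\alpha\beta}\in\mathbb R$; $\sigma_\alpha>0$; $V(x)=|x|^{-s}$ on $\mathbb R^d$ with $0<s\le d-2$; $V_{\alpha\beta}=a_{\alpha\beta}V$. The initial data $\bar f_\alpha^0\ge0$ are probability densities in $L^1\cap L^\infty(\mathbb R^d)$. $\chi\in C_c^\infty(\mathbb R^d)$ is a radially symmetric probability density supported in the unit ball $B_1$, $\chi^\varepsilon(x)=\varepsilon^{-d}\chi(\varepsilon^{-1}x)$, and $V^\varepsilon_{\alpha\beta}=a_{\alpha\beta}V*\chi^\varepsilon$. Limiting system (L), understood in the weak sense: $$\partial_t\bar f_\alpha=\sum_{\beta=1}^n\operatorname{div}(\bar f_\alpha\nabla V_{\alpha\beta}*\bar f_\beta)+\sigma_\alpha\Delta\bar f_\alpha,\quad \bar f_\alpha(0)=\bar f_\alpha^0,\quad \alpha=1,\dots,n.$$ Intermediate system (I): $$\partial_t\tilde f_{\alpha,\varepsilon}=\sum_{\beta=1}^n\operatorname{div}(\tilde f_{\alpha,\varepsilon}\nabla V^\varepsilon_{\alpha\beta}*\tilde f_{\beta,\varepsilon})+\sigma_\alpha\Delta\tilde f_{\alpha,\varepsilon},\quad \tilde f_{\alpha,\varepsilon}(0)=\bar f^0_\alpha,\quad \alpha=1,\dots,n.$$ Relative entropy: for probability densities $\mu,\nu$ on a Euclidean space $E$, $H(\mu|\nu)=\int_E\mu\log\frac{\mu}{\nu}$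 with respect to Lebesgue measure. *)

theory Defs
  imports "HOL-Probability.Probability" "HOL-Probability.Essential_Supremum"
begin

section \<open>Differential operators and test functions\<close>

definition dir_deriv :: "'a::real_normed_vector \<Rightarrow> ('a \<Rightarrow> real) \<Rightarrow> 'a \<Rightarrow> real" where
  "dir_deriv v f x = frechet_derivative f (at x) v"

definition gradient :: "('a::euclidean_space \<Rightarrow> real) \<Rightarrow> 'a \<Rightarrow> 'a" where
  "gradient f x = (\<Sum>b\<in>Basis. dir_deriv b f x *\<^sub>R b)"

definition laplacian :: "('a::euclidean_space \<Rightarrow> real) \<Rightarrow> 'a \<Rightarrow> real" where
  "laplacian f x = (\<Sum>b\<in>Basis. dir_deriv b (dir_deriv b f) x)"

primrec Ck :: "nat \<Rightarrow> ('a::euclidean_space \<Rightarrow> real) \<Rightarrow> bool" where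
  "Ck 0 f \<longleftrightarrow> continuous_on UNIV f"
| "Ck (Suc k) f \<longleftrightarrow> (\<forall>x. f differentiable (at x)) \<and> (\<forall>v. Ck k (dir_deriv v f))"

definition supp :: "('a::euclidean_space \<Rightarrow> real) \<Rightarrow> 'a set" where
  "supp f = closure {x. f x \<noteq> 0}"

definition test_function :: "('a::euclidean_space \<Rightarrow> real) \<Rightarrow> bool" where
  "test_function f \<longleftrightarrow> (\<forall>k. Ck k f) \<and> compact (supp f)"

section \<open>Norms\<close>

text \<open>Norms take values in the extended nonnegative reals, so that finiteness of a norm is
  membership in the corresponding space.\<close>

definition esqrt :: "ennreal \<Rightarrow> ennreal" where
  "esqrt x = (if x = \<top> then \<top> else ennreal (sqrt (enn2real x)))"

definition L1norm :: "'b measure \<Rightarrow> ('b \<Rightarrow> real) \<Rightarrow> ennreal" where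
  "L1norm M f = (\<integral>\<^sup>+x. ennreal \<bar>f x\<bar> \<partial>M)"

definition L2norm :: "'b measure \<Rightarrow> ('b \<Rightarrow> real) \<Rightarrow> ennreal" where
  "L2norm M f = esqrt (\<integral>\<^sup>+x. ennreal ((f x)\<^sup>2) \<partial>M)"

definition Linfnorm :: "'b measure \<Rightarrow> ('b \<Rightarrow> real) \<Rightarrow> ennreal" where
  "Linfnorm M f = esssup M (\<lambda>x. ennreal \<bar>f x\<bar>)"

definition prob_density :: "('a::euclidean_space \<Rightarrow> real) \<Rightarrow> bool" where
  "prob_density f \<longleftrightarrow> (AE x in lborel. 0 \<le> f x) \<and> has_bochner_integral lborel f 1"

definition has_weak_gradient :: "('a::euclidean_space \<Rightarrow> real) \<Rightarrow> ('a \<Rightarrow> 'a) \<Rightarrow> bool" where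
  "has_weak_gradient u g \<longleftrightarrow>
     u \<in> borel_measurable lborel \<and> g \<in> borel_measurable lborel \<and>
     (\<forall>K. compact K \<longrightarrow> set_integrable lborel K u \<and> set_integrable lborel K g) \<and>
     (\<forall>\<phi>. test_function \<phi> \<longrightarrow>
        (\<integral>x. u x *\<^sub>R gradient \<phi> x \<partial>lborel) = - (\<integral>x. \<phi> x *\<^sub>R g x \<partial>lborel))"

text \<open>Functions of time and space are written in curried form, \<open>f t x\<close>. All sections \<open>f t\<close> with
  \<open>t\<close> in the closed interval matter (see \<open>continuous_L2\<close> below), hence the closed interval here.\<close>

abbreviation time_interval :: "real \<Rightarrow> real measure" where
  "time_interval T \<equiv> restrict_space lborel {0..T}"

abbreviation space_time :: "real \<Rightarrow> (real \<times> 'a::euclidean_space) measure" where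
  "space_time T \<equiv> time_interval T \<Otimes>\<^sub>M lborel"

definition Linf_L1_Linf_norm :: "real \<Rightarrow> (real \<Rightarrow> 'a::euclidean_space \<Rightarrow> real) \<Rightarrow> ennreal" where
  "Linf_L1_Linf_norm T f =
     esssup (time_interval T) (\<lambda>t. L1norm lborel (f t) + Linfnorm lborel (f t))"

text \<open>The norm of \<open>L\<^sup>2(0,T;H\<^sup>1)\<close>. Strong measurability in \<open>H\<^sup>1\<close> amounts to joint
  measurability of the function and of its spatial weak gradient \<open>G\<close>. As \<open>G\<close> is unique up
  to null sets, the infimum ranges over a single value, or over the empty set (value \<open>\<top>\<close>) if
  there is no weak gradient.\<close>

definition L2_H1_norm :: "real \<Rightarrow> (real \<Rightarrow> 'a::euclidean_space \<Rightarrow> real) \<Rightarrow> ennreal" where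
  "L2_H1_norm T f =
     (INF G \<in> {G. (\<lambda>(t,x). G t x) \<in> borel_measurable (space_time T) \<and>
                  (AE t in time_interval T. has_weak_gradient (f t) (G t))}.
        esqrt (\<integral>\<^sup>+t. (\<integral>\<^sup>+x. ennreal ((f t x)\<^sup>2 + (norm (G t x))\<^sup>2) \<partial>lborel) \<partial>time_interval T))"

definition sol_norm :: "real \<Rightarrow> (real \<Rightarrow> 'a::euclidean_space \<Rightarrow> real) \<Rightarrow> ennreal" where
  "sol_norm T f = Linf_L1_Linf_norm T f + L2_H1_norm T f"

section \<open>Weak solutions\<close>

definition conv :: "('a::euclidean_space \<Rightarrow> 'b::euclidean_space) \<Rightarrow> ('a \<Rightarrow> real) \<Rightarrow> 'a \<Rightarrow> 'b" where
  "conv F g x = (\<integral>y. g y *\<^sub>R F (x - y) \<partial>lborel)"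

definition continuous_L2 :: "real \<Rightarrow> (real \<Rightarrow> 'a::euclidean_space \<Rightarrow> real) \<Rightarrow> bool" where
  "continuous_L2 T f \<longleftrightarrow>
     (\<forall>t\<in>{0..T}. L2norm lborel (f t) < \<top> \<and>
        ((\<lambda>r. L2norm lborel (\<lambda>x. f r x - f t x)) \<longlongrightarrow> 0) (at t within {0..T}))"

text \<open>Weak solutions of
  \<open>\<partial>\<^sub>t f\<^sub>\<alpha> = (\<Sum>\<beta>. div (f\<^sub>\<alpha> (\<nabla>W\<^sub>\<alpha>\<^sub>\<beta> * f\<^sub>\<beta>))) + \<sigma>\<^sub>\<alpha> \<Delta>f\<^sub>\<alpha>\<close>, \<open>f\<^sub>\<alpha>(0) = f0\<^sub>\<alpha>\<close>.
  A weak solution in the class where \<open>sol_norm\<close> is finite has a representative that is continuous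
  in time with values in \<open>L\<^sup>2\<close>; it is this representative that is meant by a solution, so that
  the initial condition and the values at all single times make sense.\<close>

definition weak_solution ::
  "real \<Rightarrow> ('n::finite \<Rightarrow> real) \<Rightarrow> ('n \<Rightarrow> 'n \<Rightarrow> 'a::euclidean_space \<Rightarrow> real) \<Rightarrow> ('n \<Rightarrow> 'a \<Rightarrow> real)
    \<Rightarrow> ('n \<Rightarrow> real \<Rightarrow> 'a \<Rightarrow> real) \<Rightarrow> bool" where
  "weak_solution T \<sigma> W f0 f \<longleftrightarrow>
     (\<forall>\<alpha>. (\<lambda>(t,x). f \<alpha> t x) \<in> borel_measurable (space_time T) \<and>
          continuous_L2 T (f \<alpha>) \<and>
          (AE x in lborel. f \<alpha> 0 x = f0 \<alpha> x) \<and>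
          (\<forall>\<phi> :: real \<times> 'a \<Rightarrow> real. test_function \<phi> \<and> supp \<phi> \<subseteq> {0<..<T} \<times> UNIV \<longrightarrow>
             has_bochner_integral (space_time T)
               (\<lambda>(t,x). f \<alpha> t x * (dir_deriv (1, 0) \<phi> (t, x)
                  - (\<Sum>\<beta>\<in>UNIV. conv (gradient (W \<alpha> \<beta>)) (f \<beta> t) x \<bullet> gradient (\<lambda>y. \<phi> (t, y)) x)
                  + \<sigma> \<alpha> * laplacian (\<lambda>y. \<phi> (t, y)) x)) 0))"

section \<open>Interaction potentials\<close>

text \<open>The value at the origin (\<open>0\<close>, since \<open>0 powr r = 0\<close>), and likewise the value of the gradient
  there, are immaterial: the potential only enters through convolutions.\<close>

definition potential :: "real \<Rightarrow> 'a::euclidean_space \<Rightarrow> real" where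
  "potential s x = norm x powr (- s)"

definition mollifier :: "('a::euclidean_space \<Rightarrow> real) \<Rightarrow> real \<Rightarrow> 'a \<Rightarrow> real" where
  "mollifier chi \<epsilon> x = chi ((1 / \<epsilon>) *\<^sub>R x) / \<epsilon> ^ DIM('a)"

definition interaction ::
  "('n \<Rightarrow> 'n \<Rightarrow> real) \<Rightarrow> real \<Rightarrow> 'n \<Rightarrow> 'n \<Rightarrow> 'a::euclidean_space \<Rightarrow> real" where
  "interaction a s \<alpha> \<beta> x = a \<alpha> \<beta> * potential s x"

definition interaction_eps ::
  "('n \<Rightarrow> 'n \<Rightarrow> real) \<Rightarrow> real \<Rightarrow> ('a::euclidean_space \<Rightarrow> real) \<Rightarrow> real \<Rightarrow> 'n \<Rightarrow> 'n \<Rightarrow> 'a \<Rightarrow> real" where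
  "interaction_eps a s chi \<epsilon> \<alpha> \<beta> x = a \<alpha> \<beta> * conv (potential s) (mollifier chi \<epsilon>) x"

section \<open>Relative entropy and tensor products\<close>

text \<open>The integrand \<open>\<mu> log (\<mu>/\<nu>)\<close> with the usual conventions \<open>0 log (0/\<nu>) = 0\<close>
  and \<open>\<mu> log (\<mu>/0) = \<infinity>\<close> for positive \<open>\<mu>\<close>. For probability densities its negative part
  is integrable because \<open>\<mu> log (\<mu>/\<nu>) \<ge> \<mu> - \<nu>\<close>, so the difference below never
  has the form \<open>\<infinity> - \<infinity>\<close>.\<close>

definition entropy_integrand :: "real \<Rightarrow> real \<Rightarrow> ereal" where
  "entropy_integrand u v = (if u = 0 then 0 else if v = 0 then \<infinity> else ereal (u * ln (u / v)))"

definition rel_entropy :: "('a::euclidean_space \<Rightarrow> real) \<Rightarrow> ('a \<Rightarrow> real) \<Rightarrow> ereal" where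
  "rel_entropy \<mu> \<nu> =
     enn2ereal (\<integral>\<^sup>+x. e2ennreal (entropy_integrand (\<mu> x) (\<nu> x)) \<partial>lborel)
     - enn2ereal (\<integral>\<^sup>+x. e2ennreal (- entropy_integrand (\<mu> x) (\<nu> x)) \<partial>lborel)"

text \<open>A point of \<open>(\<real>\<^sup>d)\<^bsup>|K|\<^esup>\<close> is a family indexed by the pairs \<open>(\<alpha>, k)\<close> with \<open>k < K \<alpha>\<close>.\<close>

definition tensor_index :: "('n \<Rightarrow> nat) \<Rightarrow> ('n \<times> nat) set" where
  "tensor_index K = (SIGMA \<alpha>:UNIV. {..<K \<alpha>})"

definition tensor :: "('n::finite \<Rightarrow> nat) \<Rightarrow> ('n \<Rightarrow> 'a \<Rightarrow> real) \<Rightarrow> ('n \<times> nat \<Rightarrow> 'a) \<Rightarrow> real" where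
  "tensor K g x = (\<Prod>\<alpha>\<in>UNIV. \<Prod>k<K \<alpha>. g \<alpha> (x (\<alpha>, k)))"

end

(*
  Everything is done on solutions mollified in space, for which the equation can be tested with
  nonlinear functions although the solutions have no regularity beyond L^2(0,T;H^1).
  Write w for the difference of the two solutions and c for the difference of their drifts.
  The L^2 energy of w and the relative entropy H (through its Hessian, a perfect square) are both
  bounded by the time integral of int ftilde |c|^2 + |w|^2, and H controls the square of the L^1
  norm of w by Hellinger's inequality. Splitting the kernel into an integrable and a bounded
  Lipschitz part gives int ftilde |c|^2 <= C (eps^2 (1 + |grad ftilde|_2^2) + |w|_2^2 + |w|_1^2),
  because mollifying a function at scale eps moves it by at most eps |grad|_2 in L^2. Gronwall's
  inequality for |w|_2^2 + |w|_1^2 closes the argument.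
  The second density in the entropy is replaced by v = (1 - l) fbar + l ftilde, which dominates
  l ftilde; this keeps the quotient bounded, and l tends to 0 only at the end.
*)
theory Submission imports Defs begin

text \<open>Mollifying in space alone already allows nonlinear test functions, because at each point
  the mollified density is a Lipschitz primitive in time. The price is that mollification does not
  commute with multiplication by the drift. The gradient of the potential is a small integrable
  kernel plus a bounded Lipschitz one, so the drifts have a modulus of continuity uniform in time
  and space; the commutator is then small relative to the mollified density itself, which the
  entropy tolerates although it divides by that density. The logarithm must also be kept away from
  0. Adding a constant \<open>\<kappa>\<close> to both densities does this, with an error of order
  \<open>B^2 / l^2\<close> times the integral of \<open>min \<kappa> v\<close>. This fixes the order
  of choices: the mollification scale and the weight \<open>l\<close> are tied together, and
  \<open>\<kappa>\<close> comes after both. Neither a sign of the solutions nor finiteness of the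
  entropy is assumed: nonnegativity is derived from the equation, and the entropy bound is obtained
  in the limit by lower semicontinuity. Gronwall's inequality needs an a priori bound, which is why
  the entropy is kept out of it.\<close>

abbreviation sum_Basis :: "('a::euclidean_space => 'c::comm_monoid_add) => 'c" (binder "SB " 10) where
 "sum_Basis f == sum f Basis"

abbreviation tends :: "(nat => 'a::topological_space) => 'a => bool" ("((_)/ ----> (_))" [60, 60] 60) where
 "X ----> L == X \<longlonglongrightarrow> L"

abbreviation ilb :: "('a::euclidean_space => 'c::{banach,second_countable_topology}) => bool" where "ilb == integrable lborel"

abbreviation bmb :: "('a::topological_space => 'b::topological_space) set" where "bmb == borel_measurable borel"

abbreviation nn_lborel :: "('a::euclidean_space => ennreal) => ennreal" (binder "NN " 10) where
 "nn_lborel f == nn_integral lborel f"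

abbreviation lebesgue_lborel :: "('a::euclidean_space => 'c::{banach,second_countable_topology}) => 'c" (binder "LB " 10) where
 "lebesgue_lborel f == integral\<^sup>L lborel f"

abbreviation joint_borel :: "(real * 'a::euclidean_space => 'b::topological_space) set" where
 "joint_borel == borel_measurable (lborel \<Otimes>\<^sub>M lborel)"

section \<open>Calculus of smooth functions with compact support\<close>

lemma Ck_differentiable: "Ck (Suc k) f ==> f differentiable (at x)"
 by simp

lemma Ck_dir_deriv: "Ck (Suc k) f ==> Ck k (dir_deriv v f)"
 by simp

lemma Ck_continuous: "Ck k f ==> continuous_on UNIV f"
 by (cases k) (auto intro!: differentiable_imp_continuous_on simp: differentiable_on_def)

lemma Ck_SucD: "Ck (Suc k) f ==> Ck k f"
proof (induction k arbitrary: f)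
 case 0
 then show ?case using Ck_continuous[OF 0] by simp
next
 case (Suc k)
 then show ?case by auto
qed

lemma dir_deriv_eq:
 assumes "(f has_derivative f') (at x)"
 shows "dir_deriv v f x = f' v"
 using frechet_derivative_at[OF assms] by (simp add: dir_deriv_def)

lemma has_derivative_dir_deriv:
 assumes "f differentiable (at x)"
 shows "(f has_derivative (%v. dir_deriv v f x)) (at x)"
 using assms frechet_derivative_works by (auto simp: dir_deriv_def)

lemma Ck_add: "Ck k f ==> Ck k g ==> Ck k (%x. f x + g x)"
proof (induction k arbitrary: f g)
 case 0
 then show ?case by (auto intro: continuous_intros)
next
 case (Suc k)
 have "dir_deriv v (%x. f x + g x) = (%x. dir_deriv v f x + dir_deriv v g x)" for v
 proof
  fix x
  have "((%x. f x + g x) has_derivative (%v. dir_deriv v f x + dir_deriv v g x)) (at x)"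
   using Suc.prems by (intro has_derivative_add has_derivative_dir_deriv) auto
  then show "dir_deriv v (%x. f x + g x) x = dir_deriv v f x + dir_deriv v g x"
   by (rule dir_deriv_eq)
 qed
 then show ?case using Suc by auto
qed

text \<open>The Leibniz rule keeps one factor undifferentiated, so the induction step also needs the
  factors themselves at the lower order, which \<open>Ck_SucD\<close> supplies.\<close>

lemma Ck_mult: "Ck k f ==> Ck k g ==> Ck k (%x. f x * g x)"
proof (induction k arbitrary: f g)
 case 0
 then show ?case by (auto intro: continuous_intros)
next
 case (Suc k)
 have "dir_deriv v (%x. f x * g x) = (%x. f x * dir_deriv v g x + dir_deriv v f x * g x)" for v
 proof
  fix x
  have "((%x. f x * g x) has_derivative (%v. f x * dir_deriv v g x + dir_deriv v f x * g x)) (at x)"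
   using Suc.prems by (intro has_derivative_mult has_derivative_dir_deriv) auto
  then show "dir_deriv v (%x. f x * g x) x = f x * dir_deriv v g x + dir_deriv v f x * g x"
   by (rule dir_deriv_eq)
 qed
 then show ?case using Suc Ck_SucD[OF Suc.prems(1)] Ck_SucD[OF Suc.prems(2)]
  by (auto intro!: Ck_add)
qed

lemma Ck_affine:
 fixes f :: "'a::euclidean_space => real" and L :: "'b::euclidean_space => 'a"
 assumes L: "bounded_linear L"
 shows "Ck k f ==> Ck k (%x. f (c + L x))"
proof (induction k arbitrary: f)
 case 0
 have "continuous_on UNIV (%x. c + L x)"
  using L by (intro continuous_intros) (auto intro: linear_continuous_on)
 then show ?case using 0 continuous_on_compose2[of UNIV f UNIV] by auto
next
 case (Suc k)
 have D: "((%x. f (c + L x)) has_derivative (%v. dir_deriv (L v) f (c + L x))) (at x)" for x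
 proof -
  have "((%x. c + L x) has_derivative L) (at x)"
   using L by (auto intro!: derivative_eq_intros bounded_linear_imp_has_derivative)
  moreover have "(f has_derivative (%v. dir_deriv v f (c + L x))) (at (c + L x))"
   using Suc.prems by (intro has_derivative_dir_deriv) auto
  ultimately show ?thesis
   using diff_chain_at[of "%x. c + L x" L x f] by (auto simp: o_def)
 qed
 then have "dir_deriv v (%x. f (c + L x)) = (%x. dir_deriv (L v) f (c + L x))" for v
  by (intro ext dir_deriv_eq)
 then show ?case using Suc D by (auto simp: differentiable_def)
qed

lemma supp_subset: "closed S ==> (!!x. f x ~= 0 ==> x \<in> S) ==> supp f \<subseteq> S"
 unfolding supp_def by (rule closure_minimal) auto

lemma supp_supset: "f x ~= 0 ==> x \<in> supp f"
 unfolding supp_def by (simp add: closure_def)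

lemma test_functionI:
 assumes "!!k. Ck k f" "compact S" "!!x. f x ~= 0 ==> x \<in> S"
 shows "test_function f"
proof -
 have "supp f \<subseteq> S"
  using assms by (intro supp_subset compact_imp_closed) auto
 then have "compact (supp f)"
  using assms(2) by (metis compact_Int_closed closed_closure inf.absorb2 supp_def)
 then show ?thesis using assms(1) by (auto simp: test_function_def)
qed

lemma test_function_dir_deriv_Ck: "test_function f ==> Ck k (dir_deriv v f)"
 unfolding test_function_def using Ck_dir_deriv by blast

lemma test_function_differentiable: "test_function f ==> f differentiable (at x)"
 unfolding test_function_def using Ck_differentiable by blast

lemma test_function_has_derivative:
 "test_function f ==> (f has_derivative (%v. dir_deriv v f x)) (at x)"
 by (intro has_derivative_dir_deriv test_function_differentiable)

lemma test_function_continuous: "test_function f ==> continuous_on UNIV f"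
 unfolding test_function_def using Ck_continuous by blast

lemma test_function_measurable [measurable_dest]:
 "test_function f ==> f \<in> bmb"
 by (intro borel_measurable_continuous_onI test_function_continuous)

lemma test_function_dir_deriv:
 assumes "test_function f"
 shows "test_function (dir_deriv v f)"
proof (rule test_functionI)
 show "Ck k (dir_deriv v f)" for k
  using assms by (rule test_function_dir_deriv_Ck)
 show "compact (supp f)"
  using assms by (simp add: test_function_def)
 fix x assume nz: "dir_deriv v f x ~= 0"
 show "x \<in> supp f"
 proof (rule ccontr)
  assume x: "x \<notin> supp f"
  \<comment> \<open>Off the closed support the function agrees with 0 on an open set, so its
    derivative vanishes there.\<close>
  have "open (- supp f)" by (auto simp: supp_def)
  have "((%_. 0) has_derivative (%_. 0)) (at x)" by simp
  then have "(f has_derivative (%_. 0)) (at x)"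
  proof (rule has_derivative_transform_within_open)
   show "open (- supp f)" "x \<in> - supp f" by fact (use x in auto)
   show "!!y. y \<in> - supp f ==> 0 = f y" using supp_supset[of f] by auto
  qed
  then show False using nz dir_deriv_eq by fastforce
 qed
qed

lemma test_function_affine:
 fixes f :: "'a::euclidean_space => real"
 assumes f: "test_function f" and "c ~= 0"
 shows "test_function (%x. f (b + c *\<^sub>R x))"
proof (rule test_functionI)
 show "Ck k (%x. f (b + c *\<^sub>R x))" for k
  using f by (intro Ck_affine bounded_linear_scaleR_right) (auto simp: test_function_def)
 show "compact ((%y. (1 / c) *\<^sub>R (y - b)) ` supp f)"
  using f by (intro compact_continuous_image continuous_intros) (auto simp: test_function_def)
 fix x assume "f (b + c *\<^sub>R x) ~= 0"
 then have "b + c *\<^sub>R x \<in> supp f" by (rule supp_supset)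
 then show "x \<in> (%y. (1 / c) *\<^sub>R (y - b)) ` supp f"
  using \<open>c ~= 0\<close> by (intro image_eqI[where x="b + c *\<^sub>R x"]) auto
qed

lemma Ck_const: "Ck k (%x. c)"
proof (induction k arbitrary: c)
 case (Suc k)
 have "dir_deriv v (%x::'a. c) = (%x. 0)" for v
  by (auto intro!: dir_deriv_eq[where f'="%_. 0"])
 then show ?case using Suc by auto
qed auto

lemma test_function_cmult:
 assumes f: "test_function f"
 shows "test_function (%x. c * f x)"
proof (rule test_functionI)
 show "Ck k (%x. c * f x)" for k
  using f Ck_mult[OF Ck_const] by (auto simp: test_function_def)
 show "compact (supp f)" using f by (auto simp: test_function_def)
qed (auto intro: supp_supset)

lemma test_function_bounded:
 assumes f: "test_function f"
 obtains B where "B > 0" "!!x. \<bar>f x\<bar> <= B"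
proof -
 have "compact (f ` supp f)"
  using f by (intro compact_continuous_image continuous_on_subset[OF test_function_continuous])
   (auto simp: test_function_def)
 then obtain B where B: "B > 0" "!!y. y \<in> f ` supp f ==> \<bar>y\<bar> <= B"
  using compact_imp_bounded bounded_pos by (metis real_norm_def)
 have "\<bar>f x\<bar> <= B" for x
  using B supp_supset[of f x] by (cases "f x = 0") auto
 then show ?thesis using B(1) that by blast
qed

lemma test_function_integrable:
 fixes f :: "'a::euclidean_space => real"
 assumes f: "test_function f"
 shows "ilb f"
proof -
 have "ilb (%x. indicator (supp f) x *\<^sub>R f x)"
  using f by (intro borel_integrable_compact continuous_on_subset[OF test_function_continuous[OF f]])
   (auto simp: test_function_def)
 moreover have "(%x. indicator (supp f) x *\<^sub>R f x) = f"
  using supp_supset[of f] by (auto simp: indicator_def fun_eq_iff)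
 ultimately show ?thesis by simp
qed

text \<open>The partial derivatives are again test functions, hence bounded, and finitely many of
  them bound the whole derivative. The mean value inequality on the convex set \<open>UNIV\<close>
  does the rest.\<close>

lemma test_function_lipschitz:
 fixes f :: "'a::euclidean_space => real"
 assumes f: "test_function f"
 obtains L where "L > 0" "!!x y. \<bar>f x - f y\<bar> <= L * norm (x - y)"
proof -
 have "\<exists>B>0. \<forall>x. \<bar>dir_deriv b f x\<bar> <= B" for b
  using test_function_bounded[OF test_function_dir_deriv[OF f]] by metis
 then obtain B where B: "!!b. B b > 0" "!!b x. \<bar>dir_deriv b f x\<bar> <= B b" by metis
 define L where "L = (SB b. B b)"
 have bd: "norm (dir_deriv v f x) <= L * norm v" for v x
 proof -
  have lin: "linear (%v. dir_deriv v f x)"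
   using test_function_has_derivative[OF f] has_derivative_linear by blast
  have "dir_deriv v f x = dir_deriv (SB b. (v \<bullet> b) *\<^sub>R b) f x"
   by (simp add: euclidean_representation)
  also have "... = (SB b. dir_deriv ((v \<bullet> b) *\<^sub>R b) f x)"
   by (rule linear_sum[OF lin])
  also have "... = (SB b. (v \<bullet> b) * dir_deriv b f x)"
   using linear_scale[OF lin] by (intro sum.cong) auto
  also have "norm ... <= (SB b. \<bar>v \<bullet> b\<bar> * \<bar>dir_deriv b f x\<bar>)"
   by (metis (no_types, lifting) abs_mult norm_sum real_norm_def sum.cong)
  also have "... <= (SB b. norm v * B b)"
   using B by (intro sum_mono mult_mono) (auto simp: Basis_le_norm)
  finally show ?thesis by (simp add: L_def sum_distrib_left mult.commute)
 qed
 have "L > 0" unfolding L_def using B by (intro sum_pos) auto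
 moreover have "\<bar>f x - f y\<bar> <= L * norm (x - y)" for x y
 proof -
  have "norm (f x - f y) <= L * norm (x - y)"
  proof (rule differentiable_bound[where S=UNIV and f'="%x v. dir_deriv v f x"])
   show "!!x. (f has_derivative (%v. dir_deriv v f x)) (at x within UNIV)"
    using test_function_has_derivative[OF f] by simp
   show "!!x. onorm (%v. dir_deriv v f x) <= L"
    using bd \<open>L > 0\<close> by (intro onorm_le) auto
  qed auto
  then show ?thesis by simp
 qed
 ultimately show ?thesis using that by blast
qed

section \<open>Invariance of Lebesgue measure and elementary integral inequalities\<close>

lemma lborel_distr_translate: "distr lborel borel (%x::'a::euclidean_space. c + x) = lborel"
 using lborel_affine[of 1 c] by (simp add: density_1)

lemma lborel_distr_reflect: "distr lborel borel (%x::'a::euclidean_space. c - x) = lborel"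
 using lborel_affine[of "-1" c] by (simp add: density_1)

lemma nn_integral_translate:
 fixes f :: "'a::euclidean_space => ennreal"
 assumes [measurable]: "f \<in> bmb"
 shows "(NN x. f (x + c)) = (NN x. f x)"
proof -
 have "(NN x. f x) = (\<integral>\<^sup>+x. f x \<partial>distr lborel borel (%x. c + x))"
  by (simp add: lborel_distr_translate)
 also have "... = (NN x. f (c + x))"
  by (subst nn_integral_distr) auto
 finally show ?thesis by (simp add: add.commute)
qed

lemma nn_integral_reflect:
 fixes f :: "'a::euclidean_space => ennreal"
 assumes [measurable]: "f \<in> bmb"
 shows "(NN x. f (c - x)) = (NN x. f x)"
proof -
 have "(NN x. f x) = (\<integral>\<^sup>+x. f x \<partial>distr lborel borel (%x. c - x))"
  by (simp add: lborel_distr_reflect)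
 also have "... = (NN x. f (c - x))"
  by (subst nn_integral_distr) auto
 finally show ?thesis by simp
qed

lemma integral_translate:
 fixes f :: "'a::euclidean_space => 'b::{banach,second_countable_topology}"
 assumes [measurable]: "f \<in> bmb"
 shows "(LB x. f (x + c)) = (LB x. f x)"
proof -
 have "(LB x. f x) = (\<integral>x. f x \<partial>distr lborel borel (%x. c + x))"
  by (simp add: lborel_distr_translate)
 also have "... = (LB x. f (c + x))"
  by (subst integral_distr) auto
 finally show ?thesis by (simp add: add.commute)
qed

lemma integral_reflect:
 fixes f :: "'a::euclidean_space => 'b::{banach,second_countable_topology}"
 assumes [measurable]: "f \<in> bmb"
 shows "(LB x. f (c - x)) = (LB x. f x)"
proof -
 have "(LB x. f x) = (\<integral>x. f x \<partial>distr lborel borel (%x. c - x))"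
  by (simp add: lborel_distr_reflect)
 also have "... = (LB x. f (c - x))"
  by (subst integral_distr) auto
 finally show ?thesis by simp
qed

lemma integrable_translate:
 fixes f :: "'a::euclidean_space => 'b::{banach,second_countable_topology}"
 assumes "ilb f"
 shows "ilb (%x. f (x + c))"
proof -
 have [measurable]: "f \<in> bmb" using assms by auto
 have "integrable (distr lborel borel (%x. c + x)) f"
  using assms by (simp add: lborel_distr_translate)
 then show ?thesis
  by (subst (asm) integrable_distr_eq) (auto simp: add.commute)
qed

lemma integrable_reflect:
 fixes f :: "'a::euclidean_space => 'b::{banach,second_countable_topology}"
 assumes "ilb f"
 shows "ilb (%x. f (c - x))"
proof -
 have [measurable]: "f \<in> bmb" using assms by auto
 have "integrable (distr lborel borel (%x. c - x)) f"
  using assms by (simp add: lborel_distr_reflect)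
 then show ?thesis
  by (subst (asm) integrable_distr_eq) auto
qed

lemma integrable_scaleR_bounded:
 fixes g :: "'a => 'b::{banach,second_countable_topology}"
 assumes g: "integrable M g" and [measurable]: "h \<in> borel_measurable M"
  and B: "AE x in M. \<bar>h x\<bar> <= B"
 shows "integrable M (%x. h x *\<^sub>R g x)"
proof (rule Bochner_Integration.integrable_bound)
 show "integrable M (%x. B * norm (g x))" using g by auto
 show "AE x in M. norm (h x *\<^sub>R g x) <= norm (B * norm (g x))"
  using B by eventually_elim (auto simp: abs_mult intro!: mult_right_mono)
qed (use g in measurable)

lemma norm_integral_scaleR_bounded:
 fixes g :: "'a => 'b::{banach,second_countable_topology}"
 assumes g: "integrable M g" and "h \<in> borel_measurable M"
  and B: "AE x in M. \<bar>h x\<bar> <= B"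
 shows "norm (\<integral>x. h x *\<^sub>R g x \<partial>M) <= B * (\<integral>x. norm (g x) \<partial>M)"
proof -
 have "norm (\<integral>x. h x *\<^sub>R g x \<partial>M) <= (\<integral>x. norm (h x *\<^sub>R g x) \<partial>M)"
  by (rule integral_norm_bound)
 also have "... <= (\<integral>x. B * norm (g x) \<partial>M)"
  using integrable_scaleR_bounded[OF assms] g
  by (intro integral_mono_AE integrable_norm) (use B in \<open>auto intro!: mult_right_mono\<close>)
 finally show ?thesis by simp
qed

text \<open>The weight is split into two square roots. With a weight of mass one this is Jensen's
  inequality for the square; with the norm of a kernel as weight it is the core of Young's
  inequality in \<open>L^2\<close>.\<close>

lemma Cauchy_Schwarz_weighted:
 fixes w g :: "'a => real"
 assumes [measurable]: "w \<in> borel_measurable M" "g \<in> borel_measurable M"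
  and "!!x. 0 <= w x" "!!x. 0 <= g x"
 shows "(\<integral>\<^sup>+x. ennreal (w x * g x) \<partial>M)^2
  <= (\<integral>\<^sup>+x. ennreal (w x) \<partial>M) * (\<integral>\<^sup>+x. ennreal (w x * (g x)^2) \<partial>M)"
proof -
 have "(\<integral>\<^sup>+x. ennreal (w x * g x) \<partial>M)
   = (\<integral>\<^sup>+x. ennreal (sqrt (w x)) * ennreal (sqrt (w x) * g x) \<partial>M)"
  using assms by (intro nn_integral_cong) (simp flip: ennreal_mult add: ennreal_mult[symmetric] mult.assoc[symmetric])
 also have "(...)^2 <= (\<integral>\<^sup>+x. (ennreal (sqrt (w x)))^2 \<partial>M) * (\<integral>\<^sup>+x. (ennreal (sqrt (w x) * g x))^2 \<partial>M)"
  by (rule Cauchy_Schwarz_nn_integral) measurable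
 also have "(\<integral>\<^sup>+x. (ennreal (sqrt (w x)))^2 \<partial>M) = (\<integral>\<^sup>+x. ennreal (w x) \<partial>M)"
  using assms by (intro nn_integral_cong) (simp add: ennreal_power)
 also have "(\<integral>\<^sup>+x. (ennreal (sqrt (w x) * g x))^2 \<partial>M) = (\<integral>\<^sup>+x. ennreal (w x * (g x)^2) \<partial>M)"
  using assms by (intro nn_integral_cong) (simp add: ennreal_power power_mult_distrib)
 finally show ?thesis .
qed

lemma ennreal_norm_integral_le:
 fixes f :: "'a => 'b::{banach,second_countable_topology}"
 shows "ennreal (norm (\<integral>x. f x \<partial>M)) <= (\<integral>\<^sup>+x. ennreal (norm (f x)) \<partial>M)"
proof (cases "integrable M f")
 case True
 then show ?thesis
  by (subst nn_integral_eq_integral) (auto intro!: ennreal_leI integral_norm_bound)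
qed (simp add: not_integrable_integral_eq)

section \<open>Mollification\<close>

text \<open>A mirror image of \<open>conv\<close>: here the kernel is scalar and the function may be
  vector valued, so that a pair of densities can be mollified as one object.\<close>

definition mollify :: "('a::euclidean_space => real) => ('a => 'c::euclidean_space) => 'a => 'c" where
 "mollify \<phi> g z = (LB x. \<phi> (z - x) *\<^sub>R g x)"

lemma mollify_eq_integral_shift:
 assumes [measurable]: "\<phi> \<in> bmb" "g \<in> bmb"
 shows "mollify \<phi> g z = (LB y. \<phi> y *\<^sub>R g (z - y))"
 using integral_reflect[of "%x. \<phi> (z - x) *\<^sub>R g x" z] by (simp add: mollify_def)

lemma mollify_cong_AE:
 assumes "AE x in lborel. g x = h x"
  and [measurable]: "\<phi> \<in> bmb" "g \<in> bmb" "h \<in> bmb"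
 shows "mollify \<phi> g = mollify \<phi> h"
 unfolding mollify_def using assms(1) by (intro ext integral_cong_AE) auto

lemma mollify_integrand_integrable:
 fixes g :: "'a::euclidean_space => 'c::euclidean_space"
 assumes "ilb g" and [measurable]: "\<phi> \<in> bmb" and "!!x. \<bar>\<phi> x\<bar> <= B"
 shows "ilb (%x. \<phi> (z - x) *\<^sub>R g x)"
 using assms by (intro integrable_scaleR_bounded[where B=B]) auto

lemma mollify_test_integrand:
 fixes g :: "'a::euclidean_space => 'c::euclidean_space"
 assumes "ilb g" "test_function \<phi>"
 shows "ilb (%x. \<phi> (z - x) *\<^sub>R g x)"
 using test_function_bounded[OF assms(2)] mollify_integrand_integrable[OF assms(1)]
  test_function_measurable[OF assms(2)] by metis

lemma mollify_norm_le:
 assumes "ilb g" and [measurable]: "\<phi> \<in> bmb" and "!!x. \<bar>\<phi> x\<bar> <= B"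
 shows "norm (mollify \<phi> g z) <= B * (LB x. norm (g x))"
 unfolding mollify_def using assms by (intro norm_integral_scaleR_bounded) auto

lemma mollify_measurable_pair [measurable (raw)]:
 assumes [measurable]: "\<phi> \<in> bmb"
  "(%(t,x). f t x) \<in> borel_measurable (M \<Otimes>\<^sub>M lborel)"
 shows "(%(t,z). mollify \<phi> (f t) z) \<in> borel_measurable (M \<Otimes>\<^sub>M lborel)"
proof -
 have [measurable]: "(%p. (%(t,x). f t x) (fst (fst p), snd p)) \<in> borel_measurable ((M \<Otimes>\<^sub>M lborel) \<Otimes>\<^sub>M lborel)"
  by (rule measurable_compose[OF _ assms(2)]) measurable
 have "(%w. LB x. (%p. \<phi> (snd (fst p) - snd p) *\<^sub>R (%(t,x). f t x) (fst (fst p), snd p)) (w, x))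
   \<in> borel_measurable (M \<Otimes>\<^sub>M lborel)"
  by (rule lborel.borel_measurable_lebesgue_integral) measurable
 then show ?thesis by (simp add: mollify_def case_prod_beta')
qed

lemma mollify_measurable [measurable (raw)]:
 assumes [measurable]: "\<phi> \<in> bmb" "g \<in> bmb"
 shows "mollify \<phi> g \<in> bmb"
proof -
 have "(%z. LB x. (%(z,x). \<phi> (z - x) *\<^sub>R g x) (z, x)) \<in> borel_measurable lborel"
  by (rule lborel.borel_measurable_lebesgue_integral) measurable
 then show ?thesis by (simp add: mollify_def[abs_def])
qed

text \<open>Young's inequality for two \<open>L^1\<close> factors, by Tonelli and translation
  invariance. In extended nonnegative form it can be used to prove integrability, not just to bound
  a norm.\<close>

lemma mollify_nn_integral_le:
 assumes [measurable]: "\<phi> \<in> bmb" "g \<in> bmb"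
 shows "(NN z. ennreal (norm (mollify \<phi> g z)))
  <= (NN x. ennreal \<bar>\<phi> x\<bar>) * (NN x. ennreal (norm (g x)))"
proof -
 have "(NN z. ennreal (norm (mollify \<phi> g z)))
   <= (NN z. (NN x. ennreal \<bar>\<phi> (z - x)\<bar> * ennreal (norm (g x))))"
  unfolding mollify_def
  by (intro nn_integral_mono order_trans[OF ennreal_norm_integral_le]) (auto simp: ennreal_mult)
 also have "... = (NN x. (NN z. ennreal \<bar>\<phi> (z - x)\<bar> * ennreal (norm (g x))))"
  by (rule lborel_pair.Fubini') measurable
 also have "... = (NN x. (NN z. ennreal \<bar>\<phi> (z + (- x))\<bar>) * ennreal (norm (g x)))"
  by (intro nn_integral_cong) (subst nn_integral_multc, auto)
 also have "... = (NN x. ennreal \<bar>\<phi> x\<bar>) * (NN x. ennreal (norm (g x)))"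
  by (subst nn_integral_translate) (auto simp: nn_integral_cmult)
 finally show ?thesis .
qed

lemma mollify_integrable:
 assumes \<phi>: "ilb \<phi>" and g: "ilb g"
 shows "ilb (mollify \<phi> g)"
  and "(LB z. norm (mollify \<phi> g z)) <= (LB x. \<bar>\<phi> x\<bar>) * (LB x. norm (g x))"
proof -
 have [measurable]: "\<phi> \<in> bmb" "g \<in> bmb" using \<phi> g by auto
 have le: "(NN z. ennreal (norm (mollify \<phi> g z)))
  <= ennreal ((LB x. \<bar>\<phi> x\<bar>) * (LB x. norm (g x)))"
  using mollify_nn_integral_le[of \<phi> g] \<phi> g
  by (simp add: nn_integral_eq_integral ennreal_mult)
 show i: "ilb (mollify \<phi> g)"
  by (rule integrableI_bounded) (use le in \<open>auto simp: le_less_trans[OF le ennreal_less_top]\<close>)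
 show "(LB z. norm (mollify \<phi> g z)) <= (LB x. \<bar>\<phi> x\<bar>) * (LB x. norm (g x))"
 proof -
  have "0 <= (LB x. \<bar>\<phi> x\<bar>) * (LB x. norm (g x))"
   by (intro mult_nonneg_nonneg Bochner_Integration.integral_nonneg) auto
  then show ?thesis
   using le i by (subst (asm) nn_integral_eq_integral) (auto simp: ennreal_le_iff)
 qed
qed

lemma integral_mollify:
 assumes \<phi>: "ilb \<phi>" and g: "ilb g"
 shows "(LB z. mollify \<phi> g z) = (LB x. \<phi> x) *\<^sub>R (LB x. g x)"
proof -
 have [measurable]: "\<phi> \<in> bmb" "g \<in> bmb" using \<phi> g by auto
 have tr: "ilb (%z. \<phi> (z - x))" "(LB z. \<phi> (z - x)) = (LB x. \<phi> x)" for x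
  using integrable_translate[OF \<phi>, of "- x"] integral_translate[of \<phi> "-x"] by auto
 have trn: "(LB z. \<bar>\<phi> (z - x)\<bar>) = (LB x. \<bar>\<phi> x\<bar>)" for x
  using integral_translate[of "%z. \<bar>\<phi> z\<bar>" "-x"] by auto
 have int: "integrable (lborel \<Otimes>\<^sub>M lborel) (%(x,z). \<phi> (z - x) *\<^sub>R g x)"
 proof (rule lborel_pair.Fubini_integrable)
  show "ilb (%x. LB z. norm (case (x, z) of (x, z) => \<phi> (z - x) *\<^sub>R g x))"
   using g by (simp add: trn)
  show "AE x in lborel. ilb (%z. case (x, z) of (x, z) => \<phi> (z - x) *\<^sub>R g x)"
   using tr by auto
 qed measurable
 have "(LB z. mollify \<phi> g z) = (LB x. (LB z. \<phi> (z - x) *\<^sub>R g x))"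
  unfolding mollify_def using lborel_pair.Fubini_integral[OF int] by simp
 also have "... = (LB x. (LB x. \<phi> x) *\<^sub>R g x)"
  using tr by simp
 finally show ?thesis by simp
qed

lemma test_function_dir_deriv_linear:
 assumes "test_function \<phi>" shows "linear (%v. dir_deriv v \<phi> x)"
 using test_function_has_derivative[OF assms] has_derivative_linear by blast

lemma test_function_dir_deriv_expand:
 assumes "test_function (\<phi> :: 'a::euclidean_space => real)"
 shows "dir_deriv v \<phi> x = (SB b. (v \<bullet> b) * dir_deriv b \<phi> x)"
proof -
 note lin = test_function_dir_deriv_linear[OF assms, of x]
 have "dir_deriv v \<phi> x = dir_deriv (SB b. (v \<bullet> b) *\<^sub>R b) \<phi> x"
  by (simp add: euclidean_representation)
 also have "... = (SB b. dir_deriv ((v \<bullet> b) *\<^sub>R b) \<phi> x)"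
  by (rule linear_sum[OF lin])
 also have "... = (SB b. (v \<bullet> b) * dir_deriv b \<phi> x)"
  using linear_scale[OF lin] by (intro sum.cong) auto
 finally show ?thesis .
qed

lemma test_function_dir_deriv_bound:
 fixes \<phi> :: "'a::euclidean_space => real"
 assumes \<phi>: "test_function \<phi>"
 obtains L where "L > 0" "!!v x. \<bar>dir_deriv v \<phi> x\<bar> <= L * norm v"
  "!!v x y. \<bar>dir_deriv v \<phi> x - dir_deriv v \<phi> y\<bar> <= L * norm (x - y) * norm v"
proof -
 have "\<exists>B>0. \<forall>x. \<bar>dir_deriv b \<phi> x\<bar> <= B" for b
  using test_function_bounded[OF test_function_dir_deriv[OF \<phi>]] by metis
 then obtain B where B: "!!b. B b > 0" "!!b x. \<bar>dir_deriv b \<phi> x\<bar> <= B b" by metis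
 have "\<exists>B>0. \<forall>x y. \<bar>dir_deriv b \<phi> x - dir_deriv b \<phi> y\<bar> <= B * norm (x - y)" for b
  using test_function_lipschitz[OF test_function_dir_deriv[OF \<phi>]] by metis
 then obtain B' where B': "!!b. B' b > 0"
  "!!b x y. \<bar>dir_deriv b \<phi> x - dir_deriv b \<phi> y\<bar> <= B' b * norm (x - y)" by metis
 define L where "L = (\<Sum>b\<in>(Basis::'a set). B b + B' b)"
 have "L > 0" unfolding L_def using B B' by (intro sum_pos) (auto simp: add_pos_pos)
 moreover have "\<bar>dir_deriv v \<phi> x\<bar> <= L * norm v" for v x
 proof -
  have "\<bar>dir_deriv v \<phi> x\<bar> <= (SB b. \<bar>(v \<bullet> b) * dir_deriv b \<phi> x\<bar>)"
   by (subst test_function_dir_deriv_expand[OF \<phi>]) (rule sum_abs)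
  also have "... <= (SB b. norm v * (B b + B' b))"
   unfolding abs_mult using B B'
   by (intro sum_mono mult_mono) (auto simp: Basis_le_norm less_imp_le intro!: add_increasing2)
  finally show ?thesis by (simp add: L_def sum_distrib_left mult.commute)
 qed
 moreover have "\<bar>dir_deriv v \<phi> x - dir_deriv v \<phi> y\<bar> <= L * norm (x - y) * norm v" for v x y
 proof -
  have "dir_deriv v \<phi> x - dir_deriv v \<phi> y = (SB b. (v \<bullet> b) * (dir_deriv b \<phi> x - dir_deriv b \<phi> y))"
   by (simp add: test_function_dir_deriv_expand[OF \<phi>, of v] sum_subtractf right_diff_distrib)
  also have "\<bar>...\<bar> <= (SB b. \<bar>(v \<bullet> b) * (dir_deriv b \<phi> x - dir_deriv b \<phi> y)\<bar>)"
   by (rule sum_abs)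
  also have "... <= (SB b. norm v * ((B b + B' b) * norm (x - y)))"
   unfolding abs_mult using B B'
   by (intro sum_mono mult_mono order_trans[OF B'(2)] mult_right_mono)
    (auto simp: Basis_le_norm less_imp_le)
  finally show ?thesis by (simp add: L_def sum_distrib_left sum_distrib_right mult.commute mult.left_commute)
 qed
 ultimately show ?thesis using that by blast
qed

text \<open>The mean value inequality is applied on the segment to \<open>f\<close> minus its
  linearisation at \<open>x\<close>, whose derivative is at most \<open>L * norm (y - x)\<close>
  there. This crude route gives \<open>L\<close> in place of \<open>L / 2\<close>.\<close>

lemma norm_taylor_le:
 fixes f :: "'a::real_normed_vector => 'b::real_normed_vector"
 assumes "convex S" "x \<in> S" "y \<in> S" "L \<ge> 0"
  and D: "!!z. z \<in> S ==> (f has_derivative f' z) (at z within S)"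
  and L: "!!z w h. z \<in> S ==> w \<in> S ==> norm (f' z h - f' w h) <= L * norm (z - w) * norm h"
 shows "norm (f y - f x - f' x (y - x)) <= L * norm (y - x) ^ 2"
proof -
 let ?S = "closed_segment x y"
 have sub: "?S \<subseteq> S" using assms by (simp add: closed_segment_subset)
 have "norm (f y - f x - f' x (y - x)) <= norm (y - x) * (L * norm (y - x))"
 proof (rule differentiable_bound_linearization[where S="?S"])
  show "x + t *\<^sub>R (y - x) \<in> ?S" if "t \<in> {0..1}" for t
   using that by (auto simp: in_segment algebra_simps intro!: exI[of _ t])
  show "(f has_derivative f' z) (at z within ?S)" if "z \<in> ?S" for z
   using D sub that by (meson has_derivative_subset subsetD)
  show "onorm (f' z - f' x) <= L * norm (y - x)" if "z \<in> ?S" for z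
  proof (rule onorm_bound)
   show "0 <= L * norm (y - x)" using \<open>L \<ge> 0\<close> by simp
   fix h
   have "norm (f' z h - f' x h) <= L * norm (z - x) * norm h"
    using L that sub assms by blast
   also have "... <= L * norm (y - x) * norm h"
    using that \<open>L \<ge> 0\<close> segment_bound(1)[OF that] by (intro mult_right_mono mult_left_mono) auto
   finally show "norm ((f' z - f' x) h) <= L * norm (y - x) * norm h" by simp
  qed
 qed auto
 then show ?thesis by (simp add: power2_eq_square mult_ac)
qed

text \<open>The derivative falls on the kernel. The second order Taylor remainder of a test function
  is uniform in the point, so integrating it against \<open>g\<close> leaves an error of size
  \<open>L * N * norm h ^ 2\<close>.\<close>

lemma mollify_has_derivative:
 fixes g :: "'a::euclidean_space => 'c::euclidean_space"
 assumes \<phi>: "test_function \<phi>" and g: "ilb g"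
 shows "(mollify \<phi> g has_derivative (%v. mollify (dir_deriv v \<phi>) g z)) (at z)"
proof -
 obtain L where L: "L > 0" "!!v x. \<bar>dir_deriv v \<phi> x\<bar> <= L * norm v"
  "!!v x y. \<bar>dir_deriv v \<phi> x - dir_deriv v \<phi> y\<bar> <= L * norm (x - y) * norm v"
  using test_function_dir_deriv_bound[OF \<phi>] by metis
 define N where "N = (LB x. norm (g x))"
 have N: "N \<ge> 0" by (simp add: N_def)
 have [measurable]: "g \<in> bmb" "\<phi> \<in> bmb"
  "dir_deriv v \<phi> \<in> bmb" for v
  using g \<phi> test_function_measurable test_function_dir_deriv by auto
 note int = mollify_test_integrand[OF g \<phi>]
 note intd = mollify_test_integrand[OF g test_function_dir_deriv[OF \<phi>]]
 have bl: "bounded_linear (%v. mollify (dir_deriv v \<phi>) g z)"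
 proof (rule bounded_linear_intro[where K="L * N"])
  note lin = test_function_dir_deriv_linear[OF \<phi>]
  show "mollify (dir_deriv (v + w) \<phi>) g z = mollify (dir_deriv v \<phi>) g z + mollify (dir_deriv w \<phi>) g z" for v w
   unfolding mollify_def linear_add[OF lin] using intd
   by (simp add: scaleR_add_left)
  show "mollify (dir_deriv (r *\<^sub>R v) \<phi>) g z = r *\<^sub>R mollify (dir_deriv v \<phi>) g z" for r v
   unfolding mollify_def linear_scale[OF lin] using intd by (simp flip: scaleR_scaleR)
  show "norm (mollify (dir_deriv v \<phi>) g z) <= norm v * (L * N)" for v
   using mollify_norm_le[OF g _ L(2)[of v]] by (simp add: N_def mult_ac)
 qed
 have "norm (mollify \<phi> g (z + h) - mollify \<phi> g z - mollify (dir_deriv h \<phi>) g z) <= L * N * norm h ^ 2" for h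
 proof -
  have "mollify \<phi> g (z + h) - mollify \<phi> g z - mollify (dir_deriv h \<phi>) g z
    = (LB x. (\<phi> (z + h - x) - \<phi> (z - x) - dir_deriv h \<phi> (z - x)) *\<^sub>R g x)"
   unfolding mollify_def scaleR_diff_left
   using int intd by simp
  also have "norm ... <= (L * norm h ^ 2) * (LB x. norm (g x))"
  proof (rule norm_integral_scaleR_bounded[OF g])
   show "AE x in lborel. \<bar>\<phi> (z + h - x) - \<phi> (z - x) - dir_deriv h \<phi> (z - x)\<bar> <= L * norm h ^ 2"
   proof (intro AE_I2)
    fix x
    have "norm (\<phi> (z + h - x) - \<phi> (z - x) - dir_deriv (z + h - x - (z - x)) \<phi> (z - x)) <= L * norm (z + h - x - (z - x)) ^ 2"
     by (rule norm_taylor_le[where S=UNIV])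
      (use L test_function_has_derivative[OF \<phi>] in auto)
    then show "\<bar>\<phi> (z + h - x) - \<phi> (z - x) - dir_deriv h \<phi> (z - x)\<bar> <= L * norm h ^ 2" by simp
   qed
  qed measurable
  finally show ?thesis by (simp add: N_def mult_ac)
 qed
 note est = this
 show ?thesis unfolding has_derivative_at
 proof (intro conjI bl)
  show "(%h. norm (mollify \<phi> g (z + h) - mollify \<phi> g z - mollify (dir_deriv h \<phi>) g z) / norm h) \<midarrow>0\<rightarrow> 0"
  proof (rule Lim_null_comparison)
   show "\<forall>\<^sub>F h in at 0. norm (norm (mollify \<phi> g (z + h) - mollify \<phi> g z - mollify (dir_deriv h \<phi>) g z) / norm h) <= L * N * norm h"
    unfolding eventually_at_filter
    using est by (intro always_eventually) (auto simp: divide_le_eq power2_eq_square mult_ac)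
   show "((%h. L * N * norm h) \<longlongrightarrow> 0) (at (0::'a))"
    by (auto intro!: tendsto_eq_intros)
  qed
 qed
qed

lemma mollify_continuous:
 assumes "test_function \<phi>" "ilb g"
 shows "continuous_on UNIV (mollify \<phi> g)"
 using mollify_has_derivative[OF assms] has_derivative_continuous continuous_at_imp_continuous_on by blast

text \<open>Jensen's inequality for the probability density
  \<open>y \<mapsto> \<rho> (z - y)\<close>.\<close>

lemma mollify_norm_square_le:
 assumes [measurable]: "\<rho> \<in> bmb" "g \<in> bmb"
  and "!!x. 0 <= \<rho> x" "(NN x. ennreal (\<rho> x)) = 1"
 shows "ennreal ((norm (mollify \<rho> g z))^2) <= (NN x. ennreal (\<rho> (z - x) * (norm (g x))^2))"
proof -
 have "ennreal ((norm (mollify \<rho> g z))^2) = (ennreal (norm (mollify \<rho> g z)))^2"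
  by (simp add: ennreal_power)
 also have "... <= (NN x. ennreal (\<rho> (z - x) * norm (g x)))^2"
  unfolding mollify_def using assms(3)
  by (intro power_mono order_trans[OF ennreal_norm_integral_le]) auto
 also have "... <= (NN x. ennreal (\<rho> (z - x))) * (NN x. ennreal (\<rho> (z - x) * (norm (g x))^2))"
  using assms(3) by (intro Cauchy_Schwarz_weighted) auto
 also have "(NN x. ennreal (\<rho> (z - x))) = 1"
  using nn_integral_reflect[of "%x. ennreal (\<rho> x)" z] assms(4) by simp
 finally show ?thesis by simp
qed

lemma nn_integral_mollify_weight:
 assumes [measurable]: "\<rho> \<in> bmb" "h \<in> bmb"
  and "!!x. 0 <= \<rho> x" "(NN x. ennreal (\<rho> x)) = 1" "!!x. 0 <= h x"
 shows "(NN z. (NN x. ennreal (\<rho> (z - x) * h x))) = (NN x. ennreal (h x))"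
proof -
 have "(NN z. (NN x. ennreal (\<rho> (z - x) * h x)))
  = (NN x. (NN z. ennreal (\<rho> (z - x) * h x)))"
  by (rule lborel_pair.Fubini') measurable
 also have "... = (NN x. (NN z. ennreal (\<rho> (z + (- x)))) * ennreal (h x))"
  using assms by (intro nn_integral_cong, subst nn_integral_multc[symmetric]) (auto simp: ennreal_mult)
 also have "... = (NN x. ennreal (h x))"
  using assms by (subst nn_integral_translate) auto
 finally show ?thesis .
qed

lemma mollify_L2_le:
 assumes [measurable]: "\<rho> \<in> bmb" "g \<in> bmb"
  and "!!x. 0 <= \<rho> x" "(NN x. ennreal (\<rho> x)) = 1"
 shows "(NN z. ennreal ((norm (mollify \<rho> g z))^2)) <= (NN x. ennreal ((norm (g x))^2))"
proof -
 have "(NN z. ennreal ((norm (mollify \<rho> g z))^2))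
  <= (NN z. (NN x. ennreal (\<rho> (z - x) * (norm (g x))^2)))"
  using assms by (intro nn_integral_mono mollify_norm_square_le) auto
 also have "... = (NN x. ennreal ((norm (g x))^2))"
  using assms by (intro nn_integral_mollify_weight) auto
 finally show ?thesis .
qed

text \<open>An approximate identity at scale \<open>\<delta>\<close>. The same predicate covers the
  regularisation of the potential, the auxiliary mollifiers in space and the ones in time.\<close>

definition bump :: "real => ('a::euclidean_space => real) => bool" where
 "bump \<delta> \<rho> \<longleftrightarrow> test_function \<rho> \<and> (\<forall>x. 0 <= \<rho> x) \<and> (NN x. ennreal (\<rho> x)) = 1 \<and>
  (\<forall>x. \<rho> x ~= 0 --> norm x <= \<delta>)"

lemma bumpD:
 assumes "bump \<delta> \<rho>"
 shows "test_function \<rho>" "!!x. 0 <= \<rho> x" "(NN x. ennreal (\<rho> x)) = 1"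
  "!!x. \<rho> x ~= 0 ==> norm x <= \<delta>" "\<rho> \<in> bmb"
  "ilb \<rho>" "(LB x. \<rho> x) = 1"
proof -
 show 1: "test_function \<rho>" "!!x. 0 <= \<rho> x" "(NN x. ennreal (\<rho> x)) = 1"
  "!!x. \<rho> x ~= 0 ==> norm x <= \<delta>"
  using assms by (auto simp: bump_def)
 show "\<rho> \<in> bmb" "ilb \<rho>"
  using 1(1) test_function_measurable test_function_integrable by auto
 then show "(LB x. \<rho> x) = 1"
  using 1 by (subst integral_eq_nn_integral) auto
qed

lemma nn_integral_scale:
 fixes f :: "'a::euclidean_space => ennreal"
 assumes [measurable]: "f \<in> bmb" and "c > 0"
 shows "(NN x. f x) = ennreal (c ^ DIM('a)) * (NN x. f (c *\<^sub>R x))"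
proof -
 have "(NN x. f x) = (\<integral>\<^sup>+x. f x \<partial>density (distr lborel borel (%x. 0 + c *\<^sub>R x)) (%_. \<bar>c\<bar>^DIM('a)))"
  using lborel_affine[of c "0::'a"] assms by simp
 also have "... = ennreal (c ^ DIM('a)) * (NN x. f (c *\<^sub>R x))"
  using assms by (subst nn_integral_density) (auto simp: nn_integral_distr nn_integral_cmult)
 finally show ?thesis .
qed

text \<open>A continuous function that is negative somewhere is negative on a nonempty open set, and
  such a set is not null. \<open>prob_density\<close> gives the sign of \<open>chi\<close> almost
  everywhere only, whereas kernels are used pointwise.\<close>

lemma AE_lborel_nonneg_continuous:
 fixes f :: "'a::euclidean_space => real"
 assumes "AE x in lborel. 0 <= f x" and c: "continuous_on UNIV f"
 shows "0 <= f x"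
proof (rule ccontr)
 assume "\<not> 0 <= f x"
 then have x: "x \<in> {x. f x < 0}" by simp
 have op: "open {x. f x < 0}"
  using c by (intro open_Collect_less continuous_on_const)
 have "AE x in lborel. x \<notin> {x. f x < 0}"
  using assms(1) by eventually_elim auto
 then have "{x. f x < 0} \<in> null_sets lborel"
  by (rule iffD2[OF AE_iff_null_sets, rotated]) (use op in simp)
 then have "negligible {x. f x < 0}"
  by (simp add: negligible_iff_null_sets null_sets_completionI)
 then show False using open_not_negligible[OF op] x by blast
qed

lemma bump_mollifier:
 fixes chi :: "'a::euclidean_space => real"
 assumes chi: "test_function chi" "prob_density chi" "supp chi \<subseteq> cball 0 1" and \<delta>: "\<delta> > 0"
 shows "bump \<delta> (mollifier chi \<delta>)"
proof -
 have [measurable]: "chi \<in> bmb" using chi test_function_measurable by auto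
 have nn: "0 <= chi x" for x
  by (rule AE_lborel_nonneg_continuous[OF _ test_function_continuous[OF chi(1)]])
   (use chi(2) in \<open>simp add: prob_density_def\<close>)
 have one: "(NN x. ennreal (chi x)) = 1"
  using chi(2) nn unfolding prob_density_def
  by (subst nn_integral_eq_integral) (auto simp: has_bochner_integral_iff)
 have eq: "mollifier chi \<delta> = (%x. (1 / \<delta> ^ DIM('a)) * chi (0 + (1 / \<delta>) *\<^sub>R x))"
  by (auto simp: mollifier_def fun_eq_iff)
 have "test_function (mollifier chi \<delta>)"
  unfolding eq using \<delta> chi by (intro test_function_cmult test_function_affine) auto
 moreover have "norm x <= \<delta>" if "mollifier chi \<delta> x ~= 0" for x
 proof -
  have "chi ((1 / \<delta>) *\<^sub>R x) ~= 0" using that by (auto simp: mollifier_def)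
  then have "norm ((1 / \<delta>) *\<^sub>R x) <= 1" using supp_supset[of chi] chi(3) by fastforce
  then show ?thesis using \<delta> by (simp add: field_simps)
 qed
 moreover have "(NN x. ennreal (mollifier chi \<delta> x)) = 1"
 proof -
  have "(NN x. ennreal (mollifier chi \<delta> x))
    = ennreal (\<delta> ^ DIM('a)) * (NN x. ennreal (mollifier chi \<delta> (\<delta> *\<^sub>R x)))"
   unfolding mollifier_def by (rule nn_integral_scale) (use \<delta> in auto)
  also have "... = (NN x. ennreal (\<delta> ^ DIM('a)) * ennreal (mollifier chi \<delta> (\<delta> *\<^sub>R x)))"
   unfolding mollifier_def by (subst nn_integral_cmult) auto
  also have "... = (NN x. ennreal (chi x))"
   using \<delta> nn by (intro nn_integral_cong, subst ennreal_mult[symmetric]) (auto simp: mollifier_def)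
  finally show ?thesis using one by simp
 qed
 ultimately show ?thesis using nn \<delta> by (auto simp: bump_def mollifier_def)
qed

text \<open>Density of compactly supported continuous functions in \<open>L^1\<close>: truncate
  \<open>g\<close> in space and in size, then approximate the truncation, each time with error
  \<open>e / 2\<close> by dominated convergence.\<close>

lemma integrable_approx_continuous:
 fixes g :: "'a::euclidean_space => 'c::euclidean_space"
 assumes g: "ilb g" and e: "e > 0"
 obtains h R where "continuous_on UNIV h" "!!x. h x ~= 0 ==> norm x <= R" "R > 0"
  "(NN x. ennreal (norm (g x - h x))) <= ennreal e"
proof -
 have [measurable]: "g \<in> bmb" using g by auto
 define G where "G k x = (if norm x <= real k \<and> norm (g x) <= real k then g x else 0)" for k :: nat and x
 have Gm[measurable]: "G k \<in> bmb" for k unfolding G_def by measurable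
 have "(%k. NN x. ennreal (norm (g x - G k x))) ----> 0"
 proof (rule nn_integral_dominated_convergence_norm[where w="%x. norm (g x)"])
  show "(NN x. ennreal (norm (g x))) < \<infinity>" using g by (simp add: integrable_iff_bounded)
  show "AE x in lborel. (%k. G k x) ----> g x"
  proof (rule AE_I2)
   fix x
   obtain K :: nat where K: "max (norm x) (norm (g x)) <= real K" using real_arch_simple by blast
   have "\<forall>\<^sub>F k in sequentially. G k x = g x"
    using eventually_ge_at_top[of K] by eventually_elim (use K in \<open>auto simp: G_def\<close>)
   then show "(%k. G k x) ----> g x" by (rule tendsto_eventually)
  qed
 qed (auto simp: G_def)
 then have "\<forall>\<^sub>F k in sequentially. (NN x. ennreal (norm (g x - G k x))) < ennreal (e/2)"
  using e by (intro order_tendstoD) (auto simp: ennreal_zero_less_divide)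
 then obtain k where k: "(NN x. ennreal (norm (g x - G k x))) < ennreal (e/2)"
  by (auto simp: eventually_sequentially)
 \<comment> \<open>The continuous functions provided by \<open>measurable_on\<close> converge off a
   negligible set but carry no bound. The radial clamp \<open>c\<close> and the cut-off
   \<open>\<zeta>\<close> below supply a common majorant and leave \<open>G k\<close>
   unchanged.\<close>
 have "G k \<in> borel_measurable (lebesgue_on UNIV)"
  using measurable_completion[of "G k" lborel borel] Gm by (simp add: lebesgue_on_UNIV_eq)
 then have "G k measurable_on UNIV" by (subst measurable_on_iff_borel_measurable) auto
 then obtain N H where N: "negligible N" and H: "!!n. continuous_on UNIV (H n)"
   "!!x. x \<notin> N ==> (%n. H n x) ----> G k x"
  by (auto simp: measurable_on_def)
 define c where "c = (%v::'c. ((real k + 1) / max (real k + 1) (norm v)) *\<^sub>R v)"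
 define \<zeta> where "\<zeta> = (%x::'a. max 0 (min 1 (real k + 1 - norm x)))"
 define h where "h n x = \<zeta> x *\<^sub>R c (H n x)" for n x
 have cc: "continuous_on UNIV c" unfolding c_def
  by (intro continuous_intros) (auto simp: max_def)
 have hc: "continuous_on UNIV (h n)" for n
  unfolding h_def \<zeta>_def
  by (intro continuous_intros continuous_on_compose2[OF cc H(1)]) auto
 have [measurable]: "h n \<in> bmb" for n
  using hc by (rule borel_measurable_continuous_onI)
 have cb: "norm (c v) <= real k + 1" for v
 proof -
  have "(real k + 1) * norm v <= (real k + 1) * max (real k + 1) (norm v)"
   by (intro mult_left_mono) auto
  then show ?thesis unfolding c_def by (simp add: divide_le_eq max_def mult.commute)
 qed
 have z: "0 <= \<zeta> x" "\<zeta> x <= 1" "\<zeta> x ~= 0 ==> norm x <= real k + 1" for x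
  by (auto simp: \<zeta>_def max_def min_def split: if_splits)
 have fx: "\<zeta> x *\<^sub>R c (G k x) = G k x" for x
  by (auto simp: G_def c_def \<zeta>_def max_def min_def)
 have "(%n. NN x. ennreal (norm (G k x - h n x))) ----> 0"
 proof (rule nn_integral_dominated_convergence_norm[where w="%x. (real k + 1) * indicator (cball 0 (real k + 1)) x"])
  show "(NN x. ennreal ((real k + 1) * indicator (cball (0::'a) (real k + 1)) x)) < \<infinity>"
  proof -
   have "(NN x. ennreal ((real k + 1) * indicator (cball (0::'a) (real k + 1)) x))
     = (NN x. ennreal (real k + 1) * indicator (cball (0::'a) (real k + 1)) x)"
    by (intro nn_integral_cong) (auto split: split_indicator)
   then show ?thesis
    using emeasure_lborel_cball_finite[of "0::'a" "real k + 1"]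
    by (simp add: nn_integral_cmult_indicator ennreal_mult_less_top del: ennreal_plus)
  qed
  show "AE x in lborel. norm (h n x) <= (real k + 1) * indicator (cball 0 (real k + 1)) x" for n
  proof (rule AE_I2)
   fix x
   have "norm (h n x) <= \<zeta> x * (real k + 1)"
    unfolding h_def using cb z by (auto intro!: mult_left_mono)
   then show "norm (h n x) <= (real k + 1) * indicator (cball 0 (real k + 1)) x"
   proof (cases "\<zeta> x = 0")
    case False
    have "\<zeta> x * (real k + 1) <= 1 * (real k + 1)" by (rule mult_right_mono[OF z(2)]) simp
    from order_trans[OF \<open>norm (h n x) <= \<zeta> x * (real k + 1)\<close> this]
    have "norm (h n x) <= real k + 1" unfolding mult_1 .
    then show ?thesis using z(3)[OF False] by simp
   qed (simp add: h_def)
  qed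
  have "AE x in lebesgue. x \<notin> N"
   using N AE_not_in by (simp add: negligible_iff_null_sets)
  then have "AE x in lborel. x \<notin> N" by (simp add: AE_completion_iff)
  then show "AE x in lborel. (%n. h n x) ----> G k x"
  proof eventually_elim
   case (elim x)
   have "(%n. c (H n x)) ----> c (G k x)"
    by (rule continuous_on_tendsto_compose[OF cc H(2)[OF elim]]) auto
   then have "(%n. \<zeta> x *\<^sub>R c (H n x)) ----> \<zeta> x *\<^sub>R c (G k x)" by (intro tendsto_intros)
   then show ?case by (simp add: h_def fx)
  qed
 qed (auto intro!: borel_measurable_times borel_measurable_indicator)
 then have "\<forall>\<^sub>F n in sequentially. (NN x. ennreal (norm (G k x - h n x))) < ennreal (e/2)"
  using e by (intro order_tendstoD) (auto simp: ennreal_zero_less_divide)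
 then obtain n where n: "(NN x. ennreal (norm (G k x - h n x))) < ennreal (e/2)"
  by (auto simp: eventually_sequentially)
 have "(NN x. ennreal (norm (g x - h n x)))
  <= (NN x. ennreal (norm (g x - G k x)) + ennreal (norm (G k x - h n x)))"
  using norm_triangle_ineq[of "g x - G k x" "G k x - h n x" for x]
  by (intro nn_integral_mono) (simp flip: ennreal_plus add: ennreal_leI)
 also have "... = (NN x. ennreal (norm (g x - G k x))) + (NN x. ennreal (norm (G k x - h n x)))"
  by (rule nn_integral_add) auto
 also have "... <= ennreal (e/2) + ennreal (e/2)"
  using k n by (intro add_mono) auto
 also have "... = ennreal e" using e by (simp flip: ennreal_plus)
 finally show ?thesis
  using that[of "h n" "real k + 1"] hc z by (auto simp: h_def)
qed

text \<open>A compactly supported continuous approximation is uniformly continuous, and translating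
  the approximation error does not change its \<open>L^1\<close> norm; hence three contributions of
  \<open>e / 3\<close>.\<close>

lemma L1_translation_continuous:
 fixes g :: "'a::euclidean_space => 'c::euclidean_space"
 assumes g: "ilb g" and e: "e > 0"
 obtains d where "d > 0"
  "!!y. norm y <= d ==> (NN x. ennreal (norm (g (x - y) - g x))) <= ennreal e"
proof -
 have [measurable]: "g \<in> bmb" using g by auto
 obtain h R where h: "continuous_on UNIV h" "!!x. h x ~= 0 ==> norm x <= R" "R > 0"
  "(NN x. ennreal (norm (g x - h x))) <= ennreal (e/3)"
  using integrable_approx_continuous[OF g, of "e/3"] e by auto
 have [measurable]: "h \<in> bmb"
  using h by (intro borel_measurable_continuous_onI)
 \<comment> \<open>Shifts by at most 1 keep both \<open>h\<close> and its translate inside the ball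
   of radius \<open>R + 1\<close>, whose volume \<open>V\<close> converts the uniform bound into an
   \<open>L^1\<close> bound.\<close>
 define V where "V = measure lborel (cball (0::'a) (R + 1))"
 have V: "V > 0" unfolding V_def using h(3) by (simp add: content_cball_pos)
 have emV: "emeasure lborel (cball (0::'a) (R + 1)) = ennreal V"
  unfolding V_def using emeasure_lborel_cball_finite[of "0::'a" "R+1"]
  by (intro emeasure_eq_ennreal_measure) auto
 have "uniformly_continuous_on (cball 0 (R + 2)) h"
  using h(1) by (intro compact_uniformly_continuous) (auto intro: continuous_on_subset)
 then obtain d where d: "d > 0" "!!x x'. x \<in> cball 0 (R+2) ==> x' \<in> cball 0 (R+2) ==> dist x' x < d ==> dist (h x') (h x) < e / (3 * V)"
  unfolding uniformly_continuous_on_def using e V by (metis divide_pos_pos mult_pos_pos zero_less_numeral)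
 show ?thesis
 proof (rule that[of "min (d/2) 1"])
  show "min (d/2) 1 > 0" using d by auto
  fix y :: 'a assume y: "norm y <= min (d/2) 1"
  have pt: "norm (h (x - y) - h x) <= e / (3 * V) * indicator (cball 0 (R + 1)) x" for x
  proof (cases "norm x <= R + 1")
   case True
   have "norm (x - y) <= R + 2" using True y norm_triangle_ineq4[of x y] by auto
   then have "dist (h (x - y)) (h x) < e / (3 * V)"
    using True y d by (intro d(2)) (auto simp: mem_cball_0 dist_norm[of "x - y" x])
   then show ?thesis using True by (auto simp: dist_norm)
  next
   case False
   then have "h x = 0" using h(2)[of x] by auto
   moreover have "h (x - y) = 0"
   proof (rule ccontr)
    assume "h (x - y) ~= 0"
    then have "norm (x - y) <= R" by (rule h(2))
    then show False using y False norm_triangle_ineq2[of x y] by linarith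
   qed
   ultimately show ?thesis using e V by simp
  qed
  have "(NN x. ennreal (norm (h (x - y) - h x))) <= (NN x. ennreal (e / (3 * V)) * indicator (cball (0::'a) (R + 1)) x)"
  proof (rule nn_integral_mono)
   fix x
   show "ennreal (norm (h (x - y) - h x)) <= ennreal (e / (3 * V)) * indicator (cball (0::'a) (R + 1)) x"
    using ennreal_leI[OF pt[of x]] by (auto split: split_indicator_asm)
  qed
  also have "... = ennreal (e/3)"
   using V e by (simp add: nn_integral_cmult_indicator emV flip: ennreal_mult)
  finally have 2: "(NN x. ennreal (norm (h (x - y) - h x))) <= ennreal (e/3)" .
  have 1: "(NN x. ennreal (norm (g (x - y) - h (x - y)))) <= ennreal (e/3)"
   using h(4) nn_integral_translate[of "%x. ennreal (norm (g x - h x))" "-y"] by simp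
  have "(NN x. ennreal (norm (g (x - y) - g x)))
   <= (NN x. ennreal (norm (g (x - y) - h (x - y))) + ennreal (norm (h (x - y) - h x)) + ennreal (norm (g x - h x)))"
  proof (intro nn_integral_mono)
   fix x
   have "norm (g (x - y) - g x) = norm ((g (x - y) - h (x - y)) + (h (x - y) - h x) + (h x - g x))" by simp
   also have "... <= norm (g (x - y) - h (x - y)) + norm (h (x - y) - h x) + norm (g x - h x)"
    using norm_triangle_ineq[of "g (x - y) - h (x - y) + (h (x - y) - h x)" "h x - g x"]
     norm_triangle_ineq[of "g (x - y) - h (x - y)" "h (x - y) - h x"]
    by (simp only: norm_minus_commute[of "h x"])
   finally show "ennreal (norm (g (x - y) - g x)) <= ennreal (norm (g (x - y) - h (x - y))) + ennreal (norm (h (x - y) - h x)) + ennreal (norm (g x - h x))"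
    by (simp flip: ennreal_plus add: ennreal_leI)
  qed
  also have "... = (NN x. ennreal (norm (g (x - y) - h (x - y)))) + (NN x. ennreal (norm (h (x - y) - h x))) + (NN x. ennreal (norm (g x - h x)))"
   by (simp add: nn_integral_add)
  also have "... <= ennreal (e/3) + ennreal (e/3) + ennreal (e/3)"
   using 1 2 h(4) by (intro add_mono)
  also have "... = ennreal e" using e by (simp flip: ennreal_plus)
  finally show "(NN x. ennreal (norm (g (x - y) - g x))) <= ennreal e" .
 qed
qed

text \<open>The mollification error is an average of translation errors over
  \<open>norm y <= \<delta> n\<close>, so Tonelli reduces it to continuity of translations in
  \<open>L^1\<close>.\<close>

lemma mollify_L1_tendsto:
 fixes g :: "'a::euclidean_space => 'c::euclidean_space"
 assumes g: "ilb g" and \<delta>: "\<delta> ----> 0" and \<rho>: "!!n. bump (\<delta> n) (\<rho> n)"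
 shows "(%n. LB x. norm (mollify (\<rho> n) g x - g x)) ----> 0"
proof (rule LIMSEQ_I)
 fix e :: real assume e: "e > 0"
 have [measurable]: "g \<in> bmb" using g by auto
 obtain d where d: "d > 0"
  "!!y. norm y <= d ==> (NN x. ennreal (norm (g (x - y) - g x))) <= ennreal (e/2)"
  using L1_translation_continuous[OF g, of "e/2"] e by auto
 obtain N where N: "!!n. n \<ge> N ==> norm (\<delta> n) < d" using LIMSEQ_D[OF \<delta> d(1)] by auto
 have "norm ((LB x. norm (mollify (\<rho> n) g x - g x)) - 0) < e" if "n \<ge> N" for n
 proof -
  note b = bumpD[OF \<rho>[of n]]
  have [measurable]: "\<rho> n \<in> bmb" by fact
  have mi: "ilb (mollify (\<rho> n) g)" using mollify_integrable(1)[OF b(6) g] .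
  have "ennreal (LB x. norm (mollify (\<rho> n) g x - g x)) = (NN x. ennreal (norm (mollify (\<rho> n) g x - g x)))"
   using mi g by (subst nn_integral_eq_integral) auto
  also have "... <= (NN x. (NN y. ennreal (\<rho> n y) * ennreal (norm (g (x - y) - g x))))"
  proof (rule nn_integral_mono)
   fix x
   have i1: "ilb (%y. \<rho> n y *\<^sub>R g (x - y))"
    using integrable_reflect[OF mollify_test_integrand[OF g b(1)], of x x] by simp
   have "mollify (\<rho> n) g x - g x = (LB y. \<rho> n y *\<^sub>R g (x - y)) - (LB y. \<rho> n y *\<^sub>R g x)"
    using b by (simp add: mollify_eq_integral_shift)
   also have "... = (LB y. \<rho> n y *\<^sub>R (g (x - y) - g x))"
    using i1 b by (subst Bochner_Integration.integral_diff[symmetric]) (auto simp: scaleR_diff_right)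
   finally show "ennreal (norm (mollify (\<rho> n) g x - g x)) <= (NN y. ennreal (\<rho> n y) * ennreal (norm (g (x - y) - g x)))"
    using ennreal_norm_integral_le[of lborel "%y. \<rho> n y *\<^sub>R (g (x - y) - g x)"] b
    by (simp add: ennreal_mult)
  qed
  also have "... = (NN y. (NN x. ennreal (\<rho> n y) * ennreal (norm (g (x - y) - g x))))"
   by (rule lborel_pair.Fubini') measurable
  also have "... <= (NN y. ennreal (\<rho> n y) * ennreal (e/2))"
  proof (rule nn_integral_mono)
   fix y
   have "(NN x. ennreal (\<rho> n y) * ennreal (norm (g (x - y) - g x)))
    = ennreal (\<rho> n y) * (NN x. ennreal (norm (g (x - y) - g x)))"
    by (rule nn_integral_cmult) measurable
   also have "... <= ennreal (\<rho> n y) * ennreal (e/2)"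
   proof (cases "\<rho> n y = 0")
    case False
    then have "norm y <= d" using b(4)[OF False] N[OF that] by auto
    then show ?thesis using d by (intro mult_left_mono) auto
   qed simp
   finally show "(NN x. ennreal (\<rho> n y) * ennreal (norm (g (x - y) - g x))) <= ennreal (\<rho> n y) * ennreal (e/2)" .
  qed
  also have "... = ennreal (e/2)"
   using b by (subst nn_integral_multc) auto
  finally have "(LB x. norm (mollify (\<rho> n) g x - g x)) <= e/2"
   using e by (subst (asm) ennreal_le_iff) auto
  moreover have "0 <= (LB x. norm (mollify (\<rho> n) g x - g x))" by simp
  ultimately show ?thesis using e by simp
 qed
 then show "\<exists>no. \<forall>n\<ge>no. norm ((LB x. norm (mollify (\<rho> n) g x - g x)) - 0) < e" by blast
qed

lemma mollify_AE_subseq: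
 fixes g :: "'a::euclidean_space => 'c::euclidean_space"
 assumes g: "ilb g" and \<delta>: "\<delta> ----> 0" and \<rho>: "!!n. bump (\<delta> n) (\<rho> n)"
 obtains r where "strict_mono r" "AE x in lborel. (%n. mollify (\<rho> (r n)) g x) ----> g x"
proof -
 have "ilb (%x. mollify (\<rho> n) g x - g x)" for n
  using g mollify_integrable(1)[OF bumpD(6)[OF \<rho>[of n]] g] by auto
 from tendsto_L1_AE_subseq[OF this mollify_L1_tendsto[OF assms]]
 obtain r where r: "strict_mono r" "AE x in lborel. (%n. mollify (\<rho> (r n)) g x - g x) ----> 0" by blast
 have "AE x in lborel. (%n. mollify (\<rho> (r n)) g x) ----> g x"
  using r(2) by eventually_elim (simp add: LIM_zero_iff)
 then show ?thesis using r(1) that by blast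
qed

section \<open>The chain rule for time primitives\<close>

text \<open>By translation invariance \<open>X (x + b) - X x\<close> has integral 0. The same
  difference is the integral of the derivative along the segment, and Fubini with translation
  invariance turns its integral into that of \<open>D x b\<close>. No cut-off at infinity is
  involved.\<close>

lemma integral_directional_derivative_eq_0:
 fixes X :: "'a::euclidean_space => real"
 assumes D: "!!x. (X has_derivative D x) (at x)"
  and c: "continuous_on UNIV (%x. D x b)"
  and X: "ilb X" and X': "ilb (%x. D x b)"
 shows "(LB x. D x b) = 0"
proof -
 have [measurable]: "X \<in> bmb" "(%x. D x b) \<in> bmb" using X X' by auto
 have ftc: "X (x + b) - X x = (LB t. indicator {0..1} t *\<^sub>R D (x + t *\<^sub>R b) b)" for x
 proof -
  have "((%t. X (x + t *\<^sub>R b)) has_vector_derivative D (x + t *\<^sub>R b) b) (at t within {0..1})" for t :: real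
  proof -
   have "((%t. x + t *\<^sub>R b) has_derivative (%s. s *\<^sub>R b)) (at t within {0..1})"
    by (auto intro!: derivative_eq_intros)
   from has_derivative_compose[OF this D]
   have "((%t. X (x + t *\<^sub>R b)) has_derivative (%s. D (x + t *\<^sub>R b) (s *\<^sub>R b))) (at t within {0..1})" .
   moreover have "D (x + t *\<^sub>R b) (s *\<^sub>R b) = s *\<^sub>R D (x + t *\<^sub>R b) b" for s
    using linear_scale[OF has_derivative_linear[OF D]] by blast
   ultimately show ?thesis by (simp add: has_vector_derivative_def)
  qed
  moreover have "continuous_on {0..1} (%t. D (x + t *\<^sub>R b) b)"
   by (rule continuous_on_compose2[OF c]) (auto intro!: continuous_intros)
  ultimately show ?thesis
   using integral_FTC_Icc[of 0 1 "%t. X (x + t *\<^sub>R b)" "%t. D (x + t *\<^sub>R b) b"] by auto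
 qed
 have tr: "(LB x. D (x + t *\<^sub>R b) b) = (LB x. D x b)"
  "(LB x. \<bar>D (x + t *\<^sub>R b) b\<bar>) = (LB x. \<bar>D x b\<bar>)"
  "ilb (%x. D (x + t *\<^sub>R b) b)" for t
  using integral_translate[of "%x. D x b" "t *\<^sub>R b"] integral_translate[of "%x. \<bar>D x b\<bar>" "t *\<^sub>R b"]
   integrable_translate[OF X'] by auto
 have [measurable]: "(%p. D (snd p + fst p *\<^sub>R b) b) \<in> borel_measurable (lborel \<Otimes>\<^sub>M lborel)"
  by (rule measurable_compose[of "%p. snd p + fst p *\<^sub>R b" _ borel "%x. D x b"]) measurable
 have int: "integrable (lborel \<Otimes>\<^sub>M lborel) (%(t, x). indicator {0..1} t *\<^sub>R D (x + t *\<^sub>R b) b)"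
 proof (rule lborel_pair.Fubini_integrable)
  show "(%(t, x). indicator {0..1} t *\<^sub>R D (x + t *\<^sub>R b) b) \<in> borel_measurable (lborel \<Otimes>\<^sub>M lborel)"
   unfolding case_prod_beta' by measurable
  have "ilb (%t::real. indicator {0..1} t *\<^sub>R (LB x. \<bar>D x b\<bar>))"
   by (intro integrable_real_mult_indicator borel_integrable_compact) auto
  then show "ilb (%t. LB x. norm (case (t, x) of (t, x) => indicator {0..1} t *\<^sub>R D (x + t *\<^sub>R b) b))"
   by (simp add: tr abs_mult)
 qed (use tr in auto)
 have "0 = (LB x. X (x + b) - X x)"
  using X integrable_translate[OF X] integral_translate[of X b] by simp
 also have "... = (LB t. (LB x. indicator {0..1} t *\<^sub>R D (x + t *\<^sub>R b) b))"
  unfolding ftc using lborel_pair.Fubini_integral[OF int] by simp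
 also have "... = (LB t. indicator {0..1::real} t *\<^sub>R (LB x. D x b))"
  by (simp add: tr)
 finally show ?thesis by simp
qed

lemma indicator_Icc_split_AE:
 fixes a b c :: real
 assumes "a <= b" "b <= c"
 shows "AE r in lborel. (indicator {a..c} r :: real) = indicator {a..b} r + indicator {b..c} r"
proof -
 have "AE r in lborel. r ~= b" by (rule AE_lborel_singleton)
 then show ?thesis by eventually_elim (use assms in \<open>auto split: split_indicator\<close>)
qed

lemma integrable_Icc_bounded:
 fixes q :: "real => 'c::euclidean_space"
 assumes [measurable]: "q \<in> bmb" and "!!r. norm (q r) <= B"
 shows "ilb (%r. indicator {a..b::real} r *\<^sub>R q r)"
proof (rule Bochner_Integration.integrable_bound)
 show "ilb (%r. indicator {a..b} r *\<^sub>R B)"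
  by (intro borel_integrable_compact) auto
 show "AE r in lborel. norm (indicator {a..b} r *\<^sub>R q r) <= norm (indicator {a..b} r *\<^sub>R B)"
  using assms(2) order_trans[OF assms(2) abs_ge_self] by (auto split: split_indicator)
qed measurable

lemma norm_integral_Icc_le:
 fixes q :: "real => 'c::euclidean_space"
 assumes "a <= b" "B \<ge> 0" "!!r. r \<in> {a..b} ==> norm (q r) <= B"
 shows "norm (LB r. indicator {a..b} r *\<^sub>R q r) <= (b - a) * B"
proof (cases "ilb (%r. indicator {a..b} r *\<^sub>R q r)")
 case True
 have "norm (LB r. indicator {a..b} r *\<^sub>R q r) <= (LB r. norm (indicator {a..b} r *\<^sub>R q r))"
  by (rule integral_norm_bound)
 also have "... <= (LB r. indicator {a..b} r *\<^sub>R B)"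
 proof (rule integral_mono)
  show "ilb (%r. indicator {a..b} r *\<^sub>R B)"
   by (intro borel_integrable_compact) auto
  show "ilb (%r. norm (indicator {a..b} r *\<^sub>R q r))"
   using True by (rule integrable_norm)
 qed (use assms in \<open>auto split: split_indicator\<close>)
 finally have "norm (LB r. indicator {a..b} r *\<^sub>R q r) <= (LB r. indicator {a..b} r *\<^sub>R B)" .
 then show ?thesis using assms(1) by simp
qed (use assms in \<open>simp add: not_integrable_integral_eq\<close>)

text \<open>\<open>Y\<close> is just a Lipschitz primitive of a bounded function, so differentiating
  it would give the rule at almost every time only. Instead the defect \<open>\<Theta>\<close>
  between the two sides has increments quadratic in the time step; hence its derivative is 0 at
  every time and it is constant.\<close>

lemma chain_rule_integral:
 fixes Y p :: "real => 'c::euclidean_space" and \<Psi> :: "'c => real"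
 assumes [measurable]: "p \<in> bmb" and P: "!!r. norm (p r) <= P"
  and Y: "!!t. t \<in> {0..T} ==> Y t - Y 0 = (LB r. indicator {0..t} r *\<^sub>R p r)"
  and S: "convex S" "!!t. Y t \<in> S"
  and \<Psi>: "!!x. x \<in> S ==> (\<Psi> has_derivative (%h. \<Psi>' x \<bullet> h)) (at x)"
  and L: "!!x y. x \<in> S ==> y \<in> S ==> norm (\<Psi>' x - \<Psi>' y) <= L * norm (x - y)" "L \<ge> 0"
  and B: "!!x. x \<in> S ==> norm (\<Psi>' x) <= B"
  and [measurable]: "(%r. \<Psi>' (Y r)) \<in> bmb"
  and t: "t \<in> {0..T}"
 shows "\<Psi> (Y t) - \<Psi> (Y 0) = (LB r. indicator {0..t} r *\<^sub>R (\<Psi>' (Y r) \<bullet> p r))"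
proof -
 have P0: "P \<ge> 0" using P[of 0] norm_ge_zero[of "p 0"] by linarith
 define I where "I t = (LB r. indicator {0..t} r *\<^sub>R (\<Psi>' (Y r) \<bullet> p r))" for t
 have Yd: "Y t - Y s = (LB r. indicator {s..t} r *\<^sub>R p r)" if "0 <= s" "s <= t" "t <= T" for s t
 proof -
  have "Y t - Y 0 = (LB r. indicator {0..s} r *\<^sub>R p r + indicator {s..t} r *\<^sub>R p r)"
   unfolding Y[of t, simplified, OF conjI[OF order_trans[OF that(1,2)] that(3)]]
   by (intro integral_cong_AE, measurable)
    (use indicator_Icc_split_AE[OF that(1,2)] in \<open>auto simp: scaleR_add_left\<close>)
  also have "... = (Y s - Y 0) + (LB r. indicator {s..t} r *\<^sub>R p r)"
   using that by (subst Bochner_Integration.integral_add)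
    (auto intro!: integrable_Icc_bounded[OF _ P] simp: Y)
  finally show ?thesis by simp
 qed
 have Yl: "norm (Y t - Y s) <= (t - s) * P" if "0 <= s" "s <= t" "t <= T" for s t
  unfolding Yd[OF that] using that P P0 by (intro norm_integral_Icc_le) auto
 have Bp: "norm (\<Psi>' (Y r) \<bullet> p r) <= B * P" for r
  using B[OF S(2)[of r]] P[of r] order_trans[OF norm_ge_zero B[OF S(2)[of r]]] unfolding real_norm_def
  by (intro order_trans[OF Cauchy_Schwarz_ineq2] mult_mono) auto
 have qb: "norm ((\<Psi>' (Y r) - \<Psi>' (Y s)) \<bullet> p r) <= (B + B) * P" for r s
  using Cauchy_Schwarz_ineq2[of "\<Psi>' (Y r) - \<Psi>' (Y s)" "p r"] B[OF S(2)[of r]] B[OF S(2)[of s]] P[of r]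
   norm_triangle_ineq4[of "\<Psi>' (Y r)" "\<Psi>' (Y s)"] order_trans[OF norm_ge_zero B[OF S(2)[of r]]]
  by (auto intro!: order_trans[OF Cauchy_Schwarz_ineq2] mult_mono)
 define \<Theta> where "\<Theta> t = \<Psi> (Y t) - I t" for t
 define C where "C = L * P ^ 2 + L * P * P"
 have C0: "C \<ge> 0" unfolding C_def using L P0 by auto
 have est: "\<bar>\<Theta> t - \<Theta> s\<bar> <= C * (t - s) ^ 2" if "0 <= s" "s <= t" "t <= T" for s t
 proof -
  have "I t = (LB r. indicator {0..s} r *\<^sub>R (\<Psi>' (Y r) \<bullet> p r) + indicator {s..t} r *\<^sub>R (\<Psi>' (Y r) \<bullet> p r))"
   unfolding I_def by (intro integral_cong_AE, measurable)
    (use indicator_Icc_split_AE[OF that(1,2)] in \<open>auto simp: distrib_right\<close>)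
  also have "... = I s + (LB r. indicator {s..t} r *\<^sub>R (\<Psi>' (Y r) \<bullet> p r))"
   unfolding I_def by (rule Bochner_Integration.integral_add)
    (auto intro!: integrable_Icc_bounded[OF _ Bp, simplified])
  \<comment> \<open>Freezing \<open>\<Psi>'\<close> at time \<open>s\<close> leaves a part that
    integrates exactly to the linear Taylor term, and a remainder that is quadratic in
    \<open>t - s\<close> since \<open>Y\<close> and \<open>\<Psi>'\<close> are Lipschitz.\<close>
  also have "(LB r. indicator {s..t} r *\<^sub>R (\<Psi>' (Y r) \<bullet> p r))
   = (LB r. indicator {s..t} r *\<^sub>R ((\<Psi>' (Y r) - \<Psi>' (Y s)) \<bullet> p r) + \<Psi>' (Y s) \<bullet> (indicator {s..t} r *\<^sub>R p r))"
   by (intro Bochner_Integration.integral_cong) (auto simp: inner_diff_left algebra_simps)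
  also have "... = (LB r. indicator {s..t} r *\<^sub>R ((\<Psi>' (Y r) - \<Psi>' (Y s)) \<bullet> p r)) + \<Psi>' (Y s) \<bullet> (Y t - Y s)"
  proof -
   have ip: "ilb (%r. indicator {s..t} r *\<^sub>R p r)"
    by (rule integrable_Icc_bounded[OF _ P]) measurable
   have iE: "ilb (%r. indicator {s..t} r *\<^sub>R ((\<Psi>' (Y r) - \<Psi>' (Y s)) \<bullet> p r))"
    by (rule integrable_Icc_bounded[OF _ qb]) measurable
   have iF: "ilb (%r. \<Psi>' (Y s) \<bullet> (indicator {s..t} r *\<^sub>R p r))"
    using ip by (rule integrable_inner_right)
   show ?thesis
    unfolding Yd[OF that] integral_inner_right[OF ip, symmetric]
    by (rule Bochner_Integration.integral_add[OF iE iF])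
  qed
  finally have I: "I t = I s + ((LB r. indicator {s..t} r *\<^sub>R ((\<Psi>' (Y r) - \<Psi>' (Y s)) \<bullet> p r)) + \<Psi>' (Y s) \<bullet> (Y t - Y s))"
   (is "_ = _ + (?E + _)") .
  have "norm ?E <= (t - s) * (L * ((t - s) * P) * P)"
  proof (rule norm_integral_Icc_le)
   fix r assume r: "r \<in> {s..t}"
   have "norm (\<Psi>' (Y r) - \<Psi>' (Y s)) <= L * norm (Y r - Y s)" by (rule L(1)[OF S(2) S(2)])
   also have "... <= L * ((t - s) * P)"
    using Yl[of s r] r that L(2) P0
    by (intro mult_left_mono order_trans[OF Yl[of s r]] mult_right_mono) auto
   finally have "norm (\<Psi>' (Y r) - \<Psi>' (Y s)) <= L * ((t - s) * P)" .
   then show "norm ((\<Psi>' (Y r) - \<Psi>' (Y s)) \<bullet> p r) <= L * ((t - s) * P) * P"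
    unfolding real_norm_def using P[of r] that L(2) P0
    by (intro order_trans[OF Cauchy_Schwarz_ineq2] mult_mono) auto
  qed (use that L P0 in auto)
  moreover have "norm (\<Psi> (Y t) - \<Psi> (Y s) - \<Psi>' (Y s) \<bullet> (Y t - Y s)) <= L * norm (Y t - Y s) ^ 2"
  proof (rule norm_taylor_le[OF S(1) S(2) S(2) L(2)])
   show "(\<Psi> has_derivative (\<bullet>) (\<Psi>' z)) (at z within S)" if "z \<in> S" for z
    using \<Psi>[OF that] by (rule has_derivative_at_withinI)
   show "norm (\<Psi>' z \<bullet> h - \<Psi>' w \<bullet> h) <= L * norm (z - w) * norm h" if "z \<in> S" "w \<in> S" for z w h
    unfolding inner_diff_left[symmetric] real_norm_def
    by (rule order_trans[OF Cauchy_Schwarz_ineq2]) (intro mult_right_mono L that, simp)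
  qed
  moreover have "L * norm (Y t - Y s) ^ 2 <= L * ((t - s) * P) ^ 2"
   using Yl[OF that] L(2) by (intro mult_left_mono power_mono) auto
  ultimately show ?thesis unfolding \<Theta>_def I C_def real_norm_def
   by (simp add: power2_eq_square algebra_simps)
 qed
 have est': "\<bar>\<Theta> t - \<Theta> s\<bar> <= C * (t - s) ^ 2" if "s \<in> {0..T}" "t \<in> {0..T}" for s t
  using est[of s t] est[of t s] that by (cases "s <= t") (auto simp: abs_minus_commute power2_commute)
 have "(\<Theta> has_derivative (%h. 0)) (at s within {0..T})" if s: "s \<in> {0..T}" for s
  unfolding has_derivative_within
 proof (intro conjI bounded_linear_zero)
  show "((%y. (1 / norm (y - s)) *\<^sub>R (\<Theta> y - (\<Theta> s + 0))) \<longlongrightarrow> 0) (at s within {0..T})"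
  proof (rule Lim_null_comparison)
   show "\<forall>\<^sub>F y in at s within {0..T}. norm ((1 / norm (y - s)) *\<^sub>R (\<Theta> y - (\<Theta> s + 0))) <= C * \<bar>y - s\<bar>"
    unfolding eventually_at_filter
    using est'[OF s] C0 by (intro always_eventually)
     (auto simp: divide_le_eq power2_eq_square abs_mult_self_eq mult.assoc)
   show "((%y. C * \<bar>y - s\<bar>) \<longlongrightarrow> 0) (at s within {0..T})"
    by (auto intro!: tendsto_eq_intros)
  qed
 qed
 then have "\<exists>c. \<forall>x\<in>{0..T}. \<Theta> x = c"
  by (intro has_derivative_zero_constant) auto
 then have "\<Theta> t = \<Theta> 0" using t by auto
 moreover have "I 0 = 0"
 proof -
  have "AE r in lborel. indicator {0..0} r *\<^sub>R (\<Psi>' (Y r) \<bullet> p r) = (0::real)"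
   using AE_lborel_singleton[of "0::real"] by eventually_elim auto
  then show ?thesis unfolding I_def by (subst integral_cong_AE[where g="%_. 0"]) auto
 qed
 ultimately show ?thesis by (simp add: \<Theta>_def I_def)
qed

text \<open>The equation with time derivative \<open>\<sigma>\<close> times the Laplacian of
  \<open>f\<close> plus the divergence of \<open>F\<close>, integrated over time. Treating the flux
  \<open>F\<close> as data instead of drift times density makes the notion linear in the pair of
  density and flux, and vector values let two equations with the same diffusion be handled as
  one.\<close>

definition fokker_planck ::
 "real => real => real => (real => 'a::euclidean_space => 'c::euclidean_space) => ('a => real => 'a => 'c) => bool" where
 "fokker_planck T \<sigma> M f F \<longleftrightarrow>
  (%(t,x). f t x) \<in> borel_measurable (lborel \<Otimes>\<^sub>M lborel) \<and>
  (\<forall>b\<in>Basis. (%(t,x). F b t x) \<in> borel_measurable (lborel \<Otimes>\<^sub>M lborel)) \<and>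
  (\<forall>t. ilb (f t) \<and> (LB x. norm (f t x)) <= M) \<and>
  (\<forall>b\<in>Basis. \<forall>t. ilb (F b t) \<and> (LB x. norm (F b t x)) <= M) \<and>
  (\<forall>\<psi> t. test_function \<psi> --> t \<in> {0..T} -->
    (LB x. \<psi> x *\<^sub>R f t x) - (LB x. \<psi> x *\<^sub>R f 0 x)
    = (LB r. indicator {0..t} r *\<^sub>R (LB x. (\<sigma> * laplacian \<psi> x) *\<^sub>R f r x
       - (SB b. dir_deriv b \<psi> x *\<^sub>R F b r x))))"

lemma fokker_planckD:
 assumes "fokker_planck T \<sigma> M f F"
 shows "(%(t,x). f t x) \<in> borel_measurable (lborel \<Otimes>\<^sub>M lborel)"
  "!!b. b \<in> Basis ==> (%(t,x). F b t x) \<in> borel_measurable (lborel \<Otimes>\<^sub>M lborel)"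
  "!!t. ilb (f t)" "!!t. (LB x. norm (f t x)) <= M"
  "!!b t. b \<in> Basis ==> ilb (F b t)"
  "!!b t. b \<in> Basis ==> (LB x. norm (F b t x)) <= M"
  "!!\<psi> t. test_function \<psi> ==> t \<in> {0..T} ==>
    (LB x. \<psi> x *\<^sub>R f t x) - (LB x. \<psi> x *\<^sub>R f 0 x)
    = (LB r. indicator {0..t} r *\<^sub>R (LB x. (\<sigma> * laplacian \<psi> x) *\<^sub>R f r x
       - (SB b. dir_deriv b \<psi> x *\<^sub>R F b r x)))"
  "M \<ge> 0"
proof -
 show 4: "!!t. (LB x. norm (f t x)) <= M" using assms by (auto simp: fokker_planck_def)
 have "0 <= (LB x. norm (f 0 x))" by simp
 then show "M \<ge> 0" using 4[of 0] by linarith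
qed (use assms in \<open>auto simp: fokker_planck_def\<close>)

lemma dir_deriv_reflect:
 assumes "test_function \<rho>"
 shows "dir_deriv v (%x. \<rho> (z - x)) = (%x. - dir_deriv v \<rho> (z - x))"
proof
 fix x
 have "((%x. z - x) has_derivative (%v. - v)) (at x)" by (auto intro!: derivative_eq_intros)
 from has_derivative_compose[OF this test_function_has_derivative[OF assms]]
 have "((%x. \<rho> (z - x)) has_derivative (%v. dir_deriv (- v) \<rho> (z - x))) (at x)" .
 then show "dir_deriv v (%x. \<rho> (z - x)) x = - dir_deriv v \<rho> (z - x)"
  using linear_neg[OF test_function_dir_deriv_linear[OF assms]] by (simp add: dir_deriv_eq)
qed

lemma dir_deriv_minus:
 assumes "test_function \<rho>"
 shows "dir_deriv v (%x. - \<rho> x) = (%x. - dir_deriv v \<rho> x)"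
 by (intro ext dir_deriv_eq has_derivative_minus test_function_has_derivative assms)

lemma laplacian_reflect:
 assumes "test_function \<rho>"
 shows "laplacian (%x. \<rho> (z - x)) x = (SB b. dir_deriv b (dir_deriv b \<rho>) (z - x))"
proof -
 have "dir_deriv b (dir_deriv b (%x. \<rho> (z - x))) x = dir_deriv b (dir_deriv b \<rho>) (z - x)" for b
 proof -
  have t: "test_function (dir_deriv b \<rho>)" using assms by (rule test_function_dir_deriv)
  have t': "test_function (%y. - dir_deriv b \<rho> y)"
   using test_function_cmult[OF t, of "-1"] by simp
  show ?thesis
   unfolding dir_deriv_reflect[OF assms] using dir_deriv_reflect[OF t', of b z] dir_deriv_minus[OF t, of b]
   by simp
 qed
 then show ?thesis by (simp add: laplacian_def)
qed

lemma test_function_reflect: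
 "test_function \<rho> ==> test_function (%x. \<rho> (z - x))"
 using test_function_affine[of \<rho> "-1" z] by simp

text \<open>Component \<open>b\<close> of the mollified total flux, diffusion included. All
  derivatives sit on the kernel, and \<open>flux_div\<close> below is the derivative of this
  component along \<open>b\<close>.\<close>

definition flux where
 "flux \<sigma> \<rho> f F b r z = \<sigma> *\<^sub>R mollify (dir_deriv b \<rho>) (f r) z + mollify \<rho> (F b r) z"

definition flux_div :: "real => ('a => real) => (real => 'a::euclidean_space => 'c::euclidean_space) => ('a => real => 'a => 'c) => 'a => real => 'a => 'c" where
 "flux_div \<sigma> \<rho> f F b r z = \<sigma> *\<^sub>R mollify (dir_deriv b (dir_deriv b \<rho>)) (f r) z + mollify (dir_deriv b \<rho>) (F b r) z"

text \<open>The reflected and translated kernel is the test function. Reflection changes the sign of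
  its first derivatives, which turns the minus before the flux into a plus, and leaves second
  derivatives alone.\<close>

lemma mollified_equation:
 fixes f :: "real => 'a::euclidean_space => 'c::euclidean_space"
 assumes fp: "fokker_planck T \<sigma> M f F" and \<rho>: "test_function \<rho>" and t: "t \<in> {0..T}"
 shows "mollify \<rho> (f t) z - mollify \<rho> (f 0) z
  = (LB r. indicator {0..t} r *\<^sub>R (SB b. flux_div \<sigma> \<rho> f F b r z))"
proof -
 note D = fokker_planckD[OF fp]
 have td: "test_function (dir_deriv b \<rho>)" "test_function (dir_deriv b (dir_deriv b \<rho>))" for b
  using \<rho> test_function_dir_deriv by auto
 have "mollify \<rho> (f t) z - mollify \<rho> (f 0) z
  = (LB r. indicator {0..t} r *\<^sub>R (LB x. (\<sigma> * laplacian (%x. \<rho> (z - x)) x) *\<^sub>R f r x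
       - (SB b. dir_deriv b (%x. \<rho> (z - x)) x *\<^sub>R F b r x)))"
  unfolding mollify_def by (rule D(7)[OF test_function_reflect[OF \<rho>] t])
 moreover have "(LB x. (\<sigma> * laplacian (%x. \<rho> (z - x)) x) *\<^sub>R f r x
       - (SB b. dir_deriv b (%x. \<rho> (z - x)) x *\<^sub>R F b r x))
   = (SB b. flux_div \<sigma> \<rho> f F b r z)" for r
 proof -
  have "(LB x. (\<sigma> * laplacian (%x. \<rho> (z - x)) x) *\<^sub>R f r x
       - (SB b. dir_deriv b (%x. \<rho> (z - x)) x *\<^sub>R F b r x))
    = (LB x. (SB b. \<sigma> *\<^sub>R (dir_deriv b (dir_deriv b \<rho>) (z - x) *\<^sub>R f r x) + dir_deriv b \<rho> (z - x) *\<^sub>R F b r x))"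
   by (intro Bochner_Integration.integral_cong refl)
    (simp add: laplacian_reflect[OF \<rho>] dir_deriv_reflect[OF \<rho>] sum_distrib_left scaleR_sum_left sum.distrib sum_negf)
  also have "... = (SB b. flux_div \<sigma> \<rho> f F b r z)"
   unfolding flux_div_def mollify_def
   using mollify_test_integrand[OF D(3) td(2)] mollify_test_integrand[OF D(5) td(1)]
   by (subst Bochner_Integration.integral_sum) (auto intro!: sum.cong simp del: scaleR_scaleR)
  finally show ?thesis .
 qed
 ultimately show ?thesis by (simp only:)
qed

lemma compact_bound:
 fixes g :: "'b::topological_space => 'c::real_normed_vector"
 assumes "compact S" "continuous_on S g"
 obtains B where "B \<ge> 0" "!!x. x \<in> S ==> norm (g x) <= B"
 using compact_imp_bounded[OF compact_continuous_image[OF assms(2,1)]] bounded_pos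
 by (metis image_eqI less_imp_le)

text \<open>\<open>g\<close> is controlled on \<open>S\<close> only, so it is extended by 0 outside
  the closed set \<open>S\<close> before composing.\<close>

lemma measurable_compose_compact:
 fixes g :: "'c::euclidean_space => 'd::euclidean_space"
 assumes "compact S" "continuous_on S g" and [measurable]: "h \<in> borel_measurable M" and "!!x. h x \<in> S"
 shows "(%x. g (h x)) \<in> borel_measurable M"
proof -
 have "S \<in> sets borel" using assms(1) by (simp add: borel_compact)
 then have [measurable]: "(%x. indicator S x *\<^sub>R g x) \<in> bmb"
  using assms(2) by (rule borel_measurable_continuous_on_indicator)
 have "(%x. (%x. indicator S x *\<^sub>R g x) (h x)) \<in> borel_measurable M" by measurable
 then show ?thesis using assms(4) by simp
qed

text \<open>The chain rule in time at each point, Fubini, and integration by parts in space.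
  Compactness of the range \<open>S\<close> makes the derivatives of \<open>\<Psi>\<close> bounded.
  Since \<open>\<Psi>\<close> vanishes on the initial data, its value at time \<open>t\<close> is
  itself a time integral of an integrable function, and so integrability needs no growth condition
  on \<open>\<Psi>\<close>.\<close>

theorem energy_identity:
 fixes f :: "real => 'a::euclidean_space => 'c::euclidean_space"
 assumes fp: "fokker_planck T \<sigma> M f F" and \<rho>: "test_function \<rho>"
  and S: "compact S" "convex S" "!!t z. mollify \<rho> (f t) z \<in> S"
  and \<Psi>: "!!x. x \<in> S ==> (\<Psi> has_derivative (%h. \<Psi>' x \<bullet> h)) (at x)"
  and \<Psi>': "!!x. x \<in> S ==> (\<Psi>' has_derivative \<Psi>'' x) (at x)"
  and \<Psi>'': "continuous_on (S \<times> UNIV) (%(x,h). \<Psi>'' x h)"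
  and z0: "!!z. \<Psi> (mollify \<rho> (f 0) z) = 0"
  and t: "t \<in> {0..T}"
 shows "ilb (%z. \<Psi> (mollify \<rho> (f t) z))"
  and "(LB z. \<Psi> (mollify \<rho> (f t) z)) = - (LB r. indicator {0..t} r *\<^sub>R
   (LB z. (SB b. \<Psi>'' (mollify \<rho> (f r) z) (mollify (dir_deriv b \<rho>) (f r) z) \<bullet> flux \<sigma> \<rho> f F b r z)))"
proof -
 note D = fokker_planckD[OF fp]
 define y where "y r z = mollify \<rho> (f r) z" for r z
 define p where "p r z = (SB b. flux_div \<sigma> \<rho> f F b r z)" for r z
 note [measurable] = D(1)
 have td: "test_function (dir_deriv b \<rho>)" "test_function (dir_deriv b (dir_deriv b \<rho>))" for b
  using \<rho> test_function_dir_deriv by auto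
 have [measurable]: "\<rho> \<in> bmb" "dir_deriv b \<rho> \<in> bmb"
  "dir_deriv b (dir_deriv b \<rho>) \<in> bmb" for b
  using \<rho> td test_function_measurable by auto
 have ym[measurable]: "(%(r,z). y r z) \<in> borel_measurable (lborel \<Otimes>\<^sub>M lborel)"
  unfolding y_def by measurable
 have fdm: "(%(r,z). flux_div \<sigma> \<rho> f F b r z) \<in> borel_measurable (lborel \<Otimes>\<^sub>M lborel)" if b: "b \<in> Basis" for b
 proof -
  have [measurable]: "(%(t,x). mollify (dir_deriv b (dir_deriv b \<rho>)) (f t) x) \<in> borel_measurable (lborel \<Otimes>\<^sub>M lborel)"
   "(%(t,x). mollify (dir_deriv b \<rho>) (F b t) x) \<in> borel_measurable (lborel \<Otimes>\<^sub>M lborel)"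
   by (rule mollify_measurable_pair; use D(1) D(2)[OF b] in measurable)+
  show ?thesis unfolding flux_div_def case_prod_beta'
   by (intro borel_measurable_add borel_measurable_scaleR borel_measurable_const) (simp_all add: case_prod_beta'[symmetric])
 qed
 have pm[measurable]: "(%(r,z). p r z) \<in> borel_measurable (lborel \<Otimes>\<^sub>M lborel)"
  unfolding p_def case_prod_beta' using fdm by (intro borel_measurable_sum) (simp add: case_prod_beta')
 have "continuous_on S \<Psi>'"
  using \<Psi>' by (intro continuous_at_imp_continuous_on) (auto intro: has_derivative_continuous)
 then obtain B1 where B1: "B1 \<ge> 0" "!!x. x \<in> S ==> norm (\<Psi>' x) <= B1"
  using compact_bound[OF S(1)] by blast
 have "compact (S \<times> cball (0::'c) 1)" using S(1) by (intro compact_Times) auto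
 moreover have "continuous_on (S \<times> cball (0::'c) 1) (%(x,h). \<Psi>'' x h)"
  using \<Psi>'' by (rule continuous_on_subset) auto
 ultimately obtain L where L: "L \<ge> 0" "!!w. w \<in> S \<times> cball (0::'c) 1 ==> norm (case w of (x,h) => \<Psi>'' x h) <= L"
  using compact_bound[of "S \<times> cball (0::'c) 1" "%(x,h). \<Psi>'' x h"] by blast
 have lin: "linear (\<Psi>'' x)" if "x \<in> S" for x using \<Psi>'[OF that] by (rule has_derivative_linear)
 \<comment> \<open>The compactness bound holds for unit directions only; linearity of the second
   derivative extends it to all directions.\<close>
 have B2: "norm (\<Psi>'' x h) <= L * norm h" if "x \<in> S" for x h
 proof (cases "h = 0")
  case False
  have "\<Psi>'' x h = norm h *\<^sub>R \<Psi>'' x (h /\<^sub>R norm h)"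
   using linear_scale[OF lin[OF that], of "norm h" "h /\<^sub>R norm h"] False by simp
  moreover have "norm (\<Psi>'' x (h /\<^sub>R norm h)) <= L"
   using L(2)[of "(x, h /\<^sub>R norm h)"] that False by simp
  ultimately show ?thesis
   using mult_left_mono[of "norm (\<Psi>'' x (h /\<^sub>R norm h))" L "norm h"]
   by (metis abs_norm_cancel mult.commute norm_ge_zero norm_scaleR)
 qed (use linear_0[OF lin[OF that]] in simp)
 have Lip: "norm (\<Psi>' x - \<Psi>' x') <= L * norm (x - x')" if "x \<in> S" "x' \<in> S" for x x'
 proof (rule differentiable_bound[OF S(2)])
  show "(\<Psi>' has_derivative \<Psi>'' w) (at w within S)" if "w \<in> S" for w
   using \<Psi>'[OF that] by (rule has_derivative_at_withinI)
  show "onorm (\<Psi>'' w) <= L" if "w \<in> S" for w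
   by (rule onorm_bound) (use L B2[OF that] in auto)
 qed (use that in auto)
 have fdi: "ilb (flux_div \<sigma> \<rho> f F b r)" if "b \<in> Basis" for b r
  unfolding flux_div_def[abs_def]
  by (intro Bochner_Integration.integrable_add Bochner_Integration.integrable_scaleR_right
    mollify_integrable(1) test_function_integrable td D that)
 have pi: "ilb (p r)" for r
  unfolding p_def[abs_def] by (intro Bochner_Integration.integrable_sum fdi)
 define I1 where "I1 b = (LB x. \<bar>dir_deriv b (dir_deriv b \<rho>) x\<bar>)" for b
 define I2 where "I2 b = (LB x. \<bar>dir_deriv b \<rho> x\<bar>)" for b
 define Cp where "Cp = (\<Sum>b\<in>(Basis::'a set). \<bar>\<sigma>\<bar> * (I1 b * M) + I2 b * M)"
 have I12: "I1 b \<ge> 0" "I2 b \<ge> 0" for b by (auto simp: I1_def I2_def)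
 have pL1: "(LB z. norm (p r z)) <= Cp" for r
 proof -
  have "(LB z. norm (p r z)) <= (LB z. (SB b. norm (flux_div \<sigma> \<rho> f F b r z)))"
   by (intro integral_mono integrable_norm pi Bochner_Integration.integrable_sum fdi) (auto simp: p_def norm_sum)
  also have "... = (SB b. (LB z. norm (flux_div \<sigma> \<rho> f F b r z)))"
   by (intro Bochner_Integration.integral_sum integrable_norm fdi)
  also have "... <= Cp"
   unfolding Cp_def
  proof (rule sum_mono)
   fix b :: 'a assume b: "b \<in> Basis"
   note i1 = mollify_integrable[OF test_function_integrable[OF td(2)[of b]] D(3)[of r]]
   note i2 = mollify_integrable[OF test_function_integrable[OF td(1)[of b]] D(5)[OF b, of r]]
   have "(LB z. norm (flux_div \<sigma> \<rho> f F b r z))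
    <= (LB z. \<bar>\<sigma>\<bar> * norm (mollify (dir_deriv b (dir_deriv b \<rho>)) (f r) z) + norm (mollify (dir_deriv b \<rho>) (F b r) z))"
    using i1(1) i2(1) by (intro integral_mono integrable_norm fdi b)
     (auto simp: flux_div_def intro: order_trans[OF norm_triangle_ineq])
   also have "... = \<bar>\<sigma>\<bar> * (LB z. norm (mollify (dir_deriv b (dir_deriv b \<rho>)) (f r) z)) + (LB z. norm (mollify (dir_deriv b \<rho>) (F b r) z))"
    using i1(1) i2(1) by simp
   also have "... <= \<bar>\<sigma>\<bar> * (I1 b * M) + I2 b * M"
    unfolding I1_def I2_def
    by (intro add_mono mult_left_mono order_trans[OF i1(2) mult_left_mono] order_trans[OF i2(2) mult_left_mono] D b) auto
   finally show "(LB z. norm (flux_div \<sigma> \<rho> f F b r z)) <= \<bar>\<sigma>\<bar> * (I1 b * M) + I2 b * M" .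
  qed
  finally show ?thesis .
 qed
 have "\<exists>P. \<forall>r z. norm (p r z) <= P"
 proof -
  have "\<exists>B>0. \<forall>x. \<bar>dir_deriv b (dir_deriv b \<rho>) x\<bar> <= B" "\<exists>B>0. \<forall>x. \<bar>dir_deriv b \<rho> x\<bar> <= B" for b
   using test_function_bounded[OF td(1)] test_function_bounded[OF td(2)] by metis+
  then obtain b1 b2 where b1: "!!b. b1 b > 0" "!!b x. \<bar>dir_deriv b (dir_deriv b \<rho>) x\<bar> <= b1 b"
   and b2: "!!b. b2 b > 0" "!!b x. \<bar>dir_deriv b \<rho> x\<bar> <= b2 b" by metis
  have "norm (p r z) <= (\<Sum>b\<in>(Basis::'a set). \<bar>\<sigma>\<bar> * (b1 b * M) + b2 b * M)" for r z
   unfolding p_def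
  proof (intro order_trans[OF norm_sum] sum_mono)
   fix b :: 'a assume b: "b \<in> Basis"
   have "norm (flux_div \<sigma> \<rho> f F b r z) <= \<bar>\<sigma>\<bar> * norm (mollify (dir_deriv b (dir_deriv b \<rho>)) (f r) z) + norm (mollify (dir_deriv b \<rho>) (F b r) z)"
    unfolding flux_div_def by (rule order_trans[OF norm_triangle_ineq]) simp
   also have "... <= \<bar>\<sigma>\<bar> * (b1 b * M) + b2 b * M"
    by (intro add_mono mult_left_mono order_trans[OF mollify_norm_le[OF D(3)[of r] _ b1(2)] mult_left_mono]
      order_trans[OF mollify_norm_le[OF D(5)[OF b] _ b2(2)] mult_left_mono] D b)
     (auto intro: less_imp_le b1(1) b2(1))
   finally show "norm (flux_div \<sigma> \<rho> f F b r z) <= \<bar>\<sigma>\<bar> * (b1 b * M) + b2 b * M" .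
  qed
  then show ?thesis by blast
 qed
 then obtain P where P: "!!r z. norm (p r z) <= P" by blast
 have yS: "y r z \<in> S" for r z unfolding y_def by (rule S(3))
 have \<Psi>'m[measurable]: "(%w. \<Psi>' (case w of (r,z) => y r z)) \<in> borel_measurable (lborel \<Otimes>\<^sub>M lborel)"
  by (rule measurable_compose_compact[OF S(1) \<open>continuous_on S \<Psi>'\<close> ym]) (auto simp: yS split: prod.split)
 have \<Psi>'m2[measurable]: "(%(r,z). \<Psi>' (y r z)) \<in> borel_measurable (lborel \<Otimes>\<^sub>M lborel)"
  using \<Psi>'m by (simp add: case_prod_beta')
 have Pb: "\<bar>\<Psi>' (y r z) \<bullet> p r z\<bar> <= B1 * norm (p r z)" for r z
  by (rule order_trans[OF Cauchy_Schwarz_ineq2]) (intro mult_right_mono B1 yS norm_ge_zero)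
 define q where "q r z = indicator {0..t} r *\<^sub>R (\<Psi>' (y r z) \<bullet> p r z)" for r z
 \<comment> \<open>The chain rule is used at a fixed point \<open>z\<close>; integration over space
   comes afterwards.\<close>
 have chain: "\<Psi> (y t z) = (LB r. q r z)" for z
 proof -
  have "\<Psi> (y t z) - \<Psi> (y 0 z) = (LB r. indicator {0..t} r *\<^sub>R (\<Psi>' (y r z) \<bullet> p r z))"
  proof (rule chain_rule_integral[where S=S and L=L and B=B1 and P=P and T=T])
   show "(%r. p r z) \<in> bmb"
    using measurable_compose[OF measurable_Pair2'[of z lborel lborel] pm] by (simp add: space_pair_measure)
   show "(%r. \<Psi>' (y r z)) \<in> bmb"
    using measurable_compose[OF measurable_Pair2'[of z lborel lborel] \<Psi>'m2] by (simp add: space_pair_measure)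
   show "y t' z - y 0 z = (LB r. indicator {0..t'} r *\<^sub>R p r z)" if "t' \<in> {0..T}" for t'
    unfolding y_def p_def by (rule mollified_equation[OF fp \<rho> that])
  qed (use S yS P \<Psi> Lip L B1 t in auto)
  then show ?thesis using z0[of z] by (simp add: y_def q_def)
 qed
 have qm: "(%(r,z). q r z) \<in> borel_measurable (lborel \<Otimes>\<^sub>M lborel)"
  unfolding q_def case_prod_beta' using \<Psi>'m2 pm by (simp add: case_prod_beta')
 have qi: "ilb (q r)" for r
 proof (rule Bochner_Integration.integrable_bound)
  show "ilb (%z. B1 * norm (p r z))" using pi by auto
  show "q r \<in> borel_measurable lborel"
   using measurable_compose[OF measurable_Pair1'[of r lborel lborel] qm] by (simp add: space_pair_measure)
  show "AE z in lborel. norm (q r z) <= norm (B1 * norm (p r z))"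
   using Pb B1(1) by (auto simp: q_def split: split_indicator)
 qed
 have qL1: "(LB z. norm (q r z)) <= indicator {0..t} r *\<^sub>R (B1 * Cp)" for r
 proof (cases "r \<in> {0..t}")
  case True
  have "(LB z. norm (q r z)) <= (LB z. B1 * norm (p r z))"
   using Pb True pi by (intro integral_mono integrable_norm qi) (auto simp: q_def)
  also have "... <= B1 * Cp" using pL1[of r] B1(1) by (simp add: mult_left_mono)
  finally show ?thesis using True by simp
 qed (simp add: q_def)
 have int: "integrable (lborel \<Otimes>\<^sub>M lborel) (%(r,z). q r z)"
 proof (rule lborel_pair.Fubini_integrable[OF qm])
  show "ilb (%r. LB z. norm (case (r, z) of (r, z) => q r z))"
  proof (rule Bochner_Integration.integrable_bound)
   show "ilb (%r. indicator {0..t} r *\<^sub>R (B1 * Cp))"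
    by (intro borel_integrable_compact) auto
   show "(%r. LB z. norm (case (r, z) of (r, z) => q r z)) \<in> borel_measurable lborel"
    by (rule lborel.borel_measurable_lebesgue_integral) (use qm in \<open>simp add: case_prod_beta'\<close>)
   show "AE r in lborel. norm (LB z. norm (case (r, z) of (r, z) => q r z)) <= norm (indicator {0..t} r *\<^sub>R (B1 * Cp))"
    using qL1 by (intro AE_I2) (auto intro: order_trans[OF _ abs_ge_self])
  qed
  show "AE r in lborel. ilb (%z. case (r, z) of (r, z) => q r z)"
   using qi by simp
 qed
 show "ilb (%z. \<Psi> (mollify \<rho> (f t) z))"
  using lborel_pair.integrable_snd[OF int] chain by (simp add: y_def)
 have parts: "(LB z. \<Psi>' (y r z) \<bullet> p r z)
  = - (LB z. (SB b. \<Psi>'' (y r z) (mollify (dir_deriv b \<rho>) (f r) z) \<bullet> flux \<sigma> \<rho> f F b r z))" for r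
 proof -
  have yd: "(y r has_derivative (%v. mollify (dir_deriv v \<rho>) (f r) z)) (at z)" for z
   unfolding y_def by (rule mollify_has_derivative[OF \<rho> D(3)])
  have yc: "continuous_on UNIV (y r)"
   unfolding y_def by (rule mollify_continuous[OF \<rho> D(3)])
  have \<Psi>'c: "continuous_on UNIV (%z. \<Psi>' (y r z))"
   by (rule continuous_on_compose2[OF \<open>continuous_on S \<Psi>'\<close> yc]) (use yS in auto)
  have each: "ilb (%z. \<Psi>' (y r z) \<bullet> flux_div \<sigma> \<rho> f F b r z)
    \<and> ilb (%z. \<Psi>'' (y r z) (mollify (dir_deriv b \<rho>) (f r) z) \<bullet> flux \<sigma> \<rho> f F b r z)
    \<and> (LB z. \<Psi>' (y r z) \<bullet> flux_div \<sigma> \<rho> f F b r z)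
     = - (LB z. \<Psi>'' (y r z) (mollify (dir_deriv b \<rho>) (f r) z) \<bullet> flux \<sigma> \<rho> f F b r z)"
   if b: "b \<in> Basis" for b
  proof -
   define J where "J z = flux \<sigma> \<rho> f F b r z" for z
   define DJ where "DJ z v = \<sigma> *\<^sub>R mollify (dir_deriv v (dir_deriv b \<rho>)) (f r) z + mollify (dir_deriv v \<rho>) (F b r) z" for z v
   have DJb: "DJ z b = flux_div \<sigma> \<rho> f F b r z" for z by (simp add: DJ_def flux_div_def)
   have Jd: "(J has_derivative DJ z) (at z)" for z
    unfolding J_def flux_def DJ_def
    by (intro has_derivative_add has_derivative_scaleR_right mollify_has_derivative td \<rho> D b)
   have Jc: "continuous_on UNIV J"
    using Jd has_derivative_continuous continuous_at_imp_continuous_on by blast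
   have Ji: "ilb J"
    unfolding J_def flux_def
    by (intro Bochner_Integration.integrable_add Bochner_Integration.integrable_scaleR_right
      mollify_integrable(1) test_function_integrable td \<rho> D b)
   have DJc: "continuous_on UNIV (%z. DJ z b)"
    unfolding DJ_def
    by (intro continuous_intros mollify_continuous test_function_dir_deriv td \<rho> D b)
   have gc: "continuous_on UNIV (%z. \<Psi>'' (y r z) (mollify (dir_deriv b \<rho>) (f r) z))"
    using continuous_on_compose2[OF \<Psi>'', of UNIV "%z. (y r z, mollify (dir_deriv b \<rho>) (f r) z)"] yS
    by (auto intro!: continuous_intros yc mollify_continuous td D)
   obtain G where G: "G > 0" "!!x. \<bar>dir_deriv b \<rho> x\<bar> <= G" using test_function_bounded[OF td(1)] by metis
   have gb: "norm (\<Psi>'' (y r z) (mollify (dir_deriv b \<rho>) (f r) z)) <= L * (G * M)" for z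
   proof -
    have "norm (mollify (dir_deriv b \<rho>) (f r) z) <= G * (LB x. norm (f r x))"
     by (rule mollify_norm_le[OF D(3)]) (use G in auto)
    also have "... <= G * M" using G D(4) by (intro mult_left_mono) auto
    finally show ?thesis using B2[OF yS, of r z "mollify (dir_deriv b \<rho>) (f r) z"] L(1)
     by (meson mult_left_mono order_trans)
   qed
   have i1: "ilb (%z. \<Psi>' (y r z) \<bullet> DJ z b)"
   proof (rule Bochner_Integration.integrable_bound)
    show "ilb (%z. B1 * norm (DJ z b))" using fdi[OF b, of r] by (auto simp: DJb)
    show "(%z. \<Psi>' (y r z) \<bullet> DJ z b) \<in> borel_measurable lborel"
     using \<Psi>'c DJc by (auto intro!: borel_measurable_continuous_onI continuous_intros)
    show "AE z in lborel. norm (\<Psi>' (y r z) \<bullet> DJ z b) <= norm (B1 * norm (DJ z b))"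
     using B1 yS by (intro AE_I2) (auto simp: abs_mult intro!: order_trans[OF Cauchy_Schwarz_ineq2] mult_right_mono)
   qed
   have i2: "ilb (%z. \<Psi>'' (y r z) (mollify (dir_deriv b \<rho>) (f r) z) \<bullet> J z)"
   proof (rule Bochner_Integration.integrable_bound)
    show "ilb (%z. (L * (G * M)) * norm (J z))" using Ji by auto
    show "(%z. \<Psi>'' (y r z) (mollify (dir_deriv b \<rho>) (f r) z) \<bullet> J z) \<in> borel_measurable lborel"
     using gc Jc by (auto intro!: borel_measurable_continuous_onI continuous_intros)
    show "AE z in lborel. norm (\<Psi>'' (y r z) (mollify (dir_deriv b \<rho>) (f r) z) \<bullet> J z) <= norm (L * (G * M) * norm (J z))"
    proof (rule AE_I2)
     fix z
     have "norm (\<Psi>'' (y r z) (mollify (dir_deriv b \<rho>) (f r) z) \<bullet> J z) <= L * (G * M) * norm (J z)"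
      unfolding real_norm_def by (rule order_trans[OF Cauchy_Schwarz_ineq2]) (intro mult_right_mono gb norm_ge_zero)
     then show "norm (\<Psi>'' (y r z) (mollify (dir_deriv b \<rho>) (f r) z) \<bullet> J z) <= norm (L * (G * M) * norm (J z))"
      unfolding real_norm_def by (rule order_trans[OF _ abs_ge_self])
    qed
   qed
   \<comment> \<open>The product whose derivative along \<open>b\<close> is the sum of the two
     integrands. Its integral is 0, which is the integration by parts.\<close>
   define X where "X z = \<Psi>' (y r z) \<bullet> J z" for z
   define DX where "DX z v = \<Psi>' (y r z) \<bullet> DJ z v + \<Psi>'' (y r z) (mollify (dir_deriv v \<rho>) (f r) z) \<bullet> J z" for z v
   have "(LB z. DX z b) = 0"
   proof (rule integral_directional_derivative_eq_0)
    show "(X has_derivative DX z) (at z)" for z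
     unfolding X_def DX_def
     by (rule has_derivative_inner[OF has_derivative_compose[OF yd \<Psi>'[OF yS]] Jd])
    show "continuous_on UNIV (%z. DX z b)"
     unfolding DX_def using \<Psi>'c DJc gc Jc by (intro continuous_intros)
    show "ilb X"
    proof (rule Bochner_Integration.integrable_bound)
     show "ilb (%z. B1 * norm (J z))" using Ji by auto
     show "X \<in> borel_measurable lborel"
      unfolding X_def[abs_def] using \<Psi>'c Jc by (auto intro!: borel_measurable_continuous_onI continuous_intros)
     show "AE z in lborel. norm (X z) <= norm (B1 * norm (J z))"
      using B1 yS by (intro AE_I2) (auto simp: X_def abs_mult intro!: order_trans[OF Cauchy_Schwarz_ineq2] mult_right_mono)
    qed
    show "ilb (%z. DX z b)"
     unfolding DX_def using i1 i2 by (rule Bochner_Integration.integrable_add)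
   qed
   then have "(LB z. \<Psi>' (y r z) \<bullet> DJ z b) + (LB z. \<Psi>'' (y r z) (mollify (dir_deriv b \<rho>) (f r) z) \<bullet> J z) = 0"
    unfolding DX_def using i1 i2 by simp
   then show ?thesis using i1 i2 by (simp add: DJb J_def)
  qed
  have "(LB z. \<Psi>' (y r z) \<bullet> p r z) = (SB b. LB z. \<Psi>' (y r z) \<bullet> flux_div \<sigma> \<rho> f F b r z)"
   unfolding p_def inner_sum_right using each by (intro Bochner_Integration.integral_sum) auto
  also have "... = - (SB b. LB z. \<Psi>'' (y r z) (mollify (dir_deriv b \<rho>) (f r) z) \<bullet> flux \<sigma> \<rho> f F b r z)"
   using each by (simp add: sum_negf)
  also have "(SB b. LB z. \<Psi>'' (y r z) (mollify (dir_deriv b \<rho>) (f r) z) \<bullet> flux \<sigma> \<rho> f F b r z)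
   = (LB z. (SB b. \<Psi>'' (y r z) (mollify (dir_deriv b \<rho>) (f r) z) \<bullet> flux \<sigma> \<rho> f F b r z))"
   using each by (intro Bochner_Integration.integral_sum[symmetric]) auto
  finally show ?thesis .
 qed
 have "(LB z. \<Psi> (mollify \<rho> (f t) z)) = (LB z. (LB r. q r z))"
  using chain by (simp add: y_def)
 also have "... = (LB r. (LB z. q r z))"
  by (rule lborel_pair.Fubini_integral[OF int])
 also have "... = (LB r. - (indicator {0..t} r *\<^sub>R (LB z. (SB b. \<Psi>'' (y r z) (mollify (dir_deriv b \<rho>) (f r) z) \<bullet> flux \<sigma> \<rho> f F b r z))))"
  unfolding q_def by (simp add: parts)
 finally show "(LB z. \<Psi> (mollify \<rho> (f t) z)) = - (LB r. indicator {0..t} r *\<^sub>R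
   (LB z. (SB b. \<Psi>'' (mollify \<rho> (f r) z) (mollify (dir_deriv b \<rho>) (f r) z) \<bullet> flux \<sigma> \<rho> f F b r z)))"
  by (simp add: y_def)
qed

lemma ennreal_integral_le_nn_integral:
 fixes h :: "'b => real"
 shows "ennreal (\<integral>x. h x \<partial>M) <= (\<integral>\<^sup>+x. ennreal (h x) \<partial>M)"
proof (cases "integrable M h")
 case True
 have "(\<integral>x. h x \<partial>M) <= (\<integral>x. max 0 (h x) \<partial>M)"
  using True by (intro integral_mono) auto
 moreover have "ennreal (\<integral>x. max 0 (h x) \<partial>M) = (\<integral>\<^sup>+x. ennreal (max 0 (h x)) \<partial>M)"
  using True by (intro nn_integral_eq_integral[symmetric]) auto
 moreover have "(\<integral>\<^sup>+x. ennreal (max 0 (h x)) \<partial>M) = (\<integral>\<^sup>+x. ennreal (h x) \<partial>M)"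
  by (intro nn_integral_cong) (auto simp: max_def ennreal_neg)
 ultimately show ?thesis by (metis ennreal_leI)
qed (simp add: not_integrable_integral_eq)

text \<open>Bounding the dissipation by an extended nonnegative \<open>R\<close> dispenses with
  measurability and integrability of the bound, and \<open>R\<close> may be infinite.\<close>

corollary energy_inequality:
 fixes f :: "real => 'a::euclidean_space => 'c::euclidean_space"
 assumes "fokker_planck T \<sigma> M f F" "test_function \<rho>"
  and "compact S" "convex S" "!!t z. mollify \<rho> (f t) z \<in> S"
  and "!!x. x \<in> S ==> (\<Psi> has_derivative (%h. \<Psi>' x \<bullet> h)) (at x)"
  and "!!x. x \<in> S ==> (\<Psi>' has_derivative \<Psi>'' x) (at x)"
  and "continuous_on (S \<times> UNIV) (%(x,h). \<Psi>'' x h)"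
  and "!!z. \<Psi> (mollify \<rho> (f 0) z) = 0"
  and "t \<in> {0..T}"
  and R: "!!r z. r \<in> {0..t} ==> ennreal (- (SB b. \<Psi>'' (mollify \<rho> (f r) z) (mollify (dir_deriv b \<rho>) (f r) z) \<bullet> flux \<sigma> \<rho> f F b r z)) <= R r z"
 shows "ennreal (LB z. \<Psi> (mollify \<rho> (f t) z)) <= (NN r. indicator {0..t} r * (NN z. R r z))"
proof -
 define A where "A r z = (SB b. \<Psi>'' (mollify \<rho> (f r) z) (mollify (dir_deriv b \<rho>) (f r) z) \<bullet> flux \<sigma> \<rho> f F b r z)" for r z
 have "(LB z. \<Psi> (mollify \<rho> (f t) z)) = (LB r. indicator {0..t} r *\<^sub>R (LB z. - A r z))"
  using energy_identity(2)[OF assms(1-10)] by (simp add: A_def)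
 also have "ennreal ... <= (NN r. ennreal (indicator {0..t} r *\<^sub>R (LB z. - A r z)))"
  by (rule ennreal_integral_le_nn_integral)
 also have "... <= (NN r. indicator {0..t} r * (NN z. R r z))"
 proof (rule nn_integral_mono)
  fix r
  show "ennreal (indicator {0..t} r *\<^sub>R (LB z. - A r z)) <= indicator {0..t} r * (NN z. R r z)"
  proof (cases "r \<in> {0..t}")
   case True
   have "ennreal (LB z. - A r z) <= (NN z. ennreal (- A r z))"
    by (rule ennreal_integral_le_nn_integral)
   also have "... <= (NN z. R r z)"
    using R[OF True] by (intro nn_integral_mono) (simp add: A_def)
   finally show ?thesis using True by simp
  qed simp
 qed
 finally show ?thesis .
qed

section \<open>Convolution with singular kernels\<close>

definition bounded_L1 :: "real => ('a::euclidean_space => real) => bool" where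
 "bounded_L1 M g \<longleftrightarrow> ilb g \<and> (LB x. \<bar>g x\<bar>) <= M \<and> (AE x in lborel. \<bar>g x\<bar> <= M)"

lemma bounded_L1D:
 assumes "bounded_L1 M g"
 shows "ilb g" "(LB x. \<bar>g x\<bar>) <= M" "AE x in lborel. \<bar>g x\<bar> <= M"
  "g \<in> bmb" "M \<ge> 0"
proof -
 show 1: "ilb g" "(LB x. \<bar>g x\<bar>) <= M" "AE x in lborel. \<bar>g x\<bar> <= M"
  using assms by (auto simp: bounded_L1_def)
 show "g \<in> bmb" using 1 by auto
 have "0 <= (LB x. \<bar>g x\<bar>)" by simp
 then show "M \<ge> 0" using 1(2) by linarith
qed

definition split_kernel :: "real => real => real => ('a::euclidean_space => 'a) => ('a => 'a) => ('a => 'a) => bool" where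
 "split_kernel A B L K K1 K2 \<longleftrightarrow> (\<forall>x. K x = K1 x + K2 x) \<and> ilb K1 \<and> (LB x. norm (K1 x)) <= A
  \<and> K2 \<in> bmb \<and> (\<forall>x. norm (K2 x) <= B) \<and> (\<forall>x y. norm (K2 x - K2 y) <= L * norm (x - y))"

text \<open>The integrable part can be made as small as desired, at the expense of \<open>B\<close>
  and \<open>L\<close>. This yields a modulus of continuity of \<open>conv K g\<close> that depends
  on \<open>g\<close> through its bound only; a single splitting would not.\<close>

definition singular_kernel :: "('a::euclidean_space => 'a) => bool" where
 "singular_kernel K \<longleftrightarrow> (\<forall>A>0. \<exists>B L K1 K2. split_kernel A B L K K1 K2)"

lemma split_kernelD:
 assumes "split_kernel A B L K K1 K2"
 shows "!!x. K x = K1 x + K2 x" "ilb K1" "(LB x. norm (K1 x)) <= A"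
  "K2 \<in> bmb" "!!x. norm (K2 x) <= B" "!!x y. norm (K2 x - K2 y) <= L * norm (x - y)"
  "K1 \<in> bmb" "K \<in> bmb" "A \<ge> 0" "B \<ge> 0" "L \<ge> 0"
proof -
 show 1: "!!x. K x = K1 x + K2 x" "ilb K1" "(LB x. norm (K1 x)) <= A"
  "K2 \<in> bmb" "!!x. norm (K2 x) <= B" "!!x y. norm (K2 x - K2 y) <= L * norm (x - y)"
  using assms by (auto simp: split_kernel_def)
 show [measurable]: "K1 \<in> bmb" using 1 by auto
 note [measurable] = 1(4)
 have "K = (%x. K1 x + K2 x)" using 1 by auto
 then show "K \<in> bmb" by simp
 have "0 <= (LB x. norm (K1 x))" by simp
 then show "A \<ge> 0" using 1(3) by linarith
 show "B \<ge> 0" using 1(5)[of 0] norm_ge_zero order_trans by blast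
 \<comment> \<open>Two distinct points are needed to read off the sign of \<open>L\<close>.\<close>
 obtain b :: 'a where "b \<in> Basis" using nonempty_Basis by blast
 then have "norm b = 1" by simp
 then show "L \<ge> 0" using order_trans[OF norm_ge_zero 1(6)[of b 0]] by simp
qed

lemma split_kernel_bounded:
 fixes K2 :: "'a::euclidean_space => 'a"
 assumes "K2 \<in> bmb" "!!x. norm (K2 x) <= B" "!!x y. norm (K2 x - K2 y) <= L * norm (x - y)"
 shows "split_kernel 0 B L K2 (%_. 0) K2"
 using assms by (auto simp: split_kernel_def)

text \<open>The integrable part of the kernel is paired with the sup bound of \<open>g\<close>, and
  the bounded part with its \<open>L^1\<close> bound. This is why densities are taken in both
  spaces.\<close>

lemma conv_integrand:
 fixes K :: "'a::euclidean_space => 'a"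
 assumes K: "split_kernel A B L K K1 K2" and g: "bounded_L1 M g"
 shows "ilb (%y. g y *\<^sub>R K (x - y))"
  and "(LB y. \<bar>g y\<bar> * norm (K (x - y))) <= M * A + B * M"
  and "ilb (%y. g y *\<^sub>R K1 (x - y))" "ilb (%y. g y *\<^sub>R K2 (x - y))"
proof -
 note k = split_kernelD[OF K] and g = bounded_L1D[OF g]
 note [measurable] = k(4,7,8) g(4)
 have r: "ilb (%y. K1 (x - y))" "(LB y. norm (K1 (x - y))) = (LB y. norm (K1 y))"
  using integrable_reflect[OF k(2)] integral_reflect[of "%y. norm (K1 y)" x] by auto
 show i1: "ilb (%y. g y *\<^sub>R K1 (x - y))"
  using r(1) g(3) by (intro integrable_scaleR_bounded) auto
 show i2: "ilb (%y. g y *\<^sub>R K2 (x - y))"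
 proof (rule Bochner_Integration.integrable_bound)
  show "ilb (%y. \<bar>g y\<bar> * B)" using g by auto
  show "AE y in lborel. norm (g y *\<^sub>R K2 (x - y)) <= norm (\<bar>g y\<bar> * B)"
   using k by (auto simp: abs_mult intro!: mult_left_mono)
 qed measurable
 show i: "ilb (%y. g y *\<^sub>R K (x - y))"
  using Bochner_Integration.integrable_add[OF i1 i2] by (simp add: k(1) scaleR_add_right)
 have "(LB y. \<bar>g y\<bar> * norm (K (x - y))) <= (LB y. M * norm (K1 (x - y)) + B * \<bar>g y\<bar>)"
 proof (rule integral_mono_AE)
  show "ilb (%y. \<bar>g y\<bar> * norm (K (x - y)))" using integrable_norm[OF i] by simp
  show "ilb (%y. M * norm (K1 (x - y)) + B * \<bar>g y\<bar>)" using r(1) g(1) by auto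
  show "AE y in lborel. \<bar>g y\<bar> * norm (K (x - y)) <= M * norm (K1 (x - y)) + B * \<bar>g y\<bar>"
   using g(3)
  proof eventually_elim
   case (elim y)
   have "\<bar>g y\<bar> * norm (K (x - y)) <= \<bar>g y\<bar> * (norm (K1 (x - y)) + norm (K2 (x - y)))"
    unfolding k(1) by (intro mult_left_mono norm_triangle_ineq) auto
   also have "... = \<bar>g y\<bar> * norm (K1 (x - y)) + \<bar>g y\<bar> * norm (K2 (x - y))" by (rule distrib_left)
   also have "... <= M * norm (K1 (x - y)) + \<bar>g y\<bar> * B"
    using elim k by (intro add_mono mult_right_mono mult_left_mono) auto
   finally show ?case by (simp add: mult.commute)
  qed
 qed
 also have "... = M * (LB y. norm (K1 y)) + B * (LB y. \<bar>g y\<bar>)"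
  using r g(1) by simp
 also have "... <= M * A + B * M"
  using k g by (intro add_mono mult_left_mono) auto
 finally show "(LB y. \<bar>g y\<bar> * norm (K (x - y))) <= M * A + B * M" .
qed

lemma conv_norm_le:
 fixes K :: "'a::euclidean_space => 'a"
 assumes K: "split_kernel A B L K K1 K2" and g: "bounded_L1 M g"
 shows "norm (conv K g x) <= M * A + B * M"
proof -
 have "norm (conv K g x) <= (LB y. norm (g y *\<^sub>R K (x - y)))"
  unfolding conv_def by (rule integral_norm_bound)
 then show ?thesis using conv_integrand(2)[OF K g, of x] by simp
qed

text \<open>The two values of the integrable part are not compared; each is at most
  \<open>M * A\<close>. The Lipschitz part carries the dependence on the distance.\<close>

lemma conv_modulus:
 fixes K :: "'a::euclidean_space => 'a"
 assumes K: "split_kernel A B L K K1 K2" and g: "bounded_L1 M g"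
 shows "norm (conv K g x - conv K g x') <= 2 * M * A + M * L * norm (x - x')"
proof -
 note k = split_kernelD[OF K] and gg = bounded_L1D[OF g]
 note [measurable] = k(4,7,8) gg(4)
 note i = conv_integrand[OF K g]
 have eq: "conv K g x = conv K1 g x + conv K2 g x" for x
  unfolding conv_def k(1) scaleR_add_right using i(3,4) by (rule Bochner_Integration.integral_add)
 have r: "ilb (%y. K1 (x - y))" "(LB y. norm (K1 (x - y))) = (LB y. norm (K1 y))" for x
  using integrable_reflect[OF k(2)] integral_reflect[of "%y. norm (K1 y)" x] by auto
 have 1: "norm (conv K1 g x) <= M * A" for x
 proof -
  have "norm (conv K1 g x) <= M * (LB y. norm (K1 (x - y)))"
   unfolding conv_def using r(1) gg(3) by (intro norm_integral_scaleR_bounded) auto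
  also have "... <= M * A" unfolding r(2) using k gg by (intro mult_left_mono) auto
  finally show ?thesis .
 qed
 have "conv K2 g x - conv K2 g x' = (LB y. g y *\<^sub>R (K2 (x - y) - K2 (x' - y)))"
  unfolding conv_def scaleR_diff_right using i(4) by (intro Bochner_Integration.integral_diff[symmetric]) auto
 also have "norm ... <= (LB y. norm (g y *\<^sub>R (K2 (x - y) - K2 (x' - y))))"
  by (rule integral_norm_bound)
 also have "... <= (LB y. \<bar>g y\<bar> * (L * norm (x - x')))"
 proof (rule integral_mono)
  show "ilb (%y. norm (g y *\<^sub>R (K2 (x - y) - K2 (x' - y))))"
   unfolding scaleR_diff_right using i(4) by (intro integrable_norm Bochner_Integration.integrable_diff) auto
  show "norm (g y *\<^sub>R (K2 (x - y) - K2 (x' - y))) <= \<bar>g y\<bar> * (L * norm (x - x'))" for y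
   using k(6)[of "x - y" "x' - y"] by (auto intro!: mult_left_mono)
 qed (use gg in auto)
 also have "... <= M * (L * norm (x - x'))"
  using gg k by (simp add: mult_right_mono)
 finally have 2: "norm (conv K2 g x - conv K2 g x') <= M * (L * norm (x - x'))" .
 have "norm (conv K g x - conv K g x') <= norm (conv K1 g x) + norm (conv K1 g x') + norm (conv K2 g x - conv K2 g x')"
  unfolding eq by norm
 then show ?thesis using 1[of x] 1[of x'] 2 by (simp add: mult_ac)
qed

lemma conv_measurable_pair:
 assumes [measurable]: "K \<in> bmb"
  "(%(t,x). f t x) \<in> borel_measurable (M \<Otimes>\<^sub>M lborel)"
 shows "(%(t,x). conv K (f t) x) \<in> borel_measurable (M \<Otimes>\<^sub>M lborel)"
proof -
 have [measurable]: "(%p. (%(t,x). f t x) (fst (fst p), snd p)) \<in> borel_measurable ((M \<Otimes>\<^sub>M lborel) \<Otimes>\<^sub>M lborel)"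
  by (rule measurable_compose[OF _ assms(2)]) measurable
 have "(%w. LB x. (%p. (%(t,x). f t x) (fst (fst p), snd p) *\<^sub>R K (snd (fst p) - snd p)) (w, x))
   \<in> borel_measurable (M \<Otimes>\<^sub>M lborel)"
  by (rule lborel.borel_measurable_lebesgue_integral) measurable
 then show ?thesis by (simp add: conv_def case_prod_beta')
qed

lemma conv_measurable:
 fixes K :: "'a::euclidean_space => 'b::euclidean_space"
 assumes [measurable]: "K \<in> bmb" "g \<in> bmb"
 shows "conv K g \<in> bmb"
proof -
 have "(%z. LB x. (%(z,x). g x *\<^sub>R K (z - x)) (z, x)) \<in> borel_measurable lborel"
  by (rule lborel.borel_measurable_lebesgue_integral) measurable
 then show ?thesis by (simp add: conv_def[abs_def])
qed

lemma mollify_AE_bound: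
 assumes \<rho>: "bump \<delta> \<rho>" and g: "ilb g" and B: "AE x in lborel. norm (g x) <= B"
 shows "norm (mollify \<rho> g z) <= B"
proof -
 note b = bumpD[OF \<rho>]
 note [measurable] = b(5)
 have "norm (mollify \<rho> g z) <= (LB x. norm (\<rho> (z - x) *\<^sub>R g x))"
  unfolding mollify_def by (rule integral_norm_bound)
 also have "... <= (LB x. \<rho> (z - x) * B)"
  using mollify_test_integrand[OF g b(1), of z] integrable_reflect[OF b(6), of z]
  by (intro integral_mono_AE integrable_norm) (use B b(2) in \<open>auto intro!: mult_left_mono\<close>)
 also have "... = B" using integral_reflect[of \<rho> z] b by simp
 finally show ?thesis .
qed

lemma bounded_L1_mollify:
 assumes \<rho>: "bump \<delta> \<rho>" and g: "bounded_L1 M g"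
 shows "bounded_L1 M (mollify \<rho> g)"
proof -
 note b = bumpD[OF \<rho>] and g = bounded_L1D[OF g]
 have "(LB z. norm (mollify \<rho> g z)) <= (LB x. \<bar>\<rho> x\<bar>) * (LB x. norm (g x))"
  by (rule mollify_integrable(2)[OF b(6) g(1)])
 also have "(LB x. \<bar>\<rho> x\<bar>) = 1" using b by simp
 finally have "(LB z. \<bar>mollify \<rho> g z\<bar>) <= M" using g(2) by simp
 then show ?thesis
  using mollify_integrable(1)[OF b(6) g(1)] mollify_AE_bound[OF \<rho> g(1), of M] g(3)
  by (auto simp: bounded_L1_def)
qed

lemma bounded_L1_bump:
 assumes "bump \<delta> \<rho>" shows "\<exists>M. bounded_L1 M \<rho>"
proof -
 note b = bumpD[OF assms]
 obtain B where B: "B > 0" "!!x. \<bar>\<rho> x\<bar> <= B" using test_function_bounded[OF b(1)] by metis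
 have "bounded_L1 (max B 1) \<rho>"
  unfolding bounded_L1_def using b B(2) by (auto intro!: AE_I2 max.coboundedI1)
 then show ?thesis by blast
qed

text \<open>Associativity of convolution, by Fubini. It moves the mollifier from the kernel to the
  density, so that the two systems can be compared with one and the same kernel.\<close>

lemma conv_conv:
 fixes K :: "'a::euclidean_space => 'a"
 assumes K: "split_kernel A B L K K1 K2" and \<rho>: "bump \<delta> \<rho>" and g: "bounded_L1 M g"
 shows "conv (conv K \<rho>) g x = conv K (mollify \<rho> g) x"
proof -
 note b = bumpD[OF \<rho>] and k = split_kernelD[OF K] and gg = bounded_L1D[OF g]
 note [measurable] = b(5) k(8) gg(4)
 obtain N where N: "bounded_L1 N \<rho>" using bounded_L1_bump[OF \<rho>] by blast
 \<comment> \<open>Both norms are translation invariant; this makes the inner integral bounded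
   uniformly in \<open>y\<close>.\<close>
 have shift: "bounded_L1 N (%u. \<rho> (u - y))" for y
 proof -
  have "AE u in lborel. \<bar>\<rho> (u - y)\<bar> <= N"
  proof -
   have "AE u in distr lborel borel (%u. - y + u). \<bar>\<rho> u\<bar> <= N"
    unfolding lborel_distr_translate by (rule bounded_L1D(3)[OF N])
   then show ?thesis by (subst (asm) AE_distr_iff) auto
  qed
  then show ?thesis
   using bounded_L1D[OF N] integrable_translate[of \<rho> "-y"] integral_translate[of "%u. \<bar>\<rho> u\<bar>" "-y"]
   by (auto simp: bounded_L1_def)
 qed
 define C where "C = N * A + B * N"
 have int: "integrable (lborel \<Otimes>\<^sub>M lborel) (%(y,u). g y *\<^sub>R \<rho> (u - y) *\<^sub>R K (x - u))"
 proof (rule lborel_pair.Fubini_integrable)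
  show "ilb (%y. LB u. norm (case (y, u) of (y, u) => g y *\<^sub>R \<rho> (u - y) *\<^sub>R K (x - u)))"
  proof (rule Bochner_Integration.integrable_bound)
   show "ilb (%y. \<bar>g y\<bar> * C)" using gg by auto
   show "AE y in lborel. norm (LB u. norm (case (y, u) of (y, u) => g y *\<^sub>R \<rho> (u - y) *\<^sub>R K (x - u))) <= norm (\<bar>g y\<bar> * C)"
   proof (rule AE_I2)
    fix y
    have "(LB u. norm (g y *\<^sub>R \<rho> (u - y) *\<^sub>R K (x - u))) = \<bar>g y\<bar> * (LB u. \<bar>\<rho> (u - y)\<bar> * norm (K (x - u)))"
     by (simp add: abs_mult mult.assoc)
    also have "... <= \<bar>g y\<bar> * C" unfolding C_def
     by (intro mult_left_mono conv_integrand(2)[OF K shift]) auto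
    finally show "norm (LB u. norm (case (y, u) of (y, u) => g y *\<^sub>R \<rho> (u - y) *\<^sub>R K (x - u))) <= norm (\<bar>g y\<bar> * C)"
     by (auto intro: order_trans[OF _ abs_ge_self])
   qed
   show "(%y. LB u. norm (case (y, u) of (y, u) => g y *\<^sub>R \<rho> (u - y) *\<^sub>R K (x - u))) \<in> borel_measurable lborel"
    by (rule lborel.borel_measurable_lebesgue_integral) measurable
  qed
  show "AE y in lborel. ilb (%u. case (y, u) of (y, u) => g y *\<^sub>R \<rho> (u - y) *\<^sub>R K (x - u))"
  proof (rule AE_I2)
   fix y
   show "ilb (%u. case (y, u) of (y, u) => g y *\<^sub>R \<rho> (u - y) *\<^sub>R K (x - u))"
    using integrable_scaleR_right[OF conv_integrand(1)[OF K shift[of y], of x], of "g y"]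
    by (simp del: scaleR_scaleR)
  qed
 qed measurable
 have "conv (conv K \<rho>) g x = (LB y. g y *\<^sub>R (LB u. \<rho> (u - y) *\<^sub>R K (x - u)))"
 proof -
  have "(LB w. \<rho> w *\<^sub>R K (x - y - w)) = (LB u. \<rho> (u - y) *\<^sub>R K (x - u))" for y
   using integral_translate[of "%w. \<rho> w *\<^sub>R K (x - y - w)" "-y"] by (simp add: algebra_simps)
  then show ?thesis by (simp add: conv_def)
 qed
 also have "... = (LB y. (LB u. g y *\<^sub>R \<rho> (u - y) *\<^sub>R K (x - u)))"
  by (simp del: scaleR_scaleR)
 also have "... = (LB u. (LB y. g y *\<^sub>R \<rho> (u - y) *\<^sub>R K (x - u)))"
  by (rule lborel_pair.Fubini_integral[OF int, symmetric])
 also have "... = (LB u. (LB y. \<rho> (u - y) *\<^sub>R g y) *\<^sub>R K (x - u))"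
 proof (intro Bochner_Integration.integral_cong refl)
  fix u
  have "(LB y. g y *\<^sub>R \<rho> (u - y) *\<^sub>R K (x - u)) = (LB y. (\<rho> (u - y) *\<^sub>R g y) *\<^sub>R K (x - u))"
   by (simp add: mult.commute)
  also have "... = (LB y. \<rho> (u - y) *\<^sub>R g y) *\<^sub>R K (x - u)"
   using mollify_test_integrand[OF gg(1) b(1)] by (intro integral_scaleR_left) simp
  finally show "(LB y. g y *\<^sub>R \<rho> (u - y) *\<^sub>R K (x - u)) = (LB y. \<rho> (u - y) *\<^sub>R g y) *\<^sub>R K (x - u)" .
 qed
 finally show ?thesis by (simp add: conv_def mollify_def)
qed

text \<open>Associativity is now used the other way: mollifying the Lipschitz kernel at scale
  \<open>\<delta>\<close> moves it by at most \<open>L * \<delta>\<close> everywhere, and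
  \<open>g\<close> has mass at most \<open>M\<close>.\<close>

lemma conv_bounded_mollify_diff:
 fixes K :: "'a::euclidean_space => 'a"
 assumes K: "K \<in> bmb" "!!x. norm (K x) <= B" "!!x y. norm (K x - K y) <= L * norm (x - y)"
  and \<rho>: "bump \<delta> \<rho>" and g: "bounded_L1 M g"
 shows "norm (conv K (mollify \<rho> g) x - conv K g x) <= L * \<delta> * M"
proof -
 note [measurable] = K(1)
 note b = bumpD[OF \<rho>] and k = split_kernel_bounded[OF K] and gg = bounded_L1D[OF g]
 note [measurable] = b(5) gg(4)
 have L: "L \<ge> 0" using split_kernelD(11)[OF k] .
 obtain N where N: "bounded_L1 N \<rho>" using bounded_L1_bump[OF \<rho>] by blast
 have close: "norm (conv K \<rho> z - K z) <= L * \<delta>" for z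
 proof -
  have "conv K \<rho> z - K z = (LB w. \<rho> w *\<^sub>R K (z - w)) - (LB w. \<rho> w *\<^sub>R K z)"
   using b by (simp add: conv_def)
  also have "... = (LB w. \<rho> w *\<^sub>R (K (z - w) - K z))"
   unfolding scaleR_diff_right using conv_integrand(1)[OF k N] b
   by (intro Bochner_Integration.integral_diff[symmetric]) auto
  also have "norm ... <= (LB w. norm (\<rho> w *\<^sub>R (K (z - w) - K z)))"
   by (rule integral_norm_bound)
  also have "... <= (LB w. \<rho> w * (L * \<delta>))"
  proof (rule integral_mono)
   show "ilb (%w. norm (\<rho> w *\<^sub>R (K (z - w) - K z)))"
    unfolding scaleR_diff_right using conv_integrand(1)[OF k N] b
    by (intro integrable_norm Bochner_Integration.integrable_diff) auto
   show "norm (\<rho> w *\<^sub>R (K (z - w) - K z)) <= \<rho> w * (L * \<delta>)" for w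
   proof (cases "\<rho> w = 0")
    case False
    have "norm (K (z - w) - K z) <= L * norm w" using K(3)[of "z - w" z] by simp
    also have "... <= L * \<delta>" using b(4)[OF False] L by (rule mult_left_mono)
    finally show ?thesis using b(2)[of w] by (simp add: mult_left_mono)
   qed simp
  qed (use b in auto)
  also have "... = L * \<delta>" using b by simp
  finally show ?thesis .
 qed
 have bd: "norm (conv K \<rho> z) <= N * 0 + B * N" for z by (rule conv_norm_le[OF k N])
 have i1: "ilb (%y. g y *\<^sub>R conv K \<rho> (x - y))"
 proof (rule Bochner_Integration.integrable_bound)
  show "ilb (%y. \<bar>g y\<bar> * (N * 0 + B * N))" using gg by auto
  show "AE y in lborel. norm (g y *\<^sub>R conv K \<rho> (x - y)) <= norm (\<bar>g y\<bar> * (N * 0 + B * N))"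
  proof (rule AE_I2)
   fix y
   have "norm (g y *\<^sub>R conv K \<rho> (x - y)) <= \<bar>g y\<bar> * (N * 0 + B * N)"
    using bd by (auto intro!: mult_left_mono)
   then show "norm (g y *\<^sub>R conv K \<rho> (x - y)) <= norm (\<bar>g y\<bar> * (N * 0 + B * N))"
    unfolding real_norm_def by (rule order_trans[OF _ abs_ge_self])
  qed
  have [measurable]: "conv K \<rho> \<in> bmb" by (rule conv_measurable) measurable
  show "(%y. g y *\<^sub>R conv K \<rho> (x - y)) \<in> borel_measurable lborel" by measurable
 qed
 have "conv K (mollify \<rho> g) x - conv K g x = (LB y. g y *\<^sub>R (conv K \<rho> (x - y) - K (x - y)))"
  unfolding conv_conv[OF k \<rho> g, symmetric] conv_def[of _ g] scaleR_diff_right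
  using i1 conv_integrand(1)[OF k g] by (intro Bochner_Integration.integral_diff[symmetric]) auto
 also have "norm ... <= (LB y. norm (g y *\<^sub>R (conv K \<rho> (x - y) - K (x - y))))"
  by (rule integral_norm_bound)
 also have "... <= (LB y. \<bar>g y\<bar> * (L * \<delta>))"
 proof (rule integral_mono)
  show "ilb (%y. norm (g y *\<^sub>R (conv K \<rho> (x - y) - K (x - y))))"
   unfolding scaleR_diff_right using i1 conv_integrand(1)[OF k g]
   by (intro integrable_norm Bochner_Integration.integrable_diff) auto
 qed (use gg close in \<open>auto intro!: mult_left_mono\<close>)
 also have "... = (LB y. \<bar>g y\<bar>) * (L * \<delta>)" by simp
 also have "... <= M * (L * \<delta>)"
  using gg L close[of 0] norm_ge_zero[of "conv K \<rho> 0 - K 0"] by (intro mult_right_mono) linarith+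
 finally show ?thesis by (simp add: mult_ac)
qed

text \<open>Young's inequality with an \<open>L^1\<close> kernel. Cauchy-Schwarz with weight
  \<open>norm (K (x - y))\<close> gives one factor \<open>A\<close>, and Tonelli gives the
  other.\<close>

lemma conv_L2_le:
 fixes K :: "'a::euclidean_space => 'a"
 assumes K: "ilb K" "(LB x. norm (K x)) <= A" and [measurable]: "g \<in> bmb"
 shows "(NN x. ennreal ((norm (conv K g x))^2)) <= ennreal (A^2) * (NN x. ennreal ((g x)^2))"
proof -
 have [measurable]: "K \<in> bmb" using K by auto
 have A: "A \<ge> 0" using K(2) by (rule order_trans[rotated]) simp
 have KA: "(NN x. ennreal (norm (K x))) <= ennreal A"
  using K by (subst nn_integral_eq_integral) (auto intro: ennreal_leI)
 have pt: "ennreal ((norm (conv K g x))^2) <= ennreal A * (NN y. ennreal (norm (K (x - y)) * (g y)^2))" for x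
 proof -
  have "ennreal ((norm (conv K g x))^2) = (ennreal (norm (conv K g x)))^2"
   by (simp add: ennreal_power)
  also have "... <= (NN y. ennreal (norm (K (x - y)) * \<bar>g y\<bar>))^2"
   unfolding conv_def by (intro power_mono order_trans[OF ennreal_norm_integral_le]) (auto simp: mult.commute)
  also have "... <= (NN y. ennreal (norm (K (x - y)))) * (NN y. ennreal (norm (K (x - y)) * (\<bar>g y\<bar>)^2))"
   by (intro Cauchy_Schwarz_weighted) auto
  also have "(NN y. ennreal (norm (K (x - y)))) = (NN y. ennreal (norm (K y)))"
   by (rule nn_integral_reflect) measurable
  also have "... * (NN y. ennreal (norm (K (x - y)) * (\<bar>g y\<bar>)^2)) <= ennreal A * (NN y. ennreal (norm (K (x - y)) * (g y)^2))"
   using KA by (intro mult_mono) auto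
  finally show ?thesis .
 qed
 have "(NN x. ennreal ((norm (conv K g x))^2))
   <= (NN x. ennreal A * (NN y. ennreal (norm (K (x - y)) * (g y)^2)))"
  using pt by (rule nn_integral_mono)
 also have "... = ennreal A * (NN x. (NN y. ennreal (norm (K (x - y)) * (g y)^2)))"
  by (rule nn_integral_cmult) measurable
 also have "(NN x. (NN y. ennreal (norm (K (x - y)) * (g y)^2)))
  = (NN y. (NN x. ennreal (norm (K (x - y)) * (g y)^2)))"
  by (rule lborel_pair.Fubini') measurable
 also have "... = (NN y. (NN x. ennreal (norm (K (x + (- y))))) * ennreal ((g y)^2))"
  by (intro nn_integral_cong, subst nn_integral_multc[symmetric]) (auto simp: ennreal_mult)
 also have "... = (NN x. ennreal (norm (K x))) * (NN y. ennreal ((g y)^2))"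
  by (subst nn_integral_translate) (auto simp: nn_integral_cmult)
 also have "ennreal A * ... <= ennreal A * (ennreal A * (NN y. ennreal ((g y)^2)))"
  using KA by (intro mult_left_mono mult_right_mono) auto
 also have "... = ennreal (A^2) * (NN y. ennreal ((g y)^2))"
  using A by (simp add: power2_eq_square ennreal_mult mult.assoc)
 finally show ?thesis .
qed

text \<open>The integrable part is first made smaller than the target, and then the distance is
  chosen in terms of the resulting Lipschitz constant.\<close>

lemma conv_uniform_modulus:
 fixes K :: "'a::euclidean_space => 'a"
 assumes K: "singular_kernel K" and "M \<ge> 0" "e > 0"
 shows "\<exists>d>0. \<forall>g x x'. bounded_L1 M g --> norm (x - x') <= d --> norm (conv K g x - conv K g x') <= e"
proof -
 \<comment> \<open>Half of \<open>e\<close> goes to each part of the kernel. The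
   \<open>M + 1\<close> avoids a division by 0 when \<open>M\<close> vanishes.\<close>
 define A where "A = e / (4 * (M + 1))"
 have A: "A > 0" "2 * M * A <= e / 2" using assms by (auto simp: A_def field_simps)
 obtain B L K1 K2 where k: "split_kernel A B L K K1 K2"
  using K A(1) unfolding singular_kernel_def by blast
 have L: "L \<ge> 0" by (rule split_kernelD(11)[OF k])
 define d where "d = e / (2 * (M * L + 1))"
 have aux: "P * (e / (2 * (P + 1))) <= e / 2 \<and> 0 < e / (2 * (P + 1))" if "P \<ge> 0" for P
 proof -
  have "P * (e / (2 * (P + 1))) = (P / (P + 1)) * (e / 2)" by simp
  also have "... <= 1 * (e / 2)" using \<open>e > 0\<close> that by (intro mult_right_mono) auto
  finally show ?thesis using \<open>e > 0\<close> that by simp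
 qed
 have d: "d > 0" "M * L * d <= e / 2"
  using aux[OF mult_nonneg_nonneg[OF \<open>M \<ge> 0\<close> L]] by (auto simp: d_def)
 show ?thesis
 proof (intro exI[of _ d] conjI allI impI d(1))
  fix g :: "'a => real" and x x' :: 'a assume g: "bounded_L1 M g" and x: "norm (x - x') <= d"
  have "norm (conv K g x - conv K g x') <= 2 * M * A + M * L * norm (x - x')"
   by (rule conv_modulus[OF k g])
  also have "... <= e / 2 + M * L * d"
   using A x L \<open>M \<ge> 0\<close> by (intro add_mono mult_left_mono) auto
  finally show "norm (conv K g x - conv K g x') <= e" using d by simp
 qed
qed

section \<open>The gradient of the potential as a singular kernel, with value 0 at the
  origin\<close>

definition riesz :: "real => 'a::euclidean_space => 'a" where
 "riesz s x = (- s * norm x powr (- s - 2)) *\<^sub>R x"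

lemma powr_nonpos_mono:
 fixes a b q :: real
 assumes "0 < a" "a <= b" "q \<ge> 0"
 shows "b powr (- q) <= a powr (- q)"
 using powr_mono2'[of "- q" a b] assms by simp

lemma ennreal_le_suminf: "F k <= (\<Sum>k. F k)" for F :: "nat => ennreal"
proof -
 have "sum F {k} <= suminf F" by (rule sum_le_suminf) auto
 then show ?thesis by simp
qed

text \<open>On each dyadic shell the function is comparable to a constant on the enclosing ball. The
  values and volumes combine to a geometric series with ratio
  \<open>\<theta> = 2 powr (p - d)\<close>, where \<open>d\<close> is the dimension, which is below
  1 as \<open>p < d\<close>.\<close>

lemma nn_integral_powr_norm_ball_finite:
 assumes p: "0 < p" "p < real DIM('a::euclidean_space)"
 shows "(NN (x::'a). ennreal (norm x powr (- p)) * indicator (ball 0 1) x) < \<infinity>"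
proof -
 define V where "V = unit_ball_vol (real DIM('a))"
 have V: "V \<ge> 0" by (simp add: V_def)
 define \<theta> where "\<theta> = 2 powr (p - real DIM('a))"
 have \<theta>: "0 <= \<theta>" "\<theta> < 1" using p by (auto simp: \<theta>_def powr_less_one)
 have pt: "ennreal (norm x powr (- p)) * indicator (ball 0 1) x
   <= (\<Sum>k. ennreal (2 powr (p * (real k + 1))) * indicator (ball 0 ((1/2) ^ k)) x)" for x :: 'a
 proof (cases "x ~= 0 \<and> norm x < 1")
  case True
  have "\<exists>n. (1/2::real) ^ n < norm x"
   by (rule real_arch_pow_inv) (use True in auto)
  then have ex: "\<exists>n. (1/2::real) ^ n <= norm x" by (blast intro: less_imp_le)
  \<comment> \<open>The first dyadic radius not exceeding \<open>norm x\<close>. Its predecessor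
    exceeds \<open>norm x\<close>, so \<open>x\<close> lies in the ball with index
    \<open>k = n - 1\<close>; this is where the exponent \<open>real k + 1\<close> comes
    from.\<close>
  define n where "n = (LEAST n. (1/2::real) ^ n <= norm x)"
  have n: "(1/2) ^ n <= norm x" unfolding n_def by (rule LeastI_ex[OF ex])
  have "n ~= 0"
  proof
   assume "n = 0"
   then show False using n True by simp
  qed
  then obtain k where k: "n = Suc k" using not0_implies_Suc by blast
  have "\<not> (1/2) ^ k <= norm x"
   using not_less_Least[of k "%n. (1/2::real) ^ n <= norm x"] k by (simp add: n_def)
  then have inb: "x \<in> ball 0 ((1/2) ^ k)" by simp
  have e1: "(1/2::real) ^ n = 2 powr (- real n)"
   by (simp add: powr_minus powr_realpow power_one_over inverse_eq_divide)
  have e2: "- real n * - p = p * (real k + 1)" using k by (simp add: algebra_simps)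
  have "norm x powr (- p) <= ((1/2) ^ n) powr (- p)"
   using n p by (intro powr_nonpos_mono) auto
  then have le: "norm x powr (- p) <= 2 powr (p * (real k + 1))"
   by (simp only: e1 e2 powr_powr)
  have "ennreal (norm x powr (- p)) * indicator (ball 0 1) x = ennreal (norm x powr (- p))"
   using True by simp
  moreover have "ennreal (2 powr (p * (real k + 1))) * indicator (ball 0 ((1/2) ^ k)) x = ennreal (2 powr (p * (real k + 1)))"
   using inb by (simp only: indicator_simps mult_1_right)
  ultimately have "ennreal (norm x powr (- p)) * indicator (ball 0 1) x <= ennreal (2 powr (p * (real k + 1))) * indicator (ball 0 ((1/2) ^ k)) x"
   using ennreal_leI[OF le] by (simp only:)
  then show ?thesis
   by (rule order_trans[OF _ ennreal_le_suminf[of "%k. ennreal (2 powr (p * (real k + 1))) * indicator (ball 0 ((1/2) ^ k)) x" k]])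
 next
  case False
  then have "ennreal (norm x powr (- p)) * indicator (ball 0 1) x = 0" using p by auto
  then show ?thesis by (simp only: zero_le)
 qed
 define F where "F k x = ennreal (2 powr (p * (real k + 1))) * indicator (ball 0 ((1/2) ^ k)) x" for k and x :: 'a
 have Fm: "F k \<in> borel_measurable lborel" for k
  unfolding F_def[abs_def] by (intro borel_measurable_times_ennreal borel_measurable_const borel_measurable_indicator) auto
 have F: "(NN x. F k x) = ennreal (V * 2 powr p * \<theta> ^ k)" for k
 proof -
  have "(NN x. F k x)
   = ennreal (2 powr (p * (real k + 1))) * emeasure lborel (ball (0::'a) ((1/2) ^ k))"
   unfolding F_def by (rule nn_integral_cmult_indicator) auto
  also have "... = ennreal (2 powr (p * (real k + 1)) * (V * ((1/2) ^ k) ^ DIM('a)))"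
   by (simp add: emeasure_ball V_def ennreal_mult'')
  also have "2 powr (p * (real k + 1)) * (V * ((1/2) ^ k) ^ DIM('a)) = V * 2 powr p * \<theta> ^ k"
  proof -
   have "(1/2::real) ^ k = 2 powr (- real k)"
    by (simp add: powr_minus powr_realpow power_one_over inverse_eq_divide)
   then have 1: "((1/2::real) ^ k) ^ DIM('a) = 2 powr (- real DIM('a) * real k)"
    by (simp add: powr_power mult.commute)
   have 2: "\<theta> ^ k = 2 powr ((p - real DIM('a)) * real k)"
    by (simp add: \<theta>_def powr_power mult.commute)
   have 3: "2 powr (p * (real k + 1)) * 2 powr (- real DIM('a) * real k) = 2 powr p * 2 powr ((p - real DIM('a)) * real k)"
    by (simp add: powr_add[symmetric] algebra_simps)
   show ?thesis
    unfolding 1 2 mult.assoc by (subst mult.left_commute) (simp only: 3)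
  qed
  finally show ?thesis .
 qed
 have "(%k. V * 2 powr p * \<theta> ^ k) sums (V * 2 powr p * (1 / (1 - \<theta>)))"
  using \<theta> by (intro sums_mult geometric_sums) auto
 then have geo: "(\<Sum>k. ennreal (V * 2 powr p * \<theta> ^ k)) = ennreal (V * 2 powr p * (1 / (1 - \<theta>)))"
  by (rule suminf_ennreal_eq[rotated]) (use V \<theta> in auto)
 have "(NN (x::'a). ennreal (norm x powr (- p)) * indicator (ball 0 1) x)
  <= (NN x. (\<Sum>k. F k x))"
  unfolding F_def by (rule nn_integral_mono) (rule pt)
 also have "(NN x. (\<Sum>k. F k x)) = (\<Sum>k. (NN x. F k x))"
  by (rule nn_integral_suminf[OF Fm])
 also have "... = ennreal (V * 2 powr p * (1 / (1 - \<theta>)))"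
  unfolding F by (rule geo)
 also have "... < \<infinity>" by simp
 finally show ?thesis .
qed

lemma nn_integral_powr_norm_ball:
 assumes p: "0 < p" "p < real DIM('a::euclidean_space)" and \<eta>: "\<eta> > 0"
 shows "(NN (x::'a). ennreal (norm x powr (- p)) * indicator (ball 0 \<eta>) x)
  = ennreal (\<eta> powr (real DIM('a) - p)) * (NN (x::'a). ennreal (norm x powr (- p)) * indicator (ball 0 1) x)"
proof -
 have [measurable]: "ball (0::'a) \<eta> \<in> sets borel" "ball (0::'a) 1 \<in> sets borel" by auto
 have "(NN (x::'a). ennreal (norm x powr (- p)) * indicator (ball 0 \<eta>) x)
  = ennreal (\<eta> ^ DIM('a)) * (NN (x::'a). ennreal (norm (\<eta> *\<^sub>R x) powr (- p)) * indicator (ball 0 \<eta>) (\<eta> *\<^sub>R x))"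
  by (rule nn_integral_scale[OF _ \<eta>]) measurable
 also have "(NN (x::'a). ennreal (norm (\<eta> *\<^sub>R x) powr (- p)) * indicator (ball 0 \<eta>) (\<eta> *\<^sub>R x))
  = (NN (x::'a). ennreal (\<eta> powr (- p)) * (ennreal (norm x powr (- p)) * indicator (ball 0 1) x))"
  using \<eta> by (intro nn_integral_cong) (auto simp: powr_mult ennreal_mult' split: split_indicator)
 also have "... = ennreal (\<eta> powr (- p)) * (NN (x::'a). ennreal (norm x powr (- p)) * indicator (ball 0 1) x)"
  by (rule nn_integral_cmult) measurable
 also have "ennreal (\<eta> ^ DIM('a)) * (ennreal (\<eta> powr (- p)) * (NN (x::'a). ennreal (norm x powr (- p)) * indicator (ball 0 1) x))
  = ennreal (\<eta> ^ DIM('a) * \<eta> powr (- p)) * (NN (x::'a). ennreal (norm x powr (- p)) * indicator (ball 0 1) x)"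
  using \<eta> by (simp add: ennreal_mult mult.assoc)
 also have "\<eta> ^ DIM('a) * \<eta> powr (- p) = \<eta> powr (real DIM('a) - p)"
  using \<eta> by (simp add: powr_diff powr_realpow powr_minus divide_inverse)
 finally show ?thesis .
qed

text \<open>The tangent bound for a convex power, obtained from the elementary estimates of
  \<open>ln\<close> and \<open>exp\<close>.\<close>

lemma powr_difference_le:
 fixes u w m :: real
 assumes "0 < u" "u <= w" "m > 0"
 shows "u powr (- m) - w powr (- m) <= m * u powr (- m - 1) * (w - u)"
proof -
 have "ln (w / u) <= w / u - 1" using assms by (intro ln_le_minus_one) auto
 then have "1 - m * (w / u - 1) <= 1 - m * ln (w / u)" using assms by simp
 also have "... <= exp (- m * ln (w / u))" using exp_ge_add_one_self[of "- m * ln (w / u)"] by simp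
 also have "... = (w / u) powr (- m)" using assms by (simp add: powr_def)
 finally have "u powr (- m) * (1 - m * (w / u - 1)) <= u powr (- m) * (w / u) powr (- m)"
  by (intro mult_left_mono) auto
 also have "... = w powr (- m)" using assms by (simp flip: powr_mult)
 finally have "u powr (- m) - w powr (- m) <= u powr (- m) * (m * (w / u - 1))"
  by (simp add: algebra_simps)
 also have "... = m * u powr (- m - 1) * (w - u)"
  using assms by (simp add: powr_diff field_simps)
 finally show ?thesis .
qed

text \<open>Changing the vector at a fixed radius costs \<open>\<eta> powr (- m)\<close>. Changing
  the radial factor costs \<open>m\<close> times as much, because the shorter vector has length at
  most \<open>u\<close> and compensates one power of \<open>u\<close>; hence the constant
  \<open>m + 1\<close>.\<close>

lemma truncated_radial_lipschitz:
 fixes x y :: "'a::real_normed_vector"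
 assumes \<eta>: "\<eta> > 0" and m: "m > 0"
 shows "norm (max (norm x) \<eta> powr (- m) *\<^sub>R x - max (norm y) \<eta> powr (- m) *\<^sub>R y) <= (m + 1) * \<eta> powr (- m) * norm (x - y)"
proof -
 have main: "norm (max (norm x) \<eta> powr (- m) *\<^sub>R x - max (norm y) \<eta> powr (- m) *\<^sub>R y) <= (m + 1) * \<eta> powr (- m) * norm (x - y)"
  if le: "norm y <= norm x" for x y :: 'a
 proof -
  define u where "u = max (norm y) \<eta>"
  define w where "w = max (norm x) \<eta>"
  have uw: "0 < u" "u <= w" "\<eta> <= u" "\<eta> <= w" "norm y <= u" "w - u <= norm (x - y)"
   using le \<eta> norm_triangle_ineq2[of x y] by (auto simp: u_def w_def max_def)
  have "norm (w powr (- m) *\<^sub>R x - u powr (- m) *\<^sub>R y)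
    = norm (w powr (- m) *\<^sub>R (x - y) - (u powr (- m) - w powr (- m)) *\<^sub>R y)"
   by (simp add: algebra_simps)
  also have "... <= w powr (- m) * norm (x - y) + (u powr (- m) - w powr (- m)) * norm y"
   using powr_nonpos_mono[of u w m] uw m by (intro order_trans[OF norm_triangle_ineq4]) simp
  also have "(u powr (- m) - w powr (- m)) * norm y <= (m * u powr (- m - 1) * (w - u)) * u"
   using powr_difference_le[OF uw(1,2) m] uw m powr_nonpos_mono[of u w m] by (intro mult_mono) auto
  also have "... = m * u powr (- m) * (w - u)" using uw by (simp add: powr_diff)
  also have "... <= m * \<eta> powr (- m) * norm (x - y)"
   using uw m \<eta> powr_nonpos_mono[of \<eta> u m] by (intro mult_mono) auto
  also have "w powr (- m) * norm (x - y) <= \<eta> powr (- m) * norm (x - y)"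
   using uw m \<eta> powr_nonpos_mono[of \<eta> w m] by (intro mult_right_mono) auto
  finally show ?thesis by (simp add: u_def w_def algebra_simps)
 qed
 show ?thesis
  using main[of y x] main[of x y] by (cases "norm y <= norm x") (auto simp: norm_minus_commute)
qed

lemma riesz_measurable [measurable]: "riesz s \<in> bmb"
 unfolding riesz_def[abs_def] by measurable

lemma norm_riesz: "s > 0 ==> norm (riesz s x) = s * norm x powr (- (s + 1))"
proof (cases "x = 0")
 case False
 assume "s > 0"
 have "norm x powr (- (s + 1)) = norm x powr (- s - 2 + 1)"
  by (rule arg_cong[where f="%q. norm x powr q"]) simp
 also have "... = norm x powr (- s - 2) * norm x"
  using False by (subst powr_add) simp
 finally show ?thesis using \<open>s > 0\<close> by (simp add: riesz_def abs_mult)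
qed (simp add: riesz_def)

lemma singular_kernel_riesz:
 assumes s: "0 < s" "s + 1 < real DIM('a::euclidean_space)"
 shows "singular_kernel (riesz s :: 'a => 'a)"
 unfolding singular_kernel_def
proof (intro allI impI)
 fix A :: real assume A: "A > 0"
 define p where "p = s + 1"
 have p: "0 < p" "p < real DIM('a)" using s by (auto simp: p_def)
 define I where "I = enn2real (NN (x::'a). ennreal (norm x powr (- p)) * indicator (ball 0 1) x)"
 have I: "(NN (x::'a). ennreal (norm x powr (- p)) * indicator (ball 0 1) x) = ennreal I" "I \<ge> 0"
  using nn_integral_powr_norm_ball_finite[OF p] by (auto simp: I_def)
 define q where "q = real DIM('a) - p"
 have q: "q > 0" using p by (simp add: q_def)
 \<comment> \<open>Solves \<open>s * \<eta> powr q * (I + 1) = A\<close>. The \<open>I + 1\<close>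
   keeps the denominator positive.\<close>
 define \<eta> where "\<eta> = (A / (s * (I + 1))) powr (1 / q)"
 have \<eta>: "\<eta> > 0" using A s I by (auto simp: \<eta>_def)
 have "\<eta> powr q = A / (s * (I + 1))" using q A s I by (simp add: \<eta>_def powr_powr)
 then have \<eta>A: "s * (\<eta> powr q * I) <= A" 
 proof -
  have "s * (\<eta> powr q * I) = A * (I / (I + 1))"
   using s I \<open>\<eta> powr q = _\<close> by simp
  also have "... <= A * 1" using A I by (intro mult_left_mono) auto
  finally show ?thesis by simp
 qed
 define K2 where "K2 x = (- s) *\<^sub>R (max (norm x) \<eta> powr (- (s + 2)) *\<^sub>R x)" for x :: 'a
 define K1 where "K1 x = riesz s x - K2 x" for x :: 'a
 have [measurable]: "ball (0::'a) \<eta> \<in> sets borel" by auto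
 have [measurable]: "K2 \<in> bmb" unfolding K2_def[abs_def] by measurable
 have [measurable]: "K1 \<in> bmb" unfolding K1_def[abs_def] by measurable
 have K1: "norm (K1 x) <= s * norm x powr (- p) * indicator (ball 0 \<eta>) x" for x
 proof (cases "norm x < \<eta> \<and> x ~= 0")
  case True
  then have "\<eta> powr (- (s + 2)) <= norm x powr (- (s + 2))" using s by (intro powr_nonpos_mono) auto
  moreover have "K1 x = (- s * (norm x powr (- (s + 2)) - \<eta> powr (- (s + 2)))) *\<^sub>R x"
   using True by (simp add: K1_def K2_def riesz_def max_def algebra_simps)
  ultimately have "norm (K1 x) = s * ((norm x powr (- (s + 2)) - \<eta> powr (- (s + 2))) * norm x)"
   using s by (simp add: abs_mult)
  also have "... <= s * (norm x powr (- (s + 2)) * norm x)"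
   using s by (intro mult_left_mono mult_right_mono) auto
  also have "... = norm (riesz s x)" using s by (simp add: riesz_def abs_mult)
  finally show ?thesis using True norm_riesz[OF s(1), of x] by (simp add: p_def)
 next
  case False
  then have "K1 x = 0" by (auto simp: K1_def K2_def riesz_def max_def)
  then show ?thesis using s by simp
 qed
 have "(NN x. ennreal (norm (K1 x))) <= (NN (x::'a). ennreal s * (ennreal (norm x powr (- p)) * indicator (ball 0 \<eta>) x))"
  using s by (intro nn_integral_mono order_trans[OF ennreal_leI[OF K1]]) (auto simp: ennreal_mult split: split_indicator)
 also have "... = ennreal s * (NN (x::'a). ennreal (norm x powr (- p)) * indicator (ball 0 \<eta>) x)"
  by (rule nn_integral_cmult) measurable
 also have "... = ennreal s * (ennreal (\<eta> powr q) * ennreal I)"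
  by (simp only: nn_integral_powr_norm_ball[OF p \<eta>] I(1) q_def)
 also have "... <= ennreal A" using s I \<eta>A by (simp flip: ennreal_mult add: ennreal_leI)
 finally have le: "(NN x. ennreal (norm (K1 x))) <= ennreal A" .
 have i: "ilb K1"
  by (rule integrableI_bounded) (use le in \<open>auto intro: order_le_less_trans\<close>)
 have iA: "(LB x. norm (K1 x)) <= A"
  using le i A by (subst (asm) nn_integral_eq_integral) (auto simp: ennreal_le_iff)
 have "norm (K2 x) <= s * \<eta> powr (- (s + 1))" for x
 proof -
  let ?w = "max (norm x) \<eta>"
  have "norm (K2 x) = s * (?w powr (- (s + 2)) * norm x)" using s by (simp add: K2_def)
  also have "... <= s * (?w powr (- (s + 2)) * ?w)" using s by (intro mult_left_mono) auto
  also have "?w powr (- (s + 2)) * ?w = ?w powr (- (s + 2) + 1)" using \<eta> by (subst powr_add) simp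
  also have "- (s + 2) + 1 = - (s + 1)" by simp
  also have "s * ?w powr (- (s + 1)) <= s * \<eta> powr (- (s + 1))"
   using s \<eta> by (intro mult_left_mono powr_nonpos_mono) auto
  finally show ?thesis .
 qed
 moreover have "norm (K2 x - K2 y) <= (s * ((s + 2 + 1) * \<eta> powr (- (s + 2)))) * norm (x - y)" for x y
 proof -
  have "norm (K2 x - K2 y) = s * norm (max (norm x) \<eta> powr (- (s + 2)) *\<^sub>R x - max (norm y) \<eta> powr (- (s + 2)) *\<^sub>R y)"
   unfolding K2_def scaleR_diff_right[symmetric] norm_scaleR using s by simp
  also have "... <= s * ((s + 2 + 1) * \<eta> powr (- (s + 2)) * norm (x - y))"
   using s \<eta> by (intro mult_left_mono truncated_radial_lipschitz) auto
  finally show ?thesis by (simp add: mult_ac)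
 qed
 ultimately have "split_kernel A (s * \<eta> powr (- (s + 1))) (s * ((s + 2 + 1) * \<eta> powr (- (s + 2)))) (riesz s) K1 K2"
  using i iA by (auto simp: split_kernel_def K1_def)
 then show "\<exists>B L K1 K2. split_kernel A B L (riesz s :: 'a => 'a) K1 K2" by blast
qed

lemma gradient_eqI:
 assumes "(f has_derivative (%v. k \<bullet> v)) (at x)"
 shows "gradient f x = k"
 using dir_deriv_eq[OF assms] by (simp add: gradient_def euclidean_representation)

lemma potential_has_derivative:
 assumes "x ~= 0"
 shows "(potential s has_derivative (%v. riesz s x \<bullet> v)) (at x)"
proof -
 have "((%x. norm x powr (- s)) has_derivative (%v. (- s * norm x powr (- s - 1)) * (v \<bullet> sgn x))) (at x)"
 proof -
  have n: "(norm has_derivative (%v. v \<bullet> sgn x)) (at x)"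
   using has_derivative_norm[OF assms] by (simp add: inner_commute)
  have "((%r. r powr (- s)) has_real_derivative - s * norm x powr (- s - 1)) (at (norm x))"
   using assms by (intro has_real_derivative_powr) auto
  from has_derivative_compose[OF n this[unfolded has_field_derivative_def]]
  show ?thesis .
 qed
 moreover have "(- s * norm x powr (- s - 1)) * (v \<bullet> sgn x) = riesz s x \<bullet> v" for v
 proof -
  have e: "- s - 2 = - s - 1 - 1" by simp
  have "norm x powr (- s - 2) = norm x powr (- s - 1) / norm x"
   unfolding e using assms by (subst powr_diff) simp_all
  then show ?thesis by (simp add: riesz_def sgn_div_norm inner_commute divide_inverse)
 qed
 ultimately show ?thesis by (simp add: potential_def[abs_def])
qed

text \<open>At the origin the Frechet derivative is unspecified, so the gradient has some unknown
  value \<open>c\<close> there. Only the null set \<open>y = x\<close> sees it.\<close>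

lemma conv_gradient_interaction:
 assumes [measurable]: "g \<in> bmb"
 shows "conv (gradient (interaction a s \<alpha> \<beta>)) g x = a \<alpha> \<beta> *\<^sub>R conv (riesz s) g x"
proof -
 define c where "c = gradient (interaction a s \<alpha> \<beta>) (0::'a)"
 have eq: "gradient (interaction a s \<alpha> \<beta>) = (%x::'a. if x = 0 then c else a \<alpha> \<beta> *\<^sub>R riesz s x)"
 proof
  fix x :: 'a
  show "gradient (interaction a s \<alpha> \<beta>) x = (if x = 0 then c else a \<alpha> \<beta> *\<^sub>R riesz s x)"
  proof (cases "x = 0")
   case False
   have "(interaction a s \<alpha> \<beta> has_derivative (%v. (a \<alpha> \<beta> *\<^sub>R riesz s x) \<bullet> v)) (at x)"
    unfolding interaction_def[abs_def]
    using has_derivative_mult_right[OF potential_has_derivative[OF False]] by simp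
   then show ?thesis using False by (simp add: gradient_eqI)
  qed (simp add: c_def)
 qed
 have [measurable]: "gradient (interaction a s \<alpha> \<beta>) \<in> borel_measurable (borel :: 'a measure)"
  unfolding eq by measurable
 have "AE y in lborel. y ~= x" by (rule AE_lborel_singleton)
 then have "conv (gradient (interaction a s \<alpha> \<beta>)) g x = (LB y. a \<alpha> \<beta> *\<^sub>R g y *\<^sub>R riesz s (x - y))"
  unfolding conv_def by (intro integral_cong_AE) (auto simp: eq)
 also have "... = a \<alpha> \<beta> *\<^sub>R conv (riesz s) g x"
  unfolding conv_def by (rule integral_scaleR_right)
 finally show ?thesis .
qed

text \<open>The segment lies in the span of \<open>x\<close> and \<open>h\<close>, a subspace of
  dimension at most 2, which is null in dimension at least 3.\<close>

lemma AE_not_in_segment: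
 fixes x h :: "'a::euclidean_space"
 assumes "DIM('a) \<ge> 3"
 shows "AE y in lborel. \<forall>t\<in>{0..1::real}. x + t *\<^sub>R h - y ~= 0"
proof -
 have "dim (span {x, h}) <= card {x, h}" by (simp add: dim_le_card')
 also have "card {x, h} <= 2" by (cases "x = h") auto
 also have "2 < DIM('a)" using assms by simp
 finally have "negligible (span {x, h})" by (rule negligible_lowdim)
 then have "AE y in lebesgue. y \<notin> span {x, h}"
  using AE_not_in by (simp add: negligible_iff_null_sets)
 then have "AE y in lborel. y \<notin> span {x, h}" by (simp only: AE_completion_iff)
 then show ?thesis
 proof eventually_elim
  case (elim y)
  have sp: "x + t *\<^sub>R h \<in> span {x, h}" for t
   by (intro span_add span_scale span_base) auto
  show ?case
  proof (intro ballI notI)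
   fix t :: real assume "x + t *\<^sub>R h - y = 0"
   then have "y = x + t *\<^sub>R h" by simp
   then show False using elim sp by blast
  qed
 qed
qed

lemma riesz_continuous_on: "continuous_on (- {0}) (riesz s :: 'a::euclidean_space => 'a)"
 unfolding riesz_def[abs_def] by (intro continuous_intros) auto

text \<open>The singularity prevents differentiation at fixed \<open>y\<close> throughout. For
  almost every \<open>y\<close>, however, the segment from \<open>x\<close> to \<open>x + h\<close>
  misses the singularity, the fundamental theorem applies along it, and Fubini expresses the
  increment by the averaged gradient. The uniform modulus of that gradient yields
  differentiability.\<close>

lemma conv_potential_has_derivative:
 fixes \<rho> :: "'a::euclidean_space => real"
 assumes dim: "DIM('a) \<ge> 3" and s: "0 < s" "s <= real DIM('a) - 2" and \<rho>: "bump \<delta> \<rho>"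
 shows "(conv (potential s) \<rho> has_derivative (%v. conv (riesz s) \<rho> x \<bullet> v)) (at x)"
proof -
 have K: "singular_kernel (riesz s :: 'a => 'a)"
  using s by (intro singular_kernel_riesz) auto
 obtain B L K1 K2 where k: "split_kernel 1 B L (riesz s :: 'a => 'a) K1 K2"
  using K[unfolded singular_kernel_def, rule_format, of 1] by auto
 obtain N where N: "bounded_L1 N \<rho>" using bounded_L1_bump[OF \<rho>] by blast
 note b = bumpD[OF \<rho>] and n = bounded_L1D[OF N]
 have [measurable]: "\<rho> \<in> bmb" by fact
 have [measurable]: "(potential s :: 'a => real) \<in> bmb"
  unfolding potential_def[abs_def] by measurable
 define k' where "k' x = conv (riesz s) \<rho> x" for x
 define C where "C = N * 1 + B * N"
 have kb: "norm (k' x) <= C" for x unfolding k'_def C_def by (rule conv_norm_le[OF k N])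
 have [measurable]: "k' \<in> bmb"
  unfolding k'_def[abs_def] by (rule conv_measurable) measurable
 \<comment> \<open>Near the origin the potential is dominated by its gradient, elsewhere by 1; thus
   integrability of the potential is inherited from the gradient.\<close>
 have pot: "potential s z <= 1 + norm (riesz s z) / s" for z :: 'a
 proof (cases "z = 0 \<or> norm z \<ge> 1")
  case True
  then have "potential s z <= 1"
   using powr_nonpos_mono[of 1 "norm z" s] s by (auto simp: potential_def)
  then show ?thesis using s by (simp add: add_increasing2)
 next
  case False
  then have "norm z powr (- s) <= norm z powr (- (s + 1))"
   by (intro powr_mono') auto
  then show ?thesis using s norm_riesz[OF s(1), of z] by (simp add: potential_def add_increasing)
 qed
 have potn: "0 <= potential s z" for z :: 'a by (simp add: potential_def)
 have Vi: "ilb (%y. \<rho> y *\<^sub>R potential s (x - y))" for x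
 proof (rule Bochner_Integration.integrable_bound)
  show "ilb (%y. \<rho> y + norm (\<rho> y *\<^sub>R riesz s (x - y)) / s)"
   using b conv_integrand(1)[OF k N, of x] by (intro Bochner_Integration.integrable_add integrable_divide_zero integrable_norm) auto
  show "AE y in lborel. norm (\<rho> y *\<^sub>R potential s (x - y)) <= norm (\<rho> y + norm (\<rho> y *\<^sub>R riesz s (x - y)) / s)"
  proof (rule AE_I2)
   fix y
   have "\<rho> y * potential s (x - y) <= \<rho> y * (1 + norm (riesz s (x - y)) / s)"
    using pot b(2)[of y] by (intro mult_left_mono)
   also have "... = \<rho> y + norm (\<rho> y *\<^sub>R riesz s (x - y)) / s" using b(2)[of y] by (simp add: algebra_simps)
   finally show "norm (\<rho> y *\<^sub>R potential s (x - y)) <= norm (\<rho> y + norm (\<rho> y *\<^sub>R riesz s (x - y)) / s)"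
    using b(2)[of y] potn[of "x - y"] by (simp add: abs_mult)
  qed
 qed measurable
 have diff: "conv (potential s) \<rho> (x + h) - conv (potential s) \<rho> x = (LB t. indicator {0..1} t *\<^sub>R (k' (x + t *\<^sub>R h) \<bullet> h))" for x h
 proof -
  have ftc: "potential s (x + h - y) - potential s (x - y) = (LB t. indicator {0..1} t *\<^sub>R (riesz s (x + t *\<^sub>R h - y) \<bullet> h))"
   if y: "\<forall>t\<in>{0..1::real}. x + t *\<^sub>R h - y ~= 0" for y
  proof -
   have "((%t. potential s (x + t *\<^sub>R h - y)) has_vector_derivative riesz s (x + t *\<^sub>R h - y) \<bullet> h) (at t within {0..1})"
    if t: "0 <= t" "t <= 1" for t
   proof -
    have "((%t. x + t *\<^sub>R h - y) has_derivative (%u. u *\<^sub>R h)) (at t within {0..1})"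
     by (auto intro!: derivative_eq_intros)
    from has_derivative_compose[OF this potential_has_derivative] y t
    have "((%t. potential s (x + t *\<^sub>R h - y)) has_derivative (%u. riesz s (x + t *\<^sub>R h - y) \<bullet> (u *\<^sub>R h))) (at t within {0..1})"
     by auto
    then show ?thesis by (simp add: has_vector_derivative_def)
   qed
   moreover have "continuous_on {0..1} (%t. riesz s (x + t *\<^sub>R h - y) \<bullet> h)"
    using y by (intro continuous_intros continuous_on_compose2[OF riesz_continuous_on]) auto
   ultimately show ?thesis
    using integral_FTC_Icc[of 0 1 "%t. potential s (x + t *\<^sub>R h - y)" "%t. riesz s (x + t *\<^sub>R h - y) \<bullet> h"] by simp
  qed
  have [measurable]: "(%p. riesz s (x + fst p *\<^sub>R h - snd p)) \<in> borel_measurable (lborel \<Otimes>\<^sub>M lborel)"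
   by (rule measurable_compose[of _ _ borel "riesz s"]) measurable
  have gi: "ilb (%y. \<rho> y *\<^sub>R riesz s (x + t *\<^sub>R h - y))" for t by (rule conv_integrand(1)[OF k N])
  have gi': "ilb (%y. (\<rho> y *\<^sub>R riesz s (x + t *\<^sub>R h - y)) \<bullet> h)" for t
   using gi by (rule integrable_inner_left)
  have bnd: "(LB y. \<bar>(\<rho> y *\<^sub>R riesz s (x + t *\<^sub>R h - y)) \<bullet> h\<bar>) <= C * norm h" for t
  proof -
   have "(LB y. \<bar>(\<rho> y *\<^sub>R riesz s (x + t *\<^sub>R h - y)) \<bullet> h\<bar>) <= (LB y. norm (\<rho> y *\<^sub>R riesz s (x + t *\<^sub>R h - y)) * norm h)"
    using gi[of t] gi'[of t] by (intro integral_mono integrable_abs integrable_mult_left integrable_norm Cauchy_Schwarz_ineq2)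
   also have "... = (LB y. \<bar>\<rho> y\<bar> * norm (riesz s (x + t *\<^sub>R h - y))) * norm h" by simp
   also have "... <= C * norm h" unfolding C_def
    by (intro mult_right_mono conv_integrand(2)[OF k N]) auto
   finally show ?thesis .
  qed
  define q where "q t y = indicator {0..1} t *\<^sub>R ((\<rho> y *\<^sub>R riesz s (x + t *\<^sub>R h - y)) \<bullet> h)" for t :: real and y
  have qm: "(%(t,y). q t y) \<in> borel_measurable (lborel \<Otimes>\<^sub>M lborel)"
   unfolding q_def case_prod_beta' by measurable
  have int: "integrable (lborel \<Otimes>\<^sub>M lborel) (%(t,y). q t y)"
  proof (rule lborel_pair.Fubini_integrable[OF qm])
   show "ilb (%t. LB y. norm (case (t, y) of (t, y) => q t y))"
   proof (rule Bochner_Integration.integrable_bound)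
    show "ilb (%t::real. indicator {0..1} t *\<^sub>R (C * norm h))"
     by (intro borel_integrable_compact) auto
    show "(%t. LB y. norm (case (t, y) of (t, y) => q t y)) \<in> borel_measurable lborel"
     by (rule lborel.borel_measurable_lebesgue_integral) (use qm in \<open>simp add: case_prod_beta'\<close>)
    show "AE t in lborel. norm (LB y. norm (case (t, y) of (t, y) => q t y)) <= norm (indicator {0..1} t *\<^sub>R (C * norm h))"
     using order_trans[OF bnd abs_ge_self] by (intro AE_I2) (auto simp: q_def abs_mult split: split_indicator)
   qed
   show "AE t in lborel. ilb (%y. case (t, y) of (t, y) => q t y)"
    using gi' unfolding q_def by (intro AE_I2) (simp del: inner_scaleR_left)
  qed
  have "conv (potential s) \<rho> (x + h) - conv (potential s) \<rho> x = (LB y. \<rho> y * (potential s (x + h - y) - potential s (x - y)))"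
   unfolding conv_def using Vi by (subst Bochner_Integration.integral_diff[symmetric]) (auto simp: right_diff_distrib)
  also have "... = (LB y. (LB t. q t y))"
  proof (rule integral_cong_AE)
   show "AE y in lborel. \<rho> y * (potential s (x + h - y) - potential s (x - y)) = (LB t. q t y)"
    using AE_not_in_segment[OF dim, of x h]
   proof eventually_elim
    case (elim y)
    have "(LB t. q t y) = (LB t. \<rho> y * (indicator {0..1} t *\<^sub>R (riesz s (x + t *\<^sub>R h - y) \<bullet> h)))"
     by (simp add: q_def mult.left_commute)
    then show ?case unfolding ftc[OF elim] by simp
   qed
   have [measurable]: "(%p. q (snd p) (fst p)) \<in> borel_measurable (lborel \<Otimes>\<^sub>M lborel)"
    unfolding q_def by measurable
   show "(%y. LB t. q t y) \<in> borel_measurable lborel"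
    using lborel.borel_measurable_lebesgue_integral[of "%y t. q t y" lborel] by (simp add: case_prod_beta')
  qed measurable
  also have "... = (LB t. (LB y. q t y))"
   by (rule lborel_pair.Fubini_integral[OF int])
  also have "... = (LB t. indicator {0..1} t *\<^sub>R (k' (x + t *\<^sub>R h) \<bullet> h))"
  proof (intro Bochner_Integration.integral_cong refl)
   fix t
   show "(LB y. q t y) = indicator {0..1} t *\<^sub>R (k' (x + t *\<^sub>R h) \<bullet> h)"
    unfolding q_def k'_def conv_def using integral_inner_left[OF gi[of t], of h] by (simp del: inner_scaleR_left)
  qed
  finally show ?thesis .
 qed
 show ?thesis
  unfolding has_derivative_at_alt
 proof (intro conjI allI impI)
  show "bounded_linear (%v. conv (riesz s) \<rho> x \<bullet> v)" by (rule bounded_linear_inner_right)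
  fix e :: real assume "e > 0"
  from conv_uniform_modulus[OF K n(5) \<open>e > 0\<close>]
  obtain d where d: "d > 0" "\<forall>(g :: 'a => real) y y'. bounded_L1 N g --> norm (y - y') <= d --> norm (conv (riesz s) g y - conv (riesz s) g y') <= e"
   by (elim exE conjE) (rule that)
  show "\<exists>d>0. \<forall>y. norm (y - x) < d --> norm (conv (potential s) \<rho> y - conv (potential s) \<rho> x - conv (riesz s) \<rho> x \<bullet> (y - x)) <= e * norm (y - x)"
  proof (intro exI[of _ d] conjI allI impI d(1))
   fix y assume y: "norm (y - x) < d"
   define h where "h = y - x"
   have mk: "(%t. k' (x + t *\<^sub>R h) \<bullet> h) \<in> bmb" by measurable
   have kh: "norm (k' (x + t *\<^sub>R h) \<bullet> h) <= C * norm h" for t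
    unfolding real_norm_def by (rule order_trans[OF Cauchy_Schwarz_ineq2]) (intro mult_right_mono kb norm_ge_zero)
   have "conv (potential s) \<rho> y - conv (potential s) \<rho> x - k' x \<bullet> h
    = (LB t. indicator {0..1} t *\<^sub>R (k' (x + t *\<^sub>R h) \<bullet> h)) - (LB t. indicator {0..1::real} t *\<^sub>R (k' x \<bullet> h))"
    using diff[of x h] by (simp add: h_def)
   also have "... = (LB t. indicator {0..1} t *\<^sub>R ((k' (x + t *\<^sub>R h) - k' x) \<bullet> h))"
    unfolding inner_diff_left scaleR_diff_right
    by (rule Bochner_Integration.integral_diff[symmetric])
     (rule integrable_Icc_bounded[OF mk kh], rule borel_integrable_compact, auto)
   also have "norm ... <= (1 - 0) * (e * norm h)"
   proof (rule norm_integral_Icc_le)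
    fix t :: real assume t: "t \<in> {0..1}"
    have "norm (t *\<^sub>R h) <= 1 * norm h" unfolding norm_scaleR using t by (intro mult_right_mono) auto
    also have "... <= d" using y by (simp add: h_def)
    finally have "norm (k' (x + t *\<^sub>R h) - k' x) <= e"
     unfolding k'_def by (intro d(2)[rule_format, OF N]) simp
    then show "norm ((k' (x + t *\<^sub>R h) - k' x) \<bullet> h) <= e * norm h"
     unfolding real_norm_def by (intro order_trans[OF Cauchy_Schwarz_ineq2] mult_right_mono) auto
   qed (use \<open>e > 0\<close> in auto)
   finally show "norm (conv (potential s) \<rho> y - conv (potential s) \<rho> x - conv (riesz s) \<rho> x \<bullet> (y - x)) <= e * norm (y - x)"
    by (simp add: h_def k'_def)
  qed
 qed
qed

text \<open>The intermediate drift is the singular kernel acting on the mollified density, so both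
  systems share one kernel and the regularisation sits in the density.\<close>

lemma conv_gradient_interaction_eps:
 fixes chi :: "'a::euclidean_space => real"
 assumes dim: "DIM('a) \<ge> 3" and s: "0 < s" "s <= real DIM('a) - 2" and \<rho>: "bump \<epsilon> (mollifier chi \<epsilon>)"
  and g: "bounded_L1 M g"
 shows "conv (gradient (interaction_eps a s chi \<epsilon> \<alpha> \<beta>)) g x = a \<alpha> \<beta> *\<^sub>R conv (riesz s) (mollify (mollifier chi \<epsilon>) g) x"
proof -
 have K: "singular_kernel (riesz s :: 'a => 'a)"
  using s by (intro singular_kernel_riesz) auto
 obtain B L K1 K2 where k: "split_kernel 1 B L (riesz s :: 'a => 'a) K1 K2"
  using K[unfolded singular_kernel_def, rule_format, of 1] by auto
 have "gradient (interaction_eps a s chi \<epsilon> \<alpha> \<beta>) x = a \<alpha> \<beta> *\<^sub>R conv (riesz s) (mollifier chi \<epsilon>) x" for x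
 proof (rule gradient_eqI)
  show "(interaction_eps a s chi \<epsilon> \<alpha> \<beta> has_derivative (%v. (a \<alpha> \<beta> *\<^sub>R conv (riesz s) (mollifier chi \<epsilon>) x) \<bullet> v)) (at x)"
   unfolding interaction_eps_def[abs_def]
   using has_derivative_mult_right[OF conv_potential_has_derivative[OF dim s \<rho>]] by simp
 qed
 then have "conv (gradient (interaction_eps a s chi \<epsilon> \<alpha> \<beta>)) g x
   = (LB y. a \<alpha> \<beta> *\<^sub>R g y *\<^sub>R conv (riesz s) (mollifier chi \<epsilon>) (x - y))"
  unfolding conv_def[of _ g] by (simp add: mult.commute)
 also have "... = a \<alpha> \<beta> *\<^sub>R conv (conv (riesz s) (mollifier chi \<epsilon>)) g x"
  unfolding conv_def[of _ g] by (rule integral_scaleR_right)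
 also have "... = a \<alpha> \<beta> *\<^sub>R conv (riesz s) (mollify (mollifier chi \<epsilon>) g) x"
  by (simp only: conv_conv[OF k \<rho> g])
 finally show ?thesis .
qed

section \<open>Mollification error of functions with a weak gradient\<close>

lemma weak_gradient_mollify:
 fixes f :: "'a::euclidean_space => real"
 assumes G: "has_weak_gradient f G" and \<kappa>: "test_function \<kappa>" and f: "ilb f"
 shows "mollify (dir_deriv v \<kappa>) f z = mollify \<kappa> G z \<bullet> v"
proof -
 \<comment> \<open>The reflected kernel is an admissible test function; the sign from the reflection
   cancels the one in the definition of the weak gradient.\<close>
 define \<psi> where "\<psi> x = \<kappa> (z - x)" for x
 have \<psi>: "test_function \<psi>" unfolding \<psi>_def[abs_def] by (rule test_function_reflect[OF \<kappa>])
 have [measurable]: "\<psi> \<in> bmb" by (rule test_function_measurable[OF \<psi>])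
 have [measurable]: "G \<in> bmb" using G by (simp add: has_weak_gradient_def)
 have grad: "gradient \<psi> x \<bullet> v = - dir_deriv v \<kappa> (z - x)" for x
 proof -
  have "gradient \<psi> x \<bullet> v = (SB b. (v \<bullet> b) * dir_deriv b \<psi> x)"
   unfolding gradient_def inner_sum_left inner_scaleR_left
   by (intro sum.cong refl) (metis inner_commute mult.commute)
  also have "... = dir_deriv v \<psi> x" by (rule test_function_dir_deriv_expand[OF \<psi>, symmetric])
  also have "... = - dir_deriv v \<kappa> (z - x)"
   unfolding \<psi>_def[abs_def] by (simp only: dir_deriv_reflect[OF \<kappa>])
  finally show ?thesis .
 qed
 have i1: "ilb (%x. f x *\<^sub>R gradient \<psi> x)"
 proof -
  have "ilb (%x. SB b. (dir_deriv b \<psi> x *\<^sub>R f x) *\<^sub>R b)"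
  proof (intro Bochner_Integration.integrable_sum integrable_scaleR_left impI)
   fix b :: 'a
   obtain B where B: "B > 0" "!!x. \<bar>dir_deriv b \<psi> x\<bar> <= B" using test_function_bounded[OF test_function_dir_deriv[OF \<psi>]] by metis
   have "dir_deriv b \<psi> \<in> bmb" by (rule test_function_measurable[OF test_function_dir_deriv[OF \<psi>]])
   then show "ilb (%x. dir_deriv b \<psi> x *\<^sub>R f x)"
    using f B by (intro integrable_scaleR_bounded[where B=B]) auto
  qed
  then show ?thesis by (simp add: gradient_def scaleR_sum_right mult.commute)
 qed
 have i2: "ilb (%x. \<psi> x *\<^sub>R G x)"
 proof -
  have cs: "compact (supp \<psi>)" using \<psi> by (simp add: test_function_def)
  then have ii: "ilb (%x. indicator (supp \<psi>) x *\<^sub>R G x)"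
   using G by (simp add: has_weak_gradient_def set_integrable_def)
  obtain B where B: "B > 0" "!!x. \<bar>\<psi> x\<bar> <= B" using test_function_bounded[OF \<psi>] by metis
  have "ilb (%x. \<psi> x *\<^sub>R (indicator (supp \<psi>) x *\<^sub>R G x))"
   by (rule integrable_scaleR_bounded[OF ii, where B=B]) (use B in auto)
  moreover have "\<psi> x *\<^sub>R (indicator (supp \<psi>) x *\<^sub>R G x) = \<psi> x *\<^sub>R G x" for x
   using supp_supset[of \<psi> x] by (cases "\<psi> x = 0") auto
  ultimately show ?thesis by (simp only:)
 qed
 have "mollify (dir_deriv v \<kappa>) f z = - (LB x. (f x *\<^sub>R gradient \<psi> x) \<bullet> v)"
  unfolding mollify_def by (simp add: grad mult.commute)
 also have "... = - ((LB x. f x *\<^sub>R gradient \<psi> x) \<bullet> v)"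
  using integral_inner_left[OF i1, of v] by (simp only:)
 also have "(LB x. f x *\<^sub>R gradient \<psi> x) = - (LB x. \<psi> x *\<^sub>R G x)"
  using G \<psi> by (simp add: has_weak_gradient_def)
 finally show ?thesis by (simp add: mollify_def \<psi>_def)
qed

text \<open>The difference is the integral of the mollified weak gradient along the segment of
  length \<open>norm y\<close>. Cauchy-Schwarz in the segment parameter, Tonelli and translation
  invariance remove the parameter, and mollification does not increase the \<open>L^2\<close>
  norm.\<close>

lemma mollified_translation_L2:
 fixes f :: "'a::euclidean_space => real"
 assumes G: "has_weak_gradient f G" and \<kappa>: "bump \<delta> \<kappa>" and f: "ilb f"
 shows "(NN z. ennreal ((mollify \<kappa> f (z - y) - mollify \<kappa> f z)^2))
  <= ennreal ((norm y)^2) * (NN x. ennreal ((norm (G x))^2))"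
proof -
 note k = bumpD[OF \<kappa>]
 note [measurable] = k(5)
 have [measurable]: "G \<in> bmb" "f \<in> bmb" using G by (simp_all add: has_weak_gradient_def)
 define H where "H z = mollify \<kappa> G z" for z
 have [measurable]: "H \<in> bmb" unfolding H_def[abs_def] by measurable
 have [measurable]: "(%p. H (snd p - fst p *\<^sub>R y)) \<in> borel_measurable (lborel \<Otimes>\<^sub>M lborel)"
  by (rule measurable_compose[of _ _ borel H]) measurable
 have [measurable]: "(%p. H (fst p - snd p *\<^sub>R y)) \<in> borel_measurable (lborel \<Otimes>\<^sub>M lborel)"
  by (rule measurable_compose[of _ _ borel H]) measurable
 have pt: "ennreal ((mollify \<kappa> f (z - y) - mollify \<kappa> f z)^2)
  <= ennreal ((norm y)^2) * (NN t. ennreal (indicator {0..1::real} t * (norm (H (z - t *\<^sub>R y)))^2))" for z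
 proof -
  have "mollify \<kappa> f (z - 1 *\<^sub>R y) - mollify \<kappa> f (z - 0 *\<^sub>R y) = (LB t. indicator {0..1} t *\<^sub>R mollify (dir_deriv (- y) \<kappa>) f (z - t *\<^sub>R y))"
  proof (rule integral_FTC_Icc[symmetric])
   fix t :: real
   have "((%t. z - t *\<^sub>R y) has_derivative (%u. - (u *\<^sub>R y))) (at t within {0..1})"
    by (auto intro!: derivative_eq_intros)
   from has_derivative_compose[OF this mollify_has_derivative[OF k(1) f]]
   have "((%t. mollify \<kappa> f (z - t *\<^sub>R y)) has_derivative (%u. mollify (dir_deriv (- (u *\<^sub>R y)) \<kappa>) f (z - t *\<^sub>R y))) (at t within {0..1})" .
   then show "((%t. mollify \<kappa> f (z - t *\<^sub>R y)) has_vector_derivative mollify (dir_deriv (- y) \<kappa>) f (z - t *\<^sub>R y)) (at t within {0..1})"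
    by (simp add: has_vector_derivative_def weak_gradient_mollify[OF G k(1) f])
  next
   show "continuous_on {0..1} (%t. mollify (dir_deriv (- y) \<kappa>) f (z - t *\<^sub>R y))"
    by (rule continuous_on_compose2[OF mollify_continuous[OF test_function_dir_deriv[OF k(1)] f]])
     (auto intro!: continuous_intros)
  qed simp
  then have "mollify \<kappa> f (z - y) - mollify \<kappa> f z = (LB t. indicator {0..1} t *\<^sub>R (H (z - t *\<^sub>R y) \<bullet> (- y)))"
   by (simp add: weak_gradient_mollify[OF G k(1) f] H_def)
  then have "ennreal ((mollify \<kappa> f (z - y) - mollify \<kappa> f z)^2) = (ennreal (norm (LB t. indicator {0..1} t *\<^sub>R (H (z - t *\<^sub>R y) \<bullet> (- y)))))^2"
   by (simp add: ennreal_power)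
  also have "... <= (NN t. ennreal (indicator {0..1} t * (norm y * norm (H (z - t *\<^sub>R y)))))^2"
  proof (intro power_mono order_trans[OF ennreal_norm_integral_le] nn_integral_mono ennreal_leI)
   fix t
   show "norm (indicator {0..1} t *\<^sub>R (H (z - t *\<^sub>R y) \<bullet> (- y))) <= indicator {0..1} t * (norm y * norm (H (z - t *\<^sub>R y)))"
    using Cauchy_Schwarz_ineq2[of "H (z - t *\<^sub>R y)" "- y"] by (auto simp: mult.commute split: split_indicator)
  qed simp
  also have "... <= (NN t. ennreal (indicator {0..1::real} t)) * (NN t. ennreal (indicator {0..1} t * (norm y * norm (H (z - t *\<^sub>R y)))^2))"
   by (rule Cauchy_Schwarz_weighted) auto
  also have "(NN t. ennreal (indicator {0..1::real} t)) = (1::ennreal)"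
   by (simp add: ennreal_indicator)
  also have "(NN t. ennreal (indicator {0..1} t * (norm y * norm (H (z - t *\<^sub>R y)))^2))
   = (NN t. ennreal ((norm y)^2) * ennreal (indicator {0..1::real} t * (norm (H (z - t *\<^sub>R y)))^2))"
   by (intro nn_integral_cong) (simp add: power_mult_distrib mult.left_commute ennreal_mult[symmetric])
  also have "... = ennreal ((norm y)^2) * (NN t. ennreal (indicator {0..1::real} t * (norm (H (z - t *\<^sub>R y)))^2))"
   by (rule nn_integral_cmult) measurable
  finally show ?thesis by simp
 qed
 have "(NN z. ennreal ((mollify \<kappa> f (z - y) - mollify \<kappa> f z)^2))
  <= (NN z. ennreal ((norm y)^2) * (NN t. ennreal (indicator {0..1::real} t * (norm (H (z - t *\<^sub>R y)))^2)))"
  by (rule nn_integral_mono) (rule pt)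
 also have "... = ennreal ((norm y)^2) * (NN z. (NN t. ennreal (indicator {0..1::real} t * (norm (H (z - t *\<^sub>R y)))^2)))"
  by (rule nn_integral_cmult) measurable
 also have "(NN z. (NN t. ennreal (indicator {0..1::real} t * (norm (H (z - t *\<^sub>R y)))^2)))
  = (NN t. (NN z. ennreal (indicator {0..1::real} t * (norm (H (z - t *\<^sub>R y)))^2)))"
  by (rule lborel_pair.Fubini') measurable
 also have "... <= (NN t. indicator {0..1::real} t * (NN x. ennreal ((norm (G x))^2)))"
 proof (rule nn_integral_mono)
  fix t :: real
  have "(NN z. ennreal ((norm (H (z - t *\<^sub>R y)))^2)) = (NN z. ennreal ((norm (H z))^2))"
   using nn_integral_translate[of "%z. ennreal ((norm (H z))^2)" "- t *\<^sub>R y"] by simp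
  also have "... <= (NN x. ennreal ((norm (G x))^2))"
   unfolding H_def by (rule mollify_L2_le) (use k in auto)
  finally show "(NN z. ennreal (indicator {0..1::real} t * (norm (H (z - t *\<^sub>R y)))^2))
   <= indicator {0..1::real} t * (NN x. ennreal ((norm (G x))^2))"
   by (auto split: split_indicator)
 qed
 also have "... = (NN x. ennreal ((norm (G x))^2))"
  by (subst nn_integral_multc) auto
 finally show ?thesis by (simp add: mult_left_mono)
qed

lemma AE_lborel_translate:
 assumes "AE x in lborel. P x" and "c = (c::'a::euclidean_space)"
 shows "AE x in lborel. P (x - c)"
proof -
 obtain N where N: "N \<in> null_sets lborel" "{x. \<not> P x} \<subseteq> N"
  using assms(1) by (auto simp: eventually_ae_filter)
 then have [measurable]: "N \<in> sets borel" by auto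
 have "AE x in distr lborel borel (%x. - c + x). x \<notin> N"
  unfolding lborel_distr_translate using N by (simp add: AE_not_in)
 then have "AE x in lborel. - c + x \<notin> N" by (subst (asm) AE_distr_iff) auto
 then show ?thesis by eventually_elim (use N in auto)
qed

text \<open>The bound for mollified functions does not depend on the scale, so Fatou's lemma along
  an almost everywhere convergent subsequence transfers it.\<close>

lemma H1_translation_L2:
 fixes f :: "'a::euclidean_space => real" and \<kappa> :: "nat => 'a => real"
 assumes G: "has_weak_gradient f G" and f: "ilb f"
  and \<kappa>: "!!n. bump (\<delta> n) (\<kappa> n)" "\<delta> ----> 0"
 shows "(NN z. ennreal ((f (z - y) - f z)^2))
  <= ennreal ((norm y)^2) * (NN x. ennreal ((norm (G x))^2))" (is "_ <= ?R")
proof -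
 have [measurable]: "f \<in> bmb" using f by auto
 have [measurable]: "\<kappa> n \<in> bmb" for n using bumpD(5)[OF \<kappa>(1)] .
 obtain r where r: "strict_mono r" "AE x in lborel. (%n. mollify (\<kappa> (r n)) f x) ----> f x"
  by (rule mollify_AE_subseq[OF f \<kappa>(2) \<kappa>(1)])
 have "(NN z. ennreal ((f (z - y) - f z)^2))
  <= (NN z. liminf (%n. ennreal ((mollify (\<kappa> (r n)) f (z - y) - mollify (\<kappa> (r n)) f z)^2)))"
 proof (rule nn_integral_mono_AE)
  show "AE z in lborel. ennreal ((f (z - y) - f z)^2) <= liminf (%n. ennreal ((mollify (\<kappa> (r n)) f (z - y) - mollify (\<kappa> (r n)) f z)^2))"
   using r(2) AE_lborel_translate[OF r(2) refl, of y]
  proof eventually_elim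
   case (elim z)
   have "(%n. ennreal ((mollify (\<kappa> (r n)) f (z - y) - mollify (\<kappa> (r n)) f z)^2)) ----> ennreal ((f (z - y) - f z)^2)"
    using elim by (intro tendsto_ennrealI tendsto_intros)
   from lim_imp_Liminf[OF sequentially_bot this] show ?case by simp
  qed
 qed
 also have "... <= liminf (%n. NN z. ennreal ((mollify (\<kappa> (r n)) f (z - y) - mollify (\<kappa> (r n)) f z)^2))"
 proof (rule nn_integral_liminf)
  fix n
  have [measurable]: "mollify (\<kappa> (r n)) f \<in> bmb"
   by (rule mollify_measurable) measurable
  have [measurable]: "(%z. mollify (\<kappa> (r n)) f (z - y)) \<in> bmb"
   by (rule measurable_compose[of "%z. z - y" borel borel]) measurable
  show "(%z. ennreal ((mollify (\<kappa> (r n)) f (z - y) - mollify (\<kappa> (r n)) f z)^2)) \<in> borel_measurable lborel"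
   by measurable
 qed
 also have "... <= liminf (%n. ?R)"
  by (intro Liminf_mono always_eventually allI mollified_translation_L2[OF G \<kappa>(1) f])
 also have "... = ?R" by (simp add: Liminf_const)
 finally show ?thesis .
qed

text \<open>The error is an average of translation errors, so Jensen and Tonelli reduce it to
  translations by at most \<open>\<epsilon>\<close>. This is where the rate in
  \<open>\<epsilon>\<close> originates for the integrable part of the kernel.\<close>

lemma mollify_diff_L2:
 fixes f :: "'a::euclidean_space => real" and \<kappa> :: "nat => 'a => real"
 assumes G: "has_weak_gradient f G" and f: "ilb f"
  and \<kappa>: "!!n. bump (\<delta> n) (\<kappa> n)" "\<delta> ----> 0" and \<rho>: "bump \<epsilon> \<rho>"
 shows "(NN z. ennreal ((mollify \<rho> f z - f z)^2))
  <= ennreal (\<epsilon>^2) * (NN x. ennreal ((norm (G x))^2))" (is "_ <= _ * ?G")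
proof -
 note b = bumpD[OF \<rho>]
 note [measurable] = b(5)
 have [measurable]: "f \<in> bmb" using f by auto
 have pt: "ennreal ((mollify \<rho> f z - f z)^2) <= (NN y. ennreal (\<rho> y * (f (z - y) - f z)^2))" for z
 proof -
  have i1: "ilb (%y. \<rho> y *\<^sub>R f (z - y))"
   using integrable_reflect[OF mollify_test_integrand[OF f b(1)], of z z] by simp
  have "mollify \<rho> f z - f z = (LB y. \<rho> y *\<^sub>R f (z - y)) - (LB y. \<rho> y *\<^sub>R f z)"
   using b by (simp add: mollify_eq_integral_shift)
  also have "... = (LB y. \<rho> y *\<^sub>R (f (z - y) - f z))"
   using i1 b by (subst Bochner_Integration.integral_diff[symmetric]) (auto simp: right_diff_distrib)
  finally have "ennreal ((mollify \<rho> f z - f z)^2) = (ennreal (norm (LB y. \<rho> y *\<^sub>R (f (z - y) - f z))))^2"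
   by (simp add: ennreal_power)
  also have "... <= (NN y. ennreal (\<rho> y * \<bar>f (z - y) - f z\<bar>))^2"
   using b(2) by (intro power_mono order_trans[OF ennreal_norm_integral_le] nn_integral_mono ennreal_leI) (auto simp: abs_mult)
  also have "... <= (NN y. ennreal (\<rho> y)) * (NN y. ennreal (\<rho> y * (\<bar>f (z - y) - f z\<bar>)^2))"
   using b(2) by (intro Cauchy_Schwarz_weighted) auto
  finally show ?thesis using b(3) by simp
 qed
 have "(NN z. ennreal ((mollify \<rho> f z - f z)^2)) <= (NN z. (NN y. ennreal (\<rho> y * (f (z - y) - f z)^2)))"
  by (rule nn_integral_mono) (rule pt)
 also have "... = (NN y. (NN z. ennreal (\<rho> y * (f (z - y) - f z)^2)))"
  by (rule lborel_pair.Fubini') measurable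
 also have "... <= (NN y. ennreal (\<rho> y) * (ennreal (\<epsilon>^2) * ?G))"
 proof (rule nn_integral_mono)
  fix y
  have "(NN z. ennreal (\<rho> y * (f (z - y) - f z)^2)) = ennreal (\<rho> y) * (NN z. ennreal ((f (z - y) - f z)^2))"
   using b(2) by (subst nn_integral_cmult[symmetric]) (auto simp: ennreal_mult)
  also have "... <= ennreal (\<rho> y) * (ennreal (\<epsilon>^2) * ?G)"
  proof (cases "\<rho> y = 0")
   case False
   have "(NN z. ennreal ((f (z - y) - f z)^2)) <= ennreal ((norm y)^2) * ?G"
    by (rule H1_translation_L2[OF G f \<kappa>])
   also have "... <= ennreal (\<epsilon>^2) * ?G"
    using b(4)[OF False] by (intro mult_right_mono ennreal_leI power_mono) auto
   finally show ?thesis by (intro mult_left_mono) auto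
  qed simp
  finally show "(NN z. ennreal (\<rho> y * (f (z - y) - f z)^2)) <= ennreal (\<rho> y) * (ennreal (\<epsilon>^2) * ?G)" .
 qed
 also have "... = ennreal (\<epsilon>^2) * ?G"
  using b(3) by (subst nn_integral_multc) auto
 finally show ?thesis .
qed

section \<open>From the distributional to the integrated weak formulation\<close>

lemma continuous_on_primitive:
 fixes p :: "real => real"
 assumes [measurable]: "p \<in> bmb" and P: "!!r. norm (p r) <= P"
 shows "continuous_on {0..T} (%t. LB r. indicator {0..t} r *\<^sub>R p r)"
proof -
 have P0: "P \<ge> 0" using order_trans[OF norm_ge_zero P] .
 have diff: "(LB r. indicator {0..t} r *\<^sub>R p r) = (LB r. indicator {0..s} r *\<^sub>R p r) + (LB r. indicator {s..t} r *\<^sub>R p r)"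
  if "0 <= s" "s <= t" for s t
 proof -
  have "(LB r. indicator {0..t} r *\<^sub>R p r) = (LB r. indicator {0..s} r *\<^sub>R p r + indicator {s..t} r *\<^sub>R p r)"
   by (intro integral_cong_AE, measurable)
    (use indicator_Icc_split_AE[OF that] in \<open>auto simp: distrib_right\<close>)
  also have "... = (LB r. indicator {0..s} r *\<^sub>R p r) + (LB r. indicator {s..t} r *\<^sub>R p r)"
   by (rule Bochner_Integration.integral_add[OF integrable_Icc_bounded[OF _ P] integrable_Icc_bounded[OF _ P]]) measurable
  finally show ?thesis .
 qed
 have lip: "dist (LB r. indicator {0..t} r *\<^sub>R p r) (LB r. indicator {0..s} r *\<^sub>R p r) <= P * dist t s"
  if "0 <= s" "s <= t" for s t
  using norm_integral_Icc_le[of s t P p] P P0 that diff[OF that] by (simp add: dist_real_def mult.commute)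
 have "P-lipschitz_on {0..T} (%t. LB r. indicator {0..t} r *\<^sub>R p r)"
 proof (rule lipschitz_onI[OF _ P0])
  fix t s :: real assume "t \<in> {0..T}" "s \<in> {0..T}"
  then show "dist (LB r. indicator {0..t} r *\<^sub>R p r) (LB r. indicator {0..s} r *\<^sub>R p r) <= P * dist t s"
   using lip[of s t] lip[of t s] by (cases "s <= t") (auto simp: dist_commute)
 qed
 then show ?thesis by (rule lipschitz_on_continuous_on)
qed

text \<open>After mollification in time the weak identity becomes a classical derivative away from
  the endpoints. Letting the scale shrink gives the integrated identity on the open interval, and
  continuity of \<open>G\<close> carries it to both endpoints.\<close>

lemma weak_derivative_imp_integral:
 fixes G p :: "real => real"
 assumes T: "T > 0" and G: "continuous_on {0..T} G"
  and [measurable]: "p \<in> bmb" and P: "!!r. norm (p r) <= P"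
  and k: "!!h. h > 0 ==> bump h (k h :: real => real)"
  and weak: "!!\<eta>. test_function \<eta> ==> supp \<eta> \<subseteq> {0<..<T} ==>
   (LB r. indicator {0..T} r *\<^sub>R (dir_deriv 1 \<eta> r * G r + \<eta> r * p r)) = 0"
  and t: "t \<in> {0..T}"
 shows "G t - G 0 = (LB r. indicator {0..t} r *\<^sub>R p r)"
proof -
 \<comment> \<open>Extension by 0 makes \<open>mollify\<close> applicable on the whole line. The
   window \<open>h < \<tau> < T - h\<close> used below keeps the support of the reflected kernel
   inside the open interval.\<close>
 define G0 where "G0 r = indicator {0..T} r *\<^sub>R G r" for r
 define p0 where "p0 r = indicator {0..T} r *\<^sub>R p r" for r
 have G0i: "ilb G0"
  unfolding G0_def[abs_def] by (rule borel_integrable_compact[OF _ G]) auto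
 have p0i: "ilb p0"
  unfolding p0_def[abs_def] by (rule integrable_Icc_bounded[OF _ P]) measurable
 have [measurable]: "G0 \<in> bmb" "p0 \<in> bmb" using G0i p0i by auto
 have step: "mollify (k h) G0 b - mollify (k h) G0 a = (LB r. indicator {a..b} r *\<^sub>R mollify (k h) p0 r)"
  if h: "h > 0" and ab: "h < a" "a <= b" "b < T - h" for a b h
 proof -
  note kk = bumpD[OF k[OF h]]
  have [measurable]: "k h \<in> bmb" "dir_deriv 1 (k h) \<in> bmb"
   using kk(5) test_function_measurable[OF test_function_dir_deriv[OF kk(1)]] by auto
  have der: "mollify (dir_deriv 1 (k h)) G0 \<tau> = mollify (k h) p0 \<tau>" if \<tau>: "h < \<tau>" "\<tau> < T - h" for \<tau>
  proof -
   define \<eta> where "\<eta> r = k h (\<tau> - r)" for r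
   have \<eta>: "test_function \<eta>" unfolding \<eta>_def[abs_def] by (rule test_function_reflect[OF kk(1)])
   have "supp \<eta> \<subseteq> {\<tau> - h..\<tau> + h}"
   proof (rule supp_subset)
    fix r assume "\<eta> r ~= 0"
    then have "norm (\<tau> - r) <= h" by (intro kk(4)) (simp add: \<eta>_def)
    then show "r \<in> {\<tau> - h..\<tau> + h}" by (auto simp: abs_le_iff)
   qed simp
   then have "supp \<eta> \<subseteq> {0<..<T}" using \<tau> by auto
   from weak[OF \<eta> this]
   have "(LB r. k h (\<tau> - r) *\<^sub>R p0 r - dir_deriv 1 (k h) (\<tau> - r) *\<^sub>R G0 r) = 0"
    unfolding \<eta>_def[abs_def] dir_deriv_reflect[OF kk(1)]
    by (simp add: G0_def p0_def algebra_simps)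
   moreover have "(LB r. k h (\<tau> - r) *\<^sub>R p0 r - dir_deriv 1 (k h) (\<tau> - r) *\<^sub>R G0 r)
    = mollify (k h) p0 \<tau> - mollify (dir_deriv 1 (k h)) G0 \<tau>"
    unfolding mollify_def
    by (rule Bochner_Integration.integral_diff)
     (rule mollify_test_integrand[OF p0i kk(1)], rule mollify_test_integrand[OF G0i test_function_dir_deriv[OF kk(1)]])
   ultimately show ?thesis by simp
  qed
  have "(LB r. indicator {a..b} r *\<^sub>R mollify (k h) p0 r) = mollify (k h) G0 b - mollify (k h) G0 a"
  proof (rule integral_FTC_Icc[where F="mollify (k h) G0" and f="mollify (k h) p0", OF ab(2)])
   fix r assume r: "a <= r" "r <= b"
   have lin: "mollify (dir_deriv v (k h)) G0 r = v *\<^sub>R mollify (dir_deriv 1 (k h)) G0 r" for v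
   proof -
    have "dir_deriv (v *\<^sub>R 1) (k h) x = v *\<^sub>R dir_deriv 1 (k h) x" for x
     by (rule linear_scale[OF test_function_dir_deriv_linear[OF kk(1)]])
    then have "dir_deriv v (k h) x = v * dir_deriv 1 (k h) x" for x by simp
    then show ?thesis by (simp add: mollify_def mult.assoc)
   qed
   have "(mollify (k h) G0 has_derivative (%v. mollify (dir_deriv v (k h)) G0 r)) (at r within {a..b})"
    by (rule has_derivative_at_withinI[OF mollify_has_derivative[OF kk(1) G0i]])
   moreover have "(%v. mollify (dir_deriv v (k h)) G0 r) = (%v. v *\<^sub>R mollify (k h) p0 r)"
    using der[of r] r ab by (intro ext, subst lin) simp
   ultimately show "(mollify (k h) G0 has_vector_derivative mollify (k h) p0 r) (at r within {a..b})"
    unfolding has_vector_derivative_def by (simp only:)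
  next
   show "continuous_on {a..b} (mollify (k h) p0)"
    by (rule continuous_on_subset[OF mollify_continuous[OF kk(1) p0i]]) simp
  qed
  then show ?thesis by simp
 qed
 define hn where "hn n = inverse (real (Suc n))" for n
 have hn: "hn n > 0" "hn ----> 0" for n
  unfolding hn_def[abs_def] using LIMSEQ_inverse_real_of_nat by auto
 have kn: "bump (hn n) (k (hn n))" for n by (rule k[OF hn(1)])
 have limG: "(%n. mollify (k (hn n)) G0 a) ----> G a" if a: "0 < a" "a < T" for a
 proof (rule LIMSEQ_I)
  fix e :: real assume e: "e > 0"
  obtain d where d: "d > 0" "!!r. r \<in> {0..T} ==> dist r a < d ==> dist (G r) (G a) < e / 2"
   using G[unfolded continuous_on_iff, rule_format, of a "e / 2"] a e by auto
  obtain N where N: "!!n. n \<ge> N ==> norm (hn n - 0) < min d (min a (T - a))"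
   using LIMSEQ_D[OF hn(2), of "min d (min a (T - a))"] d a by auto
  have "norm (mollify (k (hn n)) G0 a - G a) < e" if n: "n \<ge> N" for n
  proof -
   note kk = bumpD[OF kn[of n]]
   have h: "hn n < d" "hn n < a" "hn n < T - a" using N[OF n] hn(1)[of n] by auto
   have i1: "ilb (%r. k (hn n) (a - r) *\<^sub>R G0 r)" by (rule mollify_test_integrand[OF G0i kk(1)])
   have i2: "ilb (%r. k (hn n) (a - r))" "(LB r. k (hn n) (a - r)) = 1"
    using integrable_reflect[OF kk(6)] integral_reflect[of "k (hn n)" a] kk(5,7) by auto
   have "mollify (k (hn n)) G0 a - G a = (LB r. k (hn n) (a - r) *\<^sub>R G0 r) - (LB r. k (hn n) (a - r) *\<^sub>R G a)"
    using i2 by (simp add: mollify_def)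
   also have "... = (LB r. k (hn n) (a - r) *\<^sub>R (G0 r - G a))"
    unfolding scaleR_diff_right using i1 i2(1) by (intro Bochner_Integration.integral_diff[symmetric] integrable_scaleR_left) auto
   also have "norm ... <= (LB r. norm (k (hn n) (a - r) *\<^sub>R (G0 r - G a)))"
    by (rule integral_norm_bound)
   also have "... <= (LB r. k (hn n) (a - r) * (e / 2))"
   proof (rule integral_mono)
    show "ilb (%r. norm (k (hn n) (a - r) *\<^sub>R (G0 r - G a)))"
     unfolding scaleR_diff_right using i1 i2(1)
     by (intro integrable_norm Bochner_Integration.integrable_diff integrable_scaleR_left) auto
    show "ilb (%r. k (hn n) (a - r) * (e / 2))" using i2(1) by simp
    show "norm (k (hn n) (a - r) *\<^sub>R (G0 r - G a)) <= k (hn n) (a - r) * (e / 2)" for r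
    proof (cases "k (hn n) (a - r) = 0")
     case False
     then have "\<bar>a - r\<bar> <= hn n" using kk(4)[OF False] by simp
     then have r: "r \<in> {0..T}" "dist r a < d" using h by (auto simp: dist_real_def abs_le_iff)
     then have "\<bar>G0 r - G a\<bar> <= e / 2" using d(2)[OF r] by (simp add: G0_def dist_real_def)
     from mult_left_mono[OF this kk(2)[of "a - r"]]
     show ?thesis using kk(2)[of "a - r"] by (simp add: abs_mult)
    qed simp
   qed
   also have "... = e / 2" using i2 by simp
   finally show ?thesis using e by simp
  qed
  then show "\<exists>no. \<forall>n\<ge>no. norm (mollify (k (hn n)) G0 a - G a) < e" by blast
 qed
 have inner: "G b - G a = (LB r. indicator {a..b} r *\<^sub>R p r)" if ab: "0 < a" "a <= b" "b < T" for a b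
 proof (rule LIMSEQ_unique)
  show "(%n. mollify (k (hn n)) G0 b - mollify (k (hn n)) G0 a) ----> G b - G a"
   using ab by (intro tendsto_diff limG) auto
  have mi: "ilb (mollify (k (hn n)) p0)" for n
   by (rule mollify_integrable(1)[OF bumpD(6)[OF kn] p0i])
  have l0: "(%n. LB r. indicator {a..b} r *\<^sub>R mollify (k (hn n)) p0 r) ----> (LB r. indicator {a..b} r *\<^sub>R p0 r)"
  proof (rule LIM_zero_cancel, rule Lim_null_comparison)
   show "(%n. LB r. norm (mollify (k (hn n)) p0 r - p0 r)) ----> 0"
    by (rule mollify_L1_tendsto[OF p0i hn(2) kn])
   show "\<forall>\<^sub>F n in sequentially. norm ((LB r. indicator {a..b} r *\<^sub>R mollify (k (hn n)) p0 r) - (LB r. indicator {a..b} r *\<^sub>R p0 r))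
     <= (LB r. norm (mollify (k (hn n)) p0 r - p0 r))"
   proof (intro always_eventually allI)
    fix n
    have ii: "ilb (%r. indicator {a..b} r *\<^sub>R mollify (k (hn n)) p0 r)" "ilb (%r. indicator {a..b} r *\<^sub>R p0 r)"
     using mi p0i by (auto intro!: integrable_mult_indicator[of "{a..b}" lborel] simp del: real_scaleR_def)
    have "norm ((LB r. indicator {a..b} r *\<^sub>R mollify (k (hn n)) p0 r) - (LB r. indicator {a..b} r *\<^sub>R p0 r))
     = norm (LB r. indicator {a..b} r *\<^sub>R mollify (k (hn n)) p0 r - indicator {a..b} r *\<^sub>R p0 r)"
     using ii by (simp only: Bochner_Integration.integral_diff)
    also have "... <= (LB r. norm (indicator {a..b} r *\<^sub>R mollify (k (hn n)) p0 r - indicator {a..b} r *\<^sub>R p0 r))"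
     by (rule integral_norm_bound)
    also have "... <= (LB r. norm (mollify (k (hn n)) p0 r - p0 r))"
     using ii mi p0i
     by (intro integral_mono integrable_norm Bochner_Integration.integrable_diff) (auto split: split_indicator)
    finally show "norm ((LB r. indicator {a..b} r *\<^sub>R mollify (k (hn n)) p0 r) - (LB r. indicator {a..b} r *\<^sub>R p0 r))
     <= (LB r. norm (mollify (k (hn n)) p0 r - p0 r))" .
   qed
  qed
  have "(LB r. indicator {a..b} r *\<^sub>R p0 r) = (LB r. indicator {a..b} r *\<^sub>R p r)"
   using ab by (intro Bochner_Integration.integral_cong) (auto simp: p0_def split: split_indicator)
  with l0 have l: "(%n. LB r. indicator {a..b} r *\<^sub>R mollify (k (hn n)) p0 r) ----> (LB r. indicator {a..b} r *\<^sub>R p r)" by (simp only:)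
  have "\<forall>\<^sub>F n in sequentially. hn n < min a (T - b)"
   using hn(2) ab by (intro order_tendstoD) auto
  then have "\<forall>\<^sub>F n in sequentially. (LB r. indicator {a..b} r *\<^sub>R mollify (k (hn n)) p0 r) = mollify (k (hn n)) G0 b - mollify (k (hn n)) G0 a"
  proof eventually_elim
   case (elim n)
   then show ?case using step[OF hn(1)[of n], of a b] ab by simp
  qed
  then show "(%n. mollify (k (hn n)) G0 b - mollify (k (hn n)) G0 a) ----> (LB r. indicator {a..b} r *\<^sub>R p r)"
   by (rule Lim_transform_eventually[OF l])
 qed
 \<comment> \<open>The defect is constant on the open interval and continuous on the closed one,
   hence constant up to the endpoints.\<close>
 define D where "D t = G t - (LB r. indicator {0..t} r *\<^sub>R p r)" for t
 have Dc: "continuous_on {0..T} D"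
  unfolding D_def[abs_def] using G continuous_on_primitive[of p P T] P by (intro continuous_intros) auto
 have cl: "closure {0<..<T} = {0..T}" using T by simp
 have const: "D b = D a" if ab: "0 < a" "a <= b" "b < T" for a b
 proof -
  have "(LB r. indicator {0..b} r *\<^sub>R p r) = (LB r. indicator {0..a} r *\<^sub>R p r + indicator {a..b} r *\<^sub>R p r)"
   by (intro integral_cong_AE, measurable)
    (use indicator_Icc_split_AE[of 0 a b] ab in \<open>auto simp: distrib_right\<close>)
  also have "... = (LB r. indicator {0..a} r *\<^sub>R p r) + (LB r. indicator {a..b} r *\<^sub>R p r)"
   by (rule Bochner_Integration.integral_add[OF integrable_Icc_bounded[OF _ P] integrable_Icc_bounded[OF _ P]]) measurable
  finally show ?thesis using inner[OF ab] by (simp add: D_def)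
 qed
 have Dall: "D x = D (T / 2)" if "x \<in> closure {0<..<T}" for x
 proof (rule continuous_constant_on_closure[where f=D and S="{0<..<T}"])
  show "continuous_on (closure {0<..<T}) D" unfolding cl by (rule Dc)
  show "D y = D (T / 2)" if "y \<in> {0<..<T}" for y
  proof (cases "y <= T / 2")
   case True
   then have "D (T / 2) = D y" using that T by (intro const) auto
   then show ?thesis by (rule sym)
  next
   case False
   then show ?thesis using that T by (intro const) auto
  qed
 qed (rule that)
 have "D t = D (T / 2)" by (rule Dall) (use t cl in simp)
 also have "... = D 0" by (rule Dall[symmetric]) (use T cl in simp)
 finally have "D t = D 0" .
 moreover have "(LB r. indicator {0..0} r *\<^sub>R p r) = 0"
 proof -
  have "AE r in lborel. indicator {0..0} r *\<^sub>R p r = (0::real)"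
   using AE_lborel_singleton[of "0::real"] by eventually_elim auto
  then show ?thesis by (subst integral_cong_AE[where g="%_. 0"]) auto
 qed
 ultimately show ?thesis by (simp add: D_def)
qed

text \<open>A smooth kernel on the line is obtained by restricting \<open>chi\<close> to a line
  through the origin and normalising, so no bump function has to be built by hand.\<close>

lemma real_bump_exists:
 fixes chi :: "'a::euclidean_space => real"
 assumes chi: "test_function chi" "prob_density chi" "supp chi \<subseteq> cball 0 1"
 obtains k :: "real => real => real" where "!!h. h > 0 ==> bump h (k h)"
proof -
 have [measurable]: "chi \<in> bmb" using chi test_function_measurable by auto
 have nn: "0 <= chi x" for x
  by (rule AE_lborel_nonneg_continuous[OF _ test_function_continuous[OF chi(1)]])
   (use chi(2) in \<open>simp add: prob_density_def\<close>)
 \<comment> \<open>A nonzero point is needed to span the line. One exists because \<open>chi\<close>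
   has integral 1 and a single point is null.\<close>
 have "\<exists>x. x ~= 0 \<and> chi x ~= 0"
 proof (rule ccontr)
  assume "\<not> (\<exists>x. x ~= 0 \<and> chi x ~= 0)"
  then have "AE x in lborel. chi x = 0"
   using AE_lborel_singleton[of "0::'a"] by (auto elim: eventually_mono)
  then have "(LB x. chi x) = (\<integral>x. 0 \<partial>(lborel::'a measure))" by (intro integral_cong_AE) auto
  then show False using chi(2) by (simp add: prob_density_def has_bochner_integral_iff)
 qed
 then obtain x0 where x0: "x0 ~= 0" "chi x0 ~= 0" by blast
 define v where "v = (1 / norm x0) *\<^sub>R x0"
 have v: "norm v = 1" using x0 by (simp add: v_def)
 define \<kappa>0 where "\<kappa>0 t = chi (t *\<^sub>R v)" for t :: real
 have tf: "test_function \<kappa>0"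
 proof (rule test_functionI)
  show "Ck n \<kappa>0" for n
   unfolding \<kappa>0_def[abs_def] using Ck_affine[OF bounded_linear_scaleR_left[of v], of n chi 0] chi(1)
   by (simp add: test_function_def)
  show "compact (cball (0::real) 1)" by simp
  show "t \<in> cball 0 1" if "\<kappa>0 t ~= 0" for t
   using supp_supset[of chi "t *\<^sub>R v"] that chi(3) v by (auto simp: \<kappa>0_def)
 qed
 have supp0: "supp \<kappa>0 \<subseteq> cball 0 1"
 proof (rule supp_subset)
  show "t \<in> cball 0 1" if "\<kappa>0 t ~= 0" for t
   using supp_supset[of chi "t *\<^sub>R v"] that chi(3) v by (auto simp: \<kappa>0_def)
 qed auto
 have i0: "ilb \<kappa>0" by (rule test_function_integrable[OF tf])
 have [measurable]: "\<kappa>0 \<in> bmb" using i0 by auto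
 have \<kappa>0nn: "0 <= \<kappa>0 t" for t using nn by (simp add: \<kappa>0_def)
 define c where "c = (LB t. \<kappa>0 t)"
 have "c ~= 0"
 proof
  assume "c = 0"
  then have "(LB t. \<kappa>0 t) = 0" by (simp only: c_def)
  then have "AE t in lborel. \<kappa>0 t = 0"
   by (subst (asm) integral_nonneg_eq_0_iff_AE[OF i0]) (use \<kappa>0nn in auto)
  then have ae: "AE t in lborel. 0 <= - \<kappa>0 t" by eventually_elim simp
  have "0 <= - \<kappa>0 (norm x0)"
   by (rule AE_lborel_nonneg_continuous[OF ae]) (intro continuous_intros test_function_continuous[OF tf])
  moreover have "\<kappa>0 (norm x0) = chi x0" using x0 by (simp add: \<kappa>0_def v_def)
  ultimately show False using nn[of x0] x0 by simp
 qed
 moreover have "c \<ge> 0" unfolding c_def using \<kappa>0nn by (intro Bochner_Integration.integral_nonneg)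
 ultimately have c: "c > 0" by simp
 define \<kappa> where "\<kappa> t = (1 / c) * \<kappa>0 t" for t
 have 1: "test_function \<kappa>" unfolding \<kappa>_def[abs_def] by (rule test_function_cmult[OF tf])
 have 2: "prob_density \<kappa>"
  unfolding prob_density_def has_bochner_integral_iff \<kappa>_def[abs_def]
  using i0 c \<kappa>0nn by (auto simp: c_def[symmetric] intro!: AE_I2)
 have "supp \<kappa> = supp \<kappa>0" using c by (simp add: supp_def \<kappa>_def)
 then have 3: "supp \<kappa> \<subseteq> cball 0 1" using supp0 by simp
 show ?thesis using that[of "mollifier \<kappa>"] bump_mollifier[OF 1 2 3] by blast
qed

lemma esqrt_less_imp:
 assumes "esqrt x < ennreal c" "c > 0"
 shows "x < ennreal (c^2)"
proof (cases x)
 case (real r)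
 then have "sqrt r < c" using assms by (simp add: esqrt_def ennreal_less_iff)
 then have "r < c^2" using real assms(2) by (metis real_sqrt_less_iff real_sqrt_abs abs_of_pos)
 then show ?thesis using real by (simp add: ennreal_less_iff)
qed (use assms in \<open>simp add: esqrt_def\<close>)

lemma ennreal_tendsto_0I:
 fixes f :: "'b => ennreal"
 assumes "!!c::real. c > 0 ==> eventually (%x. f x < ennreal c) F"
 shows "(f \<longlongrightarrow> 0) F"
proof (rule order_tendstoI)
 fix e :: ennreal assume e: "0 < e"
 then obtain c :: real where c: "0 < c" "ennreal c <= e"
 proof (cases e)
  case (real r)
  then show ?thesis using e that[of r] by simp
 next
  case top
  then show ?thesis using that[of 1] by simp
 qed
 show "\<forall>\<^sub>F x in F. f x < e" using assms[OF c(1)] by eventually_elim (use c in auto)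
qed auto

lemma L2norm_tendsto_0:
 assumes "((%r. L2norm M (h r)) \<longlongrightarrow> 0) F"
 shows "((%r. \<integral>\<^sup>+x. ennreal ((h r x)^2) \<partial>M) \<longlongrightarrow> 0) F"
proof (rule ennreal_tendsto_0I)
 fix c :: real assume c: "c > 0"
 have "\<forall>\<^sub>F r in F. L2norm M (h r) < ennreal (sqrt c)"
  using c by (intro order_tendstoD[OF assms]) simp
 then show "\<forall>\<^sub>F r in F. (\<integral>\<^sup>+x. ennreal ((h r x)^2) \<partial>M) < ennreal c"
 proof eventually_elim
  case (elim r)
  then show ?case using esqrt_less_imp[of _ "sqrt c"] c by (simp add: L2norm_def)
 qed
qed

text \<open>Both bounds survive limits in \<open>L^2\<close>: a subsequence converges almost
  everywhere, which preserves the sup bound, and Fatou's lemma preserves the \<open>L^1\<close>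
  bound.\<close>

lemma bounded_L1_limit:
 fixes f :: "'a::euclidean_space => real"
 assumes g: "!!n. bounded_L1 M (g n)" and [measurable]: "f \<in> bmb"
  and lim: "(%n. NN x. ennreal ((g n x - f x)^2)) ----> 0"
 shows "bounded_L1 M f"
proof -
 have [measurable]: "g n \<in> bmb" for n using bounded_L1D(4)[OF g] .
 have "\<forall>\<^sub>F n in sequentially. (NN x. ennreal ((g n x - f x)^2)) < ennreal 1"
  by (intro order_tendstoD[OF lim]) simp
 then obtain N where N: "!!n. n \<ge> N ==> (NN x. ennreal ((g n x - f x)^2)) < ennreal 1"
  by (auto simp: eventually_sequentially)
 \<comment> \<open>Dropping the first \<open>N\<close> terms ensures that every remaining squared
   difference is integrable.\<close>
 define u where "u n x = (g (n + N) x - f x)^2" for n x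
 have ui: "ilb (u n)" for n
 proof (rule integrableI_bounded)
  have "(NN x. ennreal (norm (u n x))) = (NN x. ennreal ((g (n + N) x - f x)^2))"
   by (simp add: u_def)
  also have "... < ennreal 1" by (rule N) simp
  also have "... < \<infinity>" by simp
  finally show "(NN x. ennreal (norm (u n x))) < \<infinity>" .
 qed (simp add: u_def[abs_def])
 have "(%n. LB x. norm (u n x)) ----> 0"
 proof -
  have "(%n. NN x. ennreal ((g (n + N) x - f x)^2)) ----> 0"
   by (rule LIMSEQ_ignore_initial_segment[OF lim])
  moreover have "(NN x. ennreal ((g (n + N) x - f x)^2)) = ennreal (LB x. norm (u n x))" for n
   using nn_integral_eq_integral[OF ui[of n]] by (simp add: u_def[abs_def])
  ultimately have "(%n. ennreal (LB x. norm (u n x))) ----> ennreal 0" by simp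
  then show ?thesis by (subst (asm) tendsto_ennreal_iff) auto
 qed
 from tendsto_L1_AE_subseq[OF ui this] obtain r where r: "strict_mono r" "AE x in lborel. (%n. u (r n) x) ----> 0"
  by blast
 have conv: "AE x in lborel. (%n. g (r n + N) x) ----> f x"
  using r(2)
 proof eventually_elim
  case (elim x)
  have "(%n. sqrt (u (r n) x)) ----> sqrt 0" using elim by (rule tendsto_real_sqrt)
  then have "(%n. g (r n + N) x - f x) ----> 0"
   by (simp add: u_def tendsto_rabs_zero_iff)
  then show ?case by (simp add: LIM_zero_iff)
 qed
 have "AE x in lborel. \<forall>n. \<bar>g n x\<bar> <= M"
  using bounded_L1D(3)[OF g] by (simp add: AE_all_countable)
 then have ae: "AE x in lborel. \<bar>f x\<bar> <= M"
  using conv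
 proof eventually_elim
  case (elim x)
  have "(%n. \<bar>g (r n + N) x\<bar>) ----> \<bar>f x\<bar>" using elim by (intro tendsto_intros) auto
  then show ?case by (rule LIMSEQ_le_const2) (use elim in auto)
 qed
 have le: "(NN x. ennreal (norm (f x))) <= ennreal M"
 proof -
  have "(NN x. ennreal (norm (f x))) <= (NN x. liminf (%n. ennreal (norm (g (r n + N) x))))"
  proof (rule nn_integral_mono_AE, use conv in eventually_elim)
   case (elim x)
   have "(%n. ennreal (norm (g (r n + N) x))) ----> ennreal (norm (f x))"
    using elim by (intro tendsto_ennrealI tendsto_norm)
   from lim_imp_Liminf[OF sequentially_bot this] show ?case by simp
  qed
  also have "... <= liminf (%n. NN x. ennreal (norm (g (r n + N) x)))"
   by (rule nn_integral_liminf) measurable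
  also have "... <= liminf (%n::nat. ennreal M)"
  proof (intro Liminf_mono always_eventually allI)
   fix n
   show "(NN x. ennreal (norm (g (r n + N) x))) <= ennreal M"
    using bounded_L1D(1,2)[OF g[of "r n + N"]] by (subst nn_integral_eq_integral) (auto intro: ennreal_leI)
  qed
  also have "... = ennreal M" by (simp add: Liminf_const)
  finally show ?thesis .
 qed
 have i: "ilb f"
  by (rule integrableI_bounded) (use le in \<open>auto intro: order_le_less_trans\<close>)
 then have "(LB x. \<bar>f x\<bar>) <= M"
  using le bounded_L1D(5)[OF g] by (subst (asm) nn_integral_eq_integral) (auto simp: ennreal_le_iff)
 then show ?thesis using i ae by (simp add: bounded_L1_def)
qed

lemma space_time_section:
 assumes "(%(t,x). f t x) \<in> borel_measurable (space_time T)" and "t \<in> {0..T}"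
 shows "f t \<in> bmb"
proof -
 have "t \<in> space (time_interval T)" using assms(2) by (simp add: space_restrict_space)
 from measurable_compose[OF measurable_Pair1'[OF this] assms(1)] show ?thesis by simp
qed

text \<open>The essential supremum controls almost every time only. Such times accumulate at every
  \<open>t\<close>, and continuity in \<open>L^2\<close> transfers the bounds, so each single time
  section is controlled.\<close>

lemma solution_bounded_L1:
 fixes f :: "real => 'a::euclidean_space => real"
 assumes T: "T > 0" and m: "(%(t,x). f t x) \<in> borel_measurable (space_time T)"
  and c: "continuous_L2 T f" and M: "Linf_L1_Linf_norm T f <= ennreal M" and M0: "M \<ge> 0" and t: "t \<in> {0..T}"
 shows "bounded_L1 M (f t)"
proof -
 have good: "bounded_L1 M (f s)" if s: "s \<in> {0..T}" and le: "L1norm lborel (f s) + Linfnorm lborel (f s) <= ennreal M" for s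
 proof -
  have [measurable]: "f s \<in> bmb" by (rule space_time_section[OF m s])
  have "L1norm lborel (f s) <= ennreal M" by (rule order_trans[OF _ le]) simp
  then have 1: "(NN x. ennreal (norm (f s x))) <= ennreal M" by (simp add: L1norm_def)
  have 2: "Linfnorm lborel (f s) <= ennreal M" by (rule order_trans[OF _ le]) simp
  have i: "ilb (f s)"
   by (rule integrableI_bounded) (use 1 in \<open>auto intro: order_le_less_trans\<close>)
  have "AE x in lborel. ennreal \<bar>f s x\<bar> <= Linfnorm lborel (f s)"
   unfolding Linfnorm_def by (rule esssup_AE)
  then have "AE x in lborel. \<bar>f s x\<bar> <= M"
  proof eventually_elim
   case (elim x)
   then show ?case using order_trans[OF elim 2] M0 by (simp add: ennreal_le_iff)
  qed
  moreover have "(LB x. \<bar>f s x\<bar>) <= M"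
   using 1 M0 i by (subst (asm) nn_integral_eq_integral) (auto simp: ennreal_le_iff)
  ultimately show ?thesis using i by (simp add: bounded_L1_def)
 qed
 have "AE s in time_interval T. L1norm lborel (f s) + Linfnorm lborel (f s) <= Linf_L1_Linf_norm T f"
  unfolding Linf_L1_Linf_norm_def by (rule esssup_AE)
 then have "AE s in lborel. s \<in> {0..T} --> L1norm lborel (f s) + Linfnorm lborel (f s) <= Linf_L1_Linf_norm T f"
  by (subst (asm) AE_restrict_space_iff) auto
 then have ae: "AE s in lborel. s \<in> {0..T} --> s ~= t \<and> bounded_L1 M (f s)"
  using AE_lborel_singleton[of t] by eventually_elim (use good M in \<open>auto intro: order_trans\<close>)
 \<comment> \<open>If no good time lay near \<open>t\<close>, a nondegenerate interval at
   \<open>t\<close> would be null. The interval is cut to \<open>{0..T}\<close>, so endpoints are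
   included.\<close>
 have ex: "\<exists>s. s \<in> {0..T} \<and> s ~= t \<and> bounded_L1 M (f s) \<and> dist s t < d" if d: "d > 0" for d
 proof (rule ccontr)
  assume n: "\<not> ?thesis"
  define l where "l = max 0 (t - d / 2)"
  define u where "u = min T (t + d / 2)"
  have lu: "l < u" using T t d by (auto simp: l_def u_def)
  have "AE s in lborel. s \<notin> {l..u}"
   using ae
  proof eventually_elim
   case (elim s)
   show ?case
   proof
    assume "s \<in> {l..u}"
    then have "s \<in> {0..T}" "dist s t < d" using t d by (auto simp: l_def u_def dist_real_def)
    then show False using elim n by blast
   qed
  qed
  then have "{l..u} \<in> null_sets lborel" by (rule iffD2[OF AE_iff_null_sets, rotated]) auto
  then show False using lu by (auto simp: null_sets_def)
 qed
 define s where "s n = (SOME s. s \<in> {0..T} \<and> s ~= t \<and> bounded_L1 M (f s) \<and> dist s t < inverse (real (Suc n)))" for n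
 have s: "s n \<in> {0..T}" "s n ~= t" "bounded_L1 M (f (s n))" "dist (s n) t < inverse (real (Suc n))" for n
  using someI_ex[OF ex[of "inverse (real (Suc n))"]] by (auto simp: s_def)
 have st: "s ----> t"
 proof (rule metric_LIMSEQ_I)
  fix r :: real assume "r > 0"
  then obtain N where N: "inverse (real (Suc N)) < r" using reals_Archimedean by blast
  have "dist (s n) t < r" if "n \<ge> N" for n
  proof -
   have "inverse (real (Suc n)) <= inverse (real (Suc N))" using that by (intro le_imp_inverse_le) auto
   then show ?thesis using s(4)[of n] N by linarith
  qed
  then show "\<exists>no. \<forall>n\<ge>no. dist (s n) t < r" by blast
 qed
 then have "filterlim s (at t within {0..T}) sequentially"
  using s by (auto simp: filterlim_at intro!: always_eventually)
 moreover have "((%r. L2norm lborel (%x. f r x - f t x)) \<longlongrightarrow> 0) (at t within {0..T})"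
  using c t by (simp add: continuous_L2_def)
 ultimately have "(%n. L2norm lborel (%x. f (s n) x - f t x)) ----> 0"
  by (rule filterlim_compose[rotated])
 from L2norm_tendsto_0[OF this] show ?thesis
  by (rule bounded_L1_limit[OF s(3) space_time_section[OF m t]])
qed

text \<open>Cauchy-Schwarz against the square integrable test function turns continuity in
  \<open>L^2\<close> into continuity of the pairing.\<close>

lemma continuous_on_pairing:
 fixes f :: "real => 'a::euclidean_space => real"
 assumes m: "(%(t,x). f t x) \<in> borel_measurable (space_time T)"
  and c: "continuous_L2 T f" and f: "!!t. t \<in> {0..T} ==> ilb (f t)" and \<psi>: "test_function \<psi>"
 shows "continuous_on {0..T} (%t. LB x. \<psi> x * f t x)"
 unfolding continuous_on_def
proof
 fix t assume t: "t \<in> {0..T}"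
 have [measurable]: "\<psi> \<in> bmb" by (rule test_function_measurable[OF \<psi>])
 obtain B where B: "B > 0" "!!x. \<bar>\<psi> x\<bar> <= B" using test_function_bounded[OF \<psi>] by metis
 define C where "C = (LB x. (\<psi> x)^2)"
 have "ilb (%x. \<psi> x *\<^sub>R \<psi> x)"
  by (rule integrable_scaleR_bounded[OF test_function_integrable[OF \<psi>], where B=B]) (use B in auto)
 then have Ci: "ilb (%x. (\<psi> x)^2)" by (simp add: power2_eq_square)
 have C: "(NN x. ennreal ((\<psi> x)^2)) = ennreal C" "C \<ge> 0"
  unfolding C_def using nn_integral_eq_integral[OF Ci] by auto
 have i: "ilb (%x. \<psi> x * f r x)" if "r \<in> {0..T}" for r
  using integrable_scaleR_bounded[OF f[OF that], of \<psi> B] B by simp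
 have est: "ennreal (((LB x. \<psi> x * f r x) - (LB x. \<psi> x * f t x))^2)
  <= ennreal C * (NN x. ennreal ((f r x - f t x)^2))" if r: "r \<in> {0..T}" for r
 proof -
  note [measurable] = space_time_section[OF m r] space_time_section[OF m t]
  have eq: "(LB x. \<psi> x * f r x) - (LB x. \<psi> x * f t x) = (LB x. \<psi> x * (f r x - f t x))"
   unfolding right_diff_distrib by (rule Bochner_Integration.integral_diff[OF i[OF r] i[OF t], symmetric])
  have "ennreal (((LB x. \<psi> x * f r x) - (LB x. \<psi> x * f t x))^2)
   = (ennreal (norm (LB x. \<psi> x * (f r x - f t x))))^2"
   unfolding eq by (simp add: ennreal_power)
  also have "... <= (NN x. ennreal \<bar>\<psi> x\<bar> * ennreal \<bar>f r x - f t x\<bar>)^2"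
   by (intro power_mono order_trans[OF ennreal_norm_integral_le]) (auto simp: abs_mult ennreal_mult)
  also have "... <= (NN x. (ennreal \<bar>\<psi> x\<bar>)^2) * (NN x. (ennreal \<bar>f r x - f t x\<bar>)^2)"
   by (rule Cauchy_Schwarz_nn_integral) measurable
  finally show ?thesis by (simp add: ennreal_power C(1))
 qed
 have lim: "((%r. NN x. ennreal ((f r x - f t x)^2)) \<longlongrightarrow> 0) (at t within {0..T})"
  using c t by (intro L2norm_tendsto_0) (simp add: continuous_L2_def)
 show "((%t. LB x. \<psi> x * f t x) \<longlongrightarrow> (LB x. \<psi> x * f t x)) (at t within {0..T})"
 proof (rule tendstoI)
  fix e :: real assume e: "e > 0"
  \<comment> \<open>Chosen so that \<open>C * d < e^2\<close>; the \<open>C + 1\<close> also covers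
    a vanishing test function.\<close>
  define d where "d = e^2 / (C + 1)"
  have d: "d > 0" using e C by (simp add: d_def)
  have "C / (C + 1) < 1" using C by simp
  then have Cd: "C * d < e^2" using e mult_strict_right_mono[of "C / (C + 1)" 1 "e^2"] by (simp add: d_def)
  have "\<forall>\<^sub>F r in at t within {0..T}. (NN x. ennreal ((f r x - f t x)^2)) < ennreal d"
   using d by (intro order_tendstoD[OF lim]) simp
  moreover have "\<forall>\<^sub>F r in at t within {0..T}. r \<in> {0..T}"
   by (simp add: eventually_at_filter)
  ultimately show "\<forall>\<^sub>F r in at t within {0..T}. dist (LB x. \<psi> x * f r x) (LB x. \<psi> x * f t x) < e"
  proof eventually_elim
   case (elim r)
   have "ennreal (((LB x. \<psi> x * f r x) - (LB x. \<psi> x * f t x))^2) <= ennreal C * ennreal d"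
    by (rule order_trans[OF est[OF elim(2)] mult_left_mono]) (use elim(1) in auto)
   then have "((LB x. \<psi> x * f r x) - (LB x. \<psi> x * f t x))^2 <= C * d"
    using C d by (simp add: ennreal_mult[symmetric] ennreal_le_iff)
   then have "\<bar>(LB x. \<psi> x * f r x) - (LB x. \<psi> x * f t x)\<bar>^2 < e^2"
    using Cd by simp
   then show ?case unfolding dist_real_def by (rule power2_less_imp_less) (use e in simp)
  qed
 qed
qed

text \<open>Freezing a solution outside \<open>{0..T}\<close> makes every time section admissible,
  and Fubini can run over Lebesgue measure on the line instead of a restricted space.\<close>

definition time_clamp :: "real => real => real" where
 "time_clamp T t = max 0 (min T t)"

lemma time_clamp_in: "T \<ge> 0 ==> time_clamp T t \<in> {0..T}"
 by (auto simp: time_clamp_def)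

lemma time_clamp_id: "t \<in> {0..T} ==> time_clamp T t = t"
 by (auto simp: time_clamp_def)

lemma time_clamp_measurable_pair:
 assumes "(%(t,x). f t x) \<in> borel_measurable (space_time T)" "T \<ge> 0"
 shows "(%(t,x). f (time_clamp T t) x) \<in> borel_measurable (lborel \<Otimes>\<^sub>M lborel)"
proof -
 have "time_clamp T \<in> borel_measurable lborel"
  unfolding time_clamp_def[abs_def] by measurable
 then have "time_clamp T \<in> lborel \<rightarrow>\<^sub>M time_interval T"
  using time_clamp_in[OF assms(2)] by (intro measurable_restrict_space2) auto
 then have "(%p. (time_clamp T (fst p), snd p)) \<in> lborel \<Otimes>\<^sub>M lborel \<rightarrow>\<^sub>M space_time T"
  by (intro measurable_Pair measurable_snd measurable_compose[OF measurable_fst])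
 from measurable_compose[OF this assms(1)] show ?thesis by (simp add: case_prod_beta')
qed

lemma test_function_tensor:
 fixes \<eta> :: "real => real" and \<psi> :: "'a::euclidean_space => real"
 assumes \<eta>: "test_function \<eta>" and \<psi>: "test_function \<psi>"
 shows "test_function (%p. \<eta> (fst p) * \<psi> (snd p))"
  and "dir_deriv (1, 0) (%p. \<eta> (fst p) * \<psi> (snd p)) (t, x) = dir_deriv 1 \<eta> t * \<psi> x"
  and "supp (%p. \<eta> (fst p) * \<psi> (snd p)) \<subseteq> supp \<eta> \<times> supp \<psi>"
proof -
 have cs: "compact (supp \<eta> \<times> supp \<psi>)"
  using \<eta> \<psi> by (intro compact_Times) (auto simp: test_function_def)
 have sub: "p \<in> supp \<eta> \<times> supp \<psi>" if "\<eta> (fst p) * \<psi> (snd p) ~= 0" for p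
  using that supp_supset[of \<eta> "fst p"] supp_supset[of \<psi> "snd p"] by (cases p) auto
 show "test_function (%p. \<eta> (fst p) * \<psi> (snd p))"
 proof (rule test_functionI[OF _ cs sub])
  fix k
  have "Ck k (%p::real\<times>'a. \<eta> (0 + fst p))" "Ck k (%p::real\<times>'a. \<psi> (0 + snd p))"
   using \<eta> \<psi> by (intro Ck_affine bounded_linear_fst bounded_linear_snd; simp add: test_function_def)+
  then show "Ck k (%p::real\<times>'a. \<eta> (fst p) * \<psi> (snd p))" using Ck_mult by fastforce
 qed
 show "supp (%p. \<eta> (fst p) * \<psi> (snd p)) \<subseteq> supp \<eta> \<times> supp \<psi>"
  by (rule supp_subset[OF compact_imp_closed[OF cs] sub])
 have "((%p. \<eta> (fst p)) has_derivative (%v. dir_deriv (fst v) \<eta> t)) (at (t, x))"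
  using has_derivative_compose[OF bounded_linear_imp_has_derivative[OF bounded_linear_fst], of \<eta> _ "(t,x)"]
   test_function_has_derivative[OF \<eta>, of t] by simp
 moreover have "((%p. \<psi> (snd p)) has_derivative (%v. dir_deriv (snd v) \<psi> x)) (at (t, x))"
  using has_derivative_compose[OF bounded_linear_imp_has_derivative[OF bounded_linear_snd], of \<psi> _ "(t,x)"]
   test_function_has_derivative[OF \<psi>, of x] by simp
 ultimately have "((%p. \<eta> (fst p) * \<psi> (snd p)) has_derivative (%v. \<eta> (fst (t,x)) * dir_deriv (snd v) \<psi> x + dir_deriv (fst v) \<eta> t * \<psi> (snd (t,x)))) (at (t, x))"
  by (rule has_derivative_mult)
 from dir_deriv_eq[OF this, of "(1,0)"]
 have "dir_deriv (1, 0) (%p. \<eta> (fst p) * \<psi> (snd p)) (t, x) = \<eta> t * dir_deriv 0 \<psi> x + dir_deriv 1 \<eta> t * \<psi> x"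
  by simp
 also have "dir_deriv 0 \<psi> x = 0" using linear_0[OF test_function_dir_deriv_linear[OF \<psi>]] .
 finally show "dir_deriv (1, 0) (%p. \<eta> (fst p) * \<psi> (snd p)) (t, x) = dir_deriv 1 \<eta> t * \<psi> x" by simp
qed

lemma dir_deriv_cmult:
 assumes "test_function \<psi>" shows "dir_deriv v (%y. c * \<psi> y) = (%x. c * dir_deriv v \<psi> x)"
 by (intro ext dir_deriv_eq has_derivative_mult_right test_function_has_derivative assms)

lemma gradient_cmult:
 assumes "test_function \<psi>" shows "gradient (%y. c * \<psi> y) x = c *\<^sub>R gradient \<psi> x"
 by (simp add: gradient_def dir_deriv_cmult[OF assms] scaleR_sum_right)

lemma laplacian_cmult:
 assumes "test_function \<psi>" shows "laplacian (%y. c * \<psi> y) x = c * laplacian \<psi> x"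
 by (simp add: laplacian_def dir_deriv_cmult[OF assms] dir_deriv_cmult[OF test_function_dir_deriv[OF assms]] sum_distrib_left)

lemma inner_gradient: "w \<bullet> gradient \<psi> x = (SB b. dir_deriv b \<psi> x * (w \<bullet> b))"
 by (simp add: gradient_def inner_sum_right)

text \<open>What \<open>fokker_planck\<close> asks for apart from the equation itself. It is kept
  separate because regularity of the source term is needed while the equation is still being
  established.\<close>

definition flux_data ::
 "real => (real => 'a::euclidean_space => 'c::euclidean_space) => ('a => real => 'a => 'c) => bool" where
 "flux_data M f F \<longleftrightarrow>
  (%(t,x). f t x) \<in> borel_measurable (lborel \<Otimes>\<^sub>M lborel) \<and>
  (\<forall>b\<in>Basis. (%(t,x). F b t x) \<in> borel_measurable (lborel \<Otimes>\<^sub>M lborel)) \<and>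
  (\<forall>t. ilb (f t) \<and> (LB x. norm (f t x)) <= M) \<and>
  (\<forall>b\<in>Basis. \<forall>t. ilb (F b t) \<and> (LB x. norm (F b t x)) <= M)"

lemma fokker_planck_flux_data: "fokker_planck T \<sigma> M f F ==> flux_data M f F"
 by (simp add: fokker_planck_def flux_data_def)

text \<open>The right-hand side of the tested equation has to be a bounded measurable function of
  time before primitives of it make sense.\<close>

lemma source_measurable_bounded:
 fixes f :: "real => 'a::euclidean_space => 'c::euclidean_space"
 assumes fd: "flux_data M f F"
  and \<psi>: "test_function \<psi>"
 shows "!!t. ilb (%x. \<psi> x *\<^sub>R f t x)"
  and "!!r. ilb (%x. (\<sigma> * laplacian \<psi> x) *\<^sub>R f r x - (SB b. dir_deriv b \<psi> x *\<^sub>R F b r x))"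
  and "(%r. LB x. (\<sigma> * laplacian \<psi> x) *\<^sub>R f r x - (SB b. dir_deriv b \<psi> x *\<^sub>R F b r x)) \<in> bmb"
  and "\<exists>P. \<forall>r. norm (LB x. (\<sigma> * laplacian \<psi> x) *\<^sub>R f r x - (SB b. dir_deriv b \<psi> x *\<^sub>R F b r x)) <= P"
proof -
 have fm: "(%(t,x). f t x) \<in> borel_measurable (lborel \<Otimes>\<^sub>M lborel)"
  and Fm: "!!b. b \<in> Basis ==> (%(t,x). F b t x) \<in> borel_measurable (lborel \<Otimes>\<^sub>M lborel)"
  and fi: "!!t. ilb (f t)" "!!t. (LB x. norm (f t x)) <= M"
  and Fi: "!!b t. b \<in> Basis ==> ilb (F b t)" "!!b t. b \<in> Basis ==> (LB x. norm (F b t x)) <= M"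
  using fd by (auto simp: flux_data_def)
 define lap where "lap x = laplacian \<psi> x" for x
 define I where "I r x = (\<sigma> * lap x) *\<^sub>R f r x - (SB b. dir_deriv b \<psi> x *\<^sub>R F b r x)" for r x
 have M0: "M \<ge> 0" by (rule order_trans[OF _ fi(2)]) simp
 have td: "test_function (dir_deriv b \<psi>)" "test_function (dir_deriv b (dir_deriv b \<psi>))" for b
  using \<psi> test_function_dir_deriv by auto
 have dmeas[measurable]: "dir_deriv b \<psi> \<in> bmb" "dir_deriv b (dir_deriv b \<psi>) \<in> bmb" for b
  by (rule test_function_measurable[OF td(1)], rule test_function_measurable[OF td(2)])
 have [measurable]: "\<psi> \<in> bmb" by (rule test_function_measurable[OF \<psi>])
 have lapm[measurable]: "lap \<in> bmb"
  unfolding lap_def[abs_def] laplacian_def by (intro borel_measurable_sum dmeas)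
 have "\<exists>B>0. \<forall>x. \<bar>dir_deriv b (dir_deriv b \<psi>) x\<bar> <= B" "\<exists>B>0. \<forall>x. \<bar>dir_deriv b \<psi> x\<bar> <= B" for b
  using test_function_bounded[OF td(1)] test_function_bounded[OF td(2)] by metis+
 then obtain b1 b2 where b1: "!!b. b1 b > 0" "!!b x. \<bar>dir_deriv b (dir_deriv b \<psi>) x\<bar> <= b1 b"
  and b2: "!!b. b2 b > 0" "!!b x. \<bar>dir_deriv b \<psi> x\<bar> <= b2 b" by metis
 have lapb: "\<bar>lap x\<bar> <= (SB b. b1 b)" for x
  unfolding lap_def laplacian_def by (rule order_trans[OF sum_abs]) (intro sum_mono b1)
 obtain b0 where b0: "b0 > 0" "!!x. \<bar>\<psi> x\<bar> <= b0" using test_function_bounded[OF \<psi>] by metis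
 show "ilb (%x. \<psi> x *\<^sub>R f t x)" for t
  by (rule integrable_scaleR_bounded[OF fi(1), where B=b0]) (use b0 in auto)
 have i1: "ilb (%x. (\<sigma> * lap x) *\<^sub>R f t x)" for t
  by (rule integrable_scaleR_bounded[OF fi(1), where B="\<bar>\<sigma>\<bar> * (SB b. b1 b)"])
   (use lapb in \<open>auto simp: abs_mult intro!: mult_left_mono\<close>)
 have i2: "ilb (%x. dir_deriv b \<psi> x *\<^sub>R F b t x)" if "b \<in> Basis" for b t
  by (rule integrable_scaleR_bounded[OF Fi(1)[OF that], where B="b2 b"]) (use b2 in auto)
 have Ii: "ilb (I t)" for t
  unfolding I_def[abs_def] by (intro Bochner_Integration.integrable_diff Bochner_Integration.integrable_sum i1 i2)
 then show "ilb (%x. (\<sigma> * laplacian \<psi> x) *\<^sub>R f r x - (SB b. dir_deriv b \<psi> x *\<^sub>R F b r x))" for r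
  unfolding I_def[abs_def] lap_def .
 define p where "p t = (LB x. I t x)" for t
 define P where "P = \<bar>\<sigma>\<bar> * (\<Sum>b\<in>(Basis::'a set). b1 b) * M + (\<Sum>b\<in>(Basis::'a set). b2 b * M)"
 have pP: "norm (p t) <= P" for t
 proof -
  have "p t = (LB x. (\<sigma> * lap x) *\<^sub>R f t x) - (SB b. LB x. dir_deriv b \<psi> x *\<^sub>R F b t x)"
   unfolding p_def I_def
   by (subst Bochner_Integration.integral_diff[OF i1 Bochner_Integration.integrable_sum[OF i2]], assumption,
     subst Bochner_Integration.integral_sum[OF i2], assumption) (rule refl)
  also have "norm ... <= norm (LB x. (\<sigma> * lap x) *\<^sub>R f t x) + (SB b. norm (LB x. dir_deriv b \<psi> x *\<^sub>R F b t x))"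
   by (intro order_trans[OF norm_triangle_ineq4] add_left_mono norm_sum)
  also have "... <= P" unfolding P_def
  proof (intro add_mono sum_mono)
   have "norm (LB x. (\<sigma> * lap x) *\<^sub>R f t x) <= (\<bar>\<sigma>\<bar> * (\<Sum>b\<in>(Basis::'a set). b1 b)) * (LB x. norm (f t x))"
    by (rule norm_integral_scaleR_bounded[OF fi(1)]) (use lapb in \<open>auto simp: abs_mult intro!: mult_left_mono\<close>)
   also have "... <= (\<bar>\<sigma>\<bar> * (\<Sum>b\<in>(Basis::'a set). b1 b)) * M"
    using fi(2)[of t] b1 by (intro mult_left_mono mult_nonneg_nonneg sum_nonneg) (auto intro: less_imp_le)
   finally show "norm (LB x. (\<sigma> * lap x) *\<^sub>R f t x) <= \<bar>\<sigma>\<bar> * (\<Sum>b\<in>(Basis::'a set). b1 b) * M" .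
   fix b :: 'a assume b: "b \<in> Basis"
   have "norm (LB x. dir_deriv b \<psi> x *\<^sub>R F b t x) <= b2 b * (LB x. norm (F b t x))"
    by (rule norm_integral_scaleR_bounded[OF Fi(1)[OF b]]) (use b2 in auto)
   also have "... <= b2 b * M" using Fi(2)[OF b, of t] b2(1)[of b] by (intro mult_left_mono) auto
   finally show "norm (LB x. dir_deriv b \<psi> x *\<^sub>R F b t x) <= b2 b * M" .
  qed
  finally show ?thesis .
 qed
 then show "\<exists>P. \<forall>r. norm (LB x. (\<sigma> * laplacian \<psi> x) *\<^sub>R f r x - (SB b. dir_deriv b \<psi> x *\<^sub>R F b r x)) <= P"
  unfolding p_def I_def lap_def by blast
 have "(%w. I (fst w) (snd w)) \<in> borel_measurable (lborel \<Otimes>\<^sub>M lborel)"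
  unfolding I_def
 proof (intro borel_measurable_diff borel_measurable_sum borel_measurable_scaleR)
  show "(%w. f (fst w) (snd w)) \<in> borel_measurable (lborel \<Otimes>\<^sub>M lborel)" using fm by (simp add: case_prod_beta')
  show "(%w. F b (fst w) (snd w)) \<in> borel_measurable (lborel \<Otimes>\<^sub>M lborel)" if "b \<in> Basis" for b
   using Fm[OF that] by (simp add: case_prod_beta')
 qed measurable
 then have "(%t. LB x. I t x) \<in> borel_measurable lborel"
  by (intro lborel.borel_measurable_lebesgue_integral) (simp add: case_prod_beta')
 then show "(%r. LB x. (\<sigma> * laplacian \<psi> x) *\<^sub>R f r x - (SB b. dir_deriv b \<psi> x *\<^sub>R F b r x)) \<in> bmb"
  by (simp add: I_def lap_def)
qed

text \<open>Product test functions suffice: with a fixed spatial factor the equation says that the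
  pairing with it has a bounded weak derivative in time. The pairing is continuous, so the
  integrated identity holds at all times. The constant \<open>M + B * M\<close> bounds the density
  and the flux at once.\<close>

lemma weak_solution_imp_fokker_planck:
 fixes f :: "real => 'a::euclidean_space => real" and d :: "real => 'a => 'a"
 assumes T: "T > 0" and m: "(%(t,x). f t x) \<in> borel_measurable (space_time T)"
  and c: "continuous_L2 T f" and bd: "!!t. t \<in> {0..T} ==> bounded_L1 M (f t)"
  and dm: "(%(t,x). d t x) \<in> borel_measurable (lborel \<Otimes>\<^sub>M lborel)" and db: "!!t x. norm (d t x) <= B"
  and k: "!!h. h > 0 ==> bump h (k h :: real => real)"
  and weak: "!!\<phi> :: real \<times> 'a => real. test_function \<phi> ==> supp \<phi> \<subseteq> {0<..<T} \<times> UNIV ==>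
   has_bochner_integral (space_time T) (%(t,x). f t x * (dir_deriv (1, 0) \<phi> (t, x)
     - d t x \<bullet> gradient (%y. \<phi> (t, y)) x + \<sigma> * laplacian (%y. \<phi> (t, y)) x)) 0"
 shows "fokker_planck T \<sigma> (M + B * M) (%t. f (time_clamp T t)) (%b t x. (d t x \<bullet> b) * f (time_clamp T t) x)"
proof -
 define g where "g t = f (time_clamp T t)" for t
 have gm[measurable]: "(%(t,x). g t x) \<in> borel_measurable (lborel \<Otimes>\<^sub>M lborel)"
  unfolding g_def by (rule time_clamp_measurable_pair[OF m]) (use T in simp)
 note dm[measurable]
 have gb: "bounded_L1 M (g t)" for t unfolding g_def by (rule bd[OF time_clamp_in]) (use T in simp)
 have gf: "g t = f t" if "t \<in> {0..T}" for t using that by (simp add: g_def time_clamp_id)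
 note gi = bounded_L1D[OF gb]
 have [measurable]: "g t \<in> bmb" for t by (rule gi(4))
 have [measurable]: "d t \<in> bmb" for t
  using measurable_compose[OF measurable_Pair1'[of t lborel lborel] dm] by (simp add: space_pair_measure)
 have B0: "B \<ge> 0" using order_trans[OF norm_ge_zero db] .
 have dbb: "\<bar>d t x \<bullet> b\<bar> <= B" if "b \<in> Basis" for t x b
  using Basis_le_norm[OF that, of "d t x"] db[of t x] by linarith
 define F where "F b t x = (d t x \<bullet> b) * g t x" for b t x
 have Fi: "ilb (F b t)" if "b \<in> Basis" for b t
  using integrable_scaleR_bounded[OF gi(1)[of t], of "%x. d t x \<bullet> b" B] dbb[OF that] by (simp add: F_def[abs_def])
 have FL1: "(LB x. norm (F b t x)) <= B * M" if "b \<in> Basis" for b t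
 proof -
  have "(LB x. norm (F b t x)) <= (LB x. B * \<bar>g t x\<bar>)"
   using gi(1)[of t] by (intro integral_mono integrable_norm Fi that)
    (auto simp: F_def abs_mult intro!: mult_right_mono dbb that)
  also have "... = B * (LB x. \<bar>g t x\<bar>)" by simp
  also have "... <= B * M" using gi(2)[of t] B0 by (rule mult_left_mono)
  finally show ?thesis .
 qed
 have M0: "M \<ge> 0" using gi(5) .
 have gn: "(LB x. norm (g t x)) <= M + B * M" for t
  using gi(2)[of t] mult_nonneg_nonneg[OF B0 M0] by simp
 have Fn: "(LB x. norm (F b t x)) <= M + B * M" if "b \<in> Basis" for b t
  using FL1[OF that, of t] M0 by simp
 have Fm: "(%(t,x). F b t x) \<in> borel_measurable (lborel \<Otimes>\<^sub>M lborel)" for b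
  unfolding F_def case_prod_beta'
  by (intro borel_measurable_times borel_measurable_inner borel_measurable_const)
   (use gm dm in \<open>simp_all add: case_prod_beta'\<close>)
 have fd: "flux_data (M + B * M) g F"
  unfolding flux_data_def using gm Fm gi(1) gn Fi Fn by auto
 show ?thesis
  unfolding fokker_planck_def g_def[symmetric] F_def[symmetric]
 proof (intro conjI allI ballI impI)
  show "(%(t,x). g t x) \<in> borel_measurable (lborel \<Otimes>\<^sub>M lborel)" by (rule gm)
  fix b :: 'a assume b: "b \<in> Basis"
  show "(%(t,x). F b t x) \<in> borel_measurable (lborel \<Otimes>\<^sub>M lborel)" by (rule Fm)
  fix t
  show "ilb (F b t)" by (rule Fi[OF b])
  show "(LB x. norm (F b t x)) <= M + B * M" by (rule Fn[OF b])
 next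
  fix t
  show "ilb (g t)" by (rule gi)
  show "(LB x. norm (g t x)) <= M + B * M" by (rule gn)
 next
  fix \<psi> :: "'a => real" and t assume \<psi>: "test_function \<psi>" and t: "t \<in> {0..T}"
  define I where "I t x = (\<sigma> * laplacian \<psi> x) *\<^sub>R g t x - (SB b. dir_deriv b \<psi> x *\<^sub>R F b t x)" for t x
  define p where "p t = (LB x. I t x)" for t
  note src = source_measurable_bounded[OF fd \<psi>]
  note i0 = src(1)
  have Ii: "ilb (I t)" for t using src(2)[where \<sigma>=\<sigma> and r=t] unfolding I_def[abs_def] .
  have pm: "p \<in> bmb" using src(3)[where \<sigma>=\<sigma>] unfolding p_def[abs_def] I_def[abs_def] .
  obtain P where pP: "!!t. norm (p t) <= P"
   using src(4)[where \<sigma>=\<sigma>] unfolding p_def[abs_def] I_def[abs_def] by blast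
  define G where "G t = (LB x. \<psi> x * g t x)" for t
  have Gc: "continuous_on {0..T} G"
  proof -
   have "continuous_on {0..T} (%t. LB x. \<psi> x * f t x)"
    by (rule continuous_on_pairing[OF m c _ \<psi>]) (use bd bounded_L1D(1) in blast)
   then show ?thesis by (rule continuous_on_eq) (simp add: G_def gf)
  qed
  have "G t - G 0 = (LB r. indicator {0..t} r *\<^sub>R p r)"
  \<comment> \<open>The weak formulation is tested with the product of the time factor and the
    spatial one, and Fubini separates the two variables.\<close>
  proof (rule weak_derivative_imp_integral[OF T Gc pm pP k _ t])
   fix \<eta> :: "real => real" assume \<eta>: "test_function \<eta>" and s: "supp \<eta> \<subseteq> {0<..<T}"
   define \<phi> where "\<phi> w = \<eta> (fst w) * \<psi> (snd w)" for w :: "real \<times> 'a"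
   note tt = test_function_tensor[OF \<eta> \<psi>, folded \<phi>_def]
   have "supp \<phi> \<subseteq> {0<..<T} \<times> UNIV" using tt(3) s by blast
   note w = weak[OF tt(1) this]
   define H where "H t x = f t x * (dir_deriv (1, 0) \<phi> (t, x) - d t x \<bullet> gradient (%y. \<phi> (t, y)) x + \<sigma> * laplacian (%y. \<phi> (t, y)) x)" for t x
   have \<phi>t: "(%y. \<phi> (t, y)) = (%y. \<eta> t * \<psi> y)" for t by (simp add: \<phi>_def)
   have H: "H t x = dir_deriv 1 \<eta> t * (\<psi> x *\<^sub>R g t x) + \<eta> t * I t x" if "t \<in> {0..T}" for t x
    unfolding H_def tt(2) \<phi>t gradient_cmult[OF \<psi>] laplacian_cmult[OF \<psi>] inner_scaleR_right inner_gradient I_def F_def gf[OF that]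
    by (simp add: algebra_simps sum_distrib_left)
   have iH: "(LB x. H t x) = dir_deriv 1 \<eta> t * G t + \<eta> t * p t" if "t \<in> {0..T}" for t
   proof -
    have "(LB x. H t x) = (LB x. dir_deriv 1 \<eta> t * (\<psi> x *\<^sub>R g t x) + \<eta> t * I t x)"
     by (simp only: H[OF that])
    also have "... = (LB x. dir_deriv 1 \<eta> t * (\<psi> x *\<^sub>R g t x)) + (LB x. \<eta> t * I t x)"
     by (rule Bochner_Integration.integral_add[OF integrable_mult_right[OF i0] integrable_mult_right[OF Ii]])
    finally show ?thesis by (simp add: G_def p_def)
   qed
   interpret TI: sigma_finite_measure "time_interval T"
    by (rule sigma_finite_measure_restrict_space) (auto intro: lborel.sigma_finite_measure_axioms)
   interpret PI: pair_sigma_finite "time_interval T" "lborel :: 'a measure" ..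
   have Hi: "integrable (space_time T) (%(t,x). H t x)" "(\<integral>w. (case w of (t,x) => H t x) \<partial>space_time T) = 0"
    using w unfolding H_def[symmetric] by (auto simp: has_bochner_integral_iff)
   have "(\<integral>t. (LB x. H t x) \<partial>time_interval T) = 0"
    using PI.integral_fst[OF Hi(1)] Hi(2) by simp
   then have "(LB t. indicator {0..T} t *\<^sub>R (LB x. H t x)) = 0"
    by (subst (asm) integral_restrict_space) (auto simp: set_lebesgue_integral_def)
   moreover have "indicator {0..T} t *\<^sub>R (LB x. H t x) = indicator {0..T} t *\<^sub>R (dir_deriv 1 \<eta> t * G t + \<eta> t * p t)" for t
    using iH[of t] by (auto split: split_indicator)
   ultimately show "(LB r. indicator {0..T} r *\<^sub>R (dir_deriv 1 \<eta> r * G r + \<eta> r * p r)) = 0"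
    by (simp only:)
  qed
  then show "(LB x. \<psi> x *\<^sub>R g t x) - (LB x. \<psi> x *\<^sub>R g 0 x) =
    (LB r. indicator {0..t} r *\<^sub>R (LB x. (\<sigma> * laplacian \<psi> x) *\<^sub>R g r x - (SB b. dir_deriv b \<psi> x *\<^sub>R F b r x)))"
   by (simp add: G_def p_def I_def)
 qed
qed

text \<open>Together with \<open>fokker_planck_add\<close> this builds the pair of a density with a
  mixture, and the difference of two solutions, without going back to the weak formulation.\<close>

lemma fokker_planck_linear:
 fixes L :: "'c::euclidean_space => 'd::euclidean_space" and f :: "real => 'a::euclidean_space => 'c"
 assumes fp: "fokker_planck T \<sigma> M f F" and L: "bounded_linear L" and K: "!!x. norm (L x) <= K * norm x" "K \<ge> 0"
 shows "fokker_planck T \<sigma> (K * M) (%t x. L (f t x)) (%b t x. L (F b t x))"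
proof -
 note D = fokker_planckD[OF fp]
 have Lm[measurable]: "L \<in> bmb"
  using L by (intro borel_measurable_continuous_onI linear_continuous_on)
 have meas: "(%(t,x). L (g t x)) \<in> borel_measurable (lborel \<Otimes>\<^sub>M lborel)"
  if "(%(t,x). g t x) \<in> borel_measurable (lborel \<Otimes>\<^sub>M lborel)" for g :: "real => 'a => 'c"
  using measurable_compose[OF that Lm] by (simp add: case_prod_beta')
 have li: "ilb (%x. L (g x))" "(LB x. L (g x)) = L (LB x. g x)"
  if "ilb g" for g :: "'a => 'c"
  using integrable_bounded_linear[OF L that] integral_bounded_linear[OF L that] by auto
 have ln: "(LB x. norm (L (g x))) <= K * M" if "ilb g" "(LB x. norm (g x)) <= M" for g :: "'a => 'c"
 proof -
  have "(LB x. norm (L (g x))) <= (LB x. K * norm (g x))"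
   using that li(1)[OF that(1)] K by (intro integral_mono integrable_norm) auto
  also have "... = K * (LB x. norm (g x))" by simp
  also have "... <= K * M" using that K by (intro mult_left_mono)
  finally show ?thesis .
 qed
 show ?thesis
  unfolding fokker_planck_def
 proof (intro conjI allI ballI impI)
  fix \<psi> :: "'a => real" and t assume \<psi>: "test_function \<psi>" and t: "t \<in> {0..T}"
  note src = source_measurable_bounded[OF fokker_planck_flux_data[OF fp] \<psi>]
  note iI = src(2)[where \<sigma>=\<sigma>]
  define p where "p r = (LB x. (\<sigma> * laplacian \<psi> x) *\<^sub>R f r x - (SB b. dir_deriv b \<psi> x *\<^sub>R F b r x))" for r
  have Lp: "(LB x. (\<sigma> * laplacian \<psi> x) *\<^sub>R L (f r x) - (SB b. dir_deriv b \<psi> x *\<^sub>R L (F b r x))) = L (p r)" for r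
   unfolding p_def li(2)[OF iI, symmetric]
   by (simp add: linear_diff[OF bounded_linear.linear[OF L]] linear_sum[OF bounded_linear.linear[OF L]] linear_scale[OF bounded_linear.linear[OF L]])
  have eq: "(LB x. \<psi> x *\<^sub>R f t x) - (LB x. \<psi> x *\<^sub>R f 0 x) = (LB r. indicator {0..t} r *\<^sub>R p r)"
   unfolding p_def by (rule D(7)[OF \<psi> t])
  have ip: "ilb (%r. indicator {0..t} r *\<^sub>R p r)"
  proof -
   obtain P where P: "!!r. norm (p r) <= P" using src(4)[where \<sigma>=\<sigma>] unfolding p_def by blast
   have "p \<in> bmb" using src(3)[where \<sigma>=\<sigma>] unfolding p_def[abs_def] .
   then show ?thesis using P by (rule integrable_Icc_bounded)
  qed
  have L1: "(LB x. \<psi> x *\<^sub>R L (f r x)) = L (LB x. \<psi> x *\<^sub>R f r x)" for r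
   unfolding li(2)[OF src(1), symmetric] by (simp add: linear_scale[OF bounded_linear.linear[OF L]])
  have "(LB x. \<psi> x *\<^sub>R L (f t x)) - (LB x. \<psi> x *\<^sub>R L (f 0 x))
   = L (LB r. indicator {0..t} r *\<^sub>R p r)"
   unfolding L1 eq[symmetric] by (simp add: linear_diff[OF bounded_linear.linear[OF L]])
  also have "... = (LB r. indicator {0..t} r *\<^sub>R L (p r))"
   unfolding integral_bounded_linear[OF L ip, symmetric] by (simp add: linear_scale[OF bounded_linear.linear[OF L]])
  finally show "(LB x. \<psi> x *\<^sub>R L (f t x)) - (LB x. \<psi> x *\<^sub>R L (f 0 x))
   = (LB r. indicator {0..t} r *\<^sub>R (LB x. (\<sigma> * laplacian \<psi> x) *\<^sub>R L (f r x) - (SB b. dir_deriv b \<psi> x *\<^sub>R L (F b r x))))"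
   unfolding Lp .
 qed (use D li ln meas in auto)
qed

lemma fokker_planck_add:
 fixes f g :: "real => 'a::euclidean_space => 'c::euclidean_space"
 assumes f: "fokker_planck T \<sigma> M f F" and g: "fokker_planck T \<sigma> N g G"
 shows "fokker_planck T \<sigma> (M + N) (%t x. f t x + g t x) (%b t x. F b t x + G b t x)"
proof -
 note D = fokker_planckD[OF f] and E = fokker_planckD[OF g]
 have meas: "(%(t,x). u t x + v t x) \<in> borel_measurable (lborel \<Otimes>\<^sub>M lborel)"
  if "(%(t,x). u t x) \<in> borel_measurable (lborel \<Otimes>\<^sub>M lborel)" "(%(t,x). v t x) \<in> borel_measurable (lborel \<Otimes>\<^sub>M lborel)"
  for u v :: "real => 'a => 'c"
  using that unfolding case_prod_beta' by (rule borel_measurable_add)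
 have ln: "ilb (%x. u x + v x) \<and> (LB x. norm (u x + v x)) <= M + N"
  if "ilb u" "(LB x. norm (u x)) <= M" "ilb v" "(LB x. norm (v x)) <= N"
  for u v :: "'a => 'c"
 proof -
  have "(LB x. norm (u x + v x)) <= (LB x. norm (u x) + norm (v x))"
   using that by (intro integral_mono norm_triangle_ineq) auto
  also have "... = (LB x. norm (u x)) + (LB x. norm (v x))" using that by simp
  finally show ?thesis using that by auto
 qed
 show ?thesis
  unfolding fokker_planck_def
 proof (intro conjI allI ballI impI)
  fix \<psi> :: "'a => real" and t assume \<psi>: "test_function \<psi>" and t: "t \<in> {0..T}"
  note src = source_measurable_bounded[OF fokker_planck_flux_data[OF f] \<psi>] and tgt = source_measurable_bounded[OF fokker_planck_flux_data[OF g] \<psi>]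
  define p where "p r = (LB x. (\<sigma> * laplacian \<psi> x) *\<^sub>R f r x - (SB b. dir_deriv b \<psi> x *\<^sub>R F b r x))" for r
  define q where "q r = (LB x. (\<sigma> * laplacian \<psi> x) *\<^sub>R g r x - (SB b. dir_deriv b \<psi> x *\<^sub>R G b r x))" for r
  have pq: "(LB x. (\<sigma> * laplacian \<psi> x) *\<^sub>R (f r x + g r x) - (SB b. dir_deriv b \<psi> x *\<^sub>R (F b r x + G b r x))) = p r + q r" for r
  proof -
   have "p r + q r = (LB x. ((\<sigma> * laplacian \<psi> x) *\<^sub>R f r x - (SB b. dir_deriv b \<psi> x *\<^sub>R F b r x))
    + ((\<sigma> * laplacian \<psi> x) *\<^sub>R g r x - (SB b. dir_deriv b \<psi> x *\<^sub>R G b r x)))"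
    unfolding p_def q_def by (rule Bochner_Integration.integral_add[OF src(2) tgt(2), symmetric])
   also have "... = (LB x. (\<sigma> * laplacian \<psi> x) *\<^sub>R (f r x + g r x) - (SB b. dir_deriv b \<psi> x *\<^sub>R (F b r x + G b r x)))"
    by (intro Bochner_Integration.integral_cong refl) (simp add: scaleR_add_right sum.distrib)
   finally show ?thesis by (rule sym)
  qed
  have ip: "ilb (%r. indicator {0..t} r *\<^sub>R p r)"
  proof -
   obtain P where P: "!!r. norm (p r) <= P" using src(4)[where \<sigma>=\<sigma>] unfolding p_def by blast
   have "p \<in> bmb" using src(3)[where \<sigma>=\<sigma>] unfolding p_def[abs_def] .
   then show ?thesis using P by (rule integrable_Icc_bounded)
  qed
  have iq: "ilb (%r. indicator {0..t} r *\<^sub>R q r)"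
  proof -
   obtain P where P: "!!r. norm (q r) <= P" using tgt(4)[where \<sigma>=\<sigma>] unfolding q_def by blast
   have "q \<in> bmb" using tgt(3)[where \<sigma>=\<sigma>] unfolding q_def[abs_def] .
   then show ?thesis using P by (rule integrable_Icc_bounded)
  qed
  have "(LB x. \<psi> x *\<^sub>R (f r x + g r x)) = (LB x. \<psi> x *\<^sub>R f r x) + (LB x. \<psi> x *\<^sub>R g r x)" for r
   unfolding scaleR_add_right by (rule Bochner_Integration.integral_add[OF src(1) tgt(1)])
  then have "(LB x. \<psi> x *\<^sub>R (f t x + g t x)) - (LB x. \<psi> x *\<^sub>R (f 0 x + g 0 x))
   = (LB r. indicator {0..t} r *\<^sub>R p r) + (LB r. indicator {0..t} r *\<^sub>R q r)"
   using D(7)[OF \<psi> t] E(7)[OF \<psi> t] unfolding p_def q_def by (simp add: algebra_simps)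
  also have "... = (LB r. indicator {0..t} r *\<^sub>R (p r + q r))"
   unfolding scaleR_add_right by (rule Bochner_Integration.integral_add[OF ip iq, symmetric])
  finally show "(LB x. \<psi> x *\<^sub>R (f t x + g t x)) - (LB x. \<psi> x *\<^sub>R (f 0 x + g 0 x))
   = (LB r. indicator {0..t} r *\<^sub>R (LB x. (\<sigma> * laplacian \<psi> x) *\<^sub>R (f r x + g r x) - (SB b. dir_deriv b \<psi> x *\<^sub>R (F b r x + G b r x))))"
   unfolding pq .
 qed (use D E ln meas in auto)
qed

section \<open>Gronwall's inequality, masses, signs and the \<open>L^2\<close> estimate\<close>

lemma gronwall_bounded:
 fixes y :: "real => real"
 assumes C: "C > 0" and A: "A \<ge> 0" and T: "T \<ge> 0"
  and y: "!!t. t \<in> {0..T} ==> 0 <= y t" "!!t. t \<in> {0..T} ==> y t <= Y"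
  and le: "!!t. t \<in> {0..T} ==>
   ennreal (y t) <= ennreal A + (NN r. indicator {0..t} r * ennreal (C * y r))"
  and t: "t \<in> {0..T}"
 shows "y t <= 2 * A * exp (2 * C * T)"
proof -
 text \<open>The weighted supremum of \<open>exp (- 2 C t) y t\<close> is at most half of itself plus \<open>A\<close>.\<close>
 define Z where "Z = (%t. exp (- 2 * C * t) * y t) ` {0..T}"
 have Y0: "Y \<ge> 0" using y[of 0] T by auto
 have bdd: "bdd_above Z" unfolding Z_def
 proof (rule bdd_aboveI2)
  fix s assume s: "s \<in> {0..T}"
  have "exp (- 2 * C * s) * y s <= 1 * Y"
   using s C y by (intro mult_mono) auto
  then show "exp (- 2 * C * s) * y s <= Y" by simp
 qed
 define S where "S = Sup Z"
 have S: "exp (- 2 * C * s) * y s <= S" if "s \<in> {0..T}" for s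
  unfolding S_def Z_def using that bdd by (intro cSUP_upper) (auto simp: Z_def)
 have S0: "S \<ge> 0" by (rule order_trans[OF _ S[of 0]]) (use y[of 0] T in auto)
 have yS: "y s <= S * exp (2 * C * s)" if "s \<in> {0..T}" for s
 proof -
  have "exp (2 * C * s) * (exp (- 2 * C * s) * y s) <= exp (2 * C * s) * S"
   using S[OF that] by (intro mult_left_mono) auto
  also have "exp (2 * C * s) * (exp (- 2 * C * s) * y s) = y s"
   by (simp add: mult.assoc[symmetric] exp_add[symmetric])
  finally show ?thesis by (simp add: mult.commute)
 qed
 have step: "exp (- 2 * C * s) * y s <= S / 2 + A" if s: "s \<in> {0..T}" for s
 proof -
  \<comment> \<open>A primitive of \<open>S * C * exp (2 * C * r)\<close>. The rate
    \<open>2 * C\<close> of the weight is what produces the factor one half.\<close>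
  define F where "F r = S * exp (2 * C * r) / 2" for r
  have "S * 1 <= S * exp (2 * C * s)" using s S0 C by (intro mult_left_mono) auto
  then have F0: "0 <= F s - F 0" by (simp add: F_def)
  have "(NN r. indicator {0..s} r * ennreal (C * y r)) <= (NN r. ennreal (S * C * exp (2 * C * r)) * indicator {0..s} r)"
  proof (rule nn_integral_mono)
   fix r
   show "indicator {0..s} r * ennreal (C * y r) <= ennreal (S * C * exp (2 * C * r)) * indicator {0..s} r"
   proof (cases "r \<in> {0..s}")
    case True
    have "C * y r <= C * (S * exp (2 * C * r))" using True s C by (intro mult_left_mono yS) auto
    then show ?thesis using True by (simp add: ennreal_leI mult_ac)
   qed simp
  qed
  also have "... = ennreal (F s - F 0)"
  proof (rule nn_integral_FTC_Icc)
   show "DERIV F r :> S * C * exp (2 * C * r)" for r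
    unfolding F_def by (auto intro!: derivative_eq_intros)
   show "0 <= S * C * exp (2 * C * r)" for r using S0 C by simp
  qed (use s in auto)
  finally have "ennreal (y s) <= ennreal A + ennreal (F s - F 0)" using add_left_mono le[OF s] by (metis order_trans)
  also have "... = ennreal (A + (F s - F 0))"
   using A F0 by (intro ennreal_plus[symmetric])
  finally have "y s <= A + (F s - F 0)"
   using A F0 by (subst (asm) ennreal_le_iff) auto
  also have "... <= S * exp (2 * C * s) / 2 + A" using S0 by (simp add: F_def)
  finally have ys: "y s <= S * exp (2 * C * s) / 2 + A" .
  have "exp (- 2 * C * s) * y s <= exp (- 2 * C * s) * (S * exp (2 * C * s) / 2 + A)"
   by (rule mult_left_mono[OF ys]) simp
  also have "... = S / 2 + exp (- 2 * C * s) * A"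
   by (simp add: distrib_left mult_ac exp_minus_inverse exp_minus)
  also have "exp (- 2 * C * s) * A <= 1 * A"
   using s A C by (intro mult_right_mono) auto
  finally show ?thesis by simp
 qed
 have "S <= S / 2 + A"
  unfolding S_def Z_def
 proof (rule cSUP_least)
  show "{0..T} ~= {}" using T by simp
 qed (rule step[unfolded S_def Z_def])
 then have "S <= 2 * A" by simp
 then have "S * exp (2 * C * t) <= 2 * A * exp (2 * C * T)"
  using t C A T S0 by (intro mult_mono) auto
 then show ?thesis using yS[OF t] by simp
qed

lemma mollify_in_cball:
 assumes fp: "fokker_planck T \<sigma> M f F" and \<rho>: "test_function \<rho>"
 obtains B where "!!t z. mollify \<rho> (f t) z \<in> cball 0 B"
proof -
 note D = fokker_planckD[OF fp]
 obtain b where b: "b > 0" "!!x. \<bar>\<rho> x\<bar> <= b" using test_function_bounded[OF \<rho>] by metis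
 have "norm (mollify \<rho> (f t) z) <= b * M" for t z
 proof -
  have "norm (mollify \<rho> (f t) z) <= b * (LB x. norm (f t x))"
   by (rule mollify_norm_le[OF D(3) test_function_measurable[OF \<rho>] b(2)])
  also have "... <= b * M" using b(1) by (intro mult_left_mono D) auto
  finally show ?thesis .
 qed
 then show ?thesis using that[of "b * M"] by simp
qed

lemma mollify_zero_AE:
 fixes g :: "'a::euclidean_space => 'c::euclidean_space"
 assumes "AE x in lborel. g x = 0" "g \<in> bmb" "\<phi> \<in> bmb"
 shows "mollify \<phi> g z = 0"
 using mollify_cong_AE[of g "%_. 0" \<phi>] assms by (simp add: mollify_def)

text \<open>Conservation of mass is the energy identity for \<open>\<Psi> x = x\<close>, whose
  second derivative vanishes; mollification keeps the mass.\<close>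

lemma fokker_planck_mass_zero:
 fixes w :: "real => 'a::euclidean_space => real" and \<rho> :: "'a => real"
 assumes fp: "fokker_planck T \<sigma> M w W" and w0: "AE x in lborel. w 0 x = 0"
  and \<rho>: "bump \<delta> \<rho>" and t: "t \<in> {0..T}"
 shows "(LB x. w t x) = 0"
proof -
 note D = fokker_planckD[OF fp] and b = bumpD[OF \<rho>]
 obtain B where B: "!!t z. mollify \<rho> (w t) z \<in> cball 0 B" by (rule mollify_in_cball[OF fp b(1)]) blast
 have "(LB z. mollify \<rho> (w t) z) = - (LB r. indicator {0..t} r *\<^sub>R
   (LB z. (SB b. (%x h. 0) (mollify \<rho> (w r) z) (mollify (dir_deriv b \<rho>) (w r) z) \<bullet> flux \<sigma> \<rho> w W b r z)))"
 proof (rule energy_identity(2)[OF fp b(1) _ _ B _ _ _ _ t, where \<Psi>="%x. x" and \<Psi>'="%x. 1" and \<Psi>''="%x h. 0"])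
  show "mollify \<rho> (w 0) z = 0" for z
   by (rule mollify_zero_AE[OF w0]) (use D(3)[of 0] b in auto)
 qed (auto simp: case_prod_unfold intro!: derivative_eq_intros)
 then have "(LB z. mollify \<rho> (w t) z) = 0" by simp
 then show ?thesis using integral_mollify[OF b(6) D(3)[of t]] b(7) by simp
qed

text \<open>Completing the square: the diffusion absorbs the gradient \<open>h\<close> and leaves
  only the transport part \<open>g\<close>.\<close>

lemma quadratic_absorb:
 fixes \<sigma> h g :: real
 assumes "\<sigma> > 0"
 shows "- (h * (\<sigma> * h + g)) <= g^2 / (4 * \<sigma>)"
proof -
 have "0 <= (2 * \<sigma> * h + g)^2 / (4 * \<sigma>)" using assms by simp
 also have "... = \<sigma> * h^2 + h * g + g^2 / (4 * \<sigma>)"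
  using assms by (simp add: power2_eq_square field_simps)
 finally show ?thesis by (simp add: power2_eq_square algebra_simps)
qed

text \<open>The energy inequality for \<open>x^2 / 2\<close>, with the gradient absorbed by the
  diffusion. The resulting bound does not depend on the mollifier, so Fatou's lemma removes it. The
  factor \<open>1 / (4 * \<sigma>)\<close> doubles because the energy is half the square.\<close>

lemma fokker_planck_L2:
 fixes w :: "real => 'a::euclidean_space => real" and \<rho> :: "nat => 'a => real"
 assumes fp: "fokker_planck T \<sigma> M w W" and \<sigma>: "\<sigma> > 0" and w0: "AE x in lborel. w 0 x = 0"
  and \<rho>: "!!n. bump (\<delta> n) (\<rho> n)" "\<delta> ----> 0" and t: "t \<in> {0..T}"
 shows "(NN x. ennreal ((w t x)^2))
  <= ennreal (1 / (2 * \<sigma>)) * (NN r. indicator {0..t} r * (SB b. NN x. ennreal ((W b r x)^2)))" (is "_ <= ?R")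
proof -
 note D = fokker_planckD[OF fp]
 note Dm[measurable] = D(2)
 have [measurable]: "w t \<in> bmb" for t using D(3)[of t] by auto
 have Wm: "W b r \<in> bmb" if "b \<in> Basis" for b r using D(5)[OF that, of r] by auto
 have Fm: "(%r. SB b. NN x. ennreal ((W b r x)^2)) \<in> borel_measurable lborel"
 proof (intro borel_measurable_sum)
  fix b :: 'a assume b: "b \<in> Basis"
  have "(%p. W b (fst p) (snd p)) \<in> borel_measurable (lborel \<Otimes>\<^sub>M lborel)" using D(2)[OF b] by (simp add: case_prod_beta')
  then have "(%p. ennreal ((W b (fst p) (snd p))^2)) \<in> borel_measurable (lborel \<Otimes>\<^sub>M lborel)" by measurable
  then show "(%r. NN x. ennreal ((W b r x)^2)) \<in> borel_measurable lborel"
   by (intro lborel.borel_measurable_nn_integral) (simp add: case_prod_beta')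
 qed
 have main: "(NN z. ennreal ((mollify (\<rho> n) (w t) z)^2)) <= ?R" for n
 proof -
  note b = bumpD[OF \<rho>(1)[of n]]
  have [measurable]: "\<rho> n \<in> bmb" by (rule b(5))
  obtain B where B: "!!t z. mollify (\<rho> n) (w t) z \<in> cball 0 B" by (rule mollify_in_cball[OF fp b(1)]) blast
  define R where "R r z = ennreal (1 / (4 * \<sigma>)) * (SB b. ennreal ((mollify (\<rho> n) (W b r) z)^2))" for r z
  have dpsi: "((%x. x^2 / 2) has_derivative (%h. x \<bullet> h)) (at x)" for x :: real
   by (auto intro!: derivative_eq_intros)
  have z0: "(mollify (\<rho> n) (w 0) z)^2 / 2 = 0" for z
   using mollify_zero_AE[OF w0, of "\<rho> n" z] by simp
  have dpsi': "((%x. x) has_derivative (%h. h)) (at x)" for x :: real by simp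
  have cpsi: "continuous_on (cball 0 B \<times> UNIV) (%(x::real,h::real). h)"
   unfolding case_prod_unfold by (intro continuous_intros)
  have Rb: "ennreal (- (SB b. mollify (dir_deriv b (\<rho> n)) (w r) z \<bullet> flux \<sigma> (\<rho> n) w W b r z)) <= R r z" for r z
  proof -
   have "- (SB b. mollify (dir_deriv b (\<rho> n)) (w r) z \<bullet> flux \<sigma> (\<rho> n) w W b r z)
    <= (SB b. (mollify (\<rho> n) (W b r) z)^2 / (4 * \<sigma>))"
    unfolding sum_negf[symmetric] flux_def inner_real_def real_scaleR_def
    by (intro sum_mono quadratic_absorb \<sigma>)
   also have "... = (1 / (4 * \<sigma>)) * (SB b. (mollify (\<rho> n) (W b r) z)^2)"
    by (simp add: sum_divide_distrib)
   finally have "ennreal (- (SB b. mollify (dir_deriv b (\<rho> n)) (w r) z \<bullet> flux \<sigma> (\<rho> n) w W b r z)) <= ennreal ((1 / (4 * \<sigma>)) * (SB b. (mollify (\<rho> n) (W b r) z)^2))"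
    by (rule ennreal_leI)
   also have "... = R r z"
    unfolding R_def using \<sigma> by (subst ennreal_mult) (auto intro!: sum_nonneg)
   finally show ?thesis .
  qed
  note en = energy_inequality[OF fp b(1) compact_cball convex_cball B dpsi dpsi' cpsi z0 t Rb]
  note ei = energy_identity(1)[OF fp b(1) compact_cball convex_cball B dpsi dpsi' cpsi z0 t]
  have "(NN z. ennreal ((mollify (\<rho> n) (w t) z)^2)) = ennreal 2 * (NN z. ennreal ((mollify (\<rho> n) (w t) z)^2 / 2))"
  proof -
   have "(NN z. ennreal ((mollify (\<rho> n) (w t) z)^2)) = (NN z. ennreal 2 * ennreal ((mollify (\<rho> n) (w t) z)^2 / 2))"
    by (intro nn_integral_cong, subst ennreal_mult[symmetric]) auto
   then show ?thesis by (subst (asm) nn_integral_cmult) auto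
  qed
  also have "(NN z. ennreal ((mollify (\<rho> n) (w t) z)^2 / 2)) = ennreal (LB z. (mollify (\<rho> n) (w t) z)^2 / 2)"
   by (rule nn_integral_eq_integral[OF ei]) simp
  also have "ennreal 2 * ... <= ennreal 2 * (NN r. indicator {0..t} r * (NN z. R r z))"
   by (rule mult_left_mono[OF en]) simp
  also have "... <= ennreal 2 * (NN r. ennreal (1 / (4 * \<sigma>)) * (indicator {0..t} r * (SB b. NN x. ennreal ((W b r x)^2))))"
  proof (intro mult_left_mono nn_integral_mono)
   fix r
   have "(NN z. R r z) = ennreal (1 / (4 * \<sigma>)) * (SB b. NN z. ennreal ((mollify (\<rho> n) (W b r) z)^2))"
    unfolding R_def
    by (subst nn_integral_cmult, (intro borel_measurable_sum measurable_compose[OF _ measurable_ennreal] borel_measurable_power mollify_measurable b(5), simp add: Wm)[1])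
     (subst nn_integral_sum, auto intro!: measurable_compose[OF _ measurable_ennreal] borel_measurable_power mollify_measurable b(5) Wm)
   also have "... <= ennreal (1 / (4 * \<sigma>)) * (SB b. NN x. ennreal ((W b r x)^2))"
   proof (intro mult_left_mono sum_mono)
    fix c :: 'a assume c: "c \<in> Basis"
    show "(NN z. ennreal ((mollify (\<rho> n) (W c r) z)^2)) <= (NN x. ennreal ((W c r x)^2))"
     using mollify_L2_le[OF b(5) Wm[OF c] b(2,3), of r] by simp
   qed simp
   finally show "indicator {0..t} r * (NN z. R r z)
    <= ennreal (1 / (4 * \<sigma>)) * (indicator {0..t} r * (SB b. NN x. ennreal ((W b r x)^2)))"
    by (auto split: split_indicator)
  qed simp
  also have "... = ?R"
  proof -
   have "ennreal 2 * ennreal (1 / (4 * \<sigma>)) = ennreal (1 / (2 * \<sigma>))"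
    using \<sigma> by (subst ennreal_mult[symmetric]) auto
   then show ?thesis using Fm by (subst nn_integral_cmult) (auto simp: mult.assoc[symmetric])
  qed
  finally show ?thesis .
 qed
 obtain r where r: "strict_mono r" "AE x in lborel. (%n. mollify (\<rho> (r n)) (w t) x) ----> w t x"
  by (rule mollify_AE_subseq[OF D(3)[of t] \<rho>(2) \<rho>(1)])
 have "(NN x. ennreal ((w t x)^2)) <= (NN z. liminf (%n. ennreal ((mollify (\<rho> (r n)) (w t) z)^2)))"
 proof (rule nn_integral_mono_AE, use r(2) in eventually_elim)
  case (elim x)
  have "(%n. ennreal ((mollify (\<rho> (r n)) (w t) x)^2)) ----> ennreal ((w t x)^2)"
   using elim by (intro tendsto_ennrealI tendsto_power)
  from lim_imp_Liminf[OF sequentially_bot this] show ?case by simp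
 qed
 also have "... <= liminf (%n. NN z. ennreal ((mollify (\<rho> (r n)) (w t) z)^2))"
 proof (rule nn_integral_liminf)
  fix n
  have [measurable]: "mollify (\<rho> (r n)) (w t) \<in> bmb"
   by (rule mollify_measurable[OF bumpD(5)[OF \<rho>(1)]]) measurable
  show "(%z. ennreal ((mollify (\<rho> (r n)) (w t) z)^2)) \<in> borel_measurable lborel" by measurable
 qed
 also have "... <= liminf (%n. ?R)"
  by (intro Liminf_mono always_eventually allI main)
 also have "... = ?R" by (simp add: Liminf_const)
 finally show ?thesis .
qed

text \<open>Only drift values within distance \<open>\<delta>\<close> of \<open>z\<close> enter, so
  the drift may be replaced by its value at \<open>z\<close> up to \<open>\<omega>\<close>. The
  bound by the mollified \<open>f\<close> itself, not by a norm of it, is what allows a later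
  division by the density.\<close>

lemma mollify_commutator:
 fixes d :: "'a::euclidean_space => 'a" and f :: "'a => real"
 assumes \<rho>: "bump \<delta> \<rho>" and f: "ilb f" and [measurable]: "d \<in> bmb"
  and B: "!!x. norm (d x) <= B" and \<omega>: "!!x. norm (z - x) <= \<delta> ==> norm (d x - d z) <= \<omega>" and b: "b \<in> Basis"
 shows "\<bar>mollify \<rho> (%x. (d x \<bullet> b) * f x) z - (d z \<bullet> b) * mollify \<rho> f z\<bar> <= \<omega> * mollify \<rho> (%x. \<bar>f x\<bar>) z"
proof -
 note r = bumpD[OF \<rho>]
 have [measurable]: "f \<in> bmb" using f by auto
 have db: "\<bar>d x \<bullet> b\<bar> <= B" for x using Basis_le_norm[OF b, of "d x"] B[of x] by linarith
 have fi: "ilb (%x. (d x \<bullet> b) * f x)"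
  using integrable_scaleR_bounded[OF f, of "%x. d x \<bullet> b" B] db by simp
 have i1: "ilb (%x. \<rho> (z - x) * ((d x \<bullet> b) * f x))"
  using mollify_test_integrand[OF fi r(1), of z] by simp
 have i2: "ilb (%x. \<rho> (z - x) * f x)"
  using mollify_test_integrand[OF f r(1), of z] by simp
 have i3: "ilb (%x. \<rho> (z - x) * \<bar>f x\<bar>)"
  using mollify_test_integrand[OF integrable_abs[OF f] r(1), of z] by simp
 have i4: "ilb (%x. \<rho> (z - x) * (((d x - d z) \<bullet> b) * f x))"
 proof -
  have "ilb (%x. \<rho> (z - x) * ((d x \<bullet> b) * f x) - (d z \<bullet> b) * (\<rho> (z - x) * f x))"
   using i1 i2 by (intro Bochner_Integration.integrable_diff integrable_mult_right)
  then show ?thesis by (simp add: inner_diff_left algebra_simps)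
 qed
 have "mollify \<rho> (%x. (d x \<bullet> b) * f x) z - (d z \<bullet> b) * mollify \<rho> f z
  = (LB x. \<rho> (z - x) * ((d x \<bullet> b) * f x)) - (LB x. (d z \<bullet> b) * (\<rho> (z - x) * f x))"
  by (simp add: mollify_def)
 also have "... = (LB x. \<rho> (z - x) * ((d x \<bullet> b) * f x) - (d z \<bullet> b) * (\<rho> (z - x) * f x))"
  by (rule Bochner_Integration.integral_diff[OF i1 integrable_mult_right[OF i2], symmetric])
 also have "... = (LB x. \<rho> (z - x) * (((d x - d z) \<bullet> b) * f x))"
  by (intro Bochner_Integration.integral_cong refl) (simp add: inner_diff_left algebra_simps)
 also have "norm ... <= (LB x. norm (\<rho> (z - x) * (((d x - d z) \<bullet> b) * f x)))"
  by (rule integral_norm_bound)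
 also have "... <= (LB x. \<omega> * (\<rho> (z - x) * \<bar>f x\<bar>))"
 proof (rule integral_mono[OF integrable_norm[OF i4] integrable_mult_right[OF i3]])
  fix x
  show "norm (\<rho> (z - x) * (((d x - d z) \<bullet> b) * f x)) <= \<omega> * (\<rho> (z - x) * \<bar>f x\<bar>)"
  proof (cases "\<rho> (z - x) = 0")
   case False
   then have "\<bar>(d x - d z) \<bullet> b\<bar> <= \<omega>"
    using \<omega>[OF r(4)[OF False]] Basis_le_norm[OF b, of "d x - d z"] by linarith
   then have "\<bar>(d x - d z) \<bullet> b\<bar> * (\<rho> (z - x) * \<bar>f x\<bar>) <= \<omega> * (\<rho> (z - x) * \<bar>f x\<bar>)"
    using r(2)[of "z - x"] by (intro mult_right_mono) auto
   then show ?thesis using r(2)[of "z - x"] by (simp add: abs_mult mult_ac)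
  qed simp
 qed
 also have "... = \<omega> * mollify \<rho> (%x. \<bar>f x\<bar>) z" by (simp add: mollify_def)
 finally show ?thesis by simp
qed

lemma negative_part_power_derivative:
 fixes x :: real
 assumes "n \<ge> 1"
 shows "((%x. max 0 (- x) ^ Suc n) has_real_derivative - (real (Suc n) * max 0 (- x) ^ n)) (at x)"
proof -
 consider "x < 0" | "x > 0" | "x = 0" by linarith
 then show ?thesis
 proof cases
  case 1
  have "((%x. (- x) ^ Suc n) has_real_derivative - (real (Suc n) * (- x) ^ n)) (at x)"
   by (rule derivative_eq_intros refl | simp)+
  then have "((%x. max 0 (- x) ^ Suc n) has_real_derivative - (real (Suc n) * (- x) ^ n)) (at x)"
   by (rule has_field_derivative_transform_within_open[where S="{..<0}"]) (use 1 in auto)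
  then show ?thesis using 1 by simp
 next
  case 2
  have "((%x. 0) has_real_derivative 0) (at x)" by simp
  then have "((%x. max 0 (- x) ^ Suc n) has_real_derivative 0) (at x)"
   by (rule has_field_derivative_transform_within_open[where S="{0<..}"]) (use 2 in auto)
  moreover have "- (real (Suc n) * max 0 (- x) ^ n) = 0" using 2 assms by simp
  ultimately show ?thesis by (simp only:)
 next
  \<comment> \<open>Only the kink needs an argument: there the difference quotient is at most
    \<open>\<bar>h\<bar> ^ n\<close>, and \<open>n \<ge> 1\<close> makes it vanish.\<close>
  case 3
  have "(%h. (max 0 (- (0 + h)) ^ Suc n - max 0 (- 0) ^ Suc n) / h) \<midarrow>0\<rightarrow> (0::real)"
  proof (rule Lim_null_comparison)
   show "\<forall>\<^sub>F h in at 0. norm ((max 0 (- (0 + h)) ^ Suc n - max 0 (- 0) ^ Suc n) / h) <= \<bar>h\<bar> ^ n"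
   proof (intro always_eventually allI)
    fix h :: real
    have "max 0 (- h) ^ Suc n <= \<bar>h\<bar> ^ Suc n" by (intro power_mono) auto
    then show "norm ((max 0 (- (0 + h)) ^ Suc n - max 0 (- 0) ^ Suc n) / h) <= \<bar>h\<bar> ^ n"
     by (cases "h = 0") (auto simp: divide_le_eq abs_mult mult.commute)
   qed
   show "(%h::real. \<bar>h\<bar> ^ n) \<midarrow>0\<rightarrow> 0"
    using assms by (auto intro!: tendsto_eq_intros)
  qed
  moreover have "- (real (Suc n) * max 0 (- x) ^ n) = 0" using 3 assms by simp
  ultimately show ?thesis unfolding DERIV_def 3 by (simp only:)
 qed
qed

section \<open>Nonnegativity\<close>

text \<open>The modulus of continuity is uniform in time and carries no rate. That suffices, since
  the commutators only have to vanish in the limit.\<close>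

definition regular_drift :: "real => (real => 'a::euclidean_space => 'a) => bool" where
 "regular_drift B d \<longleftrightarrow> (%(t,x). d t x) \<in> borel_measurable (lborel \<Otimes>\<^sub>M lborel) \<and>
  (\<forall>t x. norm (d t x) <= B) \<and>
  (\<forall>\<omega>>0. \<exists>\<delta>>0. \<forall>t x x'. norm (x - x') <= \<delta> --> norm (d t x - d t x') <= \<omega>)"

lemma regular_driftD:
 fixes d :: "real => 'a::euclidean_space => 'a"
 assumes "regular_drift B d"
 shows "(%(t,x). d t x) \<in> borel_measurable (lborel \<Otimes>\<^sub>M lborel)" "norm (d t x) <= B"
  "d t \<in> bmb" "B \<ge> 0"
proof -
 show 1: "(%(t,x). d t x) \<in> borel_measurable (lborel \<Otimes>\<^sub>M lborel)" and 2: "!!t x. norm (d t x) <= B"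
  using assms by (auto simp: regular_drift_def)
 show "d t \<in> bmb"
  using measurable_compose[OF measurable_Pair1' 1, of t] by simp
 show "B \<ge> 0" using norm_ge_zero[of "d 0 0"] 2[of 0 0] by linarith
qed

lemma regular_drift_scales:
 assumes "regular_drift B d"
 obtains \<delta> :: "nat => real" where "!!n. \<delta> n > 0" "\<delta> ----> 0"
  "!!n t x x'. norm (x - x') <= \<delta> n ==> norm (d t x - d t x') <= 1 / real (Suc n)"
proof -
 have "\<forall>n. \<exists>\<delta>>0. \<forall>t x x'. norm (x - x') <= \<delta> --> norm (d t x - d t x') <= 1 / real (Suc n)"
  using assms unfolding regular_drift_def by (auto simp del: of_nat_Suc)
 then obtain \<delta>' where \<delta>': "!!n. \<delta>' n > 0"
  "!!n t x x'. norm (x - x') <= \<delta>' n ==> norm (d t x - d t x') <= 1 / real (Suc n)"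
  by metis
 have 1: "norm (min (\<delta>' n) (1 / real (Suc n))) <= 1 / real (Suc n)" for n
  using \<delta>'(1)[of n] by (auto simp: min_def simp del: of_nat_Suc)
 have 2: "(%n. min (\<delta>' n) (1 / real (Suc n))) ----> 0"
  by (rule Lim_null_comparison[OF always_eventually lim_1_over_n[THEN LIMSEQ_Suc]]) (use 1 in auto)
 show ?thesis
  by (rule that[of "%n. min (\<delta>' n) (1 / real (Suc n))"]) (use \<delta>' 2 in auto)
qed

lemma sum_squares_le:
 fixes a b :: real
 shows "(a + b)^2 <= 2 * a^2 + 2 * b^2"
 using sum_squares_bound[of a b] by (simp add: power2_sum)

text \<open>After absorbing the gradient, the flux is compared with \<open>e * y\<close>. The main
  part yields \<open>max 0 (- y)\<close> times \<open>y^2\<close>, which is exactly the cube to be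
  controlled; the commutator yields a multiple of \<open>\<omega>^2\<close>, weighted by the
  integrable \<open>q\<close>.\<close>

lemma cube_dissipation:
 fixes y h g e B D \<omega> q N \<sigma> :: real
 assumes "\<sigma> > 0" "\<bar>g - e * y\<bar> <= \<omega> * q" "\<bar>e\<bar> <= B" "\<bar>y\<bar> <= q" "q <= N" "\<omega> \<ge> 0"
 shows "- (6 * max 0 (- y) * h * (\<sigma> * h + g)) <= 3 * B^2 / \<sigma> * max 0 (- y) ^ 3 + 3 * N^2 / \<sigma> * \<omega>^2 * q"
proof -
 define m where "m = max 0 (- y)"
 have m: "0 <= m" "m <= q" "m * y^2 = m ^ 3" using assms by (auto simp: m_def max_def power2_eq_square power3_eq_cube)
 have g2: "g^2 <= 2 * (B^2 * y^2) + 2 * (\<omega>^2 * q^2)"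
 proof -
  have "g^2 = (e * y + (g - e * y))^2" by simp
  also have "... <= 2 * (e * y)^2 + 2 * (g - e * y)^2" by (rule sum_squares_le)
  also have "(e * y)^2 <= B^2 * y^2"
   using power_mono[OF assms(3), of 2] by (auto simp: power_mult_distrib intro!: mult_right_mono)
  also have "(g - e * y)^2 <= \<omega>^2 * q^2"
   using power_mono[OF assms(2), of 2] by (simp add: power_mult_distrib)
  finally show ?thesis by simp
 qed
 have "- (6 * m * h * (\<sigma> * h + g)) = 6 * m * (- (h * (\<sigma> * h + g)))" by simp
 also have "... <= 6 * m * (g^2 / (4 * \<sigma>))"
  using m by (intro mult_left_mono quadratic_absorb assms(1)) auto
 also have "... <= 6 * m * ((2 * (B^2 * y^2) + 2 * (\<omega>^2 * q^2)) / (4 * \<sigma>))"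
  using m g2 assms(1) by (intro mult_left_mono divide_right_mono) auto
 also have "... = 3 * B^2 / \<sigma> * (m * y^2) + 3 / \<sigma> * \<omega>^2 * (m * q^2)"
  using assms(1) by (simp add: field_simps)
 also have "m * q^2 <= N^2 * q"
 proof -
  have "m * q <= N * N" using m assms by (intro mult_mono) auto
  then have "(m * q) * q <= (N * N) * q" using m by (intro mult_right_mono) auto
  then show ?thesis by (simp add: power2_eq_square mult_ac)
 qed
 then have "3 / \<sigma> * \<omega>^2 * (m * q^2) <= 3 / \<sigma> * \<omega>^2 * (N^2 * q)"
  using assms(1) by (intro mult_left_mono) auto
 finally show ?thesis unfolding m_def[symmetric] m(3) by (simp add: mult_ac)
qed

lemma mollify_abs_bounds:
 fixes g :: "'a::euclidean_space => real"
 assumes \<rho>: "bump \<delta> \<rho>" and g: "bounded_L1 N g"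
 shows "\<bar>mollify \<rho> g z\<bar> <= mollify \<rho> (%x. \<bar>g x\<bar>) z" "mollify \<rho> (%x. \<bar>g x\<bar>) z <= N"
  "(NN z. ennreal (mollify \<rho> (%x. \<bar>g x\<bar>) z)) <= ennreal N"
  "0 <= mollify \<rho> (%x. \<bar>g x\<bar>) z"
proof -
 note b = bumpD[OF \<rho>] and g' = bounded_L1D[OF g]
 note [measurable] = b(5) g'(4)
 show nn: "0 <= mollify \<rho> (%x. \<bar>g x\<bar>) z" for z
  unfolding mollify_def by (intro integral_nonneg_AE) (auto simp: b(2))
 have "\<bar>mollify \<rho> g z\<bar> <= (LB x. norm (\<rho> (z - x) *\<^sub>R g x))"
  unfolding mollify_def real_norm_def[symmetric] by (rule integral_norm_bound)
 then show "\<bar>mollify \<rho> g z\<bar> <= mollify \<rho> (%x. \<bar>g x\<bar>) z"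
  by (simp add: mollify_def abs_mult b(2))
 have abs: "ilb (%x. \<bar>g x\<bar>)" "AE x in lborel. norm \<bar>g x\<bar> <= N" using g' by auto
 show "mollify \<rho> (%x. \<bar>g x\<bar>) z <= N"
  using mollify_AE_bound[OF \<rho> abs, of z] nn[of z] by simp
 have "(NN z. ennreal (mollify \<rho> (%x. \<bar>g x\<bar>) z)) = (NN z. ennreal (norm (mollify \<rho> (%x. \<bar>g x\<bar>) z)))"
  using nn by simp
 also have "... <= (NN x. ennreal \<bar>\<rho> x\<bar>) * (NN x. ennreal (norm \<bar>g x\<bar>))"
  by (rule mollify_nn_integral_le) measurable
 also have "... = (NN x. ennreal \<bar>g x\<bar>)" using b(2,3) by simp
 also have "... <= ennreal N"
  using g' by (subst nn_integral_eq_integral) (auto intro: ennreal_leI)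
 finally show "(NN z. ennreal (mollify \<rho> (%x. \<bar>g x\<bar>) z)) <= ennreal N" .
qed

text \<open>The cube of the negative part is used because the energy identity asks for a continuous
  second derivative, which the square does not have. The cube starts from 0, grows at most
  exponentially, and is driven by the commutator alone; hence a bound proportional to
  \<open>\<omega>^2\<close>.\<close>

lemma mollified_negative_part:
 fixes f :: "real => 'a::euclidean_space => real" and \<rho> :: "'a => real" and B N :: real
 assumes fp: "fokker_planck T \<sigma> M f (%b t x. (d t x \<bullet> b) * f t x)" and \<sigma>: "\<sigma> > 0" and T: "T \<ge> 0"
  and d: "regular_drift B d" and N: "!!t. bounded_L1 N (f t)" and f0: "AE x in lborel. 0 <= f 0 x"
  and \<rho>: "bump \<delta> \<rho>" and \<omega>: "!!t x x'. norm (x - x') <= \<delta> ==> norm (d t x - d t x') <= \<omega>" "\<omega> \<ge> 0"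
  and t: "t \<in> {0..T}"
 shows "(NN z. ennreal (max 0 (- mollify \<rho> (f t) z) ^ 3))
  <= ennreal (2 * (3 * real DIM('a) * N^2 / \<sigma> * \<omega>^2 * N * T) * exp (2 * (3 * real DIM('a) * B^2 / \<sigma> + 1) * T))"
proof -
 note b = bumpD[OF \<rho>] and dd = regular_driftD[OF d]
 note D = fokker_planckD[OF fp]
 note [measurable] = b(5) dd(1,3) D(1)
 have [measurable]: "f t \<in> bmb" for t using D(3)[of t] by auto
 have N0: "N \<ge> 0" using bounded_L1D(5)[OF N] by simp
 define q where "q r z = mollify \<rho> (%x. \<bar>f r x\<bar>) z" for r z
 note ab = mollify_abs_bounds[OF \<rho> N, folded q_def]
 define m where "m r z = max 0 (- mollify \<rho> (f r) z)" for r z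
 \<comment> \<open>The added 1 only makes the Gronwall rate strictly positive.\<close>
 define C where "C = 3 * real DIM('a) * B^2 / \<sigma> + 1"
 define K where "K = 3 * real DIM('a) * N^2 / \<sigma> * \<omega>^2"
 have C: "C > 0" using \<sigma> by (auto simp: C_def intro!: add_nonneg_pos)
 have K: "K \<ge> 0" using \<sigma> by (auto simp: K_def)
 have ball: "mollify \<rho> (f t) z \<in> cball 0 N" for t z
  using ab(1)[of t z] ab(2)[of t z] by simp
 have d1: "((%x. max 0 (- x) ^ 3) has_derivative (%h. (- 3 * max 0 (- x) ^ 2) \<bullet> h)) (at x)" for x :: real
 proof -
  have "((%x. max 0 (- x) ^ 3) has_derivative times (- (3 * max 0 (- x) ^ 2))) (at x)"
   using negative_part_power_derivative[of 2 x] by (simp add: has_field_derivative_def eval_nat_numeral)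
  then show ?thesis by (rule has_derivative_eq_rhs) (simp add: fun_eq_iff)
 qed
 have d2: "((%x. - 3 * max 0 (- x) ^ 2) has_derivative (%h. 6 * max 0 (- x) * h)) (at x)" for x :: real
 proof -
  have "((%x. max 0 (- x) ^ 2) has_real_derivative - (2 * max 0 (- x))) (at x)"
   using negative_part_power_derivative[of 1 x] by (simp add: eval_nat_numeral)
  from DERIV_cmult[OF this, of "-3"]
  have "((%x. - 3 * max 0 (- x) ^ 2) has_derivative times (- 3 * - (2 * max 0 (- x)))) (at x)"
   by (simp only: has_field_derivative_def)
  then show ?thesis by (rule has_derivative_eq_rhs) (simp add: fun_eq_iff)
 qed
 have c2: "continuous_on (cball 0 N \<times> UNIV) (%(x::real,h::real). 6 * max 0 (- x) * h)"
  unfolding case_prod_unfold by (intro continuous_intros)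
 have z0: "max 0 (- mollify \<rho> (f 0) z) ^ 3 = 0" for z
 proof -
  have "0 <= mollify \<rho> (f 0) z" unfolding mollify_def using f0
   by (intro integral_nonneg_AE) (auto simp: b(2))
  then show ?thesis by simp
 qed
 define R where "R r z = ennreal (C * m r z ^ 3) + ennreal (K * q r z)" for r z
 have Rb: "ennreal (- (SB b. (6 * max 0 (- mollify \<rho> (f r) z) * mollify (dir_deriv b \<rho>) (f r) z)
   \<bullet> flux \<sigma> \<rho> f (%b t x. (d t x \<bullet> b) * f t x) b r z)) <= R r z" for r z
 proof -
  have "- (SB b. (6 * max 0 (- mollify \<rho> (f r) z) * mollify (dir_deriv b \<rho>) (f r) z)
   \<bullet> flux \<sigma> \<rho> f (%b t x. (d t x \<bullet> b) * f t x) b r z)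
   <= (\<Sum>b\<in>(Basis::'a set). 3 * B^2 / \<sigma> * max 0 (- mollify \<rho> (f r) z) ^ 3 + 3 * N^2 / \<sigma> * \<omega>^2 * q r z)"
   unfolding sum_negf[symmetric] flux_def inner_real_def real_scaleR_def
  proof (intro sum_mono cube_dissipation[OF \<sigma>, where e="d r z \<bullet> b" for b] ab(1,2) \<omega>(2))
   fix b :: 'a assume b: "b \<in> Basis"
   show "\<bar>mollify \<rho> (%x. (d r x \<bullet> b) * f r x) z - (d r z \<bullet> b) * mollify \<rho> (f r) z\<bar> <= \<omega> * q r z"
    unfolding q_def
    by (rule mollify_commutator[OF \<rho> D(3) dd(3) dd(2) _ b]) (use \<omega>(1) in \<open>simp add: norm_minus_commute\<close>)
   show "\<bar>d r z \<bullet> b\<bar> <= B" using Basis_le_norm[OF b, of "d r z"] dd(2)[of r z] by linarith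
  qed
  also have "... = real DIM('a) * (3 * B^2 / \<sigma> * m r z ^ 3 + 3 * N^2 / \<sigma> * \<omega>^2 * q r z)" by (simp add: m_def)
  also have "... <= C * m r z ^ 3 + K * q r z"
   by (simp add: C_def K_def algebra_simps m_def)
  finally have "ennreal (- (SB b. (6 * max 0 (- mollify \<rho> (f r) z) * mollify (dir_deriv b \<rho>) (f r) z)
   \<bullet> flux \<sigma> \<rho> f (%b t x. (d t x \<bullet> b) * f t x) b r z)) <= ennreal (C * m r z ^ 3 + K * q r z)"
   by (rule ennreal_leI)
  also have "... = R r z"
   unfolding R_def using C K ab(4)[of r z] by (intro ennreal_plus) (auto simp: m_def)
  finally show ?thesis .
 qed
 define y where "y t = (LB z. m t z ^ 3)" for t
 have yi: "ilb (%z. m s z ^ 3)" if "s \<in> {0..T}" for s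
  using energy_identity(1)[OF fp b(1) compact_cball convex_cball ball d1 d2 c2 z0 that] by (simp add: m_def)
 have y_eq: "(NN z. ennreal (m s z ^ 3)) = ennreal (y s)" if "s \<in> {0..T}" for s
  unfolding y_def by (rule nn_integral_eq_integral[OF yi[OF that]]) (simp add: m_def)
 have [measurable]: "m r \<in> bmb" "q r \<in> bmb" for r
  unfolding m_def[abs_def] q_def[abs_def]
  by (intro borel_measurable_max borel_measurable_uminus measurable_const mollify_measurable; measurable)+
 have "y t <= 2 * (K * N * T) * exp (2 * C * T)"
 proof (rule gronwall_bounded[OF C _ T _ _ _ t])
  show "0 <= K * N * T" using K N0 T by simp
  show "0 <= y s" for s unfolding y_def by (intro integral_nonneg_AE) (auto simp: m_def)
  show "y s <= N ^ 3" if s: "s \<in> {0..T}" for s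
  proof -
   have "ennreal (y s) <= (NN z. ennreal (N^2) * ennreal (q s z))"
    unfolding y_eq[OF s, symmetric]
   proof (rule nn_integral_mono)
    fix z
    have "m s z <= q s z" "m s z <= N" "0 <= m s z" using ab(1,2,4)[of s z] N0 by (auto simp: m_def)
    then have "m s z ^ 2 * m s z <= N^2 * q s z" by (intro mult_mono power_mono) auto
    then show "ennreal (m s z ^ 3) <= ennreal (N^2) * ennreal (q s z)"
     by (simp add: ennreal_mult'[symmetric] power3_eq_cube power2_eq_square ennreal_leI)
   qed
   also have "... = ennreal (N^2) * (NN z. ennreal (q s z))" by (rule nn_integral_cmult) measurable
   also have "... <= ennreal (N^2) * ennreal N" by (intro mult_left_mono ab(3)) simp
   also have "... = ennreal (N ^ 3)" using N0 by (simp add: ennreal_mult'[symmetric] power3_eq_cube power2_eq_square)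
   finally show ?thesis using N0 by (subst (asm) ennreal_le_iff) auto
  qed
  fix s assume s: "s \<in> {0..T}"
  have "ennreal (y s) <= (NN r. indicator {0..s} r * (NN z. R r z))"
   using energy_inequality[OF fp b(1) compact_cball convex_cball ball d1 d2 c2 z0 s Rb]
   by (simp add: y_def m_def)
  also have "... <= (NN r. indicator {0..s} r * ennreal (C * y r) + ennreal (K * N) * indicator {0..s} r)"
  proof (rule nn_integral_mono)
   fix r
   show "indicator {0..s} r * (NN z. R r z) <= indicator {0..s} r * ennreal (C * y r) + ennreal (K * N) * indicator {0..s} r"
   proof (cases "r \<in> {0..s}")
    case True
    then have r: "r \<in> {0..T}" using s by auto
    have "(NN z. R r z) = ennreal C * (NN z. ennreal (m r z ^ 3)) + ennreal K * (NN z. ennreal (q r z))"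
     unfolding R_def using C K ab(4)
     by (simp add: ennreal_mult' nn_integral_add nn_integral_cmult m_def)
    also have "... <= ennreal C * ennreal (y r) + ennreal K * ennreal N"
     unfolding y_eq[OF r] by (intro add_left_mono mult_left_mono ab(3)) simp
    finally show ?thesis using True C K by (simp add: ennreal_mult')
   qed simp
  qed
  also have "... = (NN r. indicator {0..s} r * ennreal (C * y r)) + (NN r. ennreal (K * N) * indicator {0..s} r)"
  proof (rule nn_integral_add)
   have "(%(t,z). mollify \<rho> (f t) z) \<in> borel_measurable (lborel \<Otimes>\<^sub>M lborel)" by measurable
   then have "(%p. mollify \<rho> (f (fst p)) (snd p)) \<in> borel_measurable (lborel \<Otimes>\<^sub>M lborel)" by (simp add: case_prod_beta')
   then have "(%(t,z). m t z ^ 3) \<in> borel_measurable (lborel \<Otimes>\<^sub>M lborel)"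
    unfolding m_def case_prod_beta' by measurable
   then have "y \<in> borel_measurable lborel"
    unfolding y_def[abs_def] by (rule lborel.borel_measurable_lebesgue_integral)
   then show "(%r. indicator {0..s} r * ennreal (C * y r)) \<in> borel_measurable lborel" by measurable
  qed measurable
  also have "(NN r. ennreal (K * N) * indicator {0..s} r) <= ennreal (K * N * T)"
   using s K N0 by (simp add: nn_integral_cmult_indicator ennreal_mult'[symmetric] ennreal_leI mult_left_mono)
  finally show "ennreal (y s) <= ennreal (K * N * T) + (NN r. indicator {0..s} r * ennreal (C * y r))"
   by (simp add: add.commute add_left_mono)
 qed
 then show ?thesis
  using y_eq[OF t] by (simp add: m_def K_def C_def ennreal_leI)
qed

text \<open>Along scales at which the drift oscillates by at most \<open>1 / Suc n\<close>, the
  bound for the mollified negative part tends to 0, and Fatou's lemma passes this to the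
  solution.\<close>

lemma fokker_planck_nonneg:
 fixes f :: "real => 'a::euclidean_space => real" and \<kappa> :: "real => 'a => real"
 assumes fp: "fokker_planck T \<sigma> M f (%b t x. (d t x \<bullet> b) * f t x)" and \<sigma>: "\<sigma> > 0" and T: "T \<ge> 0"
  and d: "regular_drift B d" and N: "!!t. bounded_L1 N (f t)" and f0: "AE x in lborel. 0 <= f 0 x"
  and \<kappa>: "!!h. h > 0 ==> bump h (\<kappa> h)" and t: "t \<in> {0..T}"
 shows "AE x in lborel. 0 <= f t x"
proof -
 obtain \<delta> where \<delta>: "!!n. \<delta> n > 0" "\<delta> ----> 0"
  "!!n t x x'. norm (x - x') <= \<delta> n ==> norm (d t x - d t x') <= 1 / real (Suc n)"
  by (rule regular_drift_scales[OF d]) blast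
 note f = bounded_L1D[OF N[of t]]
 note [measurable] = f(4)
 have \<kappa>': "bump (\<delta> n) (\<kappa> (\<delta> n))" for n using \<kappa> \<delta>(1) by simp
 obtain r where r: "strict_mono r" "AE x in lborel. (%n. mollify (\<kappa> (\<delta> (r n))) (f t) x) ----> f t x"
  by (rule mollify_AE_subseq[OF f(1) \<delta>(2) \<kappa>'])
 define E where "E = 2 * (3 * real DIM('a) * N^2 / \<sigma> * N * T) * exp (2 * (3 * real DIM('a) * B^2 / \<sigma> + 1) * T)"
 have "(NN x. ennreal (max 0 (- f t x) ^ 3)) <= (NN z. liminf (%n. ennreal (max 0 (- mollify (\<kappa> (\<delta> (r n))) (f t) z) ^ 3)))"
 proof (rule nn_integral_mono_AE, use r(2) in eventually_elim)
  case (elim x)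
  have "(%n. ennreal (max 0 (- mollify (\<kappa> (\<delta> (r n))) (f t) x) ^ 3)) ----> ennreal (max 0 (- f t x) ^ 3)"
   using elim by (intro tendsto_ennrealI tendsto_power tendsto_max tendsto_minus tendsto_const)
  from lim_imp_Liminf[OF sequentially_bot this] show ?case by simp
 qed
 also have "... <= liminf (%n. NN z. ennreal (max 0 (- mollify (\<kappa> (\<delta> (r n))) (f t) z) ^ 3))"
 proof (rule nn_integral_liminf)
  fix n
  have [measurable]: "mollify (\<kappa> (\<delta> (r n))) (f t) \<in> bmb"
   by (rule mollify_measurable[OF bumpD(5)[OF \<kappa>']]) measurable
  show "(%z. ennreal (max 0 (- mollify (\<kappa> (\<delta> (r n))) (f t) z) ^ 3)) \<in> borel_measurable lborel" by measurable
 qed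
 also have "... <= liminf (%n. ennreal (E * (1 / real (Suc (r n)))^2))"
 proof (intro Liminf_mono always_eventually allI)
  fix n
  have \<omega>: "0 <= 1 / real (Suc (r n))" by simp
  show "(NN z. ennreal (max 0 (- mollify (\<kappa> (\<delta> (r n))) (f t) z) ^ 3)) <= ennreal (E * (1 / real (Suc (r n)))^2)"
   by (rule order_trans[OF mollified_negative_part[OF fp \<sigma> T d N f0 \<kappa>' \<delta>(3) \<omega> t]])
    (auto simp: E_def mult_ac simp del: of_nat_Suc)
 qed
 also have "... = ennreal 0"
 proof (rule lim_imp_Liminf)
  have "(%n. (1 / real (Suc n))^2) ----> 0^2" by (intro tendsto_power LIMSEQ_Suc lim_1_over_n)
  from LIMSEQ_subseq_LIMSEQ[OF this r(1)]
  have "(%n. E * (1 / real (Suc (r n)))^2) ----> E * 0"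
   by (intro tendsto_mult_left) (simp add: o_def)
  then show "(%n. ennreal (E * (1 / real (Suc (r n)))^2)) ----> ennreal 0" by (intro tendsto_ennrealI) simp
 qed simp
 finally have "AE x in lborel. ennreal (max 0 (- f t x) ^ 3) = 0"
  by (subst nn_integral_0_iff_AE[symmetric]) auto
 then show ?thesis
  by eventually_elim (auto simp: ennreal_eq_0_iff power_le_zero_eq max_def split: if_splits)
qed

section \<open>The relative entropy estimate\<close>

text \<open>The extra \<open>- u + v\<close> makes the integrand nonnegative and integrates to 0 for
  equal masses, so the relative entropy becomes an integral in \<open>ennreal\<close>. At
  \<open>u = 0\<close> the product with the default \<open>ln 0\<close> vanishes and leaves
  \<open>v\<close>, as it should.\<close>

definition entropy_density :: "real => real => ennreal" where
 "entropy_density u v = (if v = 0 \<and> u ~= 0 then \<top> else ennreal (u * ln (u / v) - u + v))"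

text \<open>For fixed \<open>a\<close> the left side is linear in \<open>u\<close> and
  \<open>v\<close>: it is the supporting plane of the jointly convex right side along the ray
  \<open>u = a * v\<close>.\<close>

lemma entropy_tangent:
 fixes u v a :: real
 assumes "u > 0" "v > 0" "a > 0"
 shows "u * ln a + (1 - a) * v <= u * (ln u - ln v) - u + v"
proof -
 have "ln (a * v / u) <= a * v / u - 1" using assms by (intro ln_le_minus_one) auto
 then have "u * (ln a + ln v - ln u) <= u * (a * v / u - 1)"
  using assms by (intro mult_left_mono) (auto simp: ln_mult ln_div)
 then show ?thesis using assms by (simp add: algebra_simps)
qed

text \<open>Lower semicontinuity is read off the dual formula given by the tangents.\<close>

lemma entropy_density_le:
 assumes uv: "u \<ge> 0" "v \<ge> 0" and le: "!!a. a > 0 ==> ennreal (u * ln a + (1 - a) * v) <= L"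
 shows "entropy_density u v <= L"
proof -
 consider "v = 0" "u = 0" | "v = 0" "u > 0" | "v > 0" "u = 0" | "v > 0" "u > 0" using uv by linarith
 then show ?thesis
 proof cases
  case 2
  \<comment> \<open>Steep tangents show that the bound is infinite: with \<open>v = 0\<close> the
    parameter \<open>exp (n / u)\<close> gives the value \<open>n\<close>.\<close>
  have L: "ennreal (real n) <= L" for n
   using le[of "exp (real n / u)"] 2 by simp
  then have "L = \<top>"
  proof (cases L)
   case (real l)
   obtain n where "l < real n" using reals_Archimedean2 by blast
   then show ?thesis using L[of n] real by simp
  qed
  then show ?thesis by simp
 next
  case 3
  \<comment> \<open>With \<open>u = 0\<close> the supremum over \<open>a\<close> is approached as
    \<open>a\<close> tends to 0 but is not attained.\<close>
  have "(%n. ennreal ((1 - 1 / real (Suc n)) * v)) ----> ennreal ((1 - 0) * v)"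
   by (intro tendsto_ennrealI tendsto_intros LIMSEQ_Suc lim_1_over_n)
  moreover have "ennreal ((1 - 1 / real (Suc n)) * v) <= L" for n
   using le[of "1 / real (Suc n)"] 3 by simp
  ultimately have "ennreal ((1 - 0) * v) <= L" by (intro LIMSEQ_le_const2) auto
  then show ?thesis using 3 by (simp add: entropy_density_def)
 next
  case 4
  then show ?thesis using le[of "u / v"] by (simp add: entropy_density_def algebra_simps)
 qed (simp add: entropy_density_def)
qed

text \<open>Each tangent is continuous and lies below the regularised integrand, so it survives the
  limit. The shift by \<open>\<kappa>\<close> cancels in \<open>- u + v\<close>, which is why it
  appears only in the logarithmic term.\<close>

lemma entropy_density_liminf:
 fixes u v \<kappa> :: "nat => real"
 assumes "!!n. u n \<ge> 0" "!!n. v n \<ge> 0" "!!n. \<kappa> n > 0" and lim: "u ----> U" "v ----> V" "\<kappa> ----> 0"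
 shows "entropy_density U V
  <= liminf (%n. ennreal ((u n + \<kappa> n) * (ln (u n + \<kappa> n) - ln (v n + \<kappa> n)) - u n + v n))"
proof (rule entropy_density_le)
 show "U \<ge> 0" "V \<ge> 0" using assms(1,2) lim(1,2) by (auto intro: LIMSEQ_le_const)
 fix a :: real assume a: "a > 0"
 have "(%n. ennreal ((u n + \<kappa> n) * ln a + (1 - a) * (v n + \<kappa> n))) ----> ennreal ((U + 0) * ln a + (1 - a) * (V + 0))"
  by (intro tendsto_ennrealI tendsto_intros lim)
 then have "ennreal (U * ln a + (1 - a) * V) = liminf (%n. ennreal ((u n + \<kappa> n) * ln a + (1 - a) * (v n + \<kappa> n)))"
  by (simp add: lim_imp_Liminf[OF sequentially_bot])
 also have "... <= liminf (%n. ennreal ((u n + \<kappa> n) * (ln (u n + \<kappa> n) - ln (v n + \<kappa> n)) - u n + v n))"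
 proof (intro Liminf_mono always_eventually allI ennreal_leI)
  fix n
  have "u n + \<kappa> n > 0" "v n + \<kappa> n > 0" using assms(1,2,3) by (auto intro: add_nonneg_pos)
  from entropy_tangent[OF this a]
  show "(u n + \<kappa> n) * ln a + (1 - a) * (v n + \<kappa> n) <= (u n + \<kappa> n) * (ln (u n + \<kappa> n) - ln (v n + \<kappa> n)) - u n + v n"
   by linarith
 qed
 finally show "ennreal (U * ln a + (1 - a) * V) <= liminf (%n. ennreal ((u n + \<kappa> n) * (ln (u n + \<kappa> n) - ln (v n + \<kappa> n)) - u n + v n))" .
qed

lemma square_sum3:
 fixes a b c :: real
 shows "(a + b + c)^2 <= 3 * (a^2 + b^2 + c^2)"
 using sum_squares_bound[of a b] sum_squares_bound[of b c] sum_squares_bound[of a c]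
 by (simp add: power2_eq_square algebra_simps)

text \<open>The Hessian of the entropy factors through \<open>X = h / U - k / V\<close>, so that the cross terms
 are absorbed by the dissipation \<open>\<sigma> U X^2\<close>; \<open>% u <= v\<close> keeps \<open>U / V\<close> bounded.\<close>

lemma entropy_dissipation:
 fixes u v \<kappa> l B \<omega> h k F1 F2 P e \<sigma> q :: real
 defines "U \<equiv> u + \<kappa>" and "V \<equiv> v + \<kappa>"
 assumes pos: "\<sigma> > 0" "\<kappa> > 0" "0 < l" "l <= 1" "0 <= u" "0 <= v" "0 <= q" "\<omega> \<ge> 0" and luv: "l * u <= v"
  and r1: "\<bar>F1 - P - e * u\<bar> <= \<omega> * u" and r2: "\<bar>F2 - l * P - e * v\<bar> <= \<omega> * v"
  and e: "\<bar>e\<bar> <= B" and P: "P^2 <= u * q"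
 shows "- ((h / U - k / V) * (\<sigma> * h + F1) + (- h / V + U * k / V^2) * (\<sigma> * k + F2))
  <= 3 / (4 * \<sigma>) * (B^2 / l^2 * min \<kappa> v + \<omega>^2 * (2 * u + 2 * (v / l)) + q)"
proof -
 have U: "U > 0" "u <= U" "\<kappa> <= U" and V: "V > 0" "v <= V" "\<kappa> <= V" using pos by (auto simp: U_def V_def)
 have UV: "l * U <= V"
 proof -
  have "l * \<kappa> <= 1 * \<kappa>" using pos by (intro mult_right_mono) auto
  then show ?thesis using luv by (simp add: U_def V_def algebra_simps)
 qed
 \<comment> \<open>Three sources of error are separated: \<open>Z1\<close> comes from the shift by
   \<open>\<kappa>\<close>, \<open>Z2\<close> from the commutators, and \<open>Z3\<close> from the
   true difference of the drifts.\<close>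
 define Z1 where "Z1 = e * (\<kappa> * (u - v) / V)"
 define Z2 where "Z2 = (F1 - P - e * u) - (U / V) * (F2 - l * P - e * v)"
 define Z3 where "Z3 = P * (1 - l * U / V)"
 define X where "X = h / U - k / V"
 have Z: "F1 - (U / V) * F2 = Z1 + Z2 + Z3"
 proof -
  have uv: "\<kappa> * (u - v) / V = u - (U / V) * v" using V by (simp add: field_simps U_def V_def)
  show ?thesis unfolding Z1_def Z2_def Z3_def uv by (simp add: algebra_simps)
 qed
 \<comment> \<open>Since \<open>\<bar>u - v\<bar> <= v / l\<close>, the square splits into three
   ratios. Two of them are at most 1, and the third is at most both \<open>\<kappa>\<close> and
   \<open>v\<close>.\<close>
 have Z1: "Z1^2 / U <= B^2 / l^2 * min \<kappa> v"
 proof -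
  have "u <= v / l" using luv pos by (simp add: field_simps)
  moreover have "v <= v / l" using pos mult_right_mono[of l 1 v] by (simp add: field_simps)
  ultimately have "\<bar>u - v\<bar> <= v / l" using pos by linarith
  then have "(u - v)^2 <= (v / l)^2" by (metis abs_le_square_iff abs_of_nonneg abs_ge_zero order_trans)
  moreover have "e^2 <= B^2" using e by (metis abs_le_square_iff abs_of_nonneg abs_ge_zero order_trans)
  ultimately have "Z1^2 / U <= B^2 * (\<kappa>^2 * (v / l)^2 / V^2) / U"
   unfolding Z1_def power_mult_distrib power_divide using U
   by (intro divide_right_mono mult_mono mult_left_mono) auto
  also have "... = B^2 / l^2 * ((\<kappa> / U) * ((\<kappa> * v / V) * (v / V)))"
   by (simp add: power2_eq_square mult_ac)
  also have "... <= B^2 / l^2 * (1 * (min \<kappa> v * 1))"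
  proof (intro mult_left_mono mult_mono)
   have "\<kappa> * v <= \<kappa> * V" "\<kappa> * v <= V * v" using V pos by (auto intro!: mult_left_mono mult_right_mono)
   then show "\<kappa> * v / V <= min \<kappa> v" using V by (simp add: field_simps min_def)
  qed (use U V pos in auto)
  finally show ?thesis by simp
 qed
 have Z2: "Z2^2 / U <= \<omega>^2 * (2 * u + 2 * (v / l))"
 proof -
  have a: "\<bar>(U / V) * (F2 - l * P - e * v)\<bar> <= (U / V) * (\<omega> * v)"
   unfolding abs_mult using r2 U V by (intro mult_mono) auto
  have "Z2^2 <= 2 * (F1 - P - e * u)^2 + 2 * ((U / V) * (F2 - l * P - e * v))^2"
   unfolding Z2_def using sum_squares_le[of "F1 - P - e * u" "- ((U / V) * (F2 - l * P - e * v))"] by simp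
  also have "(F1 - P - e * u)^2 <= (\<omega> * u)^2" using power_mono[OF r1, of 2] by simp
  also have "((U / V) * (F2 - l * P - e * v))^2 <= ((U / V) * (\<omega> * v))^2" using power_mono[OF a abs_ge_zero, of 2] by (simp only: power2_abs)
  finally have "Z2^2 / U <= (2 * (\<omega> * u)^2 + 2 * ((U / V) * (\<omega> * v))^2) / U"
   using U by (intro divide_right_mono) auto
  also have "... = \<omega>^2 * (2 * (u * (u / U)) + 2 * (U * v / V * (v / V)))"
   using U V by (simp add: power2_eq_square field_simps)
  also have "... <= \<omega>^2 * (2 * (u * 1) + 2 * (v / l * 1))"
  proof (intro mult_left_mono add_mono mult_mono)
   have "l * U * v <= V * v" by (rule mult_right_mono[OF UV pos(6)])
   then show "U * v / V <= v / l" using V pos by (simp add: field_simps)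
  qed (use U V pos in auto)
  finally show ?thesis by simp
 qed
 \<comment> \<open>The mixture makes \<open>1 - l * U / V\<close> lie between 0 and 1. The bound on
   \<open>P^2\<close> carries a factor \<open>u\<close>, which cancels the division by
   \<open>U\<close>.\<close>
 have Z3: "Z3^2 / U <= q"
 proof -
  have "0 <= 1 - l * U / V" "1 - l * U / V <= 1" using UV V U pos by (auto simp: field_simps)
  then have "Z3^2 <= P^2 * 1" unfolding Z3_def power_mult_distrib
   by (intro mult_left_mono power_le_one) auto
  also have "... <= U * q" using P U pos mult_right_mono[of u U q] by linarith
  finally show ?thesis using U by (simp add: field_simps)
 qed
 \<comment> \<open>The second row of the Hessian is \<open>- U / V\<close> times the first, so
   everything factors through \<open>X\<close>.\<close>
 have "- ((h / U - k / V) * (\<sigma> * h + F1) + (- h / V + U * k / V^2) * (\<sigma> * k + F2))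
   = - (X * ((\<sigma> * U) * X + (F1 - (U / V) * F2)))"
  using U V by (simp add: X_def power2_eq_square field_simps)
 also have "... <= (F1 - (U / V) * F2)^2 / (4 * (\<sigma> * U))"
  by (rule quadratic_absorb) (use U pos in simp)
 also have "... <= (3 * (Z1^2 + Z2^2 + Z3^2)) / (4 * (\<sigma> * U))"
  unfolding Z using U pos by (intro divide_right_mono square_sum3) auto
 also have "... = 3 / (4 * \<sigma>) * (Z1^2 / U + Z2^2 / U + Z3^2 / U)"
  using U pos by (simp add: field_simps)
 also have "... <= 3 / (4 * \<sigma>) * (B^2 / l^2 * min \<kappa> v + \<omega>^2 * (2 * u + 2 * (v / l)) + q)"
  using pos by (intro mult_left_mono add_mono Z1 Z2 Z3) auto
 finally show ?thesis .
qed

lemma regularized_entropy_derivatives: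
 fixes \<kappa> :: real
 assumes "\<kappa> > 0" "fst p \<ge> 0" "snd p \<ge> 0"
 shows "((%p. (fst p + \<kappa>) * (ln (fst p + \<kappa>) - ln (snd p + \<kappa>)) - fst p + snd p) has_derivative
   (%h. (ln (fst p + \<kappa>) - ln (snd p + \<kappa>), 1 - (fst p + \<kappa>) / (snd p + \<kappa>)) \<bullet> h)) (at p)"
  and "((%p. (ln (fst p + \<kappa>) - ln (snd p + \<kappa>), 1 - (fst p + \<kappa>) / (snd p + \<kappa>))) has_derivative
   (%h. (fst h / (fst p + \<kappa>) - snd h / (snd p + \<kappa>),
      - fst h / (snd p + \<kappa>) + (fst p + \<kappa>) * snd h / (snd p + \<kappa>)^2))) (at p)"
proof -
 have pos: "fst p + \<kappa> > 0" "snd p + \<kappa> > 0" using assms by auto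
 have d: "((%p. fst p + \<kappa>) has_derivative fst) (at p)" "((%p. snd p + \<kappa>) has_derivative snd) (at p)"
  "(fst has_derivative fst) (at p)" "(snd has_derivative snd) (at p)"
  by (auto intro!: derivative_eq_intros)
 have ln: "((%p. ln (fst p + \<kappa>)) has_derivative (%h. fst h / (fst p + \<kappa>))) (at p)"
  "((%p. ln (snd p + \<kappa>)) has_derivative (%h. snd h / (snd p + \<kappa>))) (at p)"
  using has_derivative_ln[OF pos(1) d(1)] has_derivative_ln[OF pos(2) d(2)] by (simp_all add: divide_inverse)
 have alg: "U * (a / U - b / V) + a * (c - e) - a + b = (c - e) * a + (1 - U / V) * b"
  if "U > 0" "V > 0" for U V a b c e :: real
  using that by (simp add: field_simps)
 show "((%p. (fst p + \<kappa>) * (ln (fst p + \<kappa>) - ln (snd p + \<kappa>)) - fst p + snd p) has_derivative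
   (%h. (ln (fst p + \<kappa>) - ln (snd p + \<kappa>), 1 - (fst p + \<kappa>) / (snd p + \<kappa>)) \<bullet> h)) (at p)"
  by (rule has_derivative_eq_rhs[OF has_derivative_add[OF has_derivative_diff[OF has_derivative_mult[OF d(1) has_derivative_diff[OF ln]] d(3)] d(4)]])
   (simp add: inner_prod_def fun_eq_iff alg[OF pos])
 show "((%p. (ln (fst p + \<kappa>) - ln (snd p + \<kappa>), 1 - (fst p + \<kappa>) / (snd p + \<kappa>))) has_derivative
   (%h. (fst h / (fst p + \<kappa>) - snd h / (snd p + \<kappa>),
      - fst h / (snd p + \<kappa>) + (fst p + \<kappa>) * snd h / (snd p + \<kappa>)^2))) (at p)"
 proof (intro has_derivative_Pair has_derivative_diff ln)
  have alg: "0 - (- U * (inverse V * b * inverse V) + a / V) = - a / V + U * b / V^2" for U V a b :: real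
   by (simp add: power2_eq_square divide_inverse)
  show "((%p. 1 - (fst p + \<kappa>) / (snd p + \<kappa>)) has_derivative
    (%h. - fst h / (snd p + \<kappa>) + (fst p + \<kappa>) * snd h / (snd p + \<kappa>)^2)) (at p)"
  proof (rule has_derivative_eq_rhs[OF has_derivative_diff[OF has_derivative_const has_derivative_divide[OF d(1,2)]]])
   show "snd p + \<kappa> ~= 0" using pos by simp
  qed (intro ext alg)
 qed
qed

lemma mollify_Pair:
 fixes f g :: "'a::euclidean_space => real"
 assumes f: "ilb f" and g: "ilb g" and \<phi>: "test_function \<phi>"
 shows "mollify \<phi> (%x. (f x, g x)) z = (mollify \<phi> f z, mollify \<phi> g z)"
proof -
 have eq: "(%x. (f x, g x)) = (%x. f x *\<^sub>R (1, 0) + g x *\<^sub>R (0, 1))" by (simp add: fun_eq_iff)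
 have "ilb (%x. (f x, g x))"
  unfolding eq using f g by (intro Bochner_Integration.integrable_add integrable_scaleR_left)
 from mollify_test_integrand[OF this \<phi>]
 have i: "ilb (%x. \<phi> (z - x) *\<^sub>R (f x, g x))" .
 show ?thesis
  unfolding mollify_def
  using integral_bounded_linear[OF bounded_linear_fst i] integral_bounded_linear[OF bounded_linear_snd i]
  by (auto simp: prod_eq_iff)
qed

lemma mollify_add:
 assumes "ilb f" "ilb g" "test_function \<phi>"
 shows "mollify \<phi> (%x. f x + g x) z = mollify \<phi> f z + mollify \<phi> g z"
 unfolding mollify_def scaleR_add_right using assms
 by (intro Bochner_Integration.integral_add mollify_test_integrand)

lemma mollify_scaleR: "mollify \<phi> (%x. c *\<^sub>R f x) z = c *\<^sub>R mollify \<phi> f z"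
 unfolding mollify_def by (simp add: scaleR_left_commute del: scaleR_scaleR)

text \<open>Cauchy-Schwarz against the weight \<open>\<rho> (z - x) * f x\<close>. The squared
  mollified flux keeps a factor of the mollified density, so dividing by that density leaves the
  mollification of \<open>c^2 * f\<close>.\<close>

lemma mollify_square_le:
 fixes f c :: "'a::euclidean_space => real"
 assumes \<rho>: "bump \<delta> \<rho>" and f: "ilb f" "AE x in lborel. 0 <= f x"
  and [measurable]: "c \<in> bmb" and C: "!!x. \<bar>c x\<bar> <= C"
 shows "(mollify \<rho> (%x. c x * f x) z)^2 <= mollify \<rho> f z * mollify \<rho> (%x. (c x)^2 * f x) z"
proof -
 note b = bumpD[OF \<rho>]
 note [measurable] = b(5)
 have [measurable]: "f \<in> bmb" using f by auto
 have c2: "\<bar>(c x)^2\<bar> <= C^2" for x using power_mono[OF C[of x], of 2] by simp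
 have fi: "ilb (%x. c x * f x)" "ilb (%x. (c x)^2 * f x)"
  using integrable_scaleR_bounded[OF f(1), of c C] integrable_scaleR_bounded[OF f(1), of "%x. (c x)^2" "C^2"] C c2 by simp_all
 have i: "ilb (%x. \<rho> (z - x) * f x)" "ilb (%x. \<rho> (z - x) * (c x * f x))"
  "ilb (%x. \<rho> (z - x) * ((c x)^2 * f x))"
  using mollify_test_integrand[OF f(1) b(1)] mollify_test_integrand[OF fi(1) b(1)] mollify_test_integrand[OF fi(2) b(1)] by simp_all
 text \<open>The quadratic polynomial \<open>t \<mapsto> \<rho> * (f (c - t)^2)\<close> is nonnegative.\<close>
 define p q r where "p = mollify \<rho> f z" and "q = mollify \<rho> (%x. c x * f x) z" and "r = mollify \<rho> (%x. (c x)^2 * f x) z"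
 have pos: "0 <= r + t^2 * p - 2 * t * q" for t
 proof -
  have "0 <= (LB x. \<rho> (z - x) * ((c x)^2 * f x) + t^2 * (\<rho> (z - x) * f x) - 2 * t * (\<rho> (z - x) * (c x * f x)))"
  proof (rule integral_nonneg_AE, use f(2) in eventually_elim)
   case (elim x)
   have "\<rho> (z - x) * ((c x)^2 * f x) + t^2 * (\<rho> (z - x) * f x) - 2 * t * (\<rho> (z - x) * (c x * f x)) = \<rho> (z - x) * f x * (c x - t)^2"
    by (simp add: power2_eq_square algebra_simps)
   then show ?case using elim b(2) by simp
  qed
  also have "... = r + t^2 * p - 2 * t * q"
   using i by (simp add: p_def q_def r_def mollify_def)
  finally show ?thesis .
 qed
 have "q^2 <= p * r"
 proof (cases "p = 0")
  case True
  have "q = 0"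
  proof (rule ccontr)
   assume "q ~= 0"
   then show False using pos[of "(r + 1) / (2 * q)"] True by simp
  qed
  then show ?thesis using True by simp
 next
  case False
  have "0 <= p" unfolding p_def mollify_def using f(2) b(2) by (intro integral_nonneg_AE) auto
  then have p: "p > 0" using False by simp
  have "0 <= r - q^2 / p" using pos[of "q / p"] p by (simp add: power2_eq_square field_simps)
  then show ?thesis using p by (simp add: field_simps)
 qed
 then show ?thesis by (simp add: p_def q_def r_def)
qed

lemma mollify_cmult: "mollify \<phi> (%x. c * f x) z = c * mollify \<phi> f z" for f :: "'a::euclidean_space => real"
 using mollify_scaleR[of \<phi> c f z] by simp

lemma bump_mollify_mono:
 fixes f g :: "'a::euclidean_space => real"
 assumes \<rho>: "bump \<delta> \<rho>" and f: "ilb f" and g: "ilb g" and le: "AE x in lborel. f x <= g x"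
 shows "mollify \<rho> f z <= mollify \<rho> g z"
 unfolding mollify_def
proof (rule integral_mono_AE[OF mollify_test_integrand[OF f bumpD(1)[OF \<rho>]] mollify_test_integrand[OF g bumpD(1)[OF \<rho>]]])
 show "AE x in lborel. \<rho> (z - x) *\<^sub>R f x <= \<rho> (z - x) *\<^sub>R g x"
  using le by eventually_elim (use bumpD(2)[OF \<rho>] in \<open>auto intro: mult_left_mono\<close>)
qed

lemma nn_integral_mollify_bump_le:
 fixes g :: "'a::euclidean_space => real"
 assumes \<rho>: "bump \<delta> \<rho>" and g: "ilb g" "AE x in lborel. 0 <= g x"
 shows "(NN z. ennreal (mollify \<rho> g z)) <= (NN x. ennreal (g x))"
proof -
 note b = bumpD[OF \<rho>]
 note [measurable] = b(5)
 have [measurable]: "g \<in> bmb" using g by auto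
 have "(NN z. ennreal (mollify \<rho> g z)) <= (NN z. ennreal (norm (mollify \<rho> g z)))"
  by (intro nn_integral_mono ennreal_leI) simp
 also have "... <= (NN x. ennreal \<bar>\<rho> x\<bar>) * (NN x. ennreal (norm (g x)))"
  by (rule mollify_nn_integral_le) measurable
 also have "... = (NN x. ennreal (norm (g x)))" using b(2,3) by simp
 also have "... = (NN x. ennreal (g x))"
  by (rule nn_integral_cong_AE, use g(2) in eventually_elim) simp
 finally show ?thesis .
qed

lemma bounded_L1_combination:
 assumes f: "bounded_L1 N f" and g: "bounded_L1 N g" and l: "0 <= l" "l <= 1"
 shows "bounded_L1 N (%x. l * f x + (1 - l) * g x)"
proof -
 note f = bounded_L1D[OF f] and g = bounded_L1D[OF g]
 have le: "\<bar>l * a + (1 - l) * b\<bar> <= l * \<bar>a\<bar> + (1 - l) * \<bar>b\<bar>" for a b :: real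
  using abs_triangle_ineq[of "l * a" "(1 - l) * b"] l by (simp add: abs_mult)
 have "(LB x. \<bar>l * f x + (1 - l) * g x\<bar>) <= (LB x. l * \<bar>f x\<bar> + (1 - l) * \<bar>g x\<bar>)"
  using f(1) g(1) le by (intro integral_mono) auto
 also have "... = l * (LB x. \<bar>f x\<bar>) + (1 - l) * (LB x. \<bar>g x\<bar>)"
  using f(1) g(1) by simp
 also have "... <= l * N + (1 - l) * N" using l f(2) g(2) by (intro add_mono mult_left_mono) auto
 finally have 1: "(LB x. \<bar>l * f x + (1 - l) * g x\<bar>) <= N" by (simp add: algebra_simps)
 have "AE x in lborel. \<bar>l * f x + (1 - l) * g x\<bar> <= N"
  using f(3) g(3)
 proof eventually_elim
  case (elim x)
  have "l * \<bar>f x\<bar> + (1 - l) * \<bar>g x\<bar> <= l * N + (1 - l) * N" using l elim by (intro add_mono mult_left_mono) auto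
  then show ?case using le[of "f x" "g x"] by (simp add: algebra_simps)
 qed
 with 1 show ?thesis using f(1) g(1) by (simp add: bounded_L1_def)
qed

definition drift_flux :: "(real => 'a::euclidean_space => 'a) => (real => 'a => real) => 'a => real => 'a => real" where
 "drift_flux d f b t x = (d t x \<bullet> b) * f t x"

text \<open>The intermediate solution is meant to be \<open>f\<close> and the limiting one
  \<open>g\<close>. The drifts are frozen as given regular fields, so each equation is linear, and
  the coupling between species is postponed to the final Gronwall argument.\<close>

locale two_flows =
 fixes T \<sigma> Mf Mg B N :: real and f g :: "real => 'a::euclidean_space => real" and d e :: "real => 'a => 'a"
 assumes fp_f: "fokker_planck T \<sigma> Mf f (drift_flux d f)" and fp_g: "fokker_planck T \<sigma> Mg g (drift_flux e g)"
  and sigma: "\<sigma> > 0" and T: "T \<ge> 0" and d: "regular_drift B d" and e: "regular_drift B e"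
  and bdd_f: "!!t. bounded_L1 N (f t)" and bdd_g: "!!t. bounded_L1 N (g t)"
  and nonneg_f: "!!t. AE x in lborel. 0 <= f t x" and nonneg_g: "!!t. AE x in lborel. 0 <= g t x"
  and init: "AE x in lborel. f 0 x = g 0 x"
begin

definition mix :: "real => real => 'a => real" where
 "mix l t x = l * f t x + (1 - l) * g t x"

text \<open>The mixture obeys the equation with the mixed flux because the equation is linear in
  density and flux together. This flux is not a common drift times the mixture.\<close>

definition mix_flux :: "real => 'a => real => 'a => real" where
 "mix_flux l b t x = l * drift_flux d f b t x + (1 - l) * drift_flux e g b t x"

lemma fokker_planck_pair:
 assumes l: "0 <= l" "l <= 1"
 shows "fokker_planck T \<sigma> (2 * Mf + 2 * Mg) (%t x. (f t x, mix l t x)) (%b t x. (drift_flux d f b t x, mix_flux l b t x))"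
proof -
 have n: "norm (a, l * a) <= 2 * norm a" "norm (0::real, (1 - l) * a) <= 2 * norm a" for a :: real
 proof -
  have "l * \<bar>a\<bar> <= 1 * \<bar>a\<bar>" "(1 - l) * \<bar>a\<bar> <= 1 * \<bar>a\<bar>" 
   using mult_right_mono[of l 1 "\<bar>a\<bar>"] mult_right_mono[of "1 - l" 1 "\<bar>a\<bar>"] l by auto
  then show "norm (a, l * a) <= 2 * norm a" "norm (0::real, (1 - l) * a) <= 2 * norm a"
   using norm_Pair_le[of a "l * a"] norm_Pair_le[of "0::real" "(1 - l) * a"] l by (auto simp: abs_mult)
 qed
 have 1: "bounded_linear (%a::real. (a, l * a))" "bounded_linear (%a::real. (0::real, (1 - l) * a))"
  by (intro bounded_linear_Pair bounded_linear_ident bounded_linear_mult_right bounded_linear_zero)+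
 have "fokker_planck T \<sigma> (2 * Mf + 2 * Mg) (%t x. (f t x, l * f t x) + (0, (1 - l) * g t x))
  (%b t x. (drift_flux d f b t x, l * drift_flux d f b t x) + (0, (1 - l) * drift_flux e g b t x))"
  by (intro fokker_planck_add fokker_planck_linear[OF fp_f 1(1) n(1)] fokker_planck_linear[OF fp_g 1(2) n(2)]) auto
 then show ?thesis by (simp add: mix_def mix_flux_def)
qed

lemma mix_nonneg:
 assumes "0 <= l" "l <= 1"
 shows "AE x in lborel. 0 <= mix l t x" "AE x in lborel. l * f t x <= mix l t x"
proof -
 show "AE x in lborel. 0 <= mix l t x" using nonneg_f[of t] nonneg_g[of t]
  by eventually_elim (use assms in \<open>auto simp: mix_def\<close>)
 show "AE x in lborel. l * f t x <= mix l t x" using nonneg_g[of t]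
  by eventually_elim (use assms in \<open>auto simp: mix_def\<close>)
qed

lemma bdd_mix: "0 <= l ==> l <= 1 ==> bounded_L1 N (mix l t)"
 unfolding mix_def by (rule bounded_L1_combination[OF bdd_f bdd_g])

lemma drift_diff:
 assumes "b \<in> Basis"
 shows "\<bar>(d t x - e t x) \<bullet> b\<bar> <= 2 * B" "(%x. (d t x - e t x) \<bullet> b) \<in> bmb" "\<bar>e t x \<bullet> b\<bar> <= B"
proof -
 note [measurable] = regular_driftD(3)[OF d] regular_driftD(3)[OF e]
 have "norm (d t x - e t x) <= B + B"
  using norm_triangle_ineq4[of "d t x" "e t x"] regular_driftD(2)[OF d, of t x] regular_driftD(2)[OF e, of t x] by linarith
 then show "\<bar>(d t x - e t x) \<bullet> b\<bar> <= 2 * B" using Basis_le_norm[OF assms, of "d t x - e t x"] by linarith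
 show "(%x. (d t x - e t x) \<bullet> b) \<in> bmb" by measurable
 show "\<bar>e t x \<bullet> b\<bar> <= B" using Basis_le_norm[OF assms, of "e t x"] regular_driftD(2)[OF e, of t x] by linarith
qed

text \<open>Both fluxes are expressed relative to the single reference drift \<open>e\<close>: their
  common excess is \<open>P\<close>, entering the mixture with weight \<open>l\<close>. So only the
  modulus of \<open>e\<close> matters, and \<open>P\<close> inherits the weight \<open>f\<close>
  from Cauchy-Schwarz.\<close>

lemma flux_commutators:
 fixes t \<omega> :: real and z :: 'a
 assumes \<rho>: "bump \<delta> \<rho>" and \<omega>: "\<forall>t x x'. norm (x - x') <= \<delta> --> norm (e t x - e t x') <= \<omega>"
  and l: "0 <= l" "l <= 1" and b: "b \<in> Basis"
 defines "P \<equiv> mollify \<rho> (%x. ((d t x - e t x) \<bullet> b) * f t x) z"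
 shows "\<bar>mollify \<rho> (drift_flux d f b t) z - P - (e t z \<bullet> b) * mollify \<rho> (f t) z\<bar> <= \<omega> * mollify \<rho> (f t) z"
  and "\<bar>mollify \<rho> (mix_flux l b t) z - l * P - (e t z \<bullet> b) * mollify \<rho> (mix l t) z\<bar> <= \<omega> * mollify \<rho> (mix l t) z"
  and "P^2 <= mollify \<rho> (f t) z * mollify \<rho> (%x. ((d t x - e t x) \<bullet> b)^2 * f t x) z"
proof -
 note bp = bumpD[OF \<rho>] and dd = drift_diff[OF b]
 note [measurable] = dd(2) bp(5)
 note fi = bounded_L1D[OF bdd_f] and mi = bounded_L1D[OF bdd_mix[OF l]]
 have abs: "mollify \<rho> (%x. \<bar>h x\<bar>) z = mollify \<rho> h z" if "AE x in lborel. 0 <= h x" and [measurable]: "h \<in> bmb" for h :: "'a => real"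
 proof -
  have "AE x in lborel. \<bar>h x\<bar> = h x" using that(1) by eventually_elim auto
  then show ?thesis by (subst mollify_cong_AE[of "%x. \<bar>h x\<bar>" h]) auto
 qed
 have em: "e t \<in> bmb" by (rule regular_driftD(3)[OF e])
 have eB: "norm (e t x) <= B" for x by (rule regular_driftD(2)[OF e])
 have i: "ilb (%x. (e t x \<bullet> b) * h x)" "ilb (%x. ((d t x - e t x) \<bullet> b) * h x)"
  if "ilb h" for h :: "'a => real"
  using integrable_scaleR_bounded[OF that, of "%x. e t x \<bullet> b" B] integrable_scaleR_bounded[OF that, of "%x. (d t x - e t x) \<bullet> b" "2 * B"] dd em
  by simp_all
 have "mollify \<rho> (drift_flux d f b t) z = mollify \<rho> (%x. (e t x \<bullet> b) * f t x + ((d t x - e t x) \<bullet> b) * f t x) z"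
  unfolding drift_flux_def[abs_def] by (simp add: inner_diff_left algebra_simps)
 also have "... = mollify \<rho> (%x. (e t x \<bullet> b) * f t x) z + P"
  unfolding P_def by (rule mollify_add[OF i[OF fi(1)] bp(1)])
 finally have F1: "mollify \<rho> (drift_flux d f b t) z - P = mollify \<rho> (%x. (e t x \<bullet> b) * f t x) z" by simp
 show "\<bar>mollify \<rho> (drift_flux d f b t) z - P - (e t z \<bullet> b) * mollify \<rho> (f t) z\<bar> <= \<omega> * mollify \<rho> (f t) z"
  unfolding F1
  using mollify_commutator[OF \<rho> fi(1)[of t] em eB _ b, where \<omega>=\<omega> and z=z] \<omega> by (simp add: norm_minus_commute abs[OF nonneg_f fi(4)])
 have "mollify \<rho> (mix_flux l b t) z = mollify \<rho> (%x. (e t x \<bullet> b) * mix l t x + l *\<^sub>R (((d t x - e t x) \<bullet> b) * f t x)) z"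
  unfolding drift_flux_def mix_flux_def[abs_def] mix_def by (simp add: inner_diff_left algebra_simps)
 also have "... = mollify \<rho> (%x. (e t x \<bullet> b) * mix l t x) z + l * P"
  unfolding P_def using mollify_add[OF i(1)[OF mi(1)] integrable_scaleR_right[OF i(2)[OF fi(1)]] bp(1)]
  by (simp only: mollify_cmult real_scaleR_def)
 finally have F2: "mollify \<rho> (mix_flux l b t) z - l * P = mollify \<rho> (%x. (e t x \<bullet> b) * mix l t x) z" by simp
 show "\<bar>mollify \<rho> (mix_flux l b t) z - l * P - (e t z \<bullet> b) * mollify \<rho> (mix l t) z\<bar> <= \<omega> * mollify \<rho> (mix l t) z"
  unfolding F2
  using mollify_commutator[OF \<rho> mi(1)[of t] em eB _ b, where \<omega>=\<omega> and z=z] \<omega> by (simp add: norm_minus_commute abs[OF mix_nonneg(1)[OF l] mi(4)])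
 show "P^2 <= mollify \<rho> (f t) z * mollify \<rho> (%x. ((d t x - e t x) \<bullet> b)^2 * f t x) z"
  unfolding P_def by (rule mollify_square_le[OF \<rho> fi(1) nonneg_f dd(2) dd(1)])
qed

end

text \<open>The shift makes the entropy smooth on the closed square of possible values. It still
  vanishes on the diagonal, as the energy identity requires at time 0, and it stays
  nonnegative.\<close>

definition regularized_entropy :: "real => real \<times> real => real" where
 "regularized_entropy \<kappa> p = (fst p + \<kappa>) * (ln (fst p + \<kappa>) - ln (snd p + \<kappa>)) - fst p + snd p"

lemma regularized_entropy_nonneg:
 assumes "\<kappa> > 0" "0 <= u" "0 <= v"
 shows "0 <= regularized_entropy \<kappa> (u, v)"
 using entropy_tangent[of "u + \<kappa>" "v + \<kappa>" 1] assms by (simp add: regularized_entropy_def)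

lemma sum_inner_Basis_square:
 fixes c :: "'a::euclidean_space"
 shows "(SB b. (c \<bullet> b)^2) = (norm c)^2"
 unfolding power2_norm_eq_inner euclidean_inner[of c c] by (simp add: power2_eq_square)

lemma ennreal_dissipation_split:
 fixes c A m D u v l q :: real
 assumes "0 <= c" "0 <= A" "0 <= m" "0 <= D" "0 <= u" "0 <= v" "0 < l" "0 <= q"
 shows "ennreal (c * (A * m + D * (2 * u + 2 * (v / l)) + q))
  = ennreal c * (ennreal A * ennreal m + ennreal D * (2 * ennreal u + ennreal (2 / l) * ennreal v) + ennreal q)"
proof -
 have "2 * (v / l) = (2 / l) * v" by simp
 then show ?thesis using assms by (simp add: ennreal_mult del: times_divide_eq_left)
qed

context two_flows
begin

abbreviation (input) "u_moll \<rho> t z \<equiv> mollify \<rho> (f t) z"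
abbreviation (input) "v_moll \<rho> l t z \<equiv> mollify \<rho> (mix l t) z"

lemma moll_bounds:
 assumes \<rho>: "bump \<delta> \<rho>" and l: "0 <= l" "l <= 1"
 shows "0 <= u_moll \<rho> t z" "u_moll \<rho> t z <= N" "0 <= v_moll \<rho> l t z" "v_moll \<rho> l t z <= N" "l * u_moll \<rho> t z <= v_moll \<rho> l t z"
  "(NN z. ennreal (u_moll \<rho> t z)) <= ennreal N" "(NN z. ennreal (v_moll \<rho> l t z)) <= ennreal N"
proof -
 have bd: "0 <= mollify \<rho> h z \<and> mollify \<rho> h z <= N \<and> (NN z. ennreal (mollify \<rho> h z)) <= ennreal N"
  if h: "bounded_L1 N h" and nn: "AE x in lborel. 0 <= h x" for h
 proof (intro conjI)
  show "0 <= mollify \<rho> h z" unfolding mollify_def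
   by (intro integral_nonneg_AE, use nn in eventually_elim) (simp add: bumpD(2)[OF \<rho>])
  have "AE x in lborel. norm (h x) <= N" using bounded_L1D(3)[OF h] by simp
  from mollify_AE_bound[OF \<rho> bounded_L1D(1)[OF h] this, of z]
  show "mollify \<rho> h z <= N" by simp
  have "(NN z. ennreal (mollify \<rho> h z)) <= (NN x. ennreal (h x))"
   by (rule nn_integral_mollify_bump_le[OF \<rho> bounded_L1D(1)[OF h] nn])
  also have "... <= (NN x. ennreal \<bar>h x\<bar>)" by (intro nn_integral_mono ennreal_leI) simp
  also have "... = ennreal (LB x. \<bar>h x\<bar>)" using bounded_L1D(1)[OF h] by (intro nn_integral_eq_integral) auto
  also have "... <= ennreal N" by (intro ennreal_leI bounded_L1D(2)[OF h])
  finally show "(NN z. ennreal (mollify \<rho> h z)) <= ennreal N" .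
 qed
 show "0 <= u_moll \<rho> t z" "u_moll \<rho> t z <= N" "(NN z. ennreal (u_moll \<rho> t z)) <= ennreal N"
  using bd[OF bdd_f nonneg_f] by auto
 show "0 <= v_moll \<rho> l t z" "v_moll \<rho> l t z <= N" "(NN z. ennreal (v_moll \<rho> l t z)) <= ennreal N"
  using bd[OF bdd_mix[OF l] mix_nonneg(1)[OF l]] by auto
 have "mollify \<rho> (%x. l *\<^sub>R f t x) z <= v_moll \<rho> l t z"
  using bounded_L1D(1)[OF bdd_f, of t] mix_nonneg(2)[OF l, of t]
  by (intro bump_mollify_mono[OF \<rho> _ bounded_L1D(1)[OF bdd_mix[OF l]]]) auto
 then show "l * u_moll \<rho> t z <= v_moll \<rho> l t z" by (simp only: mollify_cmult real_scaleR_def)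
qed

lemma mix_measurable: "(%(t,x). mix l t x) \<in> borel_measurable (lborel \<Otimes>\<^sub>M lborel)"
proof -
 note [measurable] = fokker_planckD(1)[OF fp_f, unfolded case_prod_beta'] fokker_planckD(1)[OF fp_g, unfolded case_prod_beta']
 show ?thesis unfolding mix_def case_prod_beta' by measurable
qed

lemma mollified_dissipation:
 fixes \<rho> :: "'a => real" and \<omega> l \<kappa> r :: real and hh :: "'a => real \<times> real" and z :: 'a
 assumes \<rho>: "bump \<delta> \<rho>" and \<omega>: "\<forall>t x x'. norm (x - x') <= \<delta> --> norm (e t x - e t x') <= \<omega>" "\<omega> \<ge> 0"
  and l: "0 < l" "l <= 1" and \<kappa>: "\<kappa> > 0"
 defines "p \<equiv> %t z. (u_moll \<rho> t z, v_moll \<rho> l t z)"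
 shows "- (SB b. (fst (hh b) / (fst (p r z) + \<kappa>) - snd (hh b) / (snd (p r z) + \<kappa>),
      - fst (hh b) / (snd (p r z) + \<kappa>) + (fst (p r z) + \<kappa>) * snd (hh b) / (snd (p r z) + \<kappa>)^2)
    \<bullet> (\<sigma> *\<^sub>R hh b + (mollify \<rho> (drift_flux d f b r) z, mollify \<rho> (mix_flux l b r) z)))
  <= 3 / (4 * \<sigma>) * (DIM('a) * B^2 / l^2 * min \<kappa> (v_moll \<rho> l r z) + DIM('a) * \<omega>^2 * (2 * u_moll \<rho> r z + 2 * (v_moll \<rho> l r z / l))
    + (SB b. mollify \<rho> (%x. ((d r x - e r x) \<bullet> b)^2 * f r x) z))"
proof -
 have l0: "0 <= l" using l by simp
 note mb = moll_bounds[OF \<rho> l0 l(2)]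
 have "- (SB b. (fst (hh b) / (fst (p r z) + \<kappa>) - snd (hh b) / (snd (p r z) + \<kappa>),
      - fst (hh b) / (snd (p r z) + \<kappa>) + (fst (p r z) + \<kappa>) * snd (hh b) / (snd (p r z) + \<kappa>)^2)
    \<bullet> (\<sigma> *\<^sub>R hh b + (mollify \<rho> (drift_flux d f b r) z, mollify \<rho> (mix_flux l b r) z)))
  <= (SB b. 3 / (4 * \<sigma>) * (B^2 / l^2 * min \<kappa> (v_moll \<rho> l r z) + \<omega>^2 * (2 * u_moll \<rho> r z + 2 * (v_moll \<rho> l r z / l))
    + mollify \<rho> (%x. ((d r x - e r x) \<bullet> b)^2 * f r x) z))"
  unfolding sum_negf[symmetric]
 proof (rule sum_mono)
  fix b :: 'a assume b: "b \<in> Basis"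
  note fc = flux_commutators[OF \<rho> \<omega>(1) l0 l(2) b, where t=r and z=z]
  have q: "0 <= mollify \<rho> (%x. ((d r x - e r x) \<bullet> b)^2 * f r x) z" unfolding mollify_def
   by (intro integral_nonneg_AE, use nonneg_f[of r] in eventually_elim) (simp add: bumpD(2)[OF \<rho>])
  show "- ((fst (hh b) / (fst (p r z) + \<kappa>) - snd (hh b) / (snd (p r z) + \<kappa>),
      - fst (hh b) / (snd (p r z) + \<kappa>) + (fst (p r z) + \<kappa>) * snd (hh b) / (snd (p r z) + \<kappa>)^2)
    \<bullet> (\<sigma> *\<^sub>R hh b + (mollify \<rho> (drift_flux d f b r) z, mollify \<rho> (mix_flux l b r) z)))
  <= 3 / (4 * \<sigma>) * (B^2 / l^2 * min \<kappa> (v_moll \<rho> l r z) + \<omega>^2 * (2 * u_moll \<rho> r z + 2 * (v_moll \<rho> l r z / l))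
    + mollify \<rho> (%x. ((d r x - e r x) \<bullet> b)^2 * f r x) z)"
   using entropy_dissipation[OF sigma \<kappa> l mb(1)[of r z] mb(3)[of r z] q \<omega>(2) mb(5)[of r z] fc(1) fc(2) drift_diff(3)[OF b, of r z] fc(3)]
   unfolding p_def inner_prod_def fst_conv snd_conv fst_add snd_add fst_scaleR snd_scaleR inner_real_def real_scaleR_def .
 qed
 also have "... = 3 / (4 * \<sigma>) * (DIM('a) * B^2 / l^2 * min \<kappa> (v_moll \<rho> l r z) + DIM('a) * \<omega>^2 * (2 * u_moll \<rho> r z + 2 * (v_moll \<rho> l r z / l))
    + (SB b. mollify \<rho> (%x. ((d r x - e r x) \<bullet> b)^2 * f r x) z))"
  unfolding sum_distrib_left[symmetric] sum.distrib sum_constant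
  by (intro arg_cong[where f="%x. 3 / (4 * \<sigma>) * x"]) (simp add: algebra_simps add_divide_distrib)
 finally show ?thesis .
qed

text \<open>Mollification preserves the integral of a nonnegative function, and the squared
  components add up to the squared norm.\<close>

lemma nn_integral_relative_flux:
 assumes \<rho>: "bump \<delta> \<rho>"
 shows "(NN z. ennreal (SB b. mollify \<rho> (%x. ((d r x - e r x) \<bullet> b)^2 * f r x) z))
  <= (NN x. ennreal (f r x * (norm (d r x - e r x))^2))"
proof -
 note [measurable] = regular_driftD(3)[OF d] regular_driftD(3)[OF e] bumpD(5)[OF \<rho>] bounded_L1D(4)[OF bdd_f]
 have i: "ilb (%x. ((d r x - e r x) \<bullet> b)^2 * f r x)" if b: "b \<in> Basis" for b
 proof -
  have "\<bar>((d r x - e r x) \<bullet> b)^2\<bar> <= (2 * B)^2" for x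
   using power_mono[OF drift_diff(1)[OF b, of r x] abs_ge_zero, of 2] by simp
  from integrable_scaleR_bounded[OF bounded_L1D(1)[OF bdd_f] _ AE_I2[OF this]] show ?thesis
   by simp
 qed
 have nn: "AE x in lborel. 0 <= ((d r x - e r x) \<bullet> b)^2 * f r x" for b
  using nonneg_f[of r] by eventually_elim simp
 have pos: "0 <= mollify \<rho> (%x. ((d r x - e r x) \<bullet> b)^2 * f r x) z" for b z
  unfolding mollify_def by (intro integral_nonneg_AE, use nn[of b] in eventually_elim) (simp add: bumpD(2)[OF \<rho>])
 have mm: "mollify \<rho> (%x. ((d r x - e r x) \<bullet> b)^2 * f r x) \<in> bmb" for b
  by (rule mollify_measurable) measurable
 note [measurable] = mm
 have "(NN z. ennreal (SB b. mollify \<rho> (%x. ((d r x - e r x) \<bullet> b)^2 * f r x) z))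
  = (NN z. (SB b. ennreal (mollify \<rho> (%x. ((d r x - e r x) \<bullet> b)^2 * f r x) z)))"
  by (intro nn_integral_cong sum_ennreal[symmetric] pos)
 also have "... = (SB b. NN z. ennreal (mollify \<rho> (%x. ((d r x - e r x) \<bullet> b)^2 * f r x) z))"
  by (rule nn_integral_sum) measurable
 also have "... <= (SB b. NN x. ennreal (((d r x - e r x) \<bullet> b)^2 * f r x))"
  by (intro sum_mono nn_integral_mollify_bump_le[OF \<rho> i nn])
 also have "... = (NN x. (SB b. ennreal (((d r x - e r x) \<bullet> b)^2 * f r x)))"
  by (rule nn_integral_sum[symmetric]) measurable
 also have "... = (NN x. ennreal (f r x * (norm (d r x - e r x))^2))"
 proof (rule nn_integral_cong_AE, use nonneg_f[of r] in eventually_elim)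
  case (elim x)
  have "(SB b. ennreal (((d r x - e r x) \<bullet> b)^2 * f r x)) = ennreal (SB b. ((d r x - e r x) \<bullet> b)^2 * f r x)"
   using elim by (intro sum_ennreal) auto
  also have "(SB b. ((d r x - e r x) \<bullet> b)^2 * f r x) = f r x * (norm (d r x - e r x))^2"
   unfolding sum_distrib_right[symmetric] sum_inner_Basis_square by simp
  finally show ?case .
 qed
 finally show ?thesis .
qed

text \<open>The pointwise dissipation bound is integrated with the energy inequality. The shift
  error stays in the form \<open>min \<kappa> v\<close>: a bare constant \<open>\<kappa>\<close>
  would have infinite integral over the whole space.\<close>

lemma mollified_entropy:
 fixes \<rho> :: "'a => real" and \<omega> l \<kappa> :: real
 assumes \<rho>: "bump \<delta> \<rho>" and \<omega>: "\<forall>t x x'. norm (x - x') <= \<delta> --> norm (e t x - e t x') <= \<omega>" "\<omega> \<ge> 0"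
  and l: "0 < l" "l <= 1" and \<kappa>: "\<kappa> > 0" and t: "t \<in> {0..T}"
 shows "(NN z. ennreal (regularized_entropy \<kappa> (u_moll \<rho> t z, v_moll \<rho> l t z)))
  <= ennreal (3 / (4 * \<sigma>)) * (NN r. indicator {0..t} r * (ennreal (DIM('a) * B^2 / l^2) * (NN z. ennreal (min \<kappa> (v_moll \<rho> l r z)))
    + ennreal (DIM('a) * \<omega>^2 * (2 * N + 2 * (N / l)))
    + (NN x. ennreal (f r x * (norm (d r x - e r x))^2))))"
proof -
 have l0: "0 <= l" using l by simp
 note mb = moll_bounds[OF \<rho> l0 l(2)] and bp = bumpD[OF \<rho>]
 note [measurable] = bp(5) bounded_L1D(4)[OF bdd_f] bounded_L1D(4)[OF bdd_mix[OF l0 l(2)]] regular_driftD(3)[OF d] regular_driftD(3)[OF e]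
 have mm: "mollify \<rho> (f r) \<in> bmb" "mollify \<rho> (mix l r) \<in> bmb"
  "mollify \<rho> (%x. ((d r x - e r x) \<bullet> b)^2 * f r x) \<in> bmb" for r b
  by (rule mollify_measurable; measurable)+
 note [measurable] = mm
 define S where "S = {0..N} \<times> {0..N}"
 have S: "compact S" "convex S" unfolding S_def by (intro compact_Times convex_Times compact_Icc convex_real_interval)+
 note fp = fokker_planck_pair[OF l0 l(2)]
 have pair: "mollify \<rho> (%x. (f t x, mix l t x)) z = (u_moll \<rho> t z, v_moll \<rho> l t z)" for t z
  by (rule mollify_Pair[OF bounded_L1D(1)[OF bdd_f] bounded_L1D(1)[OF bdd_mix[OF l0 l(2)]] bp(1)])
 have inS: "mollify \<rho> (%x. (f t x, mix l t x)) z \<in> S" for t z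
  unfolding pair S_def using mb(1-4)[of t z] by simp
 have fpos: "fst p \<ge> 0" "snd p \<ge> 0" if "p \<in> S" for p using that by (auto simp: S_def)
 have d1: "(regularized_entropy \<kappa> has_derivative (%h. (ln (fst p + \<kappa>) - ln (snd p + \<kappa>), 1 - (fst p + \<kappa>) / (snd p + \<kappa>)) \<bullet> h)) (at p)" if "p \<in> S" for p
  using regularized_entropy_derivatives(1)[OF \<kappa> fpos[OF that]] by (simp add: regularized_entropy_def[abs_def])
 have d2: "((%p. (ln (fst p + \<kappa>) - ln (snd p + \<kappa>), 1 - (fst p + \<kappa>) / (snd p + \<kappa>))) has_derivative
   (%h. (fst h / (fst p + \<kappa>) - snd h / (snd p + \<kappa>), - fst h / (snd p + \<kappa>) + (fst p + \<kappa>) * snd h / (snd p + \<kappa>)^2))) (at p)" if "p \<in> S" for p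
  by (rule regularized_entropy_derivatives(2)[OF \<kappa> fpos[OF that]])
 have c2: "continuous_on (S \<times> UNIV) (%(p::real\<times>real,h::real\<times>real). (fst h / (fst p + \<kappa>) - snd h / (snd p + \<kappa>),
   - fst h / (snd p + \<kappa>) + (fst p + \<kappa>) * snd h / (snd p + \<kappa>)^2))"
  unfolding case_prod_unfold using \<kappa> fpos by (intro continuous_intros) (auto simp: add_nonneg_eq_0_iff S_def)
 have z0: "regularized_entropy \<kappa> (mollify \<rho> (%x. (f 0 x, mix l 0 x)) z) = 0" for z
 proof -
  have "AE x in lborel. f 0 x = mix l 0 x" using init by eventually_elim (simp add: mix_def algebra_simps)
  then have "mollify \<rho> (f 0) = mollify \<rho> (mix l 0)" by (rule mollify_cong_AE) measurable
  then show ?thesis unfolding pair by (simp add: regularized_entropy_def)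
 qed
 define Q where "Q r z = (SB b. mollify \<rho> (%x. ((d r x - e r x) \<bullet> b)^2 * f r x) z)" for r z
 have Q0: "0 <= Q r z" for r z
  unfolding Q_def mollify_def by (intro sum_nonneg integral_nonneg_AE, use nonneg_f[of r] in eventually_elim) (simp add: bp(2))
 have [measurable]: "Q r \<in> bmb" for r unfolding Q_def[abs_def] by measurable
 define R where "R r z = ennreal (3 / (4 * \<sigma>)) * (ennreal (DIM('a) * B^2 / l^2) * ennreal (min \<kappa> (v_moll \<rho> l r z))
  + ennreal (DIM('a) * \<omega>^2) * (2 * ennreal (u_moll \<rho> r z) + ennreal (2 / l) * ennreal (v_moll \<rho> l r z)) + ennreal (Q r z))" for r z
 have R_eq: "R r z = ennreal (3 / (4 * \<sigma>) * (DIM('a) * B^2 / l^2 * min \<kappa> (v_moll \<rho> l r z) + DIM('a) * \<omega>^2 * (2 * u_moll \<rho> r z + 2 * (v_moll \<rho> l r z / l)) + Q r z))" for r z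
  unfolding R_def
  by (rule ennreal_dissipation_split[symmetric]) (use mb(1,3)[of r z] l sigma \<kappa> Q0[of r z] in auto)
 have Rb: "ennreal (- (SB b. (%p h. (fst h / (fst p + \<kappa>) - snd h / (snd p + \<kappa>), - fst h / (snd p + \<kappa>) + (fst p + \<kappa>) * snd h / (snd p + \<kappa>)^2))
    (mollify \<rho> (%x. (f r x, mix l r x)) z) (mollify (dir_deriv b \<rho>) (%x. (f r x, mix l r x)) z)
   \<bullet> flux \<sigma> \<rho> (%t x. (f t x, mix l t x)) (%b t x. (drift_flux d f b t x, mix_flux l b t x)) b r z)) <= R r z" for r z
 proof -
  have Fp: "mollify \<rho> (%x. (drift_flux d f b r x, mix_flux l b r x)) z = (mollify \<rho> (drift_flux d f b r) z, mollify \<rho> (mix_flux l b r) z)"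
   if b: "b \<in> Basis" for b
  proof (rule mollify_Pair[OF _ _ bp(1)])
   show 1: "ilb (drift_flux d f b r)" using fokker_planckD(5)[OF fp_f b] .
   show "ilb (mix_flux l b r)" unfolding mix_flux_def[abs_def]
    using 1 fokker_planckD(5)[OF fp_g b, of r] by simp
  qed
  show ?thesis unfolding R_eq
   using mollified_dissipation[OF \<rho> \<omega> l \<kappa>, where hh="%b. mollify (dir_deriv b \<rho>) (%x. (f r x, mix l r x)) z" and r=r and z=z, folded Q_def]
   unfolding pair flux_def by (intro ennreal_leI) (simp only: Fp fst_conv snd_conv cong: sum.cong)
 qed
 have "(NN z. ennreal (regularized_entropy \<kappa> (u_moll \<rho> t z, v_moll \<rho> l t z)))
   = ennreal (LB z. regularized_entropy \<kappa> (u_moll \<rho> t z, v_moll \<rho> l t z))"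
  using energy_identity(1)[OF fp bp(1) S inS d1 d2 c2 z0 t] regularized_entropy_nonneg[OF \<kappa> mb(1) mb(3)]
  by (intro nn_integral_eq_integral) (auto simp: pair)
 also have "... <= (NN r. indicator {0..t} r * (NN z. R r z))"
  using energy_inequality[OF fp bp(1) S inS d1 d2 c2 z0 t Rb] by (simp add: pair)
 also have "... <= (NN r. ennreal (3 / (4 * \<sigma>)) * (indicator {0..t} r * (ennreal (DIM('a) * B^2 / l^2) * (NN z. ennreal (min \<kappa> (v_moll \<rho> l r z)))
    + ennreal (DIM('a) * \<omega>^2 * (2 * N + 2 * (N / l)))
    + (NN x. ennreal (f r x * (norm (d r x - e r x))^2)))))"
 proof (rule nn_integral_mono)
  fix r
  have N0: "N \<ge> 0" by (rule bounded_L1D(5)[OF bdd_f[of 0]])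
  have "(NN z. R r z) = ennreal (3 / (4 * \<sigma>)) * (ennreal (DIM('a) * B^2 / l^2) * (NN z. ennreal (min \<kappa> (v_moll \<rho> l r z)))
    + ennreal (DIM('a) * \<omega>^2) * (2 * (NN z. ennreal (u_moll \<rho> r z)) + ennreal (2 / l) * (NN z. ennreal (v_moll \<rho> l r z)))
    + (NN z. ennreal (Q r z)))"
   unfolding R_def by (simp add: nn_integral_cmult nn_integral_add)
  also have "... <= ennreal (3 / (4 * \<sigma>)) * (ennreal (DIM('a) * B^2 / l^2) * (NN z. ennreal (min \<kappa> (v_moll \<rho> l r z)))
    + ennreal (DIM('a) * \<omega>^2) * (2 * ennreal N + ennreal (2 / l) * ennreal N)
    + (NN x. ennreal (f r x * (norm (d r x - e r x))^2)))"
   unfolding Q_def by (intro mult_left_mono add_mono order_refl mb(6,7) nn_integral_relative_flux[OF \<rho>]) auto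
  also have "ennreal (DIM('a) * \<omega>^2) * (2 * ennreal N + ennreal (2 / l) * ennreal N) = ennreal (DIM('a) * \<omega>^2 * (2 * N + 2 * (N / l)))"
  proof -
   have "2 * ennreal N = ennreal (2 * N)" "ennreal (2 / l) * ennreal N = ennreal (2 * (N / l))"
    using N0 l by (simp_all add: ennreal_mult ennreal_mult'[symmetric])
   then show ?thesis using N0 l by (subst ennreal_mult) (simp_all add: ennreal_plus)
  qed
  finally show "indicator {0..t} r * (NN z. R r z) <= ennreal (3 / (4 * \<sigma>)) * (indicator {0..t} r * (ennreal (DIM('a) * B^2 / l^2) * (NN z. ennreal (min \<kappa> (v_moll \<rho> l r z)))
    + ennreal (DIM('a) * \<omega>^2 * (2 * N + 2 * (N / l)))
    + (NN x. ennreal (f r x * (norm (d r x - e r x))^2))))"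
   by (cases "r \<in> {0..t}") auto
 qed
 also have "... <= ennreal (3 / (4 * \<sigma>)) * (NN r. indicator {0..t} r * (ennreal (DIM('a) * B^2 / l^2) * (NN z. ennreal (min \<kappa> (v_moll \<rho> l r z)))
    + ennreal (DIM('a) * \<omega>^2 * (2 * N + 2 * (N / l)))
    + (NN x. ennreal (f r x * (norm (d r x - e r x))^2))))"
 proof (rule eq_refl, rule nn_integral_cmult)
  note [measurable] = regular_driftD(1)[OF d, unfolded case_prod_beta'] regular_driftD(1)[OF e, unfolded case_prod_beta'] fokker_planckD(1)[OF fp_f, unfolded case_prod_beta']
  have "(%(t,z). mollify \<rho> (mix l t) z) \<in> borel_measurable (lborel \<Otimes>\<^sub>M lborel)"
   by (intro mollify_measurable_pair mix_measurable) measurable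
  note [measurable] = this[unfolded case_prod_beta']
  have 1: "(%r. NN z. ennreal (min \<kappa> (v_moll \<rho> l r z))) \<in> borel_measurable lborel"
   by (intro lborel.borel_measurable_nn_integral) (unfold case_prod_beta', measurable)
  have 2: "(%r. NN x. ennreal (f r x * (norm (d r x - e r x))^2)) \<in> borel_measurable lborel"
   by (intro lborel.borel_measurable_nn_integral) (unfold case_prod_beta', measurable)
  note [measurable] = 1 2
  show "(%r. indicator {0..t} r * (ennreal (DIM('a) * B^2 / l^2) * (NN z. ennreal (min \<kappa> (v_moll \<rho> l r z)))
    + ennreal (DIM('a) * \<omega>^2 * (2 * N + 2 * (N / l)))
    + (NN x. ennreal (f r x * (norm (d r x - e r x))^2)))) \<in> borel_measurable lborel" by measurable
 qed
 finally show ?thesis .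
qed

end

context two_flows
begin

text \<open>Dominated convergence in space, with the mollified mixture as majorant, and again in
  time, with the constant \<open>N\<close>.\<close>

lemma nn_integral_min_tendsto_0:
 assumes \<rho>: "bump \<delta> \<rho>" and l: "0 <= l" "l <= 1"
 shows "(%n. NN r. indicator {0..t} r * (NN z. ennreal (min (1 / real (Suc n)) (mollify \<rho> (mix l r) z)))) ----> 0"
proof -
 note mb = moll_bounds[OF \<rho> l]
 note [measurable] = bumpD(5)[OF \<rho>] bounded_L1D(4)[OF bdd_mix[OF l]]
 have mm[measurable]: "mollify \<rho> (mix l r) \<in> bmb" for r
  by (rule mollify_measurable; measurable)
 have "(%(t,z). mollify \<rho> (mix l t) z) \<in> borel_measurable (lborel \<Otimes>\<^sub>M lborel)"
  by (intro mollify_measurable_pair mix_measurable) measurable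
 note [measurable] = this[unfolded case_prod_beta']
 have m1: "(%r. NN z. ennreal (min (1 / real (Suc n)) (mollify \<rho> (mix l r) z))) \<in> borel_measurable lborel" for n
  by (intro lborel.borel_measurable_nn_integral) (unfold case_prod_beta', measurable)
 note [measurable] = m1
 have le: "(NN z. ennreal (min (1 / real (Suc n)) (mollify \<rho> (mix l r) z))) <= ennreal N" for n r
  by (rule order_trans[OF nn_integral_mono mb(7)[of r]]) (auto intro: ennreal_leI)
 have inner: "(%n. NN z. ennreal (min (1 / real (Suc n)) (mollify \<rho> (mix l r) z))) ----> (NN (z::'a). 0)" for r
 proof (rule nn_integral_dominated_convergence)
  show "AE z in lborel. ennreal (min (1 / real (Suc n)) (mollify \<rho> (mix l r) z)) <= ennreal (mollify \<rho> (mix l r) z)" for n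
   by (intro always_eventually allI ennreal_leI) simp
  show "(NN z. ennreal (mollify \<rho> (mix l r) z)) < \<infinity>"
   by (rule le_less_trans[OF mb(7)]) simp
  show "AE z in lborel. (%n. ennreal (min (1 / real (Suc n)) (mollify \<rho> (mix l r) z))) ----> 0"
  proof (intro always_eventually allI)
   fix z
   have "(%n. min (1 / real (Suc n)) (mollify \<rho> (mix l r) z)) ----> min 0 (mollify \<rho> (mix l r) z)"
    by (intro tendsto_min tendsto_const LIMSEQ_Suc lim_1_over_n)
   from tendsto_ennrealI[OF this] show "(%n. ennreal (min (1 / real (Suc n)) (mollify \<rho> (mix l r) z))) ----> 0"
    using mb(3)[of r z] by simp
  qed
 qed measurable
 have "(%n. NN r. indicator {0..t} r * (NN z. ennreal (min (1 / real (Suc n)) (mollify \<rho> (mix l r) z)))) ----> (NN (r::real). 0)"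
 proof (rule nn_integral_dominated_convergence)
  show "AE r in lborel. indicator {0..t} r * (NN z. ennreal (min (1 / real (Suc n)) (mollify \<rho> (mix l r) z))) <= ennreal N * indicator {0..t} r" for n
   using le[of n] by (intro always_eventually allI) (auto split: split_indicator)
  show "(NN r. ennreal N * indicator {0..t} r) < \<infinity>"
   by (simp add: nn_integral_cmult_indicator ennreal_mult_less_top emeasure_lborel_Icc_eq)
  show "AE r in lborel. (%n. indicator {0..t} r * (NN z. ennreal (min (1 / real (Suc n)) (mollify \<rho> (mix l r) z)))) ----> 0"
   using inner by (intro always_eventually allI) (auto split: split_indicator)
 qed measurable
 then show ?thesis by simp
qed

text \<open>All regularisations are removed along one sequence. The mollification scale, the weight
  \<open>l\<close> and the shift \<open>\<kappa>\<close> vary together so that every error term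
  vanishes, and lower semicontinuity under Fatou's lemma recovers the entropy of the solutions
  themselves.\<close>

theorem entropy_estimate:
 fixes k :: "real => 'a => real"
 assumes k: "!!h. h > 0 ==> bump h (k h)" and t: "t \<in> {0..T}"
 shows "(NN x. entropy_density (f t x) (g t x))
  <= ennreal (3 / (4 * \<sigma>)) * (NN r. indicator {0..t} r * (NN x. ennreal (f r x * (norm (d r x - e r x))^2)))"
  (is "_ <= ennreal ?c * ?Q")
proof -
 obtain \<delta> where \<delta>: "!!n. \<delta> n > 0" "\<delta> ----> 0"
  and \<omega>: "!!n t x x'. norm (x - x') <= \<delta> n ==> norm (e t x - e t x') <= 1 / real (Suc n)"
  by (rule regular_drift_scales[OF e]) blast
 note \<rho> = k[OF \<delta>(1)]
 \<comment> \<open>The weight equals the modulus of the drift at scale \<open>\<delta> n\<close>.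
   The commutator error is of order \<open>\<omega>^2 / l\<close>, which with this choice is of
   order \<open>l\<close>.\<close>
 define l where "l n = 1 / real (Suc n)" for n
 have l: "0 < l n" "0 <= l n" "l n <= 1" for n by (auto simp: l_def)
 have l_lim: "l ----> 0" unfolding l_def[abs_def] by (intro LIMSEQ_Suc lim_1_over_n)
 define I where "I n \<kappa> = ennreal (DIM('a) * B^2 / (l n)^2) * (NN r. indicator {0..t} r * (NN z. ennreal (min \<kappa> (mollify (k (\<delta> n)) (mix (l n) r) z))))" for n \<kappa>
 \<comment> \<open>With scale and weight fixed, the shift is taken so small that even after division
   by \<open>(l n)^2\<close> its contribution is at most \<open>l n\<close>.\<close>
 have "\<exists>\<kappa>. 0 < \<kappa> \<and> \<kappa> <= l n \<and> I n \<kappa> <= ennreal (l n)" for n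
 proof -
  have "(%m. I n (l m)) ----> ennreal (DIM('a) * B^2 / (l n)^2) * 0"
   unfolding I_def l_def[of m for m] by (intro ennreal_tendsto_cmult nn_integral_min_tendsto_0[OF \<rho>]) (auto simp: l_def)
  then have "eventually (%m. I n (l m) < ennreal (l n)) sequentially"
   using l(1)[of n] by (intro order_tendstoD(2)) auto
  moreover have "eventually (%m. l m <= l n) sequentially"
   using order_tendstoD(2)[OF l_lim l(1)[of n]] by eventually_elim simp
  ultimately have "eventually (%m. I n (l m) < ennreal (l n) \<and> l m <= l n) sequentially" by eventually_elim simp
  then obtain m where "I n (l m) < ennreal (l n) \<and> l m <= l n" by (auto dest: eventually_happens)
  then show ?thesis using l(1)[of m] by (intro exI[of _ "l m"]) auto
 qed
 then obtain \<kappa> where \<kappa>: "!!n. 0 < \<kappa> n" "!!n. \<kappa> n <= l n" "!!n. I n (\<kappa> n) <= ennreal (l n)" by metis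
 have \<kappa>_lim: "\<kappa> ----> 0"
  by (rule tendsto_sandwich[OF _ _ tendsto_const l_lim]) (use \<kappa> in \<open>auto intro: always_eventually less_imp_le\<close>)
 have N0: "N \<ge> 0" by (rule bounded_L1D(5)[OF bdd_f[of 0]])
 \<comment> \<open>The 1 comes from the shift error and the rest from the commutators, integrated
   over time.\<close>
 define K where "K = 1 + 4 * DIM('a) * N * T"
 have K: "K \<ge> 0" using N0 T by (simp add: K_def)
 define U where "U n z = mollify (k (\<delta> n)) (f t) z" for n z
 define V where "V n z = mollify (k (\<delta> n)) (mix (l n) t) z" for n z
 note [measurable] = regular_driftD(1)[OF d, unfolded case_prod_beta'] regular_driftD(1)[OF e, unfolded case_prod_beta'] fokker_planckD(1)[OF fp_f, unfolded case_prod_beta']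
 have Qm[measurable]: "(%r. NN x. ennreal (f r x * (norm (d r x - e r x))^2)) \<in> borel_measurable lborel"
  by (intro lborel.borel_measurable_nn_integral) (unfold case_prod_beta', measurable)
 have main: "(NN z. ennreal (regularized_entropy (\<kappa> n) (U n z, V n z))) <= ennreal ?c * (ennreal (K * l n) + ?Q)" for n
 proof -
  have "(%(t,z). mollify (k (\<delta> n)) (mix (l n) t) z) \<in> borel_measurable (lborel \<Otimes>\<^sub>M lborel)"
   by (intro mollify_measurable_pair mix_measurable) (rule bumpD(5)[OF \<rho>])
  note [measurable] = this[unfolded case_prod_beta']
  have [measurable]: "(%r. NN z. ennreal (min (\<kappa> n) (mollify (k (\<delta> n)) (mix (l n) r) z))) \<in> borel_measurable lborel"
   by (intro lborel.borel_measurable_nn_integral) (unfold case_prod_beta', measurable)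
  define D where "D = DIM('a) * (l n)^2 * (2 * N + 2 * (N / l n))"
  have D0: "0 <= D" unfolding D_def using N0 l(2)[of n] by (intro mult_nonneg_nonneg add_nonneg_nonneg) auto
  have D: "D * T <= 4 * DIM('a) * N * T * l n"
  proof -
   have "(l n)^2 * (2 * N + 2 * (N / l n)) = l n * (2 * N * l n + 2 * N)"
    using l(1)[of n] by (simp add: power2_eq_square field_simps)
   also have "... <= l n * (2 * N * 1 + 2 * N)" using l N0 by (intro mult_left_mono add_right_mono) auto
   finally have "DIM('a) * ((l n)^2 * (2 * N + 2 * (N / l n))) * T <= DIM('a) * (l n * (2 * N * 1 + 2 * N)) * T"
    using T by (intro mult_right_mono mult_left_mono) auto
   then show ?thesis by (simp add: D_def mult_ac)
  qed
  have om: "\<forall>t x x'. norm (x - x') <= \<delta> n --> norm (e t x - e t x') <= l n" using \<omega> by (simp add: l_def)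
  have "(NN z. ennreal (regularized_entropy (\<kappa> n) (U n z, V n z)))
   <= ennreal ?c * (NN r. indicator {0..t} r * (ennreal (DIM('a) * B^2 / (l n)^2) * (NN z. ennreal (min (\<kappa> n) (mollify (k (\<delta> n)) (mix (l n) r) z)))
    + ennreal D + (NN x. ennreal (f r x * (norm (d r x - e r x))^2))))"
   unfolding U_def V_def D_def by (rule mollified_entropy[OF \<rho> om l(2) l(1) l(3) \<kappa>(1) t])
  also have "... = ennreal ?c * (I n (\<kappa> n) + ennreal D * ennreal t + ?Q)"
  proof -
   have "(NN r. indicator {0..t} r * (ennreal (DIM('a) * B^2 / (l n)^2) * (NN z. ennreal (min (\<kappa> n) (mollify (k (\<delta> n)) (mix (l n) r) z)))
    + ennreal D + (NN x. ennreal (f r x * (norm (d r x - e r x))^2))))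
    = (NN r. ennreal (DIM('a) * B^2 / (l n)^2) * (indicator {0..t} r * (NN z. ennreal (min (\<kappa> n) (mollify (k (\<delta> n)) (mix (l n) r) z))))
     + ennreal D * indicator {0..t} r + indicator {0..t} r * (NN x. ennreal (f r x * (norm (d r x - e r x))^2)))"
    by (intro nn_integral_cong) (auto split: split_indicator)
   also have "... = I n (\<kappa> n) + ennreal D * ennreal t + ?Q"
    unfolding I_def using t by (subst nn_integral_add, measurable, subst nn_integral_add, measurable)
     (simp add: nn_integral_cmult nn_integral_cmult_indicator)
   finally show ?thesis by simp
  qed
  also have "... <= ennreal ?c * (ennreal (l n) + ennreal (D * T) + ?Q)"
   using t D0 by (intro mult_left_mono add_mono \<kappa>(3) order_refl)
    (auto simp: ennreal_mult'[symmetric] intro!: ennreal_leI mult_left_mono)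
  also have "... <= ennreal ?c * (ennreal (l n) + ennreal (4 * DIM('a) * N * T * l n) + ?Q)"
   by (intro mult_left_mono add_mono order_refl ennreal_leI D) auto
  also have "ennreal (l n) + ennreal (4 * DIM('a) * N * T * l n) = ennreal (K * l n)"
   using N0 T l(2)[of n] by (subst ennreal_plus[symmetric]) (auto simp: K_def algebra_simps simp del: ennreal_plus)
  finally show ?thesis .
 qed
 have fi: "ilb (f t)" "ilb (g t)" using bounded_L1D(1)[OF bdd_f] bounded_L1D(1)[OF bdd_g] by auto
 \<comment> \<open>Almost everywhere convergence is needed for both densities at once, so a
   subsequence for \<open>f\<close> is thinned out further for \<open>g\<close>.\<close>
 obtain r1 where r1: "strict_mono r1" "AE x in lborel. (%n. mollify (k (\<delta> (r1 n))) (f t) x) ----> f t x"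
  by (rule mollify_AE_subseq[OF fi(1) \<delta>(2) \<rho>])
 have \<delta>1: "(%n. \<delta> (r1 n)) ----> 0" using LIMSEQ_subseq_LIMSEQ[OF \<delta>(2) r1(1)] by (simp add: o_def)
 obtain r2 where r2: "strict_mono r2" "AE x in lborel. (%n. mollify (k (\<delta> (r1 (r2 n)))) (g t) x) ----> g t x"
  by (rule mollify_AE_subseq[OF fi(2) \<delta>1 \<rho>])
 define r where "r n = r1 (r2 n)" for n
 have r: "strict_mono r" using r1(1) r2(1) by (simp add: r_def strict_mono_def)
 have UV: "AE x in lborel. (%n. U (r n) x) ----> f t x \<and> (%n. V (r n) x) ----> g t x"
  using r1(2) r2(2)
 proof eventually_elim
  case (elim x)
  have u: "(%n. U (r n) x) ----> f t x"
   using LIMSEQ_subseq_LIMSEQ[OF elim(1) r2(1)] by (simp add: U_def r_def o_def)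
  have "V n x = l n * U n x + (1 - l n) * mollify (k (\<delta> n)) (g t) x" for n
   unfolding V_def U_def mix_def mollify_cmult[symmetric]
   using fi by (intro mollify_add bumpD(1)[OF \<rho>]) auto
  moreover have "(%n. l (r n) * U (r n) x + (1 - l (r n)) * mollify (k (\<delta> (r n))) (g t) x) ----> 0 * f t x + (1 - 0) * g t x"
   using LIMSEQ_subseq_LIMSEQ[OF l_lim r] elim(2) by (intro tendsto_intros u) (simp_all add: o_def r_def)
  ultimately show ?case using u by simp
 qed
 have UV0: "0 <= U n x" "0 <= V n x" for n x
  unfolding U_def V_def using moll_bounds(1)[OF \<rho> l(2) l(3)] moll_bounds(3)[OF \<rho> l(2) l(3)] by auto
 have "(NN x. entropy_density (f t x) (g t x))
   <= (NN x. liminf (%n. ennreal (regularized_entropy (\<kappa> (r n)) (U (r n) x, V (r n) x))))"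
 proof (rule nn_integral_mono_AE, use UV in eventually_elim)
  case (elim x)
  have "(%n. \<kappa> (r n)) ----> 0" using LIMSEQ_subseq_LIMSEQ[OF \<kappa>_lim r] by (simp add: o_def)
  then show ?case
   using entropy_density_liminf[of "%n. U (r n) x" "%n. V (r n) x" "%n. \<kappa> (r n)"] elim UV0 \<kappa>(1)
   by (simp add: regularized_entropy_def)
 qed
 also have "... <= liminf (%n. NN x. ennreal (regularized_entropy (\<kappa> (r n)) (U (r n) x, V (r n) x)))"
 proof (rule nn_integral_liminf)
  fix n
  have [measurable]: "U (r n) \<in> bmb" "V (r n) \<in> bmb"
   unfolding U_def[abs_def] V_def[abs_def]
   using bounded_L1D(4)[OF bdd_f] bounded_L1D(4)[OF bdd_mix[OF l(2) l(3)]] bumpD(5)[OF \<rho>] by (auto intro!: mollify_measurable)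
  show "(%x. ennreal (regularized_entropy (\<kappa> (r n)) (U (r n) x, V (r n) x))) \<in> borel_measurable lborel"
   unfolding regularized_entropy_def by simp
 qed
 also have "... <= liminf (%n. ennreal ?c * (ennreal (K * l (r n)) + ?Q))"
  by (intro Liminf_mono always_eventually allI main)
 also have "... = ennreal ?c * (ennreal (K * 0) + ?Q)"
 proof (rule lim_imp_Liminf)
  have "(%n. l (r n)) ----> 0" using LIMSEQ_subseq_LIMSEQ[OF l_lim r] by (simp add: o_def)
  then show "(%n. ennreal ?c * (ennreal (K * l (r n)) + ?Q)) ----> ennreal ?c * (ennreal (K * 0) + ?Q)"
   by (intro ennreal_tendsto_cmult tendsto_add tendsto_const tendsto_ennrealI tendsto_mult) auto
 qed simp
 finally show ?thesis by simp
qed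

end

section \<open>Hellinger and tensor product inequalities\<close>

lemma entropy_density_measurable [measurable]:
 assumes [measurable]: "u \<in> borel_measurable M" "v \<in> borel_measurable M"
 shows "(%x. entropy_density (u x) (v x)) \<in> borel_measurable M"
 unfolding entropy_density_def by measurable

text \<open>In terms of the square roots \<open>p\<close> and \<open>q\<close> the claim reduces to
  \<open>ln (q / p) <= q / p - 1\<close>, multiplied by \<open>2 * p^2\<close>.\<close>

lemma entropy_density_ge_hellinger:
 assumes uv: "u \<ge> 0" "v \<ge> 0"
 shows "ennreal ((sqrt u - sqrt v)^2) <= entropy_density u v"
proof -
 consider "v = 0" "u = 0" | "v = 0" "u > 0" | "v > 0" "u = 0" | "v > 0" "u > 0" using uv by linarith
 then show ?thesis
 proof cases
  case 4
  define p q where "p = sqrt u" and "q = sqrt v"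
  have pq: "p > 0" "q > 0" "u = p^2" "v = q^2" using 4 by (auto simp: p_def q_def)
  have "ln (q / p) <= q / p - 1" using pq by (intro ln_le_minus_one) auto
  then have "2 * p^2 * (ln q - ln p) <= 2 * p^2 * (q / p - 1)"
   using pq by (intro mult_left_mono) (auto simp: ln_div)
  also have "... = 2 * p * q - 2 * p^2" using pq by (simp add: power2_eq_square field_simps)
  finally have "(p - q)^2 <= p^2 * (2 * ln p - 2 * ln q) - p^2 + q^2"
   by (simp add: power2_diff algebra_simps)
  also have "2 * ln p - 2 * ln q = ln (u / v)" using pq by (simp add: ln_div ln_realpow)
  finally have le: "(p - q)^2 <= u * ln (u / v) - u + v" by (simp only: pq(3,4)[symmetric])
  have "entropy_density u v = ennreal (u * ln (u / v) - u + v)" using 4 by (simp add: entropy_density_def)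
  then show ?thesis using ennreal_leI[OF le] by (simp only: p_def q_def)
 qed (auto simp: entropy_density_def)
qed

text \<open>Factor \<open>u - v\<close> through the square roots and apply Cauchy-Schwarz. One
  factor is the Hellinger integral; the other is at most \<open>2 * (u + v)\<close> pointwise, whose
  integral gives \<open>4 * N\<close>.\<close>

lemma L1_le_entropy:
 fixes u v :: "'a => real"
 assumes [measurable]: "u \<in> borel_measurable M" "v \<in> borel_measurable M"
  and nn: "AE x in M. 0 <= u x" "AE x in M. 0 <= v x"
  and uN: "(\<integral>\<^sup>+x. ennreal (u x) \<partial>M) <= ennreal N" and vN: "(\<integral>\<^sup>+x. ennreal (v x) \<partial>M) <= ennreal N" and N: "N \<ge> 0"
 shows "(\<integral>\<^sup>+x. ennreal \<bar>u x - v x\<bar> \<partial>M)^2 <= ennreal (4 * N) * (\<integral>\<^sup>+x. entropy_density (u x) (v x) \<partial>M)"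
proof -
 have "(\<integral>\<^sup>+x. ennreal \<bar>u x - v x\<bar> \<partial>M) = (\<integral>\<^sup>+x. ennreal \<bar>sqrt (u x) - sqrt (v x)\<bar> * ennreal (sqrt (u x) + sqrt (v x)) \<partial>M)"
 proof (rule nn_integral_cong_AE, use nn in eventually_elim)
  case (elim x)
  have "u x - v x = (sqrt (u x) - sqrt (v x)) * (sqrt (u x) + sqrt (v x))"
   using elim by (simp add: algebra_simps)
  then have "\<bar>u x - v x\<bar> = \<bar>sqrt (u x) - sqrt (v x)\<bar> * (sqrt (u x) + sqrt (v x))"
   using elim by (simp add: abs_mult)
  then show ?case using elim by (simp add: ennreal_mult)
 qed
 also have "(...)^2 <= (\<integral>\<^sup>+x. (ennreal \<bar>sqrt (u x) - sqrt (v x)\<bar>)^2 \<partial>M) * (\<integral>\<^sup>+x. (ennreal (sqrt (u x) + sqrt (v x)))^2 \<partial>M)"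
  by (rule Cauchy_Schwarz_nn_integral) measurable
 also have "... <= (\<integral>\<^sup>+x. entropy_density (u x) (v x) \<partial>M) * (\<integral>\<^sup>+x. 2 * (ennreal (u x) + ennreal (v x)) \<partial>M)"
 proof (intro mult_mono nn_integral_mono_AE)
  show "AE x in M. (ennreal \<bar>sqrt (u x) - sqrt (v x)\<bar>)^2 <= entropy_density (u x) (v x)"
   using nn by eventually_elim (use entropy_density_ge_hellinger in \<open>simp add: ennreal_power\<close>)
  show "AE x in M. (ennreal (sqrt (u x) + sqrt (v x)))^2 <= 2 * (ennreal (u x) + ennreal (v x))"
   using nn
  proof eventually_elim
   case (elim x)
   have "(sqrt (u x) + sqrt (v x))^2 <= 2 * (u x + v x)"
    using sum_squares_le[of "sqrt (u x)" "sqrt (v x)"] elim by simp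
   then have "ennreal ((sqrt (u x) + sqrt (v x))^2) <= ennreal (2 * (u x + v x))" by (rule ennreal_leI)
   also have "... = 2 * (ennreal (u x) + ennreal (v x))"
    using elim by (subst ennreal_mult) auto
   finally show ?case using elim by (subst ennreal_power) auto
  qed
 qed auto
 also have "... = (\<integral>\<^sup>+x. entropy_density (u x) (v x) \<partial>M) * (2 * ((\<integral>\<^sup>+x. ennreal (u x) \<partial>M) + (\<integral>\<^sup>+x. ennreal (v x) \<partial>M)))"
  by (simp add: nn_integral_cmult nn_integral_add)
 also have "... <= (\<integral>\<^sup>+x. entropy_density (u x) (v x) \<partial>M) * (2 * (ennreal N + ennreal N))"
  by (intro mult_left_mono add_mono uN vN) auto
 also have "2 * (ennreal N + ennreal N) = ennreal (4 * N)"
 proof -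
  have "2 * (ennreal N + ennreal N) = ennreal 2 * ennreal (N + N)"
   by (simp only: ennreal_plus[OF N N] ennreal_numeral)
  also have "... = ennreal (2 * (N + N))" using N by (intro ennreal_mult[symmetric]) auto
  finally show ?thesis by simp
 qed
 finally show ?thesis by (simp add: mult.commute)
qed

text \<open>Written as an identity of sums, since subtraction in \<open>ennreal\<close> is
  truncated. The second part makes the negative part of the entropy integrand integrable.\<close>

lemma entropy_integrand_split:
 assumes "0 <= u" "0 <= v"
 shows "e2ennreal (entropy_integrand u v) + ennreal v = entropy_density u v + ennreal u + e2ennreal (- entropy_integrand u v)"
  and "e2ennreal (- entropy_integrand u v) <= ennreal v"
proof -
 have ln: "0 <= u * ln (u / v) - u + v" if "u > 0" "v > 0"
  using entropy_tangent[of u v 1] that by (simp add: ln_div)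
 show "e2ennreal (entropy_integrand u v) + ennreal v = entropy_density u v + ennreal u + e2ennreal (- entropy_integrand u v)"
 proof (cases "u = 0 \<or> v = 0")
  case True
  then show ?thesis using assms by (auto simp: entropy_integrand_def entropy_density_def)
 next
  case False
  then have pos: "u > 0" "v > 0" using assms by auto
  define L where "L = u * ln (u / v)"
  have eq: "entropy_integrand u v = ereal L" "entropy_density u v = ennreal (L - u + v)"
   using pos by (simp_all add: entropy_integrand_def entropy_density_def L_def)
  have L: "0 <= L - u + v" using ln[OF pos] by (simp add: L_def)
  show ?thesis
  proof (cases "L \<ge> 0")
   case True
   have "ennreal L + ennreal v = ennreal (L - u + v) + ennreal u"
    using True pos L by (simp del: ennreal_plus add: ennreal_plus[symmetric])
   then show ?thesis using True by (simp add: eq ennreal_neg)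
  next
   case False
   have "ennreal v = ennreal (L - u + v) + ennreal u + ennreal (- L)"
    using False pos L by (simp del: ennreal_plus add: ennreal_plus[symmetric])
   then show ?thesis using False by (simp add: eq ennreal_neg)
  qed
 qed
 show "e2ennreal (- entropy_integrand u v) <= ennreal v"
 proof (cases "u = 0 \<or> v = 0")
  case True
  then show ?thesis using assms by (auto simp: entropy_integrand_def e2ennreal_neg)
 next
  case False
  then have pos: "u > 0" "v > 0" using assms by auto
  have "- (u * ln (u / v)) <= v" using ln[OF pos] pos by linarith
  then show ?thesis using pos by (simp add: entropy_integrand_def ennreal_leI)
 qed
qed

text \<open>With equal masses the terms \<open>- u + v\<close> integrate to 0. The common mass and
  the negative part \<open>Q\<close> are finite, so both can be cancelled in the extended
  numbers.\<close>

lemma rel_entropy_eq: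
 fixes u v :: "'a::euclidean_space => real"
 assumes u: "ilb u" "AE x in lborel. 0 <= u x" and v: "ilb v" "AE x in lborel. 0 <= v x"
  and mass: "(LB x. u x) = (LB x. v x)"
 shows "rel_entropy u v = enn2ereal (NN x. entropy_density (u x) (v x))"
proof -
 have [measurable]: "u \<in> bmb" "v \<in> bmb" using u v by auto
 have [measurable]: "(%x. entropy_integrand (u x) (v x)) \<in> bmb"
  unfolding entropy_integrand_def by measurable
 define P where "P = (NN x. e2ennreal (entropy_integrand (u x) (v x)))"
 define Q where "Q = (NN x. e2ennreal (- entropy_integrand (u x) (v x)))"
 define H where "H = (NN x. entropy_density (u x) (v x))"
 define m where "m = (LB x. u x)"
 have mu: "(NN x. ennreal (u x)) = ennreal m" "(NN x. ennreal (v x)) = ennreal m"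
  using nn_integral_eq_integral[OF u] nn_integral_eq_integral[OF v] mass by (simp_all add: m_def)
 have "P + ennreal m = (NN x. e2ennreal (entropy_integrand (u x) (v x)) + ennreal (v x))"
  unfolding P_def mu(2)[symmetric] by (rule nn_integral_add[symmetric]) measurable
 also have "... = (NN x. entropy_density (u x) (v x) + ennreal (u x) + e2ennreal (- entropy_integrand (u x) (v x)))"
  by (rule nn_integral_cong_AE, use u(2) v(2) in eventually_elim) (rule entropy_integrand_split(1))
 also have "... = H + ennreal m + Q"
  unfolding H_def Q_def mu(1)[symmetric] by (simp add: nn_integral_add)
 finally have "P + ennreal m = (H + Q) + ennreal m" by (simp add: add_ac)
 then have PHQ: "P = H + Q" using ennreal_add_left_cancel[of "ennreal m" P "H + Q"] by (simp add: add.commute)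
 have "Q <= ennreal m" unfolding Q_def mu(2)[symmetric]
  by (rule nn_integral_mono_AE, use u(2) v(2) in eventually_elim) (rule entropy_integrand_split(2))
 then have "Q < \<top>" using le_less_trans ennreal_less_top by blast
 then obtain q where q: "Q = ennreal q" "q \<ge> 0" by (cases Q) auto
 have "enn2ereal P - enn2ereal Q = enn2ereal H"
  unfolding PHQ q(1) using q(2) by (cases H) (simp_all add: plus_ennreal.rep_eq enn2ereal_ennreal)
 then show ?thesis by (simp add: rel_entropy_def P_def Q_def H_def)
qed

lemma prod_mono_ennreal:
 fixes a b :: "'i => ennreal"
 assumes "!!i. a i <= b i"
 shows "(\<Prod>i\<in>I. a i) <= (\<Prod>i\<in>I. b i)"
 by (induction I rule: infinite_finite_induct) (auto intro!: mult_mono assms)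

text \<open>One factor is exchanged at a time, the others contributing their norms. Assuming
  \<open>N \<ge> 1\<close> lets a single power of \<open>N\<close> absorb the lower ones in the
  induction.\<close>

lemma product_L1_difference:
 fixes p q :: "'i => 'a::euclidean_space => real" and N D :: real
 assumes "finite I" and "!!i. p i \<in> bmb" "!!i. q i \<in> bmb"
  and N: "N \<ge> 1" "!!i. (NN x. ennreal \<bar>p i x\<bar>) <= ennreal N" "!!i. (NN x. ennreal \<bar>q i x\<bar>) <= ennreal N"
  and D: "D \<ge> 0" "!!i. (NN x. ennreal \<bar>p i x - q i x\<bar>) <= ennreal D"
 shows "(\<integral>\<^sup>+x. ennreal \<bar>(\<Prod>i\<in>I. p i (x i)) - (\<Prod>i\<in>I. q i (x i))\<bar> \<partial>PiM I (%_. lborel)) <= ennreal (card I * N ^ card I * D)"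
 using assms(1)
proof (induction I rule: finite_induct)
 case empty
 then show ?case by simp
next
 case (insert i I)
 interpret product_sigma_finite "%_::'i. lborel :: 'a measure" by standard
 note [measurable] = assms(2,3)
 define P where "P x = (\<Prod>j\<in>I. p j (x j))" for x :: "'i => 'a"
 define Q where "Q x = (\<Prod>j\<in>I. q j (x j))" for x :: "'i => 'a"
 have [measurable]: "P \<in> borel_measurable (PiM I (%_. lborel))" "Q \<in> borel_measurable (PiM I (%_. lborel))"
  unfolding P_def[abs_def] Q_def[abs_def] by measurable
 have upd: "(\<Prod>j\<in>insert i I. h j ((x(i := y)) j)) = h i y * (\<Prod>j\<in>I. h j (x j))" for h :: "'i => 'a => real" and x y
  using insert.hyps by (subst prod.insert) (auto intro!: prod.cong)
 have "(\<integral>\<^sup>+x. ennreal \<bar>(\<Prod>j\<in>insert i I. p j (x j)) - (\<Prod>j\<in>insert i I. q j (x j))\<bar> \<partial>PiM (insert i I) (%_. lborel))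
  = (\<integral>\<^sup>+x. (NN y. ennreal \<bar>p i y * P x - q i y * Q x\<bar>) \<partial>PiM I (%_. lborel))"
  unfolding P_def Q_def upd[symmetric] using insert.hyps by (intro product_nn_integral_insert) auto
 also have "... <= (\<integral>\<^sup>+x. (NN y. ennreal \<bar>p i y - q i y\<bar> * ennreal \<bar>P x\<bar> + ennreal \<bar>q i y\<bar> * ennreal \<bar>P x - Q x\<bar>) \<partial>PiM I (%_. lborel))"
 proof (intro nn_integral_mono)
  fix x y
  have "p i y * P x - q i y * Q x = (p i y - q i y) * P x + q i y * (P x - Q x)" by (simp add: algebra_simps)
  then have "\<bar>p i y * P x - q i y * Q x\<bar> <= \<bar>p i y - q i y\<bar> * \<bar>P x\<bar> + \<bar>q i y\<bar> * \<bar>P x - Q x\<bar>"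
   using abs_triangle_ineq[of "(p i y - q i y) * P x" "q i y * (P x - Q x)"] by (simp add: abs_mult)
  then have "ennreal \<bar>p i y * P x - q i y * Q x\<bar> <= ennreal (\<bar>p i y - q i y\<bar> * \<bar>P x\<bar> + \<bar>q i y\<bar> * \<bar>P x - Q x\<bar>)" by (rule ennreal_leI)
  then show "ennreal \<bar>p i y * P x - q i y * Q x\<bar> <= ennreal \<bar>p i y - q i y\<bar> * ennreal \<bar>P x\<bar> + ennreal \<bar>q i y\<bar> * ennreal \<bar>P x - Q x\<bar>"
   by (simp add: ennreal_mult)
 qed
 also have "... = (\<integral>\<^sup>+x. (NN y. ennreal \<bar>p i y - q i y\<bar>) * ennreal \<bar>P x\<bar> + (NN y. ennreal \<bar>q i y\<bar>) * ennreal \<bar>P x - Q x\<bar> \<partial>PiM I (%_. lborel))"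
  by (simp add: nn_integral_add nn_integral_multc)
 also have "... = (NN y. ennreal \<bar>p i y - q i y\<bar>) * (\<integral>\<^sup>+x. ennreal \<bar>P x\<bar> \<partial>PiM I (%_. lborel))
   + (NN y. ennreal \<bar>q i y\<bar>) * (\<integral>\<^sup>+x. ennreal \<bar>P x - Q x\<bar> \<partial>PiM I (%_. lborel))"
  by (simp add: nn_integral_add nn_integral_cmult)
 also have "... <= ennreal D * ennreal (N ^ card I) + ennreal N * ennreal (card I * N ^ card I * D)"
 proof (intro add_mono mult_mono D(2) N(3))
  have "(\<integral>\<^sup>+x. ennreal \<bar>P x\<bar> \<partial>PiM I (%_. lborel)) = (\<integral>\<^sup>+x. (\<Prod>j\<in>I. ennreal \<bar>p j (x j)\<bar>) \<partial>PiM I (%_. lborel))"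
   by (simp add: P_def abs_prod prod_ennreal)
  also have "... = (\<Prod>j\<in>I. NN x. ennreal \<bar>p j x\<bar>)"
   using insert.hyps by (intro product_nn_integral_prod) auto
  also have "... <= (\<Prod>j\<in>I. ennreal N)" by (rule prod_mono_ennreal[OF N(2)])
  also have "... = ennreal (N ^ card I)" using N(1) by (simp add: ennreal_power)
  finally show "(\<integral>\<^sup>+x. ennreal \<bar>P x\<bar> \<partial>PiM I (%_. lborel)) <= ennreal (N ^ card I)" .
  show "(\<integral>\<^sup>+x. ennreal \<bar>P x - Q x\<bar> \<partial>PiM I (%_. lborel)) <= ennreal (card I * N ^ card I * D)"
   using insert.IH by (simp add: P_def Q_def)
 qed auto
 also have "... = ennreal (D * N ^ card I + N * (card I * N ^ card I * D))"
  using D(1) N(1) by (simp add: ennreal_mult)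
 also have "... <= ennreal (card (insert i I) * N ^ card (insert i I) * D)"
 proof (rule ennreal_leI)
  have "D * N ^ card I <= D * N ^ card I * N" using mult_left_mono[OF N(1), of "D * N ^ card I"] D(1) N(1) by simp
  then show "D * N ^ card I + N * (card I * N ^ card I * D) <= card (insert i I) * N ^ card (insert i I) * D"
   using insert.hyps by (simp add: algebra_simps)
 qed
 finally show ?case .
qed

section \<open>The difference of the drifts\<close>

lemma bounded_L1_nn:
 assumes "bounded_L1 N f"
 shows "(NN x. ennreal \<bar>f x\<bar>) <= ennreal N"
 using bounded_L1D[OF assms] by (subst nn_integral_eq_integral) (auto intro: ennreal_leI)

lemma conv_diff:
 fixes K :: "'a::euclidean_space => 'a"
 assumes "ilb (%y. g y *\<^sub>R K (x - y))" "ilb (%y. h y *\<^sub>R K (x - y))"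
 shows "conv K (%y. g y - h y) x = conv K g x - conv K h x"
 unfolding conv_def scaleR_diff_left using assms by (rule Bochner_Integration.integral_diff)

lemma norm_sum3_square:
 fixes a b c :: "'a::euclidean_space"
 assumes "norm b <= B" "norm c <= C"
 shows "(norm (a + b + c))^2 <= 3 * ((norm a)^2 + B^2 + C^2)"
proof -
 have "norm (a + b + c) <= norm a + B + C"
  using norm_triangle_ineq[of "a + b" c] norm_triangle_ineq[of a b] assms by linarith
 then have "(norm (a + b + c))^2 <= (norm a + B + C)^2" by (intro power_mono) auto
 also have "... <= 3 * ((norm a)^2 + B^2 + C^2)" by (rule square_sum3)
 finally show ?thesis .
qed

text \<open>Three contributions: the integrable part of the kernel acts on
  \<open>mollify \<rho> u - v\<close> in \<open>L^2\<close>, with \<open>f\<close> bounded by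
  \<open>N\<close>; the Lipschitz part sees the mollification at cost
  \<open>L * \<epsilon> * N\<close> pointwise; and the bounded part sees \<open>u - v\<close>
  through its \<open>L^1\<close> norm. In the last two, \<open>f\<close> enters through its
  mass.\<close>

lemma conv_mollified_difference:
 fixes K :: "'a::euclidean_space => 'a" and f u v :: "'a => real" and \<kappa> :: "nat => 'a => real"
 assumes K: "split_kernel A B L K K1 K2" and \<rho>: "bump \<epsilon> \<rho>" and \<epsilon>: "\<epsilon> > 0"
  and u: "bounded_L1 N u" and v: "bounded_L1 N v" and f: "bounded_L1 N f" "AE x in lborel. 0 <= f x"
  and G: "has_weak_gradient u G" and \<kappa>: "!!n. bump (\<delta> n) (\<kappa> n)" "\<delta> ----> 0"
 shows "(NN x. ennreal (f x * (norm (conv K (mollify \<rho> u) x - conv K v x))^2))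
  <= ennreal (6 * N * A^2 + 3 * N ^ 3 * L^2 + 3 * N * B^2) *
   (ennreal (\<epsilon>^2) * (1 + (NN x. ennreal ((norm (G x))^2)))
    + (NN x. ennreal ((u x - v x)^2)) + (NN x. ennreal \<bar>u x - v x\<bar>)^2)" (is "?lhs <= _")
proof -
 note k = split_kernelD[OF K] and uu = bounded_L1D[OF u] and vv = bounded_L1D[OF v] and ff = bounded_L1D[OF f(1)]
 define m where "m = mollify \<rho> u"
 have m: "bounded_L1 N m" unfolding m_def by (rule bounded_L1_mollify[OF \<rho> u])
 note mm = bounded_L1D[OF m]
 note [measurable] = uu(4) vv(4) ff(4) mm(4) k(4,7,8)
 define I where "I = (LB x. \<bar>u x - v x\<bar>)"
 have I: "(NN x. ennreal \<bar>u x - v x\<bar>) = ennreal I" "I \<ge> 0"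
  unfolding I_def using uu(1) vv(1) by (auto intro!: nn_integral_eq_integral)
 define p where "p x = conv K1 (%y. m y - v y) x" for x
 have pm[measurable]: "p \<in> bmb"
  unfolding p_def[abs_def] by (rule conv_measurable) measurable
 have pt: "(norm (conv K m x - conv K v x))^2 <= 3 * ((norm (p x))^2 + (L * \<epsilon> * N)^2 + (B * I)^2)" for x
 proof -
  have split: "conv K g x = conv K1 g x + conv K2 g x" if "bounded_L1 N g" for g
   unfolding conv_def k(1) scaleR_add_right using conv_integrand(3,4)[OF K that] by (rule Bochner_Integration.integral_add)
  have "p x = conv K1 m x - conv K1 v x"
   unfolding p_def by (rule conv_diff[OF conv_integrand(3)[OF K m] conv_integrand(3)[OF K v]])
  then have eq: "conv K m x - conv K v x = p x + (conv K2 m x - conv K2 u x) + (conv K2 u x - conv K2 v x)"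
   by (simp add: split m v)
  have b1: "norm (conv K2 m x - conv K2 u x) <= L * \<epsilon> * N"
   unfolding m_def by (rule conv_bounded_mollify_diff[OF k(4) k(5) k(6) \<rho> u])
  have "conv K2 u x - conv K2 v x = (LB y. (u y - v y) *\<^sub>R K2 (x - y))"
   using conv_diff[OF conv_integrand(4)[OF K u] conv_integrand(4)[OF K v], of x] by (simp add: conv_def)
  also have "norm ... <= B * I"
  proof -
   have "norm (LB y. (u y - v y) *\<^sub>R K2 (x - y)) <= (LB y. norm ((u y - v y) *\<^sub>R K2 (x - y)))"
    by (rule integral_norm_bound)
   also have "... <= (LB y. B * \<bar>u y - v y\<bar>)"
   proof (rule integral_mono)
    have "ilb (%y. u y *\<^sub>R K2 (x - y) - v y *\<^sub>R K2 (x - y))"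
     using conv_integrand(4)[OF K u] conv_integrand(4)[OF K v] by (rule Bochner_Integration.integrable_diff)
    then show "ilb (%y. norm ((u y - v y) *\<^sub>R K2 (x - y)))"
     by (simp only: scaleR_diff_left[symmetric] integrable_norm)
    show "norm ((u y - v y) *\<^sub>R K2 (x - y)) <= B * \<bar>u y - v y\<bar>" for y
     using mult_left_mono[OF k(5)[of "x - y"], of "\<bar>u y - v y\<bar>"] by (simp add: mult.commute)
   qed (use uu(1) vv(1) in auto)
   finally show ?thesis by (simp add: I_def)
  qed
  finally show ?thesis unfolding eq using b1 by (intro norm_sum3_square)
 qed
 have N: "N \<ge> 0" by (rule uu(5))
 have mv: "(NN x. ennreal ((m x - v x)^2)) <= 2 * (ennreal (\<epsilon>^2) * (NN x. ennreal ((norm (G x))^2))) + 2 * (NN x. ennreal ((u x - v x)^2))"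
 proof -
  have "(NN x. ennreal ((m x - v x)^2)) <= (NN x. 2 * ennreal ((m x - u x)^2) + 2 * ennreal ((u x - v x)^2))"
  proof (rule nn_integral_mono)
   fix x
   have "ennreal ((m x - v x)^2) <= ennreal (2 * (m x - u x)^2 + 2 * (u x - v x)^2)"
    using sum_squares_le[of "m x - u x" "u x - v x"] by (intro ennreal_leI) simp
   then show "ennreal ((m x - v x)^2) <= 2 * ennreal ((m x - u x)^2) + 2 * ennreal ((u x - v x)^2)"
    by (simp add: ennreal_mult)
  qed
  also have "... = 2 * (NN x. ennreal ((m x - u x)^2)) + 2 * (NN x. ennreal ((u x - v x)^2))"
   by (simp add: nn_integral_add nn_integral_cmult)
  also have "... <= 2 * (ennreal (\<epsilon>^2) * (NN x. ennreal ((norm (G x))^2))) + 2 * (NN x. ennreal ((u x - v x)^2))"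
   unfolding m_def by (intro add_mono mult_left_mono mollify_diff_L2[OF G uu(1) \<kappa> \<rho>]) auto
  finally show ?thesis .
 qed
 define X1 where "X1 = (NN x. ennreal ((norm (G x))^2))"
 define X2 where "X2 = (NN x. ennreal ((u x - v x)^2))"
 define c where "c = 6 * N * A^2 + 3 * N ^ 3 * L^2 + 3 * N * B^2"
 have "?lhs <= (NN x. ennreal (3 * N) * ennreal ((norm (p x))^2) + ennreal (3 * ((L * \<epsilon> * N)^2 + (B * I)^2)) * ennreal \<bar>f x\<bar>)"
 proof (rule nn_integral_mono_AE, use f(2) ff(3) in eventually_elim)
  case (elim x)
  have "f x * (norm (conv K m x - conv K v x))^2 <= f x * (3 * ((norm (p x))^2 + (L * \<epsilon> * N)^2 + (B * I)^2))"
   using elim by (intro mult_left_mono pt) auto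
  also have "... = 3 * f x * (norm (p x))^2 + 3 * ((L * \<epsilon> * N)^2 + (B * I)^2) * \<bar>f x\<bar>"
   using elim by (simp add: algebra_simps)
  also have "... <= 3 * N * (norm (p x))^2 + 3 * ((L * \<epsilon> * N)^2 + (B * I)^2) * \<bar>f x\<bar>"
   using elim by (intro add_right_mono mult_right_mono) auto
  finally have "ennreal (f x * (norm (conv K m x - conv K v x))^2)
    <= ennreal (3 * N * (norm (p x))^2 + 3 * ((L * \<epsilon> * N)^2 + (B * I)^2) * \<bar>f x\<bar>)" by (rule ennreal_leI)
  also have "... = ennreal (3 * N) * ennreal ((norm (p x))^2) + ennreal (3 * ((L * \<epsilon> * N)^2 + (B * I)^2)) * ennreal \<bar>f x\<bar>"
   using N by (subst ennreal_plus) (auto simp: ennreal_mult'')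
  finally show ?case by (simp add: m_def)
 qed
 also have "... = ennreal (3 * N) * (NN x. ennreal ((norm (p x))^2))
   + ennreal (3 * ((L * \<epsilon> * N)^2 + (B * I)^2)) * (NN x. ennreal \<bar>f x\<bar>)"
  by (simp add: nn_integral_add nn_integral_cmult)
 also have "... <= ennreal (3 * N) * (ennreal (A^2) * (2 * (ennreal (\<epsilon>^2) * X1) + 2 * X2))
   + ennreal (3 * ((L * \<epsilon> * N)^2 + (B * I)^2)) * ennreal N"
 proof (intro add_mono mult_left_mono bounded_L1_nn f(1))
  have "(NN x. ennreal ((norm (p x))^2)) <= ennreal (A^2) * (NN x. ennreal ((m x - v x)^2))"
   unfolding p_def by (rule conv_L2_le[OF k(2,3)]) measurable
  also have "... <= ennreal (A^2) * (2 * (ennreal (\<epsilon>^2) * X1) + 2 * X2)"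
   unfolding X1_def X2_def by (intro mult_left_mono mv) simp
  finally show "(NN x. ennreal ((norm (p x))^2)) <= ennreal (A^2) * (2 * (ennreal (\<epsilon>^2) * X1) + 2 * X2)" .
 qed auto
 also have "... = ennreal (6 * N * A^2) * (ennreal (\<epsilon>^2) * X1) + ennreal (6 * N * A^2) * X2
   + ennreal (3 * N ^ 3 * L^2) * ennreal (\<epsilon>^2) + ennreal (3 * N * B^2) * (ennreal I)^2"
 proof -
  have 1: "ennreal (3 * N) * (ennreal (A^2) * (2 * y)) = ennreal (6 * N * A^2) * y" for y
  proof -
   have "ennreal (6 * N * A^2) = ennreal (3 * N) * (ennreal (A^2) * 2)"
    using N by (simp add: ennreal_mult[symmetric] ennreal_numeral[symmetric] mult_ac del: ennreal_numeral)
   then show ?thesis by (simp add: mult_ac)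
  qed
  have 2: "ennreal (3 * ((L * \<epsilon> * N)^2 + (B * I)^2)) * ennreal N = ennreal (3 * N ^ 3 * L^2) * ennreal (\<epsilon>^2) + ennreal (3 * N * B^2) * (ennreal I)^2"
  proof -
   have "3 * ((L * \<epsilon> * N)^2 + (B * I)^2) * N = (3 * N ^ 3 * L^2) * \<epsilon>^2 + (3 * N * B^2) * I^2"
    by (simp add: power2_eq_square power3_eq_cube algebra_simps)
   then have "ennreal (3 * ((L * \<epsilon> * N)^2 + (B * I)^2)) * ennreal N = ennreal ((3 * N ^ 3 * L^2) * \<epsilon>^2 + (3 * N * B^2) * I^2)"
    using N by (subst ennreal_mult''[symmetric]) auto
   also have "... = ennreal (3 * N ^ 3 * L^2) * ennreal (\<epsilon>^2) + ennreal (3 * N * B^2) * ennreal (I^2)"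
    using N by (subst ennreal_plus) (auto simp: ennreal_mult'')
   also have "ennreal (I^2) = (ennreal I)^2" using I(2) by (simp add: ennreal_power)
   finally show ?thesis .
  qed
  show ?thesis unfolding 2 unfolding distrib_left 1 by (simp add: add_ac)
 qed
 also have "... <= ennreal c * (ennreal (\<epsilon>^2) * X1) + ennreal c * X2 + ennreal c * ennreal (\<epsilon>^2) + ennreal c * (ennreal I)^2"
  unfolding c_def using N by (intro add_mono mult_right_mono ennreal_leI) auto
 also have "... = ennreal c * (ennreal (\<epsilon>^2) * (1 + X1) + X2 + (ennreal I)^2)"
  by (simp add: distrib_left distrib_right add_ac mult_ac)
 finally show ?thesis by (simp add: c_def X1_def X2_def I(1))
qed

text \<open>The weights \<open>w\<close> are one row of the interaction matrix, so a single species
  is treated at a time. Both systems have drifts of this form, for different densities.\<close>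

definition riesz_drift :: "('n::finite => real) => real => ('n => real => 'a::euclidean_space => real) => real => 'a => 'a" where
 "riesz_drift w s h t x = (\<Sum>\<beta>\<in>UNIV. w \<beta> *\<^sub>R conv (riesz s) (h \<beta> t) x)"

text \<open>The fixed splitting \<open>K\<close> gives the size of the drift; arbitrarily fine
  splittings give the modulus, shared among the species through \<open>W\<close>, whose added 1
  prevents a division by 0.\<close>

lemma regular_riesz_drift:
 fixes h :: "'n::finite => real => 'a::euclidean_space => real"
 assumes K: "split_kernel A B L (riesz s :: 'a => 'a) K1 K2" and sing: "singular_kernel (riesz s :: 'a => 'a)"
  and h: "!!\<beta> t. bounded_L1 N (h \<beta> t)" "!!\<beta>. (%(t,x). h \<beta> t x) \<in> borel_measurable (lborel \<Otimes>\<^sub>M lborel)"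
 shows "regular_drift ((\<Sum>\<beta>\<in>UNIV. \<bar>w \<beta>\<bar>) * (N * A + B * N)) (riesz_drift w s h)"
 unfolding regular_drift_def
proof (intro conjI allI impI)
 have N: "N \<ge> 0" by (rule bounded_L1D(5)[OF h(1)])
 have "(%(t,x). conv (riesz s) (h \<beta> t) x) \<in> borel_measurable (lborel \<Otimes>\<^sub>M lborel)" for \<beta>
  by (rule conv_measurable_pair[OF split_kernelD(8)[OF K] h(2)])
 note [measurable] = this[unfolded case_prod_beta']
 show "(%(t,x). riesz_drift w s h t x) \<in> borel_measurable (lborel \<Otimes>\<^sub>M lborel)"
  unfolding riesz_drift_def case_prod_beta' by measurable
 show "norm (riesz_drift w s h t x) <= (\<Sum>\<beta>\<in>UNIV. \<bar>w \<beta>\<bar>) * (N * A + B * N)" for t x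
  unfolding riesz_drift_def sum_distrib_right
  by (rule order_trans[OF norm_sum]) (auto intro!: sum_mono mult_left_mono conv_norm_le[OF K h(1)])
 fix \<omega> :: real assume \<omega>: "\<omega> > 0"
 define W where "W = 1 + (\<Sum>\<beta>\<in>UNIV. \<bar>w \<beta>\<bar>)"
 have W: "W > 0" by (auto simp: W_def intro!: add_pos_nonneg sum_nonneg)
 obtain d where d: "d > 0" "!!g x x'. bounded_L1 N g ==> norm (x - x') <= d ==> norm (conv (riesz s) g x - conv (riesz s) g x' :: 'a) <= \<omega> / W"
  using conv_uniform_modulus[OF sing N divide_pos_pos[OF \<omega> W]] by metis
 have "norm (riesz_drift w s h t x - riesz_drift w s h t x') <= \<omega>" if "norm (x - x') <= d" for t x x'
 proof -
  have "riesz_drift w s h t x - riesz_drift w s h t x' = (\<Sum>\<beta>\<in>UNIV. w \<beta> *\<^sub>R (conv (riesz s) (h \<beta> t) x - conv (riesz s) (h \<beta> t) x'))"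
   by (simp add: riesz_drift_def sum_subtractf scaleR_diff_right)
  also have "norm ... <= (\<Sum>\<beta>\<in>UNIV. \<bar>w \<beta>\<bar> * (\<omega> / W))"
   by (rule order_trans[OF norm_sum], intro sum_mono, unfold norm_scaleR, intro mult_left_mono d(2)[OF h(1) that] abs_ge_zero)
  also have "... <= W * (\<omega> / W)" unfolding sum_distrib_right[symmetric] using \<omega> W
   by (intro mult_right_mono) (auto simp: W_def)
  finally show ?thesis using W by simp
 qed
 then show "\<exists>\<delta>>0. \<forall>t x x'. norm (x - x') <= \<delta> --> norm (riesz_drift w s h t x - riesz_drift w s h t x') <= \<omega>"
  using d(1) by blast
qed

lemma sum_square_le_card:
 fixes x :: "'n::finite => 'a::real_normed_vector"
 shows "(norm (\<Sum>\<beta>\<in>UNIV. x \<beta>))^2 <= real CARD('n) * (\<Sum>\<beta>\<in>UNIV. (norm (x \<beta>))^2)"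
proof -
 have "(norm (\<Sum>\<beta>\<in>UNIV. x \<beta>))^2 <= (\<Sum>\<beta>\<in>UNIV. 1 * norm (x \<beta>))^2"
  using norm_sum[of x UNIV] by (intro power_mono) auto
 also have "... <= (\<Sum>\<beta>\<in>(UNIV::'n set). 1^2) * (\<Sum>\<beta>\<in>UNIV. (norm (x \<beta>))^2)"
  by (rule Cauchy_Schwarz_ineq_sum)
 finally show ?thesis by simp
qed

text \<open>Cauchy-Schwarz over the species separates them, at the cost of their number and of the
  sum of the squared weights.\<close>

lemma relative_drift_estimate:
 fixes u v :: "'n::finite => real => 'a::euclidean_space => real" and w :: "'n => real" and f :: "'a => real" and \<kappa> :: "nat => 'a => real"
 assumes K: "split_kernel A B L (riesz s :: 'a => 'a) K1 K2" and \<rho>: "bump \<epsilon> \<rho>" and \<epsilon>: "\<epsilon> > 0"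
  and u: "!!\<beta>. bounded_L1 N (u \<beta> t)" and v: "!!\<beta>. bounded_L1 N (v \<beta> t)" and f: "bounded_L1 N f" "AE x in lborel. 0 <= f x"
  and G: "!!\<beta>. has_weak_gradient (u \<beta> t) (G \<beta>)" and \<kappa>: "!!n. bump (\<delta> n) (\<kappa> n)" "\<delta> ----> 0"
 shows "(NN x. ennreal (f x * (norm (riesz_drift w s (%\<beta> t. mollify \<rho> (u \<beta> t)) t x - riesz_drift w s v t x))^2))
  <= ennreal (CARD('n) * (\<Sum>\<beta>\<in>UNIV. (w \<beta>)^2) * (6 * N * A^2 + 3 * N ^ 3 * L^2 + 3 * N * B^2)) *
   (\<Sum>\<beta>\<in>UNIV. ennreal (\<epsilon>^2) * (1 + (NN x. ennreal ((norm (G \<beta> x))^2)))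
    + (NN x. ennreal ((u \<beta> t x - v \<beta> t x)^2)) + (NN x. ennreal \<bar>u \<beta> t x - v \<beta> t x\<bar>)^2)"
  (is "_ <= ennreal (_ * _ * ?c) * (\<Sum>\<beta>\<in>UNIV. ?E \<beta>)")
proof -
 define S where "S = (\<Sum>\<beta>\<in>UNIV. (w \<beta>)^2)"
 define D where "D \<beta> x = conv (riesz s) (mollify \<rho> (u \<beta> t)) x - conv (riesz s) (v \<beta> t) x" for \<beta> x
 have N: "N \<ge> 0" by (rule bounded_L1D(5)[OF u])
 have S: "S \<ge> 0" by (auto simp: S_def intro: sum_nonneg)
 have c: "?c \<ge> 0" using N by (intro add_nonneg_nonneg) auto
 note [measurable] = split_kernelD(8)[OF K] bounded_L1D(4)[OF u] bounded_L1D(4)[OF v] bounded_L1D(4)[OF f(1)] bumpD(5)[OF \<rho>]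
 have [measurable]: "D \<beta> \<in> bmb" for \<beta>
  unfolding D_def[abs_def] by (intro borel_measurable_diff conv_measurable mollify_measurable) measurable
 have "(NN x. ennreal (f x * (norm (riesz_drift w s (%\<beta> t. mollify \<rho> (u \<beta> t)) t x - riesz_drift w s v t x))^2))
  <= (NN x. (\<Sum>\<beta>\<in>UNIV. ennreal (CARD('n) * S) * ennreal (f x * (norm (D \<beta> x))^2)))"
 proof (rule nn_integral_mono_AE, use f(2) in eventually_elim)
  case (elim x)
  have "riesz_drift w s (%\<beta> t. mollify \<rho> (u \<beta> t)) t x - riesz_drift w s v t x = (\<Sum>\<beta>\<in>UNIV. w \<beta> *\<^sub>R D \<beta> x)"
   by (simp add: riesz_drift_def sum_subtractf scaleR_diff_right D_def)
  then have "(norm (riesz_drift w s (%\<beta> t. mollify \<rho> (u \<beta> t)) t x - riesz_drift w s v t x))^2 <= CARD('n) * (\<Sum>\<beta>\<in>UNIV. (w \<beta>)^2 * (norm (D \<beta> x))^2)"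
   using sum_square_le_card[of "%\<beta>. w \<beta> *\<^sub>R D \<beta> x"] by (simp add: power_mult_distrib)
  also have "... <= CARD('n) * (\<Sum>\<beta>\<in>UNIV. S * (norm (D \<beta> x))^2)"
   unfolding S_def by (intro mult_left_mono sum_mono mult_right_mono member_le_sum) auto
  finally have "f x * (norm (riesz_drift w s (%\<beta> t. mollify \<rho> (u \<beta> t)) t x - riesz_drift w s v t x))^2 <= f x * (CARD('n) * (\<Sum>\<beta>\<in>UNIV. S * (norm (D \<beta> x))^2))"
   using elim by (intro mult_left_mono) auto
  also have "... = (\<Sum>\<beta>\<in>UNIV. CARD('n) * S * (f x * (norm (D \<beta> x))^2))" by (simp add: sum_distrib_left mult_ac)
  finally have "ennreal (f x * (norm (riesz_drift w s (%\<beta> t. mollify \<rho> (u \<beta> t)) t x - riesz_drift w s v t x))^2) <= ennreal (\<Sum>\<beta>\<in>UNIV. CARD('n) * S * (f x * (norm (D \<beta> x))^2))"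
   by (rule ennreal_leI)
  also have "... = (\<Sum>\<beta>\<in>UNIV. ennreal (CARD('n) * S) * ennreal (f x * (norm (D \<beta> x))^2))"
   using elim S by (subst sum_ennreal[symmetric]) (auto simp: ennreal_mult'')
  finally show ?case .
 qed
 also have "... = (\<Sum>\<beta>\<in>UNIV. ennreal (CARD('n) * S) * (NN x. ennreal (f x * (norm (D \<beta> x))^2)))"
  by (simp add: nn_integral_sum nn_integral_cmult)
 also have "... <= (\<Sum>\<beta>\<in>UNIV. ennreal (CARD('n) * S) * (ennreal ?c * ?E \<beta>))"
  unfolding D_def by (intro sum_mono mult_left_mono conv_mollified_difference[OF K \<rho> \<epsilon> u v f G \<kappa>]) auto
 also have "... = ennreal (CARD('n) * S * ?c) * (\<Sum>\<beta>\<in>UNIV. ?E \<beta>)"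
  using c S by (subst ennreal_mult) (auto simp: sum_distrib_left mult.assoc)
 finally show ?thesis by (simp add: S_def)
qed

section \<open>Stability of the flow\<close>

context two_flows
begin

lemma difference_fokker_planck:
 "fokker_planck T \<sigma> (Mf + Mg) (%t x. f t x - g t x) (%b t x. drift_flux d f b t x - drift_flux e g b t x)"
proof -
 have "fokker_planck T \<sigma> (1 * Mg) (%t x. - g t x) (%b t x. - drift_flux e g b t x)"
  by (rule fokker_planck_linear[OF fp_g]) (auto intro: bounded_linear_minus bounded_linear_ident)
 from fokker_planck_add[OF fp_f this] show ?thesis by simp
qed

lemma equal_mass:
 fixes k :: "'a => real"
 assumes k: "bump h k" and t: "t \<in> {0..T}"
 shows "(LB x. f t x) = (LB x. g t x)"
proof -
 have "AE x in lborel. f 0 x - g 0 x = 0" using init by eventually_elim simp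
 from fokker_planck_mass_zero[OF difference_fokker_planck this k t]
 show ?thesis using bounded_L1D(1)[OF bdd_f] bounded_L1D(1)[OF bdd_g] by simp
qed

text \<open>The difference of fluxes is \<open>f\<close> times the drift difference plus
  \<open>f - g\<close> times the bounded drift \<open>e\<close>. One factor \<open>f\<close> of the
  square is replaced by its bound \<open>N\<close>, which leaves the weight that also occurs in the
  entropy estimate.\<close>

lemma nn_integral_flux_difference:
 "(SB b. NN x. ennreal ((drift_flux d f b r x - drift_flux e g b r x)^2))
  <= ennreal (2 * N) * (NN x. ennreal (f r x * (norm (d r x - e r x))^2))
   + ennreal (2 * B^2) * (NN x. ennreal ((f r x - g r x)^2))"
proof -
 note [measurable] = regular_driftD(3)[OF d] regular_driftD(3)[OF e] bounded_L1D(4)[OF bdd_f] bounded_L1D(4)[OF bdd_g]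
 have N: "N \<ge> 0" by (rule bounded_L1D(5)[OF bdd_f[of 0]])
 have "(SB b. NN x. ennreal ((drift_flux d f b r x - drift_flux e g b r x)^2))
  = (NN x. (SB b. ennreal ((drift_flux d f b r x - drift_flux e g b r x)^2)))"
  unfolding drift_flux_def by (intro nn_integral_sum[symmetric]) measurable
 also have "... <= (NN x. ennreal (2 * N) * ennreal (f r x * (norm (d r x - e r x))^2) + ennreal (2 * B^2) * ennreal ((f r x - g r x)^2))"
 proof (rule nn_integral_mono_AE, use nonneg_f[of r] bounded_L1D(3)[OF bdd_f[of r]] in eventually_elim)
  case (elim x)
  have "(SB b. (drift_flux d f b r x - drift_flux e g b r x)^2) = (norm (f r x *\<^sub>R (d r x - e r x) + (f r x - g r x) *\<^sub>R e r x))^2"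
   unfolding sum_inner_Basis_square[symmetric] drift_flux_def by (simp add: inner_add_left inner_diff_left algebra_simps)
  also have "... <= (norm (f r x *\<^sub>R (d r x - e r x)) + norm ((f r x - g r x) *\<^sub>R e r x))^2"
   by (intro power_mono norm_triangle_ineq) simp
  also have "... <= 2 * (norm (f r x *\<^sub>R (d r x - e r x)))^2 + 2 * (norm ((f r x - g r x) *\<^sub>R e r x))^2"
   by (rule sum_squares_le)
  also have "(norm (f r x *\<^sub>R (d r x - e r x)))^2 <= N * (f r x * (norm (d r x - e r x))^2)"
  proof -
   have "f r x * (f r x * (norm (d r x - e r x))^2) <= N * (f r x * (norm (d r x - e r x))^2)"
    using elim by (intro mult_right_mono) auto
   then show ?thesis by (simp add: power_mult_distrib power2_eq_square mult_ac)
  qed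
  also have "(norm ((f r x - g r x) *\<^sub>R e r x))^2 <= B^2 * (f r x - g r x)^2"
   using mult_left_mono[OF power_mono[OF regular_driftD(2)[OF e, of r x] norm_ge_zero, of 2], of "(f r x - g r x)^2"]
   by (simp add: power_mult_distrib mult_ac)
  finally have le: "(SB b. (drift_flux d f b r x - drift_flux e g b r x)^2) <= (2 * N) * (f r x * (norm (d r x - e r x))^2) + (2 * B^2) * (f r x - g r x)^2"
   by simp
  have "(SB b. ennreal ((drift_flux d f b r x - drift_flux e g b r x)^2)) = ennreal (SB b. (drift_flux d f b r x - drift_flux e g b r x)^2)"
   by (intro sum_ennreal) simp
  also have "... <= ennreal ((2 * N) * (f r x * (norm (d r x - e r x))^2) + (2 * B^2) * (f r x - g r x)^2)"
   by (rule ennreal_leI[OF le])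
  also have "... = ennreal (2 * N) * ennreal (f r x * (norm (d r x - e r x))^2) + ennreal (2 * B^2) * ennreal ((f r x - g r x)^2)"
   using N elim by (subst ennreal_plus) (auto simp: ennreal_mult'')
  finally show ?case .
 qed
 also have "... = ennreal (2 * N) * (NN x. ennreal (f r x * (norm (d r x - e r x))^2))
   + ennreal (2 * B^2) * (NN x. ennreal ((f r x - g r x)^2))"
  by (simp add: nn_integral_add nn_integral_cmult)
 finally show ?thesis .
qed

definition total_error :: "real => ennreal" where
 "total_error t = (NN x. ennreal ((f t x - g t x)^2)) + (NN x. ennreal \<bar>f t x - g t x\<bar>)^2
  + (NN x. entropy_density (f t x) (g t x))"

text \<open>The three errors have a common driving term. Their constants are \<open>N + B^2\<close>
  for the \<open>L^2\<close> part, \<open>3 * N\<close> for the squared \<open>L^1\<close> part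
  through the entropy, and \<open>3 / 4\<close> for the entropy, all divided by
  \<open>\<sigma>\<close>.\<close>

lemma difference_estimate:
 fixes k :: "real => 'a => real"
 assumes k: "!!h. h > 0 ==> bump h (k h)" and t: "t \<in> {0..T}"
 shows "total_error t <= ennreal ((1 + 4 * N + B^2) / \<sigma>) *
  (NN r. indicator {0..t} r * ((NN x. ennreal (f r x * (norm (d r x - e r x))^2)) + (NN x. ennreal ((f r x - g r x)^2))))"
proof -
 have N: "N \<ge> 0" by (rule bounded_L1D(5)[OF bdd_f[of 0]])
 define Q where "Q r = (NN x. ennreal (f r x * (norm (d r x - e r x))^2))" for r
 define W where "W r = (NN x. ennreal ((f r x - g r x)^2))" for r
 define H where "H = (NN x. entropy_density (f t x) (g t x))"
 define J where "J = (NN r. indicator {0..t} r * (Q r + W r))"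
 note [measurable] = regular_driftD(1)[OF d, unfolded case_prod_beta'] regular_driftD(1)[OF e, unfolded case_prod_beta']
  fokker_planckD(1)[OF fp_f, unfolded case_prod_beta'] fokker_planckD(1)[OF fp_g, unfolded case_prod_beta']
 have [measurable]: "Q \<in> borel_measurable lborel" unfolding Q_def[abs_def]
  by (intro lborel.borel_measurable_nn_integral) (unfold case_prod_beta', measurable)
 have [measurable]: "W \<in> borel_measurable lborel" unfolding W_def[abs_def]
  by (intro lborel.borel_measurable_nn_integral) (unfold case_prod_beta', measurable)
 have H: "H <= ennreal (3 / (4 * \<sigma>)) * J"
 proof -
  have "H <= ennreal (3 / (4 * \<sigma>)) * (NN r. indicator {0..t} r * Q r)"
   unfolding H_def Q_def by (rule entropy_estimate[OF k t])
  also have "... <= ennreal (3 / (4 * \<sigma>)) * J"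
   unfolding J_def by (intro mult_left_mono nn_integral_mono) (auto split: split_indicator)
  finally show ?thesis .
 qed
 have w0: "AE x in lborel. f 0 x - g 0 x = 0" using init by eventually_elim simp
 have k': "bump (1 / real (Suc n)) (k (1 / real (Suc n)))" for n by (rule k) simp
 have kl: "(%n. 1 / real (Suc n)) ----> 0" by (intro LIMSEQ_Suc lim_1_over_n)
 have "W t <= ennreal (1 / (2 * \<sigma>)) * (NN r. indicator {0..t} r * (SB b. NN x. ennreal ((drift_flux d f b r x - drift_flux e g b r x)^2)))"
  unfolding W_def by (rule fokker_planck_L2[OF difference_fokker_planck sigma w0 k' kl t])
 also have "... <= ennreal (1 / (2 * \<sigma>)) * (NN r. ennreal (2 * N + 2 * B^2) * (indicator {0..t} r * (Q r + W r)))"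
 proof (intro mult_left_mono nn_integral_mono)
  fix r
  have "(SB b. NN x. ennreal ((drift_flux d f b r x - drift_flux e g b r x)^2)) <= ennreal (2 * N) * Q r + ennreal (2 * B^2) * W r"
   unfolding Q_def W_def by (rule nn_integral_flux_difference)
  also have "... <= ennreal (2 * N + 2 * B^2) * Q r + ennreal (2 * N + 2 * B^2) * W r"
   using N by (intro add_mono mult_right_mono ennreal_leI) auto
  also have "... = ennreal (2 * N + 2 * B^2) * (Q r + W r)" by (rule distrib_left[symmetric])
  finally show "indicator {0..t} r * (SB b. NN x. ennreal ((drift_flux d f b r x - drift_flux e g b r x)^2)) <= ennreal (2 * N + 2 * B^2) * (indicator {0..t} r * (Q r + W r))"
   by (auto split: split_indicator)
 qed simp
 also have "... = ennreal (1 / (2 * \<sigma>)) * ennreal (2 * N + 2 * B^2) * J"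
  unfolding J_def by (subst nn_integral_cmult, measurable) (simp only: mult.assoc)
 also have "ennreal (1 / (2 * \<sigma>)) * ennreal (2 * N + 2 * B^2) = ennreal ((N + B^2) / \<sigma>)"
  using sigma N by (subst ennreal_mult'[symmetric]) (auto simp: field_simps)
 finally have W: "W t <= ennreal ((N + B^2) / \<sigma>) * J" .
 have mass: "(NN x. ennreal (f t x)) <= ennreal N" "(NN x. ennreal (g t x)) <= ennreal N"
  by (rule order_trans[OF nn_integral_mono bounded_L1_nn[OF bdd_f[of t]]], simp add: ennreal_leI,
    rule order_trans[OF nn_integral_mono bounded_L1_nn[OF bdd_g[of t]]], simp add: ennreal_leI)
 have "(NN x. ennreal \<bar>f t x - g t x\<bar>)^2 <= ennreal (4 * N) * H"
  unfolding H_def using bounded_L1D(4)[OF bdd_f] bounded_L1D(4)[OF bdd_g]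
  by (intro L1_le_entropy nonneg_f nonneg_g mass N) auto
 also have "... <= ennreal (4 * N) * (ennreal (3 / (4 * \<sigma>)) * J)" by (intro mult_left_mono H) simp
 also have "... = ennreal (3 * N / \<sigma>) * J"
  using sigma N by (subst mult.assoc[symmetric], subst ennreal_mult'[symmetric]) auto
 finally have L: "(NN x. ennreal \<bar>f t x - g t x\<bar>)^2 <= ennreal (3 * N / \<sigma>) * J" .
 have "total_error t <= ennreal ((N + B^2) / \<sigma>) * J + ennreal (3 * N / \<sigma>) * J + ennreal (3 / (4 * \<sigma>)) * J"
  unfolding total_error_def W_def[symmetric] H_def[symmetric] by (intro add_mono W L H)
 also have "... = (ennreal ((N + B^2) / \<sigma>) + ennreal (3 * N / \<sigma>) + ennreal (3 / (4 * \<sigma>))) * J"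
  by (simp only: distrib_right)
 also have "ennreal ((N + B^2) / \<sigma>) + ennreal (3 * N / \<sigma>) + ennreal (3 / (4 * \<sigma>)) = ennreal ((N + B^2) / \<sigma> + 3 * N / \<sigma> + 3 / (4 * \<sigma>))"
  using sigma N by simp
 also have "... * J <= ennreal ((1 + 4 * N + B^2) / \<sigma>) * J"
  using sigma by (intro mult_right_mono ennreal_leI) (auto simp: field_simps)
 finally show ?thesis unfolding J_def Q_def W_def .
qed

end

text \<open>Two quantities are kept apart: \<open>E\<close> may contain an entropy about which
  nothing is known in advance, whereas \<open>e\<close> is bounded and measurable. Only the sum of
  the \<open>e\<close> over all species is needed on the right, so Gronwall closes for it, and
  \<open>E\<close> is bounded afterwards.\<close>

lemma coupled_gronwall:
 fixes E e Q :: "'n::finite => real => ennreal" and g :: "real => ennreal" and c k :: "'n => real"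
 assumes c: "!!\<alpha>. 0 <= c \<alpha>" "!!\<alpha>. 0 <= k \<alpha>" and T: "T \<ge> 0" and \<Gamma>: "\<Gamma> \<ge> 0"
  and E: "!!\<alpha> t. t \<in> {0..T} ==> E \<alpha> t <= ennreal (c \<alpha>) * (NN r. indicator {0..t} r * (Q \<alpha> r + e \<alpha> r))"
  and Q: "!!\<alpha>. AE r in lborel. r \<in> {0..T} --> Q \<alpha> r <= ennreal (k \<alpha>) * (ennreal (\<epsilon>^2) * g r + (\<Sum>\<beta>\<in>UNIV. e \<beta> r))"
  and e: "!!\<alpha> r. e \<alpha> r <= E \<alpha> r" "!!\<alpha> r. e \<alpha> r <= ennreal Y"
  and em[measurable]: "!!\<alpha>. e \<alpha> \<in> borel_measurable lborel" and gm[measurable]: "g \<in> borel_measurable lborel"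
  and g: "(NN r. indicator {0..T} r * g r) <= ennreal \<Gamma>" and t: "t \<in> {0..T}"
 defines "C \<equiv> 1 + (\<Sum>\<alpha>\<in>UNIV. c \<alpha> * (k \<alpha> + 1))"
 shows "E \<alpha> t <= ennreal (C * \<Gamma> * (1 + 2 * C * T * exp (2 * C * T)) * \<epsilon>^2)"
proof -
 define S where "S r = (\<Sum>\<beta>\<in>UNIV. e \<beta> r)" for r
 have Sm[measurable]: "S \<in> borel_measurable lborel" unfolding S_def[abs_def] by measurable
 have C: "C > 0" using c by (auto simp: C_def intro!: add_pos_nonneg sum_nonneg)
 have S_le: "S r <= ennreal (CARD('n) * max 0 Y)" for r
 proof -
  have "S r <= (\<Sum>\<beta>\<in>(UNIV::'n set). ennreal (max 0 Y))"
   unfolding S_def by (intro sum_mono order_trans[OF e(2)] ennreal_leI) simp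
  then show ?thesis by (simp add: ennreal_mult ennreal_of_nat_eq_real_of_nat)
 qed
 have Sfin: "S r < \<top>" for r using le_less_trans[OF S_le ennreal_less_top] .
 define y where "y r = enn2real (S r)" for r
 have Sy: "S r = ennreal (y r)" for r using Sfin[of r] by (simp add: y_def)
 have main: "(\<Sum>\<alpha>\<in>UNIV. E \<alpha> s) <= ennreal (C * \<Gamma> * \<epsilon>^2) + (NN r. indicator {0..s} r * ennreal (C * y r))" if s: "s \<in> {0..T}" for s
 proof -
  define J where "J = (NN r. indicator {0..s} r * (ennreal (\<epsilon>^2) * g r + S r))"
  have "E \<alpha> s <= ennreal (c \<alpha> * (k \<alpha> + 1)) * J" for \<alpha>
  proof -
   have "(NN r. indicator {0..s} r * (Q \<alpha> r + e \<alpha> r)) <= (NN r. ennreal (k \<alpha> + 1) * (indicator {0..s} r * (ennreal (\<epsilon>^2) * g r + S r)))"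
   proof (rule nn_integral_mono_AE, use Q[of \<alpha>] in eventually_elim)
    case (elim r)
    show ?case
    proof (cases "r \<in> {0..s}")
     case True
     have "e \<alpha> r <= S r" unfolding S_def by (intro member_le_sum) auto
     also have "S r <= ennreal (\<epsilon>^2) * g r + S r" by simp
     finally have "Q \<alpha> r + e \<alpha> r <= ennreal (k \<alpha>) * (ennreal (\<epsilon>^2) * g r + S r) + 1 * (ennreal (\<epsilon>^2) * g r + S r)"
      using elim True s by (intro add_mono) (auto simp: S_def)
     also have "... = ennreal (k \<alpha> + 1) * (ennreal (\<epsilon>^2) * g r + S r)"
      using c(2)[of \<alpha>] by (simp add: distrib_right)
     finally show ?thesis using True by simp
    qed simp
   qed
   also have "... = ennreal (k \<alpha> + 1) * J" unfolding J_def by (rule nn_integral_cmult) measurable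
   finally have "ennreal (c \<alpha>) * (NN r. indicator {0..s} r * (Q \<alpha> r + e \<alpha> r)) <= ennreal (c \<alpha>) * (ennreal (k \<alpha> + 1) * J)"
    by (intro mult_left_mono) auto
   also have "... = ennreal (c \<alpha> * (k \<alpha> + 1)) * J" using c by (subst ennreal_mult) (auto simp: mult.assoc)
   finally show ?thesis using E[OF s, of \<alpha>] by (rule order_trans[rotated])
  qed
  then have "(\<Sum>\<alpha>\<in>UNIV. E \<alpha> s) <= (\<Sum>\<alpha>\<in>UNIV. ennreal (c \<alpha> * (k \<alpha> + 1)) * J)" by (rule sum_mono)
  also have "... = ennreal (\<Sum>\<alpha>\<in>UNIV. c \<alpha> * (k \<alpha> + 1)) * J"
   unfolding sum_distrib_right[symmetric] using c by (subst sum_ennreal) auto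
  also have "... <= ennreal C * J" unfolding C_def by (intro mult_right_mono ennreal_leI) auto
  also have "... <= ennreal C * (ennreal (\<epsilon>^2) * ennreal \<Gamma> + (NN r. indicator {0..s} r * S r))"
  proof (rule mult_left_mono)
   have "J = (NN r. ennreal (\<epsilon>^2) * (indicator {0..s} r * g r) + indicator {0..s} r * S r)"
    unfolding J_def by (intro nn_integral_cong) (auto split: split_indicator)
   also have "... = ennreal (\<epsilon>^2) * (NN r. indicator {0..s} r * g r) + (NN r. indicator {0..s} r * S r)"
    by (simp add: nn_integral_add nn_integral_cmult)
   also have "(NN r. indicator {0..s} r * g r) <= ennreal \<Gamma>"
    by (rule order_trans[OF nn_integral_mono g]) (use s in \<open>auto split: split_indicator\<close>)
   finally show "J <= ennreal (\<epsilon>^2) * ennreal \<Gamma> + (NN r. indicator {0..s} r * S r)"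
    by (simp add: add_mono mult_left_mono)
  qed simp
  also have "... = ennreal (C * \<Gamma> * \<epsilon>^2) + (NN r. ennreal C * (indicator {0..s} r * S r))"
   using C \<Gamma> by (subst nn_integral_cmult, measurable) (simp add: distrib_left ennreal_mult mult_ac)
  also have "(NN r. ennreal C * (indicator {0..s} r * S r)) = (NN r. indicator {0..s} r * ennreal (C * y r))"
   using C by (intro nn_integral_cong) (simp add: Sy ennreal_mult' mult_ac)
  finally show ?thesis .
 qed
 have y0: "0 <= y s" for s by (simp add: y_def)
 have gron: "y s <= 2 * (C * \<Gamma> * \<epsilon>^2) * exp (2 * C * T)" if s: "s \<in> {0..T}" for s
 proof (rule gronwall_bounded[OF C _ T y0 _ _ s])
  show "0 <= C * \<Gamma> * \<epsilon>^2" using C \<Gamma> by simp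
  show "y r <= CARD('n) * max 0 Y" for r using S_le[of r] by (simp add: Sy)
  fix r assume r: "r \<in> {0..T}"
  have "ennreal (y r) <= (\<Sum>\<alpha>\<in>UNIV. E \<alpha> r)" unfolding Sy[symmetric] S_def by (intro sum_mono e(1))
  also note main[OF r]
  finally show "ennreal (y r) <= ennreal (C * \<Gamma> * \<epsilon>^2) + (NN r'. indicator {0..r} r' * ennreal (C * y r'))" .
 qed
 define Z where "Z = 2 * (C * \<Gamma> * \<epsilon>^2) * exp (2 * C * T)"
 have Z: "Z \<ge> 0" using C \<Gamma> by (simp add: Z_def)
 \<comment> \<open>The Gronwall bound is inserted into \<open>main\<close> once more, since
   \<open>y\<close> itself does not see the part of \<open>E\<close> beyond
   \<open>e\<close>.\<close>
 have "E \<alpha> t <= (\<Sum>\<alpha>\<in>UNIV. E \<alpha> t)" by (intro member_le_sum) auto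
 also have "... <= ennreal (C * \<Gamma> * \<epsilon>^2) + (NN r. indicator {0..t} r * ennreal (C * y r))" by (rule main[OF t])
 also have "... <= ennreal (C * \<Gamma> * \<epsilon>^2) + (NN r. ennreal (C * Z) * indicator {0..t} r)"
 proof (intro add_left_mono nn_integral_mono)
  fix r
  show "indicator {0..t} r * ennreal (C * y r) <= ennreal (C * Z) * indicator {0..t} r"
  proof (cases "r \<in> {0..t}")
   case True
   then have "y r <= Z" unfolding Z_def using t by (intro gron) auto
   then show ?thesis using True C by (simp add: ennreal_leI)
  qed simp
 qed
 also have "(NN r. ennreal (C * Z) * indicator {0..t} r) <= ennreal (C * Z * T)"
  using t C Z by (simp add: nn_integral_cmult_indicator ennreal_mult'[symmetric] ennreal_leI mult_left_mono)
 also have "ennreal (C * \<Gamma> * \<epsilon>^2) + ennreal (C * Z * T) = ennreal (C * \<Gamma> * \<epsilon>^2 + C * Z * T)"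
  using C Z T \<Gamma> by (intro ennreal_plus[symmetric]) auto
 also have "C * \<Gamma> * \<epsilon>^2 + C * Z * T = C * \<Gamma> * (1 + 2 * C * T * exp (2 * C * T)) * \<epsilon>^2"
  by (simp add: Z_def algebra_simps)
 finally show ?thesis by (simp add: add_left_mono)
qed

text \<open>On \<open>{0..T}\<close> the clamped drift agrees with the one in the weak formulation,
  and times outside play no part in its integrals.\<close>

lemma weak_solution_flow:
 fixes f :: "'n::finite => real => 'a::euclidean_space => real" and D :: "real => 'a => 'a" and k :: "real => real => real"
 assumes T: "T > 0" and sol: "weak_solution T \<sigma> W f0 f" and bd: "!!t. t \<in> {0..T} ==> bounded_L1 N (f \<alpha> t)"
  and D: "regular_drift B D" and eq: "!!t x. t \<in> {0..T} ==> D t x = (\<Sum>\<beta>\<in>UNIV. conv (gradient (W \<alpha> \<beta>)) (f \<beta> t) x)"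
  and k: "!!h. h > 0 ==> bump h (k h)"
 shows "fokker_planck T (\<sigma> \<alpha>) (N + B * N) (%t. f \<alpha> (time_clamp T t)) (drift_flux D (%t. f \<alpha> (time_clamp T t)))"
proof -
 have s: "(%(t,x). f \<alpha> t x) \<in> borel_measurable (space_time T)" "continuous_L2 T (f \<alpha>)"
  and weak: "!!\<phi> :: real \<times> 'a => real. test_function \<phi> ==> supp \<phi> \<subseteq> {0<..<T} \<times> UNIV ==>
      has_bochner_integral (space_time T)
       (%(t,x). f \<alpha> t x * (dir_deriv (1, 0) \<phi> (t, x)
         - (\<Sum>\<beta>\<in>UNIV. conv (gradient (W \<alpha> \<beta>)) (f \<beta> t) x \<bullet> gradient (%y. \<phi> (t, y)) x)
         + \<sigma> \<alpha> * laplacian (%y. \<phi> (t, y)) x)) 0"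
 proof -
  note sa = spec[OF sol[unfolded weak_solution_def], of \<alpha>]
  show "(%(t,x). f \<alpha> t x) \<in> borel_measurable (space_time T)" "continuous_L2 T (f \<alpha>)"
   by (rule conjunct1[OF sa], rule conjunct1[OF conjunct2[OF sa]])
  show "has_bochner_integral (space_time T)
       (%(t,x). f \<alpha> t x * (dir_deriv (1, 0) \<phi> (t, x)
         - (\<Sum>\<beta>\<in>UNIV. conv (gradient (W \<alpha> \<beta>)) (f \<beta> t) x \<bullet> gradient (%y. \<phi> (t, y)) x)
         + \<sigma> \<alpha> * laplacian (%y. \<phi> (t, y)) x)) 0"
   if "test_function \<phi>" "supp \<phi> \<subseteq> {0<..<T} \<times> UNIV" for \<phi> :: "real \<times> 'a => real"
   by (rule conjunct2[OF conjunct2[OF conjunct2[OF sa]], THEN spec, THEN mp, OF conjI[OF that]])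
 qed
 have "fokker_planck T (\<sigma> \<alpha>) (N + B * N) (%t. f \<alpha> (time_clamp T t)) (%b t x. (D t x \<bullet> b) * f \<alpha> (time_clamp T t) x)"
 proof (rule weak_solution_imp_fokker_planck[OF T s bd regular_driftD(1)[OF D] regular_driftD(2)[OF D] k])
  fix \<phi> :: "real \<times> 'a => real" assume \<phi>: "test_function \<phi>" "supp \<phi> \<subseteq> {0<..<T} \<times> UNIV"
  show "has_bochner_integral (space_time T) (%(t,x). f \<alpha> t x * (dir_deriv (1, 0) \<phi> (t, x)
     - D t x \<bullet> gradient (%y. \<phi> (t, y)) x + \<sigma> \<alpha> * laplacian (%y. \<phi> (t, y)) x)) 0"
  proof (rule has_bochner_integral_cong[THEN iffD1, OF refl _ refl weak[OF \<phi>]])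
   fix p assume "p \<in> space (space_time T :: (real \<times> 'a) measure)"
   then have "fst p \<in> {0..T}" by (auto simp: space_pair_measure space_restrict_space)
   then show "(case p of (t, x) => f \<alpha> t x * (dir_deriv (1, 0) \<phi> (t, x)
         - (\<Sum>\<beta>\<in>UNIV. conv (gradient (W \<alpha> \<beta>)) (f \<beta> t) x \<bullet> gradient (%y. \<phi> (t, y)) x)
         + \<sigma> \<alpha> * laplacian (%y. \<phi> (t, y)) x))
    = (case p of (t, x) => f \<alpha> t x * (dir_deriv (1, 0) \<phi> (t, x)
     - D t x \<bullet> gradient (%y. \<phi> (t, y)) x + \<sigma> \<alpha> * laplacian (%y. \<phi> (t, y)) x))"
    by (cases p) (simp add: eq inner_sum_left)
  qed
 qed
 then show ?thesis unfolding drift_flux_def[abs_def] .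
qed

lemma L2norm_square: "(L2norm M f)^2 = (\<integral>\<^sup>+x. ennreal ((f x)^2) \<partial>M)"
proof (cases "\<integral>\<^sup>+x. ennreal ((f x)^2) \<partial>M")
 case (real r)
 then show ?thesis by (simp add: L2norm_def esqrt_def ennreal_power)
next
 case top
 then show ?thesis by (simp add: L2norm_def esqrt_def power2_eq_square ennreal_top_mult)
qed

lemma tensor_eq_prod: "tensor K p x = (\<Prod>i\<in>tensor_index K. p (fst i) (x i))"
 unfolding tensor_def tensor_index_def by (subst prod.Sigma) (auto simp: case_prod_beta')

lemma card_tensor_index: "card (tensor_index K) = (\<Sum>\<alpha>\<in>UNIV. K \<alpha>)" for K :: "'n::finite => nat"
 unfolding tensor_index_def by (subst card_SigmaI) auto

text \<open>The strict bound on the infimum hands over a concrete gradient for each species, with no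
  appeal to its uniqueness. Clamping extends these gradients measurably to all times.\<close>

lemma weak_gradient_family:
 fixes f :: "'n::finite => real => 'a::euclidean_space => real" and T M :: real
 assumes T: "T \<ge> 0" and H: "!!\<beta>. L2_H1_norm T (f \<beta>) < ennreal M" and M: "M > 0"
 obtains G where "\<forall>\<beta>. (%(t,x). G \<beta> t x) \<in> borel_measurable (lborel \<Otimes>\<^sub>M lborel)"
  "AE t in lborel. t \<in> {0..T} --> (\<forall>\<beta>. has_weak_gradient (f \<beta> t) (G \<beta> t))"
  "(NN t. indicator {0..T} t * (\<Sum>\<beta>\<in>UNIV. 1 + (NN x. ennreal ((norm (G \<beta> t x))^2)))) <= ennreal (CARD('n) * (T + M^2))"
proof -
 let ?P = "%\<beta> G. (%(t,x). G t x) \<in> borel_measurable (space_time T) \<and> (AE t in time_interval T. has_weak_gradient (f \<beta> t) (G t)) \<and>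
  esqrt (\<integral>\<^sup>+t. (NN x. ennreal ((f \<beta> t x)^2 + (norm (G t x))^2)) \<partial>time_interval T) < ennreal M"
 have "\<forall>\<beta>. \<exists>G. ?P \<beta> G"
  using H unfolding L2_H1_norm_def INF_less_iff by (simp only: Bex_def mem_Collect_eq conj_assoc simp_thms)
 then have "\<exists>G. \<forall>\<beta>. ?P \<beta> (G \<beta>)" by (rule choice)
 then obtain G where G0: "\<forall>\<beta>. ?P \<beta> (G \<beta>)" by (rule exE)
 note G = G0[THEN spec, THEN conjunct1] G0[THEN spec, THEN conjunct2, THEN conjunct1] G0[THEN spec, THEN conjunct2, THEN conjunct2]
 define G' where "G' \<beta> t = G \<beta> (time_clamp T t)" for \<beta> t
 have m: "(%(t,x). G' \<beta> t x) \<in> borel_measurable (lborel \<Otimes>\<^sub>M lborel)" for \<beta>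
  unfolding G'_def by (rule time_clamp_measurable_pair[OF G(1) T])
 note [measurable] = m[unfolded case_prod_beta']
 have [measurable]: "(%t. NN x. ennreal ((norm (G' \<beta> t x))^2)) \<in> borel_measurable lborel" for \<beta>
  by (intro lborel.borel_measurable_nn_integral) (unfold case_prod_beta', measurable)
 have I: "(NN t. indicator {0..T} t * (NN x. ennreal ((norm (G' \<beta> t x))^2))) <= ennreal (M^2)" for \<beta>
 proof -
  define J where "J = (\<integral>\<^sup>+t. (NN x. ennreal ((f \<beta> t x)^2 + (norm (G \<beta> t x))^2)) \<partial>time_interval T)"
  have "(NN t. indicator {0..T} t * (NN x. ennreal ((norm (G' \<beta> t x))^2)))
   <= (NN t. (NN x. ennreal ((f \<beta> t x)^2 + (norm (G \<beta> t x))^2)) * indicator {0..T} t)"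
  proof (rule nn_integral_mono)
   fix t
   show "indicator {0..T} t * (NN x. ennreal ((norm (G' \<beta> t x))^2))
    <= (NN x. ennreal ((f \<beta> t x)^2 + (norm (G \<beta> t x))^2)) * indicator {0..T} t"
   proof (cases "t \<in> {0..T}")
    case True
    have "(NN x. ennreal ((norm (G \<beta> t x))^2)) <= (NN x. ennreal ((f \<beta> t x)^2 + (norm (G \<beta> t x))^2))"
     by (intro nn_integral_mono ennreal_leI) simp
    then show ?thesis using True unfolding G'_def time_clamp_id[OF True] by simp
   qed simp
  qed
  also have "... = J" unfolding J_def by (rule nn_integral_restrict_space[symmetric]) simp
  also have "J <= ennreal (M^2)"
   unfolding J_def by (rule less_imp_le[OF esqrt_less_imp[OF G(3) M]])
  finally show ?thesis .
 qed
 have ind: "(NN t. indicator {0..T} t) = ennreal T" using T by simp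
 have "(NN t. indicator {0..T} t * (\<Sum>\<beta>\<in>UNIV. 1 + (NN x. ennreal ((norm (G' \<beta> t x))^2))))
  = (NN t. (\<Sum>\<beta>\<in>UNIV. indicator {0..T} t + indicator {0..T} t * (NN x. ennreal ((norm (G' \<beta> t x))^2))))"
 proof (rule nn_integral_cong)
  fix t
  show "indicator {0..T} t * (\<Sum>\<beta>\<in>UNIV. 1 + (NN x. ennreal ((norm (G' \<beta> t x))^2)))
   = (\<Sum>\<beta>\<in>UNIV. indicator {0..T} t + indicator {0..T} t * (NN x. ennreal ((norm (G' \<beta> t x))^2)))"
   by (simp only: sum_distrib_left distrib_left mult_1_right)
 qed
 also have "... = (\<Sum>\<beta>\<in>UNIV. NN t. indicator {0..T} t + indicator {0..T} t * (NN x. ennreal ((norm (G' \<beta> t x))^2)))"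
  by (rule nn_integral_sum) measurable
 also have "... = (\<Sum>\<beta>\<in>UNIV. ennreal T + (NN t. indicator {0..T} t * (NN x. ennreal ((norm (G' \<beta> t x))^2))))"
  unfolding ind[symmetric] by (intro sum.cong refl nn_integral_add) measurable
 also have "... <= (\<Sum>\<beta>\<in>(UNIV::'n set). ennreal T + ennreal (M^2))" by (intro sum_mono add_left_mono I)
 also have "... = ennreal (CARD('n) * (T + M^2))"
  using T by (simp add: ennreal_mult ennreal_of_nat_eq_real_of_nat)
 finally have 3: "(NN t. indicator {0..T} t * (\<Sum>\<beta>\<in>UNIV. 1 + (NN x. ennreal ((norm (G' \<beta> t x))^2)))) <= ennreal (CARD('n) * (T + M^2))" .
 have "AE t in lborel. t \<in> {0..T} --> has_weak_gradient (f \<beta> t) (G' \<beta> t)" for \<beta>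
 proof -
  have "AE t in lborel. t \<in> {0..T} --> has_weak_gradient (f \<beta> t) (G \<beta> t)"
   using G(2)[of \<beta>] by (subst (asm) AE_restrict_space_iff) auto
  then show ?thesis by eventually_elim (simp add: G'_def time_clamp_id)
 qed
 then have "AE t in lborel. \<forall>\<beta>\<in>UNIV. t \<in> {0..T} --> has_weak_gradient (f \<beta> t) (G' \<beta> t)"
  by (intro AE_finite_allI finite)
 then have "AE t in lborel. t \<in> {0..T} --> (\<forall>\<beta>. has_weak_gradient (f \<beta> t) (G' \<beta> t))"
  by eventually_elim auto
 then show ?thesis using that[of G'] m 3 by blast
qed

lemma sol_norm_imp_bounded_L1:
 fixes f :: "'n::finite => real => 'a::euclidean_space => real"
 assumes T: "T > 0" and sol: "weak_solution T \<sigma> W f0 f" and N: "sol_norm T (f \<alpha>) <= ennreal N" "N \<ge> 0" and t: "t \<in> {0..T}"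
 shows "bounded_L1 N (f \<alpha> t)"
proof (rule solution_bounded_L1[OF T _ _ _ N(2) t])
 note sa = spec[OF sol[unfolded weak_solution_def], of \<alpha>]
 show "(%(t,x). f \<alpha> t x) \<in> borel_measurable (space_time T)" "continuous_L2 T (f \<alpha>)"
  by (rule conjunct1[OF sa], rule conjunct1[OF conjunct2[OF sa]])
 show "Linf_L1_Linf_norm T (f \<alpha>) <= ennreal N"
  by (rule order_trans[OF _ N(1)]) (simp add: sol_norm_def)
qed

text \<open>The a priori bound for Gronwall's inequality. The sup bound \<open>2 * N\<close> reduces
  the \<open>L^2\<close> term to the \<open>L^1\<close> norm, which is at most \<open>2 * N\<close>
  as well, so each of the two terms is at most \<open>4 * N^2\<close>.\<close>

lemma nn_integral_square_le_bounded:
 fixes u v :: "'a::euclidean_space => real"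
 assumes u: "bounded_L1 N u" and v: "bounded_L1 N v"
 shows "(NN x. ennreal ((u x - v x)^2)) + (NN x. ennreal \<bar>u x - v x\<bar>)^2 <= ennreal (8 * N^2)"
proof -
 note uu = bounded_L1D[OF u] and vv = bounded_L1D[OF v]
 note [measurable] = uu(4) vv(4)
 have L: "(NN x. ennreal \<bar>u x - v x\<bar>) <= ennreal (2 * N)"
 proof -
  have "(NN x. ennreal \<bar>u x - v x\<bar>) <= (NN x. ennreal \<bar>u x\<bar> + ennreal \<bar>v x\<bar>)"
   by (intro nn_integral_mono) (simp add: ennreal_plus[symmetric] ennreal_leI del: ennreal_plus)
  also have "... <= ennreal N + ennreal N"
   by (subst nn_integral_add) (auto intro: add_mono bounded_L1_nn u v)
  also have "... = ennreal (N + N)" using uu(5) by (intro ennreal_plus[symmetric])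
  finally show ?thesis by simp
 qed
 have "(NN x. ennreal ((u x - v x)^2)) <= (NN x. ennreal (2 * N) * ennreal \<bar>u x - v x\<bar>)"
 proof (rule nn_integral_mono_AE, use uu(3) vv(3) in eventually_elim)
  case (elim x)
  have "\<bar>u x - v x\<bar> * \<bar>u x - v x\<bar> <= (2 * N) * \<bar>u x - v x\<bar>" using elim by (intro mult_right_mono) auto
  then have "ennreal ((u x - v x)^2) <= ennreal ((2 * N) * \<bar>u x - v x\<bar>)"
   by (intro ennreal_leI) (simp add: power2_eq_square)
  then show ?case using uu(5) by (simp add: ennreal_mult)
 qed
 also have "... <= ennreal (2 * N) * ennreal (2 * N)"
  by (subst nn_integral_cmult, measurable) (intro mult_left_mono L, simp)
 finally have S: "(NN x. ennreal ((u x - v x)^2)) <= ennreal (2 * N) * ennreal (2 * N)" .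
 have "(NN x. ennreal \<bar>u x - v x\<bar>)^2 <= ennreal (2 * N) * ennreal (2 * N)"
  unfolding power2_eq_square by (intro mult_mono L) auto
 from add_mono[OF S this] have "(NN x. ennreal ((u x - v x)^2)) + (NN x. ennreal \<bar>u x - v x\<bar>)^2
   <= ennreal (2 * N) * ennreal (2 * N) + ennreal (2 * N) * ennreal (2 * N)" .
 also have "ennreal (2 * N) * ennreal (2 * N) = ennreal (4 * N^2)"
  using uu(5) by (subst ennreal_mult[symmetric]) (auto simp: power2_eq_square)
 also have "ennreal (4 * N^2) + ennreal (4 * N^2) = ennreal (4 * N^2 + 4 * N^2)" by (intro ennreal_plus[symmetric]) auto
 finally show ?thesis by simp
qed

text \<open>Two bounds on the norms are carried: \<open>N\<close> dominates both solutions and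
  controls their time sections, while the strict \<open>M\<close> for the intermediate one yields
  its weak gradients. The squared \<open>L^1\<close> distance is included since Gronwall needs it
  and the tensor estimate uses it.\<close>

theorem mean_field_error:
 fixes a :: "'n::finite => 'n => real" and \<sigma> :: "'n => real" and s T M N :: real and chi :: "'a::euclidean_space => real"
  and f0 :: "'n => 'a => real" and fbar :: "'n => real => 'a => real"
  and ftilde :: "real => 'n => real => 'a => real"
 assumes dim: "DIM('a) \<ge> 3" and T: "T > 0" and \<sigma>: "!!\<alpha>. \<sigma> \<alpha> > 0" and s: "0 < s" "s <= real DIM('a) - 2"
  and f0: "!!\<alpha>. prob_density (f0 \<alpha>)"
  and chi: "test_function chi" "prob_density chi" "supp chi \<subseteq> cball 0 1"
  and solb: "weak_solution T \<sigma> (interaction a s) f0 fbar"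
  and solt: "!!\<epsilon>. \<epsilon> > 0 ==> weak_solution T \<sigma> (interaction_eps a s chi \<epsilon>) f0 (ftilde \<epsilon>)"
  and Nb: "!!\<alpha>. sol_norm T (fbar \<alpha>) <= ennreal N" and Nt: "!!\<epsilon> \<alpha>. \<epsilon> > 0 ==> sol_norm T (ftilde \<epsilon> \<alpha>) <= ennreal N"
  and Mt: "!!\<epsilon> \<alpha>. \<epsilon> > 0 ==> sol_norm T (ftilde \<epsilon> \<alpha>) < ennreal M" and M: "M > 0" and N: "N \<ge> 0"
 shows "\<exists>C\<ge>0. \<forall>\<epsilon>>0. \<forall>\<alpha>. \<forall>t\<in>{0..T}.
  (NN x. ennreal ((ftilde \<epsilon> \<alpha> t x - fbar \<alpha> t x)^2)) + (NN x. ennreal \<bar>ftilde \<epsilon> \<alpha> t x - fbar \<alpha> t x\<bar>)^2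
   + (NN x. entropy_density (ftilde \<epsilon> \<alpha> t x) (fbar \<alpha> t x)) <= ennreal (C * \<epsilon>^2)
  \<and> rel_entropy (ftilde \<epsilon> \<alpha> t) (fbar \<alpha> t) = enn2ereal (NN x. entropy_density (ftilde \<epsilon> \<alpha> t x) (fbar \<alpha> t x))"
proof -
 define k where "k = mollifier chi"
 have k: "bump h (k h)" if "h > 0" for h unfolding k_def by (rule bump_mollifier[OF chi that])
 \<comment> \<open>Kernels on the line, for passing from the distributional equation in time to the
   integrated one.\<close>
 obtain kt :: "real => real => real" where kt: "!!h. h > 0 ==> bump h (kt h)" using real_bump_exists[OF chi] by blast
 have T0: "T \<ge> 0" using T by simp
 have clamp: "time_clamp T t \<in> {0..T}" for t by (rule time_clamp_in[OF T0])
 define Fb where "Fb \<alpha> t = fbar \<alpha> (time_clamp T t)" for \<alpha> t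
 define F where "F \<epsilon> \<alpha> t = ftilde \<epsilon> \<alpha> (time_clamp T t)" for \<epsilon> \<alpha> t
 have bb0: "bounded_L1 N (fbar \<alpha> t)" if "t \<in> {0..T}" for \<alpha> t
  by (rule sol_norm_imp_bounded_L1[OF T solb Nb N that])
 have bt0: "bounded_L1 N (ftilde \<epsilon> \<alpha> t)" if "t \<in> {0..T}" "\<epsilon> > 0" for \<epsilon> \<alpha> t
  by (rule sol_norm_imp_bounded_L1[OF T solt[OF that(2)] Nt[OF that(2)] N that(1)])
 have bb: "bounded_L1 N (Fb \<alpha> t)" for \<alpha> t unfolding Fb_def by (rule bb0[OF clamp])
 have bt: "bounded_L1 N (F \<epsilon> \<alpha> t)" if "\<epsilon> > 0" for \<epsilon> \<alpha> t unfolding F_def by (rule bt0[OF clamp that])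
 have mb: "(%(t,x). Fb \<alpha> t x) \<in> borel_measurable (lborel \<Otimes>\<^sub>M lborel)" for \<alpha>
  unfolding Fb_def by (rule time_clamp_measurable_pair[OF conjunct1[OF spec[OF solb[unfolded weak_solution_def]]] T0])
 have mt: "(%(t,x). F \<epsilon> \<alpha> t x) \<in> borel_measurable (lborel \<Otimes>\<^sub>M lborel)" if "\<epsilon> > 0" for \<epsilon> \<alpha>
  unfolding F_def by (rule time_clamp_measurable_pair[OF conjunct1[OF spec[OF solt[OF that, unfolded weak_solution_def]]] T0])
 have sing: "singular_kernel (riesz s :: 'a => 'a)" by (rule singular_kernel_riesz) (use s in auto)
 \<comment> \<open>One fixed splitting suffices for all constants here; the value 1 is arbitrary.
   Small integrable parts matter only for moduli of continuity.\<close>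
 then obtain B0 L and K1 K2 :: "'a => 'a" where K: "split_kernel 1 B0 L (riesz s) K1 K2"
  unfolding singular_kernel_def using zero_less_one by blast
 define B where "B \<alpha> = (\<Sum>\<beta>\<in>UNIV. \<bar>a \<alpha> \<beta>\<bar>) * (N * 1 + B0 * N)" for \<alpha>
 define db where "db \<alpha> = riesz_drift (a \<alpha>) s Fb" for \<alpha>
 define dt where "dt \<epsilon> \<alpha> = riesz_drift (a \<alpha>) s (%\<beta> t. mollify (k \<epsilon>) (F \<epsilon> \<beta> t))" for \<epsilon> \<alpha>
 have rb: "regular_drift (B \<alpha>) (db \<alpha>)" for \<alpha>
  unfolding B_def db_def by (rule regular_riesz_drift[OF K sing bb mb])
 have rt: "regular_drift (B \<alpha>) (dt \<epsilon> \<alpha>)" if "\<epsilon> > 0" for \<epsilon> \<alpha>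
  unfolding B_def dt_def
  by (rule regular_riesz_drift[OF K sing bounded_L1_mollify[OF k[OF that] bt[OF that]] mollify_measurable_pair[OF bumpD(5)[OF k[OF that]] mt[OF that]]])
 have fb: "fokker_planck T (\<sigma> \<alpha>) (N + B \<alpha> * N) (Fb \<alpha>) (drift_flux (db \<alpha>) (Fb \<alpha>))" for \<alpha>
 proof -
  have "db \<alpha> t x = (\<Sum>\<beta>\<in>UNIV. conv (gradient (interaction a s \<alpha> \<beta>)) (fbar \<beta> t) x)" if "t \<in> {0..T}" for t x
   unfolding db_def riesz_drift_def Fb_def time_clamp_id[OF that]
   by (intro sum.cong refl conv_gradient_interaction[symmetric] bounded_L1D(4)[OF bb0[OF that]])
  from weak_solution_flow[OF T solb bb0 rb this kt] show ?thesis unfolding Fb_def[abs_def] .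
 qed
 have ft: "fokker_planck T (\<sigma> \<alpha>) (N + B \<alpha> * N) (F \<epsilon> \<alpha>) (drift_flux (dt \<epsilon> \<alpha>) (F \<epsilon> \<alpha>))" if e: "\<epsilon> > 0" for \<epsilon> \<alpha>
 proof -
  have "dt \<epsilon> \<alpha> t x = (\<Sum>\<beta>\<in>UNIV. conv (gradient (interaction_eps a s chi \<epsilon> \<alpha> \<beta>)) (ftilde \<epsilon> \<beta> t) x)" if "t \<in> {0..T}" for t x
   unfolding dt_def riesz_drift_def F_def time_clamp_id[OF that] k_def
   by (intro sum.cong refl conv_gradient_interaction_eps[OF dim s k[OF e, unfolded k_def] bt0[OF that e], symmetric])
  from weak_solution_flow[OF T solt[OF e] bt0[OF _ e] rt[OF e] this kt] show ?thesis unfolding F_def[abs_def] .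
 qed
 have z: "time_clamp T 0 = 0" using T0 by (intro time_clamp_id) auto
 have ib: "AE x in lborel. Fb \<alpha> 0 x = f0 \<alpha> x" for \<alpha>
  unfolding Fb_def z by (rule conjunct1[OF conjunct2[OF conjunct2[OF spec[OF solb[unfolded weak_solution_def]]]]])
 have it: "AE x in lborel. F \<epsilon> \<alpha> 0 x = f0 \<alpha> x" if "\<epsilon> > 0" for \<epsilon> \<alpha>
  unfolding F_def z by (rule conjunct1[OF conjunct2[OF conjunct2[OF spec[OF solt[OF that, unfolded weak_solution_def]]]]])
 have f0n: "AE x in lborel. 0 <= f0 \<alpha> x" for \<alpha> using f0[of \<alpha>] by (simp add: prob_density_def)
 have nb: "AE x in lborel. 0 <= Fb \<alpha> t x" for \<alpha> t
 proof -
  have "AE x in lborel. 0 <= Fb \<alpha> 0 x" using ib[of \<alpha>] f0n[of \<alpha>] by eventually_elim simp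
  from fokker_planck_nonneg[OF fb[unfolded drift_flux_def[abs_def]] \<sigma> T0 rb bb this k clamp[of t]]
  show ?thesis by (simp add: Fb_def time_clamp_id[OF clamp])
 qed
 have nt: "AE x in lborel. 0 <= F \<epsilon> \<alpha> t x" if e: "\<epsilon> > 0" for \<epsilon> \<alpha> t
 proof -
  have "AE x in lborel. 0 <= F \<epsilon> \<alpha> 0 x" using it[OF e, of \<alpha>] f0n[of \<alpha>] by eventually_elim simp
  from fokker_planck_nonneg[OF ft[OF e, unfolded drift_flux_def[abs_def]] \<sigma> T0 rt[OF e] bt[OF e] this k clamp[of t]]
  show ?thesis by (simp add: F_def time_clamp_id[OF clamp])
 qed
 \<comment> \<open>The intermediate solution comes first, in accordance with the order of arguments
   of the entropy. The limiting drift thereby becomes the reference drift in the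
   commutators.\<close>
 have flows: "two_flows T (\<sigma> \<alpha>) (N + B \<alpha> * N) (N + B \<alpha> * N) (B \<alpha>) N (F \<epsilon> \<alpha>) (Fb \<alpha>) (dt \<epsilon> \<alpha>) (db \<alpha>)" if e: "\<epsilon> > 0" for \<epsilon> \<alpha>
 proof
  show "AE x in lborel. F \<epsilon> \<alpha> 0 x = Fb \<alpha> 0 x" using it[OF e, of \<alpha>] ib[of \<alpha>] by eventually_elim simp
 qed (use ft[OF e] fb \<sigma> T0 rt[OF e] rb bt[OF e] bb nt[OF e] nb in \<open>simp_all\<close>)
 define c where "c \<alpha> = (1 + 4 * N + (B \<alpha>)^2) / \<sigma> \<alpha>" for \<alpha>
 define q where "q \<alpha> = real CARD('n) * (\<Sum>\<beta>\<in>UNIV. (a \<alpha> \<beta>)^2) * (6 * N * 1^2 + 3 * N ^ 3 * L^2 + 3 * N * B0^2)" for \<alpha>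
 \<comment> \<open>The time integral of \<open>1\<close> plus the squared gradient norm, summed over
   the species. It does not depend on \<open>\<epsilon>\<close>.\<close>
 define \<Gamma> where "\<Gamma> = CARD('n) * (T + M^2)"
 have c: "c \<alpha> \<ge> 0" "q \<alpha> \<ge> 0" for \<alpha>
  unfolding c_def q_def using \<sigma>[of \<alpha>] N
  by (auto intro!: divide_nonneg_pos mult_nonneg_nonneg sum_nonneg add_nonneg_nonneg)
 have G0: "\<Gamma> \<ge> 0" using T0 by (simp add: \<Gamma>_def)
 define C where "C = 1 + (\<Sum>\<alpha>\<in>UNIV. c \<alpha> * (q \<alpha> + 1))"
 have C: "C \<ge> 0" unfolding C_def using c by (intro add_nonneg_nonneg sum_nonneg mult_nonneg_nonneg) auto
 define C1 where "C1 = C * \<Gamma> * (1 + 2 * C * T * exp (2 * C * T))"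
 have C1: "C1 \<ge> 0" unfolding C1_def using C G0 T0 by (intro mult_nonneg_nonneg add_nonneg_nonneg) auto
 have est: "two_flows.total_error (F \<epsilon> \<alpha>) (Fb \<alpha>) t <= ennreal (C1 * \<epsilon>^2)" if e: "\<epsilon> > 0" and t: "t \<in> {0..T}" for \<epsilon> \<alpha> t
 proof -
  have Mt': "L2_H1_norm T (ftilde \<epsilon> \<beta>) < ennreal M" for \<beta>
   by (rule le_less_trans[OF _ Mt[OF e, of \<beta>]]) (simp add: sol_norm_def)
  obtain G where GG: "\<forall>\<beta>. (%(t,x). G \<beta> t x) \<in> borel_measurable (lborel \<Otimes>\<^sub>M lborel)"
   "AE t in lborel. t \<in> {0..T} --> (\<forall>\<beta>. has_weak_gradient (ftilde \<epsilon> \<beta> t) (G \<beta> t))"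
   "(NN t. indicator {0..T} t * (\<Sum>\<beta>\<in>UNIV. 1 + (NN x. ennreal ((norm (G \<beta> t x))^2)))) <= ennreal (CARD('n) * (T + M^2))"
   by (rule weak_gradient_family[where f="ftilde \<epsilon>", OF T0 Mt' M])
  note G = GG(1)[THEN spec] GG(2) GG(3)[folded \<Gamma>_def]
  define W where "W \<beta> r = (NN x. ennreal ((F \<epsilon> \<beta> r x - Fb \<beta> r x)^2))" for \<beta> r
  define E1 where "E1 \<beta> r = W \<beta> r + (NN x. ennreal \<bar>F \<epsilon> \<beta> r x - Fb \<beta> r x\<bar>)^2" for \<beta> r
  define g where "g r = (\<Sum>\<beta>\<in>UNIV. 1 + (NN x. ennreal ((norm (G \<beta> r x))^2)))" for r
  define Q where "Q \<alpha> r = (NN x. ennreal (F \<epsilon> \<alpha> r x * (norm (dt \<epsilon> \<alpha> r x - db \<alpha> r x))^2))" for \<alpha> r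
  note [measurable] = G(1)[unfolded case_prod_beta'] mb[unfolded case_prod_beta'] mt[OF e, unfolded case_prod_beta']
  have [measurable]: "(%r. NN x. ennreal ((norm (G \<beta> r x))^2)) \<in> borel_measurable lborel"
   "(%r. NN x. ennreal ((F \<epsilon> \<beta> r x - Fb \<beta> r x)^2)) \<in> borel_measurable lborel"
   "(%r. NN x. ennreal \<bar>F \<epsilon> \<beta> r x - Fb \<beta> r x\<bar>) \<in> borel_measurable lborel" for \<beta>
   by (intro lborel.borel_measurable_nn_integral; unfold case_prod_beta'; measurable)+
  show ?thesis
   unfolding C1_def C_def
  proof (rule coupled_gronwall[where E="%\<alpha>. two_flows.total_error (F \<epsilon> \<alpha>) (Fb \<alpha>)" and e=E1 and Q=Q and g=g, OF c T0 G0 _ _ _ _ _ _ _ t])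
   fix \<alpha> s assume s: "s \<in> {0..T}"
   have "two_flows.total_error (F \<epsilon> \<alpha>) (Fb \<alpha>) s <= ennreal (c \<alpha>) * (NN r. indicator {0..s} r * (Q \<alpha> r + W \<alpha> r))"
    unfolding c_def Q_def W_def by (rule two_flows.difference_estimate[OF flows[OF e] k s])
   also have "... <= ennreal (c \<alpha>) * (NN r. indicator {0..s} r * (Q \<alpha> r + E1 \<alpha> r))"
    unfolding E1_def by (intro mult_left_mono nn_integral_mono add_mono order_refl) auto
   finally show "two_flows.total_error (F \<epsilon> \<alpha>) (Fb \<alpha>) s <= ennreal (c \<alpha>) * (NN r. indicator {0..s} r * (Q \<alpha> r + E1 \<alpha> r))" .
  next
   fix \<alpha>
   have k': "bump (1 / real (Suc n)) (k (1 / real (Suc n)))" for n by (rule k) simp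
   have kl: "(%n. 1 / real (Suc n)) ----> 0" by (intro LIMSEQ_Suc lim_1_over_n)
   show "AE r in lborel. r \<in> {0..T} --> Q \<alpha> r <= ennreal (q \<alpha>) * (ennreal (\<epsilon>^2) * g r + (\<Sum>\<beta>\<in>UNIV. E1 \<beta> r))"
    using G(2)
   proof eventually_elim
    case (elim r)
    show ?case
    proof
     assume r: "r \<in> {0..T}"
     have Gr: "has_weak_gradient (F \<epsilon> \<beta> r) (G \<beta> r)" for \<beta>
      using elim r by (simp add: F_def time_clamp_id[OF r])
     have "Q \<alpha> r <= ennreal (q \<alpha>) * (\<Sum>\<beta>\<in>UNIV. ennreal (\<epsilon>^2) * (1 + (NN x. ennreal ((norm (G \<beta> r x))^2))) + W \<beta> r + (NN x. ennreal \<bar>F \<epsilon> \<beta> r x - Fb \<beta> r x\<bar>)^2)"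
      unfolding Q_def q_def W_def dt_def db_def
      by (rule relative_drift_estimate[where u="F \<epsilon>" and v=Fb and t=r and f="F \<epsilon> \<alpha> r" and G="%\<beta>. G \<beta> r" and w="a \<alpha>",
       OF K k[OF e] e bt[OF e] bb bt[OF e] nt[OF e] Gr k' kl])
     also have "(\<Sum>\<beta>\<in>UNIV. ennreal (\<epsilon>^2) * (1 + (NN x. ennreal ((norm (G \<beta> r x))^2))) + W \<beta> r + (NN x. ennreal \<bar>F \<epsilon> \<beta> r x - Fb \<beta> r x\<bar>)^2)
      = ennreal (\<epsilon>^2) * g r + (\<Sum>\<beta>\<in>UNIV. E1 \<beta> r)"
      unfolding g_def E1_def sum_distrib_left sum.distrib[symmetric] by (simp only: add.assoc)
     finally show "Q \<alpha> r <= ennreal (q \<alpha>) * (ennreal (\<epsilon>^2) * g r + (\<Sum>\<beta>\<in>UNIV. E1 \<beta> r))" .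
    qed
   qed
   fix r
   show "E1 \<alpha> r <= two_flows.total_error (F \<epsilon> \<alpha>) (Fb \<alpha>) r"
    unfolding two_flows.total_error_def[OF flows[OF e]] E1_def W_def by simp
   show "E1 \<alpha> r <= ennreal (8 * N^2)"
    unfolding E1_def W_def by (rule nn_integral_square_le_bounded[OF bt[OF e] bb])
  next
   show "E1 \<alpha> \<in> borel_measurable lborel" for \<alpha> unfolding E1_def[abs_def] W_def[abs_def] by measurable
   show "g \<in> borel_measurable lborel" unfolding g_def[abs_def] by measurable
   show "(NN r. indicator {0..T} r * g r) <= ennreal \<Gamma>" unfolding g_def by (rule G(3))
  qed
 qed
 show ?thesis
 proof (intro exI[of _ C1] conjI allI impI ballI C1)
  fix \<epsilon> :: real and \<alpha> t assume e: "\<epsilon> > 0" and t: "t \<in> {0..T}"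
  have id: "F \<epsilon> \<alpha> t = ftilde \<epsilon> \<alpha> t" "Fb \<alpha> t = fbar \<alpha> t" by (simp_all only: F_def Fb_def time_clamp_id[OF t])
  show "(NN x. ennreal ((ftilde \<epsilon> \<alpha> t x - fbar \<alpha> t x)^2)) + (NN x. ennreal \<bar>ftilde \<epsilon> \<alpha> t x - fbar \<alpha> t x\<bar>)^2
   + (NN x. entropy_density (ftilde \<epsilon> \<alpha> t x) (fbar \<alpha> t x)) <= ennreal (C1 * \<epsilon>^2)"
   using est[OF e t, of \<alpha>] unfolding two_flows.total_error_def[OF flows[OF e]] id .
  show "rel_entropy (ftilde \<epsilon> \<alpha> t) (fbar \<alpha> t) = enn2ereal (NN x. entropy_density (ftilde \<epsilon> \<alpha> t x) (fbar \<alpha> t x))"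
   unfolding id[symmetric]
   by (rule rel_entropy_eq[OF bounded_L1D(1)[OF bt[OF e]] nt[OF e] bounded_L1D(1)[OF bb] nb two_flows.equal_mass[OF flows[OF e] k[OF zero_less_one] t]])
 qed
qed

theorem proposition2p4:
  fixes a :: "'n::finite \<Rightarrow> 'n \<Rightarrow> real"
    and \<sigma> :: "'n \<Rightarrow> real"
    and s T C\<^sub>T :: real
    and chi :: "'a::euclidean_space \<Rightarrow> real"
    and f0 :: "'n \<Rightarrow> 'a \<Rightarrow> real"
    and fbar :: "'n \<Rightarrow> real \<Rightarrow> 'a \<Rightarrow> real"
    and ftilde :: "real \<Rightarrow> 'n \<Rightarrow> real \<Rightarrow> 'a \<Rightarrow> real"
  assumes "DIM('a) \<ge> 3"
    and "T > 0"
    and "\<And>\<alpha>. \<sigma> \<alpha> > 0"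
    and "0 < s" and "s \<le> real DIM('a) - 2"
    and "\<And>\<alpha>. prob_density (f0 \<alpha>)" and "\<And>\<alpha>. Linfnorm lborel (f0 \<alpha>) < \<top>"
    and "test_function chi" and "prob_density chi" and "supp chi \<subseteq> cball 0 1"
    and "\<And>x y. norm x = norm y \<Longrightarrow> chi x = chi y"
    and "weak_solution T \<sigma> (interaction a s) f0 fbar"
    and "\<And>\<alpha>. sol_norm T (fbar \<alpha>) < \<top>"
    and "\<And>\<epsilon>. \<epsilon> > 0 \<Longrightarrow> weak_solution T \<sigma> (interaction_eps a s chi \<epsilon>) f0 (ftilde \<epsilon>)"
    and "(MAX \<alpha>. SUP \<epsilon>\<in>{0<..}. sol_norm T (ftilde \<epsilon> \<alpha>)) < ennreal C\<^sub>T"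
  shows "(\<exists>C::real. \<forall>\<epsilon>>0. \<forall>\<alpha>.
            (SUP t\<in>{0..T}. enn2ereal ((L2norm lborel (\<lambda>x. ftilde \<epsilon> \<alpha> t x - fbar \<alpha> t x))\<^sup>2)
                + rel_entropy (ftilde \<epsilon> \<alpha> t) (fbar \<alpha> t)) \<le> ereal (C * \<epsilon>\<^sup>2))
       \<and> (\<forall>N. \<exists>C::real. \<forall>K::'n \<Rightarrow> nat. (\<Sum>\<alpha>\<in>UNIV. K \<alpha>) = N \<longrightarrow> (\<forall>\<epsilon>>0.
            (SUP t\<in>{0..T}. L1norm (\<Pi>\<^sub>M i\<in>tensor_index K. lborel)
                (\<lambda>x. tensor K (\<lambda>\<alpha>. ftilde \<epsilon> \<alpha> t) x - tensor K (\<lambda>\<alpha>. fbar \<alpha> t) x))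
              \<le> ennreal (C * \<epsilon>)))"
proof -
 have Mt: "sol_norm T (ftilde \<epsilon> \<alpha>) < ennreal C\<^sub>T" if e: "\<epsilon> > 0" for \<epsilon> \<alpha>
 proof -
  have "sol_norm T (ftilde \<epsilon> \<alpha>) <= (SUP \<epsilon>\<in>{0<..}. sol_norm T (ftilde \<epsilon> \<alpha>))"
   by (rule SUP_upper[where f="%\<epsilon>. sol_norm T (ftilde \<epsilon> \<alpha>)"]) (use e in simp)
  also have "... <= (MAX \<alpha>. SUP \<epsilon>\<in>{0<..}. sol_norm T (ftilde \<epsilon> \<alpha>))"
   by (rule Max_ge) auto
  also note assms(15)
  finally show ?thesis .
 qed
 have "0 < ennreal C\<^sub>T" by (rule le_less_trans[OF zero_le Mt[of 1]]) simp
 then have M: "C\<^sub>T > 0" by simp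
 \<comment> \<open>A common bound for all solutions. The leading 1 provides
   \<open>N \<ge> 1\<close>, which the product estimate requires.\<close>
 define N where "N = 1 + C\<^sub>T + (\<Sum>\<alpha>\<in>UNIV. enn2real (sol_norm T (fbar \<alpha>)))"
 have S0: "0 <= (\<Sum>\<alpha>\<in>UNIV. enn2real (sol_norm T (fbar \<alpha>)))" by (intro sum_nonneg) simp
 have N: "N \<ge> 1" "N \<ge> 0" "C\<^sub>T <= N" using S0 M by (auto simp: N_def)
 have Nb: "sol_norm T (fbar \<alpha>) <= ennreal N" for \<alpha>
 proof -
  have "enn2real (sol_norm T (fbar \<alpha>)) <= (\<Sum>\<alpha>\<in>UNIV. enn2real (sol_norm T (fbar \<alpha>)))"
   by (rule member_le_sum) auto
  then have "enn2real (sol_norm T (fbar \<alpha>)) <= N" using M by (simp add: N_def)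
  then have "ennreal (enn2real (sol_norm T (fbar \<alpha>))) <= ennreal N" by (rule ennreal_leI)
  then show ?thesis using assms(13)[of \<alpha>] by simp
 qed
 have Nt: "sol_norm T (ftilde \<epsilon> \<alpha>) <= ennreal N" if "\<epsilon> > 0" for \<epsilon> \<alpha>
  using less_imp_le[OF Mt[OF that]] ennreal_leI[OF N(3)] by (rule order_trans)
 obtain C where C: "C \<ge> 0" and est: "\<forall>\<epsilon>>0. \<forall>\<alpha>. \<forall>t\<in>{0..T}.
  (NN x. ennreal ((ftilde \<epsilon> \<alpha> t x - fbar \<alpha> t x)^2)) + (NN x. ennreal \<bar>ftilde \<epsilon> \<alpha> t x - fbar \<alpha> t x\<bar>)^2
   + (NN x. entropy_density (ftilde \<epsilon> \<alpha> t x) (fbar \<alpha> t x)) <= ennreal (C * \<epsilon>^2)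
  \<and> rel_entropy (ftilde \<epsilon> \<alpha> t) (fbar \<alpha> t) = enn2ereal (NN x. entropy_density (ftilde \<epsilon> \<alpha> t x) (fbar \<alpha> t x))"
  using mean_field_error[OF assms(1-6,8-10,12) assms(14) Nb Nt Mt M N(2)] by blast
 show ?thesis
 proof (intro conjI)
  show "\<exists>C::real. \<forall>\<epsilon>>0. \<forall>\<alpha>.
      (SUP t\<in>{0..T}. enn2ereal ((L2norm lborel (%x. ftilde \<epsilon> \<alpha> t x - fbar \<alpha> t x))^2)
        + rel_entropy (ftilde \<epsilon> \<alpha> t) (fbar \<alpha> t)) <= ereal (C * \<epsilon>^2)"
  proof (intro exI[of _ C] allI impI SUP_least)
   fix \<epsilon> :: real and \<alpha> t assume e: "\<epsilon> > 0" and t: "t \<in> {0..T}"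
   define W where "W = (NN x. ennreal ((ftilde \<epsilon> \<alpha> t x - fbar \<alpha> t x)^2))"
   define H where "H = (NN x. entropy_density (ftilde \<epsilon> \<alpha> t x) (fbar \<alpha> t x))"
   note es = est[THEN spec, THEN mp, OF e, THEN spec, THEN bspec, OF t, of \<alpha>]
   have "W + H <= W + (NN x. ennreal \<bar>ftilde \<epsilon> \<alpha> t x - fbar \<alpha> t x\<bar>)^2 + H"
    by (intro add_right_mono) simp
   also have "... <= ennreal (C * \<epsilon>^2)" unfolding W_def H_def by (rule conjunct1[OF es])
   finally have "enn2ereal (W + H) <= enn2ereal (ennreal (C * \<epsilon>^2))" by (simp add: less_eq_ennreal.rep_eq)
   then have "enn2ereal W + enn2ereal H <= ereal (C * \<epsilon>^2)"
    using C by (simp add: plus_ennreal.rep_eq enn2ereal_ennreal)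
   then show "enn2ereal ((L2norm lborel (%x. ftilde \<epsilon> \<alpha> t x - fbar \<alpha> t x))^2)
        + rel_entropy (ftilde \<epsilon> \<alpha> t) (fbar \<alpha> t) <= ereal (C * \<epsilon>^2)"
    unfolding L2norm_square conjunct2[OF es] W_def H_def .
  qed
  show "\<forall>N. \<exists>C::real. \<forall>K::'n => nat. (\<Sum>\<alpha>\<in>UNIV. K \<alpha>) = N --> (\<forall>\<epsilon>>0.
      (SUP t\<in>{0..T}. L1norm (\<Pi>\<^sub>M i\<in>tensor_index K. lborel)
        (%x. tensor K (%\<alpha>. ftilde \<epsilon> \<alpha> t) x - tensor K (%\<alpha>. fbar \<alpha> t) x))
       <= ennreal (C * \<epsilon>))"
  proof (intro allI exI impI SUP_least)
   fix m :: nat and K :: "'n => nat" and \<epsilon> t :: real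
   assume K: "(\<Sum>\<alpha>\<in>UNIV. K \<alpha>) = m" and e: "\<epsilon> > 0" and t: "t \<in> {0..T}"
   \<comment> \<open>The square root of the error estimate: order \<open>\<epsilon>^2\<close> for
     the squared \<open>L^1\<close> distance becomes order \<open>\<epsilon>\<close>.\<close>
   have D: "(NN x. ennreal \<bar>ftilde \<epsilon> \<alpha> t x - fbar \<alpha> t x\<bar>) <= ennreal (sqrt C * \<epsilon>)" (is "?X <= _") for \<alpha>
   proof -
    have "?X^2 <= (NN x. ennreal ((ftilde \<epsilon> \<alpha> t x - fbar \<alpha> t x)^2)) + ?X^2
      + (NN x. entropy_density (ftilde \<epsilon> \<alpha> t x) (fbar \<alpha> t x))"
     by (rule order_trans[OF _ add_increasing2[OF zero_le order_refl]]) (rule add_increasing[OF zero_le order_refl])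
    also have "... <= ennreal (C * \<epsilon>^2)"
     by (rule conjunct1[OF est[THEN spec, THEN mp, OF e, THEN spec, THEN bspec, OF t]])
    finally have le: "?X^2 <= ennreal (C * \<epsilon>^2)" .
    show ?thesis
    proof (cases ?X)
     case (real x)
     then have "x^2 <= C * \<epsilon>^2" using le C by (simp add: ennreal_power)
     then have "sqrt (x^2) <= sqrt (C * \<epsilon>^2)" by (rule real_sqrt_le_mono)
     then have "x <= sqrt C * \<epsilon>" using real e by (simp add: real_sqrt_mult)
     then show ?thesis using real by (simp add: ennreal_leI)
    next
     case top
     then show ?thesis using le by (simp add: power2_eq_square ennreal_top_mult top_unique)
    qed
   qed
   have bt: "bounded_L1 N (ftilde \<epsilon> \<alpha> t)" for \<alpha>
    by (rule sol_norm_imp_bounded_L1[OF assms(2) assms(14)[OF e] Nt[OF e] N(2) t])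
   have bb: "bounded_L1 N (fbar \<alpha> t)" for \<alpha>
    by (rule sol_norm_imp_bounded_L1[OF assms(2) assms(12) Nb N(2) t])
   have fin: "finite (tensor_index K)" by (simp add: tensor_index_def)
   have D0: "0 <= sqrt C * \<epsilon>" using C e by simp
   \<comment> \<open>The constant sees \<open>K\<close> only through its total \<open>m\<close>, the
     number of factors, so it may be fixed before \<open>K\<close>.\<close>
   show "L1norm (\<Pi>\<^sub>M i\<in>tensor_index K. lborel)
        (%x. tensor K (%\<alpha>. ftilde \<epsilon> \<alpha> t) x - tensor K (%\<alpha>. fbar \<alpha> t) x) <= ennreal ((m * N ^ m * sqrt C) * \<epsilon>)"
    using product_L1_difference[where p="%i. ftilde \<epsilon> (fst i) t" and q="%i. fbar (fst i) t",
     OF fin bounded_L1D(4)[OF bt] bounded_L1D(4)[OF bb] N(1) bounded_L1_nn[OF bt] bounded_L1_nn[OF bb] D0 D]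
    by (simp add: L1norm_def tensor_eq_prod card_tensor_index K mult.assoc)
  qed
 qed
qed

end
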